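(* Let $A$ be a dilation and $X$ a ball quasi-Banach function space with an absolutely continuous quasi-norm satisfying Assumption (FS) with $p_-\in(0,\infty)$ and Assumption (A) with $\theta_0\in(0,\min\{p_-,1\})$ and $p_0\in(\theta_0,\infty)$. Let $d\in\mathbb Z_+$ with $d\ge\lfloor(1/\theta_0-1)\ln b/\ln\lambda_-\rfloor$, let $q\in[1,\infty)$ if $p_0\in(0,1)$ or $q\in[1,p_0')$ if $p_0\in[1,\infty)$, and let $\varepsilon\in\left(\frac{\ln b}{\ln\lambda_-}\left[\frac2s+d\frac{\ln\lambda_+}{\ln b}\right],\infty\right)$ for some $s\in(0,\theta_0)$. Write $\beta:=\varepsilon\ln\lambda_-/\ln b$ and, for $f\in L^q_{\mathrm{loc}}(\mathbb R^n)$, $$\|f\|_{*}:=\sup\left\|\left\{\sum_{i\in\mathbb N}\left(\frac{\lambda_i}{\|\mathbf 1_{x_i+B_{l_i}}\|_X}\right)^{\theta_0}\mathbf 1_{x_i+B_{l_i}}\right\}^{1/\theta_0}\right\|_X^{-1}\sum_{j\in\mathbb N}\frac{\lambda_j|x_j+B_{l_j}|}{\|\mathbf 1_{x_j+B_{l_j}}\|_X}\int_{\mathbb R^n}\frac{b^{\beta l_j}|f(x)-P^d_{x_j+B_{l_j}}f(x)|}{b^{l_j(1+\beta)}+[\rho(x-x_j)]^{1+\beta}}\,dx,$$ the supremum taken over all $\{x_j\}_{j\in\mathbb N}\subset\mathbb R^n$, $\{l_j\}_{j\in\mathbb N}\subset\mathbb Z$ and $\{\lambda_j\}_{j\in\mathbb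 N}\subset[0,\infty)$ with $\sum_j\lambda_j\ne0$ such that $\left\|\left\{\sum_{j\in\mathbb N}\left(\frac{\lambda_j}{\|\mathbf 1_{x_j+B_{l_j}}\|_X}\right)^{\theta_0}\mathbf 1_{x_j+B_{l_j}}\right\}^{1/\theta_0}\right\|_X\in(0,\infty)$. Then, for $f\in L^q_{\mathrm{loc}}(\mathbb R^n)$, $f\in\mathcal L^A_{X,q,d,\theta_0}(\mathbb R^n)$ if and only if $\|f\|_*<\infty$, and $\|f\|_{\mathcal L^A_{X,q,d,\theta_0}(\mathbb R^n)}\sim\|f\|_*$ with positive equivalence constants independent of $f$.
   Context: A real $n\times n$ matrix $A$ is a dilation if all its eigenvalues have modulus $>1$; $b:=|\det A|$; fix $\lambda_-,\lambda_+$ with $1<\lambda_-<\min|\lambda|\le\max|\lambda|<\lambda_+$, over eigenvalues $\lambda$ of $A$. Fix an open ellipsoid $\Delta$ symmetric about $0$ with $|\Delta|=1$ and $r>1$ with $\Delta\subset r\Delta\subset A\Delta$; $B_k:=A^k\Delta$ (so $|B_k|=b^k$), $\mathcal B:=\{x+B_k:x\in\mathbb R^n,k\in\mathbb Z\}$; $\rho(x):=b^k$ if $x\in B_{k+1}\setminus B_k$, $\rho(0):=0$. $\mathcal M(f)(x):=\sup_{x\in B\in\mathcal B}|B|^{-1}\int_B|f|$, $\mathcal M^{(\alpha)}(f):=[\mathcal M(|f|^\alpha)]^{1/\alpha}$. Ball quasi-Banach function space: a quasi-normed space $X$ of measurable functions with quasi-norm defined on all measurable functions such that (i) $\|f\|_X=0\Rightarrow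 f=0$ a.e.; (ii) $|g|\le|f|$ a.e. $\Rightarrow\|g\|_X\le\|f\|_X$; (iii) $0\le f_m\uparrow f$ a.e. $\Rightarrow\|f_m\|_X\uparrow\|f\|_X$; (iv) $\mathbf 1_B\in X$ for $B\in\mathcal B$. Ball Banach function space: additionally the triangle inequality and $\int_B|f|\le C_B\|f\|_X$ for each $B\in\mathcal B$. $X^p:=\{f:|f|^p\in X\}$, $\|f\|_{X^p}:=\||f|^p\|_X^{1/p}$; for ball Banach $Y$, $\|f\|_{Y'}:=\sup\{\|fg\|_{L^1}:\|g\|_Y=1\}$, $Y'$ its finiteness set. Absolutely continuous quasi-norm: $\|f\mathbf 1_{E_j}\|_X\downarrow0$ for all $f\in X$ and measurable $E_j\downarrow\emptyset$. Assumption (FS) with $p_-$: for all $p\in(0,p_-)$, $u\in(1,\infty)$, $\|(\sum_k[\mathcal M(f_k)]^u)^{1/u}\|_{X^{1/p}}\le C\|(\sum_k|f_k|^u)^{1/u}\|_{X^{1/p}}$. Assumption (A) with $\theta_0,p_0$: $X^{1/\theta_0}$ is a ball Banach function space and $\mathcal M^{((p_0/\theta_0)')}$ is bounded on $(X^{1/\theta_0})'$. $P^d_Bg$ is the unique polynomial $P$ of degree $\le d$ with $\int_B(g-P)h=0$ for all polynomials $h$ of degree $\le d$. For $t\in[1,\infty)$, $\mathcal L^A_{X,t,d,\theta_0}(\mathbb R^n)$ is the set of $f\in L^t_{\mathrm{loc}}$ with $$\|f\|_{\mathcal L^A_{X,t,d,\theta_0}}:=\sup\left\|\left\{\sum_{i=1}^m\left[\frac{\lambda_i}{\|\mathbf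 1_{B^{(i)}}\|_X}\right]^{\theta_0}\mathbf 1_{B^{(i)}}\right\}^{1/\theta_0}\right\|_X^{-1}\sum_{j=1}^m\frac{\lambda_j|B^{(j)}|}{\|\mathbf 1_{B^{(j)}}\|_X}\left[\frac1{|B^{(j)}|}\int_{B^{(j)}}|f-P^d_{B^{(j)}}f|^t\right]^{1/t}<\infty$$ (sup over $m\in\mathbb N$, $B^{(j)}\in\mathcal B$, $\lambda_j\ge0$, $\sum_j\lambda_j\ne0$). *)

theory Defs
  imports "HOL-Analysis.Analysis"
begin

definition cmat :: "real^'n^'n \<Rightarrow> complex^'n^'n" where
  "cmat A = (\<chi> i j. complex_of_real (A $ i $ j))"

definition eigen :: "real^'n^'n \<Rightarrow> complex \<Rightarrow> bool" where
  "eigen A z \<longleftrightarrow> det (mat z - cmat A) = 0"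

definition dilation :: "real^'n^'n \<Rightarrow> bool" where
  "dilation A \<longleftrightarrow> (\<forall>z. eigen A z \<longrightarrow> 1 < cmod z)"

definition bdet :: "real^'n^'n \<Rightarrow> real" where
  "bdet A = \<bar>det A\<bar>"

definition ellipsoid0 :: "(real^'n) set \<Rightarrow> bool" where
  "ellipsoid0 D \<longleftrightarrow> (\<exists>M::real^'n^'n. invertible M \<and> D = (\<lambda>y. M *v y) ` ball 0 1)"

definition dil_pow :: "real^'n^'n \<Rightarrow> int \<Rightarrow> real^'n \<Rightarrow> real^'n" where
  "dil_pow A k = (if 0 \<le> k then ((\<lambda>x. A *v x) ^^ nat k)
                  else ((\<lambda>x. matrix_inv A *v x) ^^ nat (- k)))"

definition Bk :: "real^'n^'n \<Rightarrow> (real^'n) set \<Rightarrow> int \<Rightarrow> (real^'n) set" where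
  "Bk A D k = dil_pow A k ` D"

definition dball :: "real^'n^'n \<Rightarrow> (real^'n) set \<Rightarrow> real^'n \<Rightarrow> int \<Rightarrow> (real^'n) set" where
  "dball A D x k = (\<lambda>y. x + y) ` Bk A D k"

definition rho :: "real^'n^'n \<Rightarrow> (real^'n) set \<Rightarrow> real^'n \<Rightarrow> real" where
  "rho A D x = (if x = 0 then 0
     else bdet A powr real_of_int (THE k::int. x \<in> Bk A D (k + 1) - Bk A D k))"

text \<open>Real powers (positive exponents) on [0,infinity].\<close>
definition epow :: "ennreal \<Rightarrow> real \<Rightarrow> ennreal" where
  "epow x p = (if x = top then top else ennreal (enn2real x powr p))"

definition maxf :: "real^'n^'n \<Rightarrow> (real^'n) set \<Rightarrow> (real^'n \<Rightarrow> real) \<Rightarrow> real^'n \<Rightarrow> ennreal" where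
  "maxf A D f x = (SUP yk \<in> {(y, k). x \<in> dball A D y k}.
      (\<integral>\<^sup>+ z\<in>dball A D (fst yk) (snd yk). ennreal \<bar>f z\<bar> \<partial>lebesgue)
        / emeasure lebesgue (dball A D (fst yk) (snd yk)))"

definition maxf_pow :: "real^'n^'n \<Rightarrow> (real^'n) set \<Rightarrow> real \<Rightarrow> (real^'n \<Rightarrow> real) \<Rightarrow> real^'n \<Rightarrow> ennreal" where
  "maxf_pow A D \<alpha> f x = epow (maxf A D (\<lambda>y. \<bar>f y\<bar> powr \<alpha>) x) (1 / \<alpha>)"

text \<open>A quasi-norm is modelled as a functional on real-valued functions with values
  in [0,infinity]; X is its finiteness set among Lebesgue measurable functions.\<close>

definition ball_qBfs :: "real^'n^'n \<Rightarrow> (real^'n) set \<Rightarrow> ((real^'n \<Rightarrow> real) \<Rightarrow> ennreal) \<Rightarrow> bool" where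
  "ball_qBfs A D N \<longleftrightarrow>
     (\<forall>f c. f \<in> borel_measurable lebesgue \<longrightarrow> N (\<lambda>x. c * f x) = ennreal \<bar>c\<bar> * N f) \<and>
     (\<exists>K\<ge>1. \<forall>f g. f \<in> borel_measurable lebesgue \<longrightarrow> g \<in> borel_measurable lebesgue \<longrightarrow>
          N (\<lambda>x. f x + g x) \<le> ennreal K * (N f + N g)) \<and>
     (\<forall>f. f \<in> borel_measurable lebesgue \<longrightarrow> N f = 0 \<longrightarrow> (AE x in lebesgue. f x = 0)) \<and>
     (\<forall>f g. f \<in> borel_measurable lebesgue \<longrightarrow> g \<in> borel_measurable lebesgue \<longrightarrow>
          (AE x in lebesgue. \<bar>g x\<bar> \<le> \<bar>f x\<bar>) \<longrightarrow> N g \<le> N f) \<and>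
     (\<forall>fs F. (\<forall>m. fs m \<in> borel_measurable lebesgue) \<longrightarrow> F \<in> borel_measurable lebesgue \<longrightarrow>
          (AE x in lebesgue. (\<forall>m. 0 \<le> fs m x \<and> fs m x \<le> fs (Suc m) x) \<and> (\<lambda>m. fs m x) \<longlonglongrightarrow> F x) \<longrightarrow>
          N F = (SUP m. N (fs m))) \<and>
     (\<forall>x k. N (indicator (dball A D x k)) < top)"

definition ball_Bfs :: "real^'n^'n \<Rightarrow> (real^'n) set \<Rightarrow> ((real^'n \<Rightarrow> real) \<Rightarrow> ennreal) \<Rightarrow> bool" where
  "ball_Bfs A D N \<longleftrightarrow> ball_qBfs A D N \<and>
     (\<forall>f g. f \<in> borel_measurable lebesgue \<longrightarrow> g \<in> borel_measurable lebesgue \<longrightarrow>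
          N (\<lambda>x. f x + g x) \<le> N f + N g) \<and>
     (\<forall>x k. \<exists>C::real. \<forall>f. f \<in> borel_measurable lebesgue \<longrightarrow>
          (\<integral>\<^sup>+ y\<in>dball A D x k. ennreal \<bar>f y\<bar> \<partial>lebesgue) \<le> ennreal C * N f)"

definition abs_cont_norm :: "((real^'n \<Rightarrow> real) \<Rightarrow> ennreal) \<Rightarrow> bool" where
  "abs_cont_norm N \<longleftrightarrow>
     (\<forall>f E. f \<in> borel_measurable lebesgue \<longrightarrow> N f < top \<longrightarrow>
        (\<forall>j. E j \<in> sets lebesgue) \<longrightarrow> decseq E \<longrightarrow> (\<Inter>j. E j) = {} \<longrightarrow>
        (\<lambda>j. N (\<lambda>x. f x * indicator (E j) x)) \<longlonglongrightarrow> 0)"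

definition Xext :: "((real^'n \<Rightarrow> real) \<Rightarrow> ennreal) \<Rightarrow> (real^'n \<Rightarrow> ennreal) \<Rightarrow> ennreal" where
  "Xext N G = (if AE x in lebesgue. G x \<noteq> top then N (\<lambda>x. enn2real (G x)) else top)"

definition Xpow_ext :: "((real^'n \<Rightarrow> real) \<Rightarrow> ennreal) \<Rightarrow> real \<Rightarrow> (real^'n \<Rightarrow> ennreal) \<Rightarrow> ennreal" where
  "Xpow_ext N p G = epow (Xext N (\<lambda>x. epow (G x) p)) (1 / p)"

definition Xpow :: "((real^'n \<Rightarrow> real) \<Rightarrow> ennreal) \<Rightarrow> real \<Rightarrow> (real^'n \<Rightarrow> real) \<Rightarrow> ennreal" where
  "Xpow N p f = Xpow_ext N p (\<lambda>x. ennreal \<bar>f x\<bar>)"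

definition assoc_norm :: "((real^'n \<Rightarrow> real) \<Rightarrow> ennreal) \<Rightarrow> (real^'n \<Rightarrow> ennreal) \<Rightarrow> ennreal" where
  "assoc_norm Y G = (SUP g \<in> {g. g \<in> borel_measurable lebesgue \<and> Y g = 1}.
       \<integral>\<^sup>+ x. G x * ennreal \<bar>g x\<bar> \<partial>lebesgue)"

definition Lloc :: "real \<Rightarrow> (real^'n \<Rightarrow> real) \<Rightarrow> bool" where
  "Lloc t f \<longleftrightarrow> f \<in> borel_measurable lebesgue \<and>
     (\<forall>K. compact K \<longrightarrow> (\<integral>\<^sup>+ x\<in>K. ennreal (\<bar>f x\<bar> powr t) \<partial>lebesgue) < top)"

definition assumption_FS :: "real^'n^'n \<Rightarrow> (real^'n) set \<Rightarrow> ((real^'n \<Rightarrow> real) \<Rightarrow> ennreal) \<Rightarrow> real \<Rightarrow> bool" where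
  "assumption_FS A D N pm \<longleftrightarrow>
     (\<forall>p u. 0 < p \<longrightarrow> p < pm \<longrightarrow> 1 < u \<longrightarrow>
       (\<exists>C::real. \<forall>fs. (\<forall>k. Lloc 1 (fs k)) \<longrightarrow>
          Xpow_ext N (1 / p) (\<lambda>x. epow (\<Sum>k. epow (maxf A D (fs k) x) u) (1 / u))
          \<le> ennreal C * Xpow_ext N (1 / p) (\<lambda>x. epow (\<Sum>k. ennreal (\<bar>fs k x\<bar> powr u)) (1 / u))))"

definition conj_exp :: "real \<Rightarrow> real" where
  "conj_exp p = p / (p - 1)"

definition assumption_A :: "real^'n^'n \<Rightarrow> (real^'n) set \<Rightarrow> ((real^'n \<Rightarrow> real) \<Rightarrow> ennreal) \<Rightarrow> real \<Rightarrow> real \<Rightarrow> bool" where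
  "assumption_A A D N \<theta> p0 \<longleftrightarrow>
     ball_Bfs A D (Xpow N (1 / \<theta>)) \<and>
     (\<exists>C::real. \<forall>f. f \<in> borel_measurable lebesgue \<longrightarrow>
        assoc_norm (Xpow N (1 / \<theta>)) (maxf_pow A D (conj_exp (p0 / \<theta>)) f)
        \<le> ennreal C * assoc_norm (Xpow N (1 / \<theta>)) (\<lambda>x. ennreal \<bar>f x\<bar>))"

definition poly_le :: "nat \<Rightarrow> (real^'n \<Rightarrow> real) set" where
  "poly_le d = {P. \<exists>c. \<forall>x. P x =
      (\<Sum>\<alpha>\<in>{\<alpha>::'n \<Rightarrow> nat. sum \<alpha> UNIV \<le> d}. c \<alpha> * (\<Prod>i\<in>UNIV. (x $ i) ^ \<alpha> i))}"

definition poly_proj :: "nat \<Rightarrow> (real^'n) set \<Rightarrow> (real^'n \<Rightarrow> real) \<Rightarrow> real^'n \<Rightarrow> real" where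
  "poly_proj d B g = (THE P. P \<in> poly_le d \<and>
      (\<forall>h\<in>poly_le d. set_lebesgue_integral lebesgue B (\<lambda>x. (g x - P x) * h x) = 0))"

definition nX :: "((real^'n \<Rightarrow> real) \<Rightarrow> ennreal) \<Rightarrow> (real^'n) set \<Rightarrow> real" where
  "nX N B = enn2real (N (indicator B))"

definition camp_norm :: "real^'n^'n \<Rightarrow> (real^'n) set \<Rightarrow> ((real^'n \<Rightarrow> real) \<Rightarrow> ennreal)
    \<Rightarrow> real \<Rightarrow> nat \<Rightarrow> real \<Rightarrow> (real^'n \<Rightarrow> real) \<Rightarrow> ennreal" where
  "camp_norm A D N t d \<theta> f = Sup
     { (\<Sum>j<m. ennreal (lam j * measure lebesgue (dball A D (xs j) (ks j)) / nX N (dball A D (xs j) (ks j)))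
          * epow ((\<integral>\<^sup>+ x\<in>dball A D (xs j) (ks j).
                      ennreal (\<bar>f x - poly_proj d (dball A D (xs j) (ks j)) f x\<bar> powr t) \<partial>lebesgue)
                  / emeasure lebesgue (dball A D (xs j) (ks j))) (1 / t))
       / N (\<lambda>x. (\<Sum>i<m. (lam i / nX N (dball A D (xs i) (ks i))) powr \<theta>
                          * indicator (dball A D (xs i) (ks i)) x) powr (1 / \<theta>))
     | (m::nat) xs ks lam. (\<forall>j<m. 0 \<le> lam j) \<and> (\<Sum>j<m. lam j) \<noteq> 0 }"

definition star_denom :: "real^'n^'n \<Rightarrow> (real^'n) set \<Rightarrow> ((real^'n \<Rightarrow> real) \<Rightarrow> ennreal)
    \<Rightarrow> real \<Rightarrow> (nat \<Rightarrow> real^'n) \<Rightarrow> (nat \<Rightarrow> int) \<Rightarrow> (nat \<Rightarrow> real) \<Rightarrow> ennreal" where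
  "star_denom A D N \<theta> xs ks lam =
     Xext N (\<lambda>x. epow (\<Sum>i. ennreal ((lam i / nX N (dball A D (xs i) (ks i))) powr \<theta>
                          * indicator (dball A D (xs i) (ks i)) x)) (1 / \<theta>))"

definition star_norm :: "real^'n^'n \<Rightarrow> (real^'n) set \<Rightarrow> ((real^'n \<Rightarrow> real) \<Rightarrow> ennreal)
    \<Rightarrow> nat \<Rightarrow> real \<Rightarrow> real \<Rightarrow> (real^'n \<Rightarrow> real) \<Rightarrow> ennreal" where
  "star_norm A D N d \<theta> \<beta> f = Sup
     { (\<Sum>j. ennreal (lam j * measure lebesgue (dball A D (xs j) (ks j)) / nX N (dball A D (xs j) (ks j)))
          * (\<integral>\<^sup>+ x. ennreal (bdet A powr (\<beta> * real_of_int (ks j))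
                 * \<bar>f x - poly_proj d (dball A D (xs j) (ks j)) f x\<bar>
                 / (bdet A powr (real_of_int (ks j) * (1 + \<beta>)) + rho A D (x - xs j) powr (1 + \<beta>))) \<partial>lebesgue))
       / star_denom A D N \<theta> xs ks lam
     | (xs::nat \<Rightarrow> real^'n) ks lam. (\<forall>j. 0 \<le> lam j) \<and> (\<Sum>j. ennreal (lam j)) \<noteq> 0
         \<and> 0 < star_denom A D N \<theta> xs ks lam \<and> star_denom A D N \<theta> xs ks lam < top }"

end

(*
The kernel is bounded below on x_j + B_(l_j), which gives the L^1 Campanato norm <= 2 ||f||_*. Conversely, telescoping
the polynomial projections over the balls x_j + B_(l_j + i) bounds the kernel integral by a geometrically weighted sum
of mean oscillations, and the Fefferman-Stein inequality, applied to indicators of balls, absorbs the dilations.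

It remains to raise the exponent of the oscillation from 1 to q, a John-Nirenberg argument. Assumption (A) and a norming
function in the associate space give a packing estimate: replacing each ball of a family by disjoint small balls,
with l^(q')-weights, gains a power of the proportion of measure they occupy. Stopping balls of a ball B, where the mean
oscillation exceeds a large multiple of that of B, occupy a small proportion, so by the duality of l^q and l^(q')
the q-oscillation is bounded by the 1-oscillation plus half of an expression of the same kind, and the estimate can be iterated.
*)

theory Submission
  imports Defs "HOL-Computational_Algebra.Fundamental_Theorem_Algebra"
begin

section \<open>Lebesgue measure under linear maps\<close>

text \<open>Half of the \<open>q\<close>-oscillation cannot be absorbed while the
  \<open>q\<close>-norm may be infinite. The iteration therefore tests on subsets
  \<open>G x k\<close> of the balls that miss at most a proportion \<delta> of each: empty sets
  start it with any constant, every step keeps the same constant and, up to a prescribed error,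
  halves \<delta>; a limit \<delta> \<rightarrow> 0 ends it. No dyadic cubes are at hand. Stopping
  balls come from a Vitali selection: they are disjoint only before an enlargement by
  \<open>sig\<close> steps, and may leave the ball that they stop. Hence polynomials are taken on
  balls enlarged by \<open>sig\<close>. The packing gain is the power 1 / p0 - 1 / q' of the
  proportion, positive because p0 < q'. Absolute continuity of the quasi-norm makes a Hahn-Banach
  functional countably additive, hence given by a function, to which the maximal bound on the
  associate space applies. The lower bound on \<epsilon> yields two strict inequalities: 1 / s < 1 +
  \<beta> for the Fefferman-Stein step, and lp ^ d < b powr \<beta> against the growth of
  polynomials.\<close>

declare emeasure_completion [simp del]

lemma det_shear:
  fixes m n :: "'n::finite"
  assumes "m \<noteq> n"
  shows "det (matrix (\<lambda>v::real^'n. \<chi> i. if i = m then v$m + v$n else v$i)) = 1"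
proof -
  have "matrix (\<lambda>v::real^'n. \<chi> i. if i = m then v$m + v$n else v$i)
      = (\<chi> k. if k = m then row m (mat 1) + 1 *s row n (mat 1) else row k (mat 1))"
    using assms by (auto simp: matrix_def row_def mat_def axis_def vec_eq_iff)
  then show ?thesis
    using det_row_operation[OF assms, of "mat 1" 1] by (simp add: det_I)
qed

lemma measure_shear_cbox:
  fixes m n :: "'n::finite" and a b :: "real^'n"
  assumes "m \<noteq> n"
  shows "measure lebesgue ((\<lambda>v. \<chi> i. if i = m then v$m + v$n else v$i) ` cbox a b)
       = measure lebesgue (cbox a b)" (is "measure lebesgue (?h ` _) = _")
proof (cases "cbox a b = {}")
  case False
  \<comment> \<open>\<open>measure_shear_interval\<close> asks for a nonnegative \<open>n\<close>-th
    lower bound of the box; after subtracting \<open>v\<close> that bound is 0.\<close>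
  define v :: "real^'n" where "v = axis n (a$n)"
  have lin: "linear ?h"
    by (rule linearI) (auto simp: algebra_simps plus_vec_def scaleR_vec_def vec_eq_iff)
  have cb: "cbox a b = (+) v ` cbox (a - v) (b - v)"
    by (simp flip: cbox_translation)
  have "?h ` cbox a b = (+) (?h v) ` ?h ` cbox (a - v) (b - v)"
    unfolding cb image_image by (intro image_cong) (auto simp: linear_add[OF lin])
  then have "measure lebesgue (?h ` cbox a b) = measure lebesgue (?h ` cbox (a - v) (b - v))"
    by (simp only: measure_translation)
  also have "\<dots> = measure lebesgue (cbox (a - v) (b - v))"
    using False assms cb by (intro measure_shear_interval) (auto simp: v_def axis_def)
  also have "\<dots> = measure lebesgue (cbox a b)"
    unfolding cb by (simp only: measure_translation)
  finally show ?thesis .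
qed simp

lemma det_coordinate_swap:
  fixes m n :: "'n::finite"
  assumes "m \<noteq> n"
  shows "\<bar>det (matrix (\<lambda>v::real^'n. \<chi> i. v $ Transposition.transpose m n i))\<bar> = 1"
proof -
  have "matrix (\<lambda>v::real^'n. \<chi> i. v $ Transposition.transpose m n i)
      = (\<chi> i. (mat 1 :: real^'n^'n) $ Transposition.transpose m n i)"
    by (auto simp: matrix_def mat_def axis_def vec_eq_iff)
  moreover have "det (\<chi> i. (mat 1 :: real^'n^'n) $ Transposition.transpose m n i)
      = of_int (sign (Transposition.transpose m n)) * det (mat 1 :: real^'n^'n)"
    by (rule det_permute_rows) (simp add: permutes_swap_id)
  ultimately show ?thesis
    using assms by (simp add: sign_swap_id)
qed

lemma measure_coordinate_swap_cbox:
  fixes m n :: "'n::finite" and a b :: "real^'n"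
  shows "measure lebesgue ((\<lambda>v. \<chi> i. v $ Transposition.transpose m n i) ` cbox a b)
       = measure lebesgue (cbox a b)" (is "measure lebesgue (?h ` _) = _")
proof (cases "cbox a b = {}")
  case False
  have eq: "?h ` cbox a b = cbox (?h a) (?h b)"
  proof safe
    fix x assume "x \<in> cbox (?h a) (?h b)"
    then have "?h x \<in> cbox a b"
      by (auto simp: mem_box_cart) (metis transpose_involutory)+
    moreover have "x = ?h (?h x)" by (simp add: vec_eq_iff)
    ultimately show "x \<in> ?h ` cbox a b" by blast
  qed (auto simp: mem_box_cart)
  have "cbox (?h a) (?h b) \<noteq> {}" using False eq by blast
  then show ?thesis
    using False prod.permute[OF permutes_swap_id, where S=UNIV and g="\<lambda>i. (b - a)$i", of m n, symmetric]
    by (simp add: eq content_cbox_cart)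
qed simp

text \<open>Determinants multiply under composition, so it suffices to check the elementary maps of
  \<open>induct_linear_elementary\<close>. Measurability of the image is part of the induction,
  because the outer map acts on the image under the inner one.\<close>

proposition measure_linear_image_cart:
  fixes f :: "real^'n \<Rightarrow> real^'n"
  assumes "linear f" "S \<in> lmeasurable"
  shows "f ` S \<in> lmeasurable \<and> measure lebesgue (f ` S) = \<bar>det (matrix f)\<bar> * measure lebesgue S"
proof -
  define P where "P f \<longleftrightarrow> (\<forall>S \<in> lmeasurable. f ` S \<in> lmeasurable \<and>
      measure lebesgue (f ` S) = \<bar>det (matrix f)\<bar> * measure lebesgue S)" for f :: "real^'n \<Rightarrow> real^'n"
  have "P f"
  proof (rule induct_linear_elementary[OF \<open>linear f\<close>])
    fix f g :: "real^'n \<Rightarrow> real^'n"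
    assume fg: "linear f" "linear g" "P f" "P g"
    show "P (f \<circ> g)"
      unfolding P_def
    proof (intro ballI)
      fix S :: "(real^'n) set" assume S: "S \<in> lmeasurable"
      have gS: "g ` S \<in> lmeasurable" using fg S by (simp add: P_def)
      then show "(f \<circ> g) ` S \<in> lmeasurable \<and>
          measure lebesgue ((f \<circ> g) ` S) = \<bar>det (matrix (f \<circ> g))\<bar> * measure lebesgue S"
        using fg S by (simp only: image_comp[symmetric] P_def) (simp add: matrix_compose abs_mult det_mul)
    qed
  next
    fix f :: "real^'n \<Rightarrow> real^'n" and i
    assume f: "linear f" and 0: "\<And>x. f x $ i = 0"
    then have "\<not> surj f"
      by (metis one_neq_zero surjE vec_component)
    then have ni: "\<not> inj f"
      using f linear_injective_imp_surjective by blast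
    then have "det (matrix f) = 0"
      using det_nz_iff_inj[OF f] by blast
    moreover have "negligible (f ` S)" for S
      by (rule negligible_linear_singular_image[OF f ni])
    ultimately show "P f"
      by (auto simp: P_def negligible_iff_null_sets null_setsD1 intro!: fmeasurableI_null_sets negligible_imp_measure0)
  next
    show "P (\<lambda>x. \<chi> i. c i * x $ i)" for c
      by (auto simp: P_def measurable_stretch measure_stretch axis_def matrix_def det_diagonal)
  next
    fix m n :: 'n assume "m \<noteq> n"
    have l1: "linear (\<lambda>x::real^'n. \<chi> i. x $ Transposition.transpose m n i)"
      by (rule linearI) (auto simp: vec_eq_iff)
    show "P (\<lambda>x. \<chi> i. x $ Transposition.transpose m n i)"
      unfolding P_def det_coordinate_swap[OF \<open>m \<noteq> n\<close>]
      using measure_linear_sufficient[OF l1, of _ 1] measure_coordinate_swap_cbox by (metis mult_1)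
    have l2: "linear (\<lambda>x::real^'n. \<chi> i. if i = m then x$m + x$n else x$i)"
      by (rule linearI) (auto simp: algebra_simps vec_eq_iff)
    show "P (\<lambda>x. \<chi> i. if i = m then x$m + x$n else x$i)"
      unfolding P_def det_shear[OF \<open>m \<noteq> n\<close>]
    proof
      fix S :: "(real^'n) set" assume "S \<in> lmeasurable"
      from measure_linear_sufficient[OF l2 this, of 1] measure_shear_cbox[OF \<open>m \<noteq> n\<close>]
      show "(\<lambda>x. \<chi> i. if i = m then x$m + x$n else x$i) ` S \<in> lmeasurable \<and>
          measure lebesgue ((\<lambda>x. \<chi> i. if i = m then x$m + x$n else x$i) ` S) = \<bar>1\<bar> * measure lebesgue S"
        by simp
    qed
  qed
  with assms show ?thesis by (simp add: P_def)
qed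

lemma matrix_inv_cancel:
  fixes M :: "real^'n^'n"
  assumes "invertible M"
  shows "M *v (matrix_inv M *v z) = z" "matrix_inv M *v (M *v z) = z"
proof -
  have "\<exists>M'. M ** M' = mat 1 \<and> M' ** M = mat 1"
    using assms by (simp add: invertible_def)
  then have "M ** matrix_inv M = mat 1 \<and> matrix_inv M ** M = mat 1"
    unfolding matrix_inv_def by (rule someI_ex)
  then show "M *v (matrix_inv M *v z) = z" "matrix_inv M *v (M *v z) = z"
    by (simp_all add: matrix_vector_mul_assoc)
qed

text \<open>Continuity would give only Borel preimages. A preimage under the map is an image under
  its inverse, and differentiable maps send Lebesgue sets to Lebesgue sets.\<close>

lemma affine_lebesgue_measurable:
  fixes M :: "real^'n^'n"
  assumes "invertible M"
  shows "(\<lambda>y. x + M *v y) \<in> lebesgue \<rightarrow>\<^sub>M lebesgue"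
proof -
  have der: "(\<lambda>y. M *v y) differentiable_on S" for S
    by (simp add: linear_imp_differentiable_on)
  show ?thesis
  proof (rule measurableI)
    fix S :: "(real^'n) set" assume S: "S \<in> sets lebesgue"
    have "(\<lambda>y. x + M *v y) -` S = (\<lambda>z. matrix_inv M *v z) ` ((\<lambda>z. z - x) ` S)"
      unfolding image_image using matrix_inv_cancel[OF assms]
      by (auto simp: image_iff intro!: bexI[where x="x + M *v _"])
    moreover have "(\<lambda>z. z - x) ` S \<in> sets lebesgue"
    proof -
      have "(\<lambda>z. z - x) ` S = (+) (- x) ` S" by (intro image_cong) auto
      then show ?thesis using lebesgue_sets_translation[OF S, of "-x"] by (simp only:)
    qed
    then have "(\<lambda>z. matrix_inv M *v z) ` ((\<lambda>z. z - x) ` S) \<in> sets lebesgue"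
      using S
      by (intro differentiable_image_in_sets_lebesgue) (auto simp: linear_imp_differentiable_on)
    ultimately show "(\<lambda>y. x + M *v y) -` S \<inter> space lebesgue \<in> sets lebesgue"
      by simp
  qed simp
qed

lemma affine_vimage_eq_image:
  fixes M :: "real^'n^'n"
  assumes "invertible M"
  shows "(\<lambda>y. x + M *v y) ` ((\<lambda>y. x + M *v y) -` S) = S"
proof -
  have "z = x + M *v (matrix_inv M *v (z - x))" for z
    using assms by (simp add: matrix_inv_cancel)
  then have "surj (\<lambda>y. x + M *v y)" unfolding surj_def by blast
  then show ?thesis by (rule surj_image_vimage_eq)
qed

lemma emeasure_affine_vimage:
  fixes M :: "real^'n^'n"
  assumes inv: "invertible M" and S: "S \<in> sets lebesgue"
  shows "ennreal \<bar>det M\<bar> * emeasure lebesgue ((\<lambda>y. x + M *v y) -` S) = emeasure lebesgue S"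
proof -
  let ?T = "\<lambda>y. x + M *v y"
  have Tm: "?T \<in> lebesgue \<rightarrow>\<^sub>M lebesgue" by (rule affine_lebesgue_measurable[OF inv])
  have fin: "ennreal \<bar>det M\<bar> * emeasure lebesgue V = emeasure lebesgue (?T ` V)" if V: "V \<in> lmeasurable" for V
  proof -
    have lin: "linear ((*v) M)" by simp
    have *: "(*v) M ` V \<in> lmeasurable" "measure lebesgue ((*v) M ` V) = \<bar>det M\<bar> * measure lebesgue V"
      using measure_linear_image_cart[OF lin V] by simp_all
    have eq: "?T ` V = (+) x ` (*v) M ` V" by (simp add: image_image)
    have "measure lebesgue (?T ` V) = \<bar>det M\<bar> * measure lebesgue V"
      unfolding eq by (simp only: measure_translation *)
    moreover have "?T ` V \<in> lmeasurable"
      unfolding eq using *(1) measurable_translation by blast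
    ultimately show ?thesis
      using V by (simp add: emeasure_eq_measure2 ennreal_mult')
  qed
  \<comment> \<open>The volume formula is known for sets of finite measure; bounded pieces exhaust
    the preimage, and both sides pass to the supremum.\<close>
  define V where "V n = ?T -` S \<inter> ball 0 (real n)" for n
  have Vm: "V n \<in> lmeasurable" for n
    unfolding V_def using measurable_sets[OF Tm S]
    by (auto intro!: bounded_set_imp_lmeasurable)
  have U: "(\<Union>n. V n) = ?T -` S" unfolding V_def using reals_Archimedean2 by fastforce
  have inc: "incseq V" unfolding V_def incseq_def by auto
  have inc': "incseq (\<lambda>n. ?T ` V n)" using inc by (fastforce simp: incseq_def)
  have SU: "(\<Union>n. ?T ` V n) = S" using U affine_vimage_eq_image[OF inv] by (metis image_UN)
  have TV: "?T ` V n \<in> sets lebesgue" for n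
  proof -
    have eq: "?T ` V n = (+) x ` (*v) M ` V n" by (simp add: image_image)
    have "(*v) M ` V n \<in> lmeasurable"
      using measure_linear_image_cart[of "(*v) M" "V n"] Vm by simp
    then show ?thesis unfolding eq using measurable_translation by (metis fmeasurableD)
  qed
  have "range (\<lambda>n. ?T ` V n) \<subseteq> sets lebesgue" using TV by blast
  then have "emeasure lebesgue S = (SUP n. emeasure lebesgue (?T ` V n))"
    using SUP_emeasure_incseq[OF _ inc', of lebesgue] SU by metis
  also have "\<dots> = (SUP n. ennreal \<bar>det M\<bar> * emeasure lebesgue (V n))"
    using fin Vm by simp
  also have "\<dots> = ennreal \<bar>det M\<bar> * (SUP n. emeasure lebesgue (V n))"
    by (simp add: SUP_mult_left_ennreal)
  also have "(SUP n. emeasure lebesgue (V n)) = emeasure lebesgue (?T -` S)"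
  proof -
    have "range V \<subseteq> sets lebesgue" using Vm fmeasurableD by blast
    then show ?thesis using SUP_emeasure_incseq[OF _ inc, of lebesgue] U by metis
  qed
  finally show ?thesis by simp
qed

text \<open>Once the volume formula is an identity of measures, substitution for nonnegative
  integrals and for Bochner integrals can both be read off from it.\<close>

lemma lebesgue_eq_density_distr_affine:
  fixes M :: "real^'n^'n"
  assumes inv: "invertible M"
  shows "density (distr lebesgue lebesgue (\<lambda>y. x + M *v y)) (\<lambda>_. ennreal \<bar>det M\<bar>) = lebesgue"
    (is "density ?D _ = _")
proof (rule measure_eqI)
  let ?T = "\<lambda>y. x + M *v y"
  fix S assume "S \<in> sets (density ?D (\<lambda>_. ennreal \<bar>det M\<bar>))"
  then have S: "S \<in> sets lebesgue" by simp
  have "emeasure (density ?D (\<lambda>_. ennreal \<bar>det M\<bar>)) S = ennreal \<bar>det M\<bar> * emeasure ?D S"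
    using S by (intro emeasure_density_const) (simp only: sets_distr)
  also have "emeasure ?D S = emeasure lebesgue (?T -` S)"
    using S affine_lebesgue_measurable[OF inv, of x]
    by (simp only: emeasure_distr space_completion space_lborel space_borel Int_UNIV_right)
  finally show "emeasure (density ?D (\<lambda>_. ennreal \<bar>det M\<bar>)) S = emeasure lebesgue S"
    using emeasure_affine_vimage[OF inv S, of x] by simp
qed simp

lemma nn_integral_affine:
  fixes M :: "real^'n^'n"
  assumes inv: "invertible M" and f: "f \<in> borel_measurable lebesgue"
  shows "(\<integral>\<^sup>+z. f z \<partial>lebesgue) = ennreal \<bar>det M\<bar> * (\<integral>\<^sup>+y. f (x + M *v y) \<partial>lebesgue)"
proof -
  let ?T = "\<lambda>y. x + M *v y"
  let ?D = "distr lebesgue lebesgue ?T"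
  have Tm: "?T \<in> lebesgue \<rightarrow>\<^sub>M lebesgue" by (rule affine_lebesgue_measurable[OF inv])
  have "(\<integral>\<^sup>+z. f z \<partial>lebesgue) = (\<integral>\<^sup>+z. f z \<partial>density ?D (\<lambda>_. ennreal \<bar>det M\<bar>))"
    unfolding lebesgue_eq_density_distr_affine[OF inv] by (rule refl)
  also have "\<dots> = (\<integral>\<^sup>+z. ennreal \<bar>det M\<bar> * f z \<partial>?D)"
    using f by (intro nn_integral_density) (simp_all add: measurable_distr_eq1)
  also have "\<dots> = (\<integral>\<^sup>+y. ennreal \<bar>det M\<bar> * f (?T y) \<partial>lebesgue)"
    using f Tm by (intro nn_integral_distr) (simp_all add: measurable_distr_eq1)
  also have "\<dots> = ennreal \<bar>det M\<bar> * (\<integral>\<^sup>+y. f (?T y) \<partial>lebesgue)"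
    using measurable_compose[OF Tm f] by (intro nn_integral_cmult)
  finally show ?thesis .
qed

lemma integral_affine:
  fixes M :: "real^'n^'n" and f :: "real^'n \<Rightarrow> real"
  assumes inv: "invertible M" and f: "f \<in> borel_measurable lebesgue"
  shows "(\<integral>z. f z \<partial>lebesgue) = \<bar>det M\<bar> * (\<integral>y. f (x + M *v y) \<partial>lebesgue)"
proof -
  let ?T = "\<lambda>y. x + M *v y"
  let ?D = "distr lebesgue lebesgue ?T"
  have Tm: "?T \<in> lebesgue \<rightarrow>\<^sub>M lebesgue" by (rule affine_lebesgue_measurable[OF inv])
  have "(\<integral>z. f z \<partial>lebesgue) = (\<integral>z. f z \<partial>density ?D (\<lambda>_. ennreal \<bar>det M\<bar>))"
    unfolding lebesgue_eq_density_distr_affine[OF inv] by (rule refl)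
  also have "\<dots> = (\<integral>z. \<bar>det M\<bar> *\<^sub>R f z \<partial>?D)"
    using f by (intro integral_density) (simp_all add: measurable_distr_eq1)
  also have "\<dots> = (\<integral>y. \<bar>det M\<bar> *\<^sub>R f (?T y) \<partial>lebesgue)"
    using f Tm by (intro integral_distr) (simp_all add: measurable_distr_eq1)
  finally show ?thesis by simp
qed

section \<open>Anisotropic balls\<close>

text \<open>The geometry of the balls comes from \<open>rD\<close>; eigenvalue bounds enter later,
  as hypotheses of the lemmas on growth.\<close>

locale anisotropic =
  fixes A :: "real^'n^'n" and D :: "(real^'n) set" and r :: real
  assumes invA: "invertible A" and ell: "ellipsoid0 D" and vol: "emeasure lebesgue D = 1"
    and r_gt_1: "1 < r" and rD: "(\<lambda>x. r *\<^sub>R x) ` D \<subseteq> (\<lambda>x. A *v x) ` D"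
begin

abbreviation "b \<equiv> bdet A"
abbreviation "T \<equiv> dil_pow A"
abbreviation "Bl \<equiv> dball A D"

lemma T_0 [simp]: "T 0 x = x"
  by (simp add: dil_pow_def)

lemma T_succ: "T (k + 1) x = A *v T k x"
proof (cases "0 \<le> k")
  case True
  then have "nat (k + 1) = Suc (nat k)" by simp
  with True show ?thesis by (simp add: dil_pow_def)
next
  case False
  then have e: "nat (- k) = Suc (nat (- k - 1))" by simp
  show ?thesis
  \<comment> \<open>At -1 the two branches of \<open>dil_pow\<close> meet: cancelling the single
    inverse leads to exponent 0, which belongs to the other branch.\<close>
  proof (cases "k = -1")
    case True then show ?thesis by (simp add: dil_pow_def matrix_inv_cancel[OF invA])
  next
    case F: False
    with False have k: "\<not> 0 \<le> k + 1" and "nat (- (k + 1)) = nat (- k - 1)" by auto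
    then have "T (k + 1) x = ((\<lambda>x. matrix_inv A *v x) ^^ nat (- k - 1)) x"
      by (simp only: dil_pow_def if_False)
    moreover have "T k x = matrix_inv A *v ((\<lambda>x. matrix_inv A *v x) ^^ nat (- k - 1)) x"
      using False by (simp only: dil_pow_def if_False e funpow.simps o_apply)
    ultimately show ?thesis by (simp add: matrix_inv_cancel[OF invA])
  qed
qed

lemma T_pred: "T (k - 1) x = matrix_inv A *v T k x"
  using T_succ[of "k - 1" x] by (simp add: matrix_inv_cancel[OF invA])

lemma T_add: "T (k + l) x = T k (T l x)"
proof (induction k rule: int_induct[where k = 0])
  case (step1 i)
  then show ?case using T_succ[of "i + l" x] T_succ[of i "T l x"] by (simp add: ac_simps)
next
  case (step2 i)
  then show ?case using T_pred[of "i + l" x] T_pred[of i "T l x"] by (simp add: algebra_simps)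
qed simp

lemma T_cancel [simp]: "T (- k) (T k x) = x" "T k (T (- k) x) = x"
  using T_add[of "-k" k x] T_add[of k "-k" x] by simp_all

lemma linear_T: "linear (T k)"
proof (induction k rule: int_induct[where k = 0])
  case base
  show ?case by (simp add: linear_iff)
next
  case (step1 i)
  then have "linear ((*v) A \<circ> T i)" by (intro linear_compose) auto
  then show ?case by (simp add: T_succ o_def)
next
  case (step2 i)
  then have "linear ((*v) (matrix_inv A) \<circ> T i)" by (intro linear_compose) auto
  then show ?case by (simp add: T_pred o_def)
qed

lemma T_eq_matrix: "T k x = matrix (T k) *v x"
  using linear_T by (simp add: matrix_works)

lemma invertible_matrix_T: "invertible (matrix (T k))"
proof -
  have "matrix (T k) ** matrix (T (- k)) = mat 1" "matrix (T (- k)) ** matrix (T k) = mat 1"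
    by (simp_all add: matrix_eq matrix_vector_mul_assoc[symmetric] T_eq_matrix[symmetric])
  then show ?thesis unfolding invertible_def by blast
qed

lemma b_pos: "0 < b"
  using invA by (simp add: bdet_def invertible_det_nz)

lemma det_T: "\<bar>det (matrix (T k))\<bar> = b powr real_of_int k"
proof -
  have s: "\<bar>det (matrix (T (k + 1)))\<bar> = b * \<bar>det (matrix (T k))\<bar>" for k
  proof -
    have "matrix (T (k + 1)) = A ** matrix (T k)"
      by (simp add: matrix_eq matrix_vector_mul_assoc[symmetric] T_eq_matrix[symmetric] T_succ)
    then show ?thesis by (simp add: det_mul abs_mult bdet_def)
  qed
  show ?thesis
  proof (induction k rule: int_induct[where k = 0])
    case base
    have "matrix (T 0) = (mat 1 :: real^'n^'n)" by (simp add: matrix_eq T_eq_matrix[symmetric])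
    then show ?case using b_pos by simp
  next
    case (step1 i)
    then show ?case using s[of i] b_pos by (simp add: powr_add)
  next
    case (step2 i)
    then show ?case using s[of "i - 1"] b_pos by (simp add: powr_diff field_simps)
  qed
qed

lemma mem_Bl: "y \<in> Bl x k \<longleftrightarrow> T (- k) (y - x) \<in> D"
proof
  assume "y \<in> Bl x k"
  then show "T (- k) (y - x) \<in> D" by (auto simp: dball_def Bk_def)
next
  assume a: "T (- k) (y - x) \<in> D"
  have "y = x + T k (T (- k) (y - x))" by simp
  with a show "y \<in> Bl x k" unfolding dball_def Bk_def by blast
qed

lemma affine_mem_Bl [simp]: "x + T k y \<in> Bl x k \<longleftrightarrow> y \<in> D"
  by (simp add: mem_Bl)

lemma mem_Bk: "y \<in> Bk A D k \<longleftrightarrow> y \<in> Bl 0 k"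
  by (simp add: dball_def)

lemma mem_Bk_diff: "y - x \<in> Bk A D k \<longleftrightarrow> y \<in> Bl x k"
  by (simp add: mem_Bk mem_Bl)

lemma D_image: obtains M :: "real^'n^'n" where "invertible M" "D = (\<lambda>y. M *v y) ` ball 0 1"
  using ell unfolding ellipsoid0_def by blast

lemma open_D: "open D"
proof -
  obtain M :: "real^'n^'n" where M: "invertible M" "D = (\<lambda>y. M *v y) ` ball 0 1" by (rule D_image)
  have "D = (\<lambda>z. matrix_inv M *v z) -` ball 0 1"
    unfolding M(2) using matrix_inv_cancel[OF M(1)]
    by (auto simp: image_iff intro!: bexI[where x="matrix_inv M *v _"])
  moreover have "continuous_on UNIV (\<lambda>z. matrix_inv M *v z)" by (rule matrix_vector_mult_linear_continuous_on)
  ultimately show ?thesis by (metis continuous_on_open_vimage open_UNIV open_ball Int_UNIV_right)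
qed

lemma convex_D: "convex D"
  by (rule D_image) (auto intro!: convex_linear_image)

lemma bounded_D: "bounded D"
proof -
  obtain M :: "real^'n^'n" where M: "invertible M" "D = (\<lambda>y. M *v y) ` ball 0 1" by (rule D_image)
  then show ?thesis by (auto intro!: bounded_linear_image simp: linear_linear)
qed

lemma zero_in_D: "0 \<in> D"
  by (rule D_image) (auto simp: image_iff intro!: bexI[of _ 0])

lemma uminus_in_D: "z \<in> D \<Longrightarrow> - z \<in> D"
proof -
  assume z: "z \<in> D"
  obtain M :: "real^'n^'n" where M: "D = (\<lambda>y. M *v y) ` ball 0 1" by (rule D_image)
  then obtain y where "y \<in> ball 0 1" "z = M *v y" using z by blast
  then have "- y \<in> ball 0 1" "- z = M *v (- y)"
    using linear_neg[of "(*v) M" y] by auto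
  then show ?thesis using M by blast
qed

lemma uminus_in_D_iff: "- z \<in> D \<longleftrightarrow> z \<in> D"
  using uminus_in_D[of z] uminus_in_D[of "- z"] by auto

lemma scale_in_D: "z \<in> D \<Longrightarrow> 0 \<le> t \<Longrightarrow> t \<le> 1 \<Longrightarrow> t *\<^sub>R z \<in> D"
  using convexD[OF convex_D zero_in_D, of z "1 - t" t] by simp

text \<open>The inclusion of r D in A D says that r A^-1 maps \<open>D\<close> into itself, and this
  is iterated. Nesting, engulfing, absorption and separation of the balls all derive from
  it.\<close>

lemma T_contracts: "z \<in> D \<Longrightarrow> r ^ i *\<^sub>R T (- int i) z \<in> D"
proof (induction i)
  case (Suc i)
  define w where "w = r ^ i *\<^sub>R T (- int i) z"
  have "w \<in> D" using Suc by (simp add: w_def)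
  then obtain u where u: "u \<in> D" "r *\<^sub>R w = A *v u" using rD by blast
  have "r ^ Suc i *\<^sub>R T (- int (Suc i)) z = r *\<^sub>R T (- 1) w"
    using T_add[of "-1" "- int i" z] by (simp add: w_def linear_scale[OF linear_T])
  also have "\<dots> = T (- 1) (r *\<^sub>R w)" by (simp add: linear_scale[OF linear_T])
  also have "\<dots> = u" using T_pred[of 0 "A *v u"] by (simp add: u matrix_inv_cancel[OF invA])
  finally show ?case using u by simp
qed simp

lemma T_contracts_le: "z \<in> D \<Longrightarrow> 0 \<le> t \<Longrightarrow> t \<le> r ^ i \<Longrightarrow> t *\<^sub>R T (- int i) z \<in> D"
  using scale_in_D[OF T_contracts[of z i], of "t / r ^ i"] r_gt_1 by simp

lemma T_neg_in_D: "z \<in> D \<Longrightarrow> T (- int i) z \<in> D"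
  using T_contracts_le[of z 1 i] r_gt_1 by simp

lemma Bl_mono: "k \<le> l \<Longrightarrow> Bl x k \<subseteq> Bl x l"
proof
  fix y assume "k \<le> l" "y \<in> Bl x k"
  then show "y \<in> Bl x l"
    using T_neg_in_D[of "T (- k) (y - x)" "nat (l - k)"] T_add[of "k - l" "- k" "y - x"]
    by (simp add: mem_Bl)
qed

lemma center_in_Bl: "x \<in> Bl x k"
  by (simp add: mem_Bl zero_in_D linear_0[OF linear_T])

lemma mem_Bl_sym: "y \<in> Bl x k \<longleftrightarrow> x \<in> Bl y k"
  using uminus_in_D_iff[of "T (- k) (y - x)"] linear_neg[OF linear_T, of "-k" "y - x"] by (simp add: mem_Bl)

lemma continuous_T: "continuous_on S (T k)"
  using linear_T linear_continuous_on linear_linear by blast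

lemma open_Bl: "open (Bl x k)"
proof -
  have "Bl x k = (\<lambda>y. T (- k) (y - x)) -` D" by (auto simp: mem_Bl)
  moreover have "continuous_on UNIV (\<lambda>y. T (- k) (y - x))"
    by (intro continuous_on_compose2[OF continuous_T[of UNIV]] continuous_intros) auto
  ultimately show ?thesis using open_D by (metis continuous_on_open_vimage open_UNIV Int_UNIV_right)
qed

lemma bounded_Bl: "bounded (Bl x k)"
  unfolding dball_def Bk_def
  by (intro bounded_translation bounded_linear_image bounded_D) (use linear_T linear_linear in blast)

lemma Bl_sets [measurable, simp]: "Bl x k \<in> sets lebesgue"
  using open_Bl by simp

lemma D_sets [measurable, simp]: "D \<in> sets lebesgue"
  using open_D by simp

lemma indicator_Bl_affine: "(indicator (Bl x k) (x + T k y) :: 'a::zero_neq_one) = indicator D y"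
  by (simp add: indicator_def)

lemma nn_integral_Bl:
  assumes f: "f \<in> borel_measurable lebesgue"
  shows "(\<integral>\<^sup>+z\<in>Bl x k. f z \<partial>lebesgue) = ennreal (b powr k) * (\<integral>\<^sup>+y\<in>D. f (x + T k y) \<partial>lebesgue)"
proof -
  have "(\<lambda>z. f z * indicator (Bl x k) z) \<in> borel_measurable lebesgue" using f by measurable
  from nn_integral_affine[OF invertible_matrix_T[of k] this, of x] show ?thesis
    by (simp add: T_eq_matrix[symmetric] det_T indicator_Bl_affine)
qed

lemma set_integral_Bl:
  fixes f :: "real^'n \<Rightarrow> real"
  assumes f: "f \<in> borel_measurable lebesgue"
  shows "set_lebesgue_integral lebesgue (Bl x k) f = b powr k * set_lebesgue_integral lebesgue D (\<lambda>y. f (x + T k y))"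
proof -
  have "(\<lambda>z. indicator (Bl x k) z *\<^sub>R f z) \<in> borel_measurable lebesgue" using f by measurable
  from integral_affine[OF invertible_matrix_T[of k] this, of x] show ?thesis
    by (simp add: T_eq_matrix[symmetric] det_T indicator_Bl_affine set_lebesgue_integral_def)
qed

lemma affine_T_measurable: "(\<lambda>y. x + T k y) \<in> lebesgue \<rightarrow>\<^sub>M lebesgue"
  using affine_lebesgue_measurable[OF invertible_matrix_T[of k], of x] by (simp add: T_eq_matrix[symmetric])

lemma measurable_affine_T:
  "f \<in> borel_measurable lebesgue \<Longrightarrow> (\<lambda>y. f (x + T k y)) \<in> borel_measurable lebesgue"
  by (rule measurable_compose[OF affine_T_measurable])

lemma emeasure_Bl: "emeasure lebesgue (Bl x k) = ennreal (b powr k)"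
  using nn_integral_Bl[of "\<lambda>_. 1" x k] vol by simp

lemma measure_Bl: "measure lebesgue (Bl x k) = b powr k"
  by (simp add: measure_def emeasure_Bl)

text \<open>A^-1 D lies in (1/r) D, and the latter has measure r^-n < 1.\<close>

lemma b_gt_1: "1 < b"
proof -
  have "Bl 0 (-1) \<subseteq> (\<lambda>z. (1 / r) *\<^sub>R z + 0) ` D"
  proof
    fix y assume "y \<in> Bl 0 (-1)"
    then have "r ^ 1 *\<^sub>R T (- int 1) (T 1 y) \<in> D" by (intro T_contracts) (simp add: mem_Bl)
    then have "r *\<^sub>R y \<in> D" using T_cancel(1)[of 1 y] by simp
    then show "y \<in> (\<lambda>z. (1 / r) *\<^sub>R z + 0) ` D" using r_gt_1 by (auto simp: image_iff intro!: bexI[of _ "r *\<^sub>R y"])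
  qed
  then have "emeasure lebesgue (Bl 0 (-1)) \<le> emeasure lebesgue ((\<lambda>z. (1 / r) *\<^sub>R z + 0) ` D)"
  proof (rule emeasure_mono)
    have "open ((\<lambda>z. (1 / r) *\<^sub>R z + 0) ` D)"
      using open_scaling[of "1 / r" D] open_D r_gt_1 by simp
    then show "(\<lambda>z. (1 / r) *\<^sub>R z + 0) ` D \<in> sets lebesgue"
      by (metis borel_open sets_completionI_sets sets_lborel)
  qed
  also have "\<dots> = ennreal ((1 / r) ^ CARD('n))"
    using emeasure_lebesgue_affine[of "1 / r" 0 D] vol r_gt_1 by (simp add: ennreal_power[symmetric])
  also have "\<dots> < ennreal 1"
    using r_gt_1 by (intro ennreal_lessI) (auto simp: power_less_one_iff)
  finally have "b powr -1 < 1" by (simp add: emeasure_Bl)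
  then show ?thesis using b_pos by (simp add: powr_minus field_simps)
qed

text \<open>The number of dilations that makes room for a sum of three elements of \<open>D\<close>:
  convexity puts a third of the sum into \<open>D\<close>, and the contraction by r ^ sig pays for
  the factor 3.\<close>

definition sig :: nat where "sig = (SOME i. 3 \<le> r ^ i)"

lemma sig: "3 \<le> r ^ sig"
proof -
  obtain i where "3 < r ^ i" using real_arch_pow[OF r_gt_1] by blast
  then have "3 \<le> r ^ i" by simp
  then show ?thesis unfolding sig_def by (rule someI)
qed

lemma triple_sum_in_D:
  assumes "x \<in> D" "y \<in> D" "z \<in> D"
  shows "T (- int sig) (x + y + z) \<in> D"
proof -
  have "(1/2) *\<^sub>R x + (1/2) *\<^sub>R y \<in> D" using convexD[OF convex_D assms(1,2), of "1/2" "1/2"] by simp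
  then have "(2/3) *\<^sub>R ((1/2) *\<^sub>R x + (1/2) *\<^sub>R y) + (1/3) *\<^sub>R z \<in> D"
    using convexD[OF convex_D _ assms(3), of _ "2/3" "1/3"] by simp
  then have *: "(1/3) *\<^sub>R (x + y + z) \<in> D" by (simp add: algebra_simps)
  have "3 *\<^sub>R T (- int sig) ((1/3) *\<^sub>R (x + y + z)) \<in> D"
    by (rule T_contracts_le[OF *]) (use sig in auto)
  then show ?thesis by (simp add: linear_scale[OF linear_T])
qed

text \<open>A point \<open>w\<close> of the smaller ball satisfies w - x = (y - x) + (z - y) + (w -
  z), with all three differences in the \<open>k\<close>-th dilate of \<open>D\<close>.\<close>

lemma Bl_engulf:
  assumes "y \<in> Bl x k" "y \<in> Bl z j" "j \<le> k"
  shows "Bl z j \<subseteq> Bl x (k + int sig)"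
proof
  fix w assume "w \<in> Bl z j"
  with assms(3) have w: "w \<in> Bl z k" using Bl_mono by blast
  have "z \<in> Bl y k" using assms(2,3) Bl_mono mem_Bl_sym by blast
  then have "T (- int sig) (T (- k) (y - x) + T (- k) (z - y) + T (- k) (w - z)) \<in> D"
    using w assms(1) by (intro triple_sum_in_D) (auto simp: mem_Bl)
  also have "T (- k) (y - x) + T (- k) (z - y) + T (- k) (w - z) = T (- k) (w - x)"
    by (simp add: linear_add[OF linear_T, symmetric])
  finally show "w \<in> Bl x (k + int sig)"
    using T_add[of "- int sig" "- k" "w - x"] by (simp add: mem_Bl algebra_simps)
qed

lemma Bl_absorbing: "\<exists>i::nat. y \<in> Bl x (int i)"
proof -
  obtain e where e: "e > 0" "ball 0 e \<subseteq> D" using open_D zero_in_D open_contains_ball by blast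
  define s where "s = norm (y - x) / e * 2"
  obtain i where i: "s < r ^ i" using real_arch_pow[OF r_gt_1] by blast
  show ?thesis
  proof (cases "y = x")
    case True then show ?thesis using center_in_Bl by auto
  next
    case False
    then have s0: "s > 0" using e by (simp add: s_def)
    have "(1 / s) *\<^sub>R (y - x) \<in> D"
      using e False by (intro subsetD[OF e(2)]) (auto simp: s_def)
    then have "s *\<^sub>R T (- int i) ((1 / s) *\<^sub>R (y - x)) \<in> D"
      by (rule T_contracts_le) (use i s0 in auto)
    then show ?thesis using s0 by (auto simp: mem_Bl linear_scale[OF linear_T] intro!: exI[of _ i])
  qed
qed

text \<open>If \<open>y\<close> lay in all the small balls, contraction would put every r^i (y - x)
  into \<open>D\<close>, which is bounded.\<close>

lemma Bl_separating:
  assumes "y \<noteq> x"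
  shows "\<exists>i::nat. y \<notin> Bl x (- int i)"
proof (rule ccontr)
  assume "\<not> ?thesis"
  then have *: "y \<in> Bl x (- int i)" for i by blast
  obtain R where R: "\<And>z. z \<in> D \<Longrightarrow> norm z \<le> R" using bounded_D bounded_iff by blast
  have "r ^ i * norm (y - x) \<le> R" for i
  proof -
    have "r ^ i *\<^sub>R T (- int i) (T (int i) (y - x)) \<in> D"
      using *[of i] by (intro T_contracts) (simp add: mem_Bl)
    from R[OF this] show ?thesis using r_gt_1 by simp
  qed
  moreover obtain i where "R / norm (y - x) < r ^ i" using real_arch_pow[OF r_gt_1] by blast
  ultimately show False using assms by (simp add: field_simps) (meson leD)
qed

lemma annulus_exists:
  assumes "y \<noteq> x"
  obtains k where "y \<in> Bl x (k + 1)" "y \<notin> Bl x k"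
proof -
  obtain i j where i: "y \<in> Bl x (int i)" and j: "y \<notin> Bl x (- int j)"
    using Bl_absorbing Bl_separating[OF assms] by blast
  \<comment> \<open>Counting from - j makes the exponents natural numbers, so that a least one
    exists; index 0 fails, so the least index has a predecessor.\<close>
  define P where "P n \<longleftrightarrow> y \<in> Bl x (- int j + int n)" for n
  have "P (i + j)" using i by (simp add: P_def)
  then have L: "P (LEAST n. P n)" by (rule LeastI)
  have "\<not> P 0" using j by (simp add: P_def)
  then obtain n where n: "(LEAST n. P n) = Suc n" using L by (metis not0_implies_Suc)
  then have "\<not> P n" using not_less_Least[of n P] by simp
  with L n show ?thesis by (intro that[of "- int j + int n"]) (auto simp: P_def algebra_simps)
qed

text \<open>By nesting, a point lies in one annulus only, so the definite description in
  \<open>rho\<close> picks out \<open>k\<close>.\<close>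

lemma rho_annulus:
  assumes "y \<in> Bl x (k + 1)" "y \<notin> Bl x k"
  shows "rho A D (y - x) = b powr k"
proof -
  have "y \<noteq> x" using assms(2) center_in_Bl by auto
  moreover have "(THE k. y - x \<in> Bk A D (k + 1) - Bk A D k) = k"
  proof (rule the_equality)
    show "y - x \<in> Bk A D (k + 1) - Bk A D k" using assms by (simp add: mem_Bk_diff)
  next
    fix l assume "y - x \<in> Bk A D (l + 1) - Bk A D l"
    then have l: "y \<in> Bl x (l + 1)" "y \<notin> Bl x l" by (simp_all add: mem_Bk_diff)
    show "l = k"
      using assms l Bl_mono[of "k + 1" l x] Bl_mono[of "l + 1" k x] by force
  qed
  ultimately show ?thesis by (simp add: rho_def)
qed

lemma rho_nonneg: "0 \<le> rho A D z"
  by (simp add: rho_def)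

lemma rho_le:
  assumes "y \<in> Bl x k"
  shows "rho A D (y - x) \<le> b powr k"
proof (cases "y = x")
  case False
  then obtain l where l: "y \<in> Bl x (l + 1)" "y \<notin> Bl x l" by (rule annulus_exists)
  have "l < k" using l(2) assms Bl_mono[of k l x] by (metis in_mono linorder_not_less)
  then show ?thesis using b_gt_1 by (simp add: rho_annulus[OF l])
qed (simp add: rho_def)

text \<open>The form in which the kernel is split. Index 0 is the ball itself, where
  \<open>rho\<close> may be small; at any other index the point lies in the outermost annulus, so
  \<open>rho\<close> is known exactly, one exponent lower.\<close>

lemma enclosing_Bl:
  obtains i :: nat where "y \<in> Bl x (k + int i)" "i \<noteq> 0 \<Longrightarrow> rho A D (y - x) = b powr (k + int i - 1)"
proof (cases "y \<in> Bl x k")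
  case True
  then show ?thesis using that[of 0] by simp
next
  case False
  then have "y \<noteq> x" using center_in_Bl by auto
  then obtain l where l: "y \<in> Bl x (l + 1)" "y \<notin> Bl x l" by (rule annulus_exists)
  have "k \<le> l" using False l(1) Bl_mono[of "l + 1" k x] by (metis in_mono linorder_not_le zless_iff_Suc_zadd int_one_le_iff_zero_less add1_zle_eq)
  with l rho_annulus[OF l] show ?thesis
    by (intro that[of "nat (l + 1 - k)"]) (auto simp: algebra_simps)
qed

lemma set_nn_integral_Bl_Lloc:
  assumes f: "Lloc q f"
  shows "(\<integral>\<^sup>+z\<in>Bl x k. ennreal (\<bar>f z\<bar> powr q) \<partial>lebesgue) < top"
proof -
  have c: "compact (closure (Bl x k))" using bounded_Bl by simp
  have "(\<integral>\<^sup>+z\<in>Bl x k. ennreal (\<bar>f z\<bar> powr q) \<partial>lebesgue) \<le> (\<integral>\<^sup>+z\<in>closure (Bl x k). ennreal (\<bar>f z\<bar> powr q) \<partial>lebesgue)"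
    using closure_subset[of "Bl x k"] by (intro nn_integral_mono mult_left_mono) (auto simp: indicator_def)
  also have "\<dots> < top" using f c by (simp add: Lloc_def)
  finally show ?thesis .
qed

lemma Lloc_measurable: "Lloc q f \<Longrightarrow> f \<in> borel_measurable lebesgue"
  by (simp add: Lloc_def)

end

section \<open>Growth of matrix powers\<close>

definition vnorm1 :: "complex^'n \<Rightarrow> real" where
  "vnorm1 v = (\<Sum>i\<in>UNIV. cmod (v $ i))"

lemma vnorm1_nonneg: "0 \<le> vnorm1 v"
  by (simp add: vnorm1_def sum_nonneg)

lemma vnorm1_add: "vnorm1 (v + w) \<le> vnorm1 v + vnorm1 w"
  unfolding vnorm1_def sum.distrib[symmetric] by (intro sum_mono) (simp add: norm_triangle_ineq)

lemma vnorm1_scale: "vnorm1 (z *s v) = cmod z * vnorm1 v"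
  by (simp add: vnorm1_def norm_mult sum_distrib_left)

text \<open>The vector p(B) v. An action on vectors suffices because annihilating polynomials are
  used for one vector at a time.\<close>

definition poly_mat :: "complex^'n^'n \<Rightarrow> complex poly \<Rightarrow> complex^'n \<Rightarrow> complex^'n" where
  "poly_mat B p v = (\<Sum>j\<le>degree p. coeff p j *s (((*v) B) ^^ j) v)"

lemma poly_mat_bound:
  assumes "degree p \<le> n"
  shows "poly_mat B p v = (\<Sum>j\<le>n. coeff p j *s (((*v) B) ^^ j) v)"
  unfolding poly_mat_def using assms
  by (intro sum.mono_neutral_left) (auto simp: coeff_eq_0)

lemma matrix_vector_mult_sum:
  fixes B :: "'a::field^'n^'n"
  shows "B *v (\<Sum>j\<in>S. c j *s f j) = (\<Sum>j\<in>S. c j *s (B *v f j))"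
  by (induction S rule: infinite_finite_induct)
     (simp_all add: matrix_vector_right_distrib vector_scalar_commute)

lemma poly_mat_linear_factor:
  "poly_mat B ([:- z, 1:] * p) v = B *v poly_mat B p v - z *s poly_mat B p v"
proof (cases "p = 0")
  case True
  then show ?thesis by (simp add: poly_mat_def)
next
  case False
  let ?f = "\<lambda>j. (((*v) B) ^^ j) v"
  have c0: "coeff ([:- z, 1:] * p) 0 = - z * coeff p 0" by simp
  have cS: "coeff ([:- z, 1:] * p) (Suc j) = coeff p j - z * coeff p (Suc j)" for j by simp
  have "degree ([:- z, 1:] * p) \<le> Suc (degree p)"
    using False by (subst degree_mult_eq) auto
  then have "poly_mat B ([:- z, 1:] * p) v = (\<Sum>j\<le>Suc (degree p). coeff ([:- z, 1:] * p) j *s ?f j)"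
    by (rule poly_mat_bound)
  also have "\<dots> = (- z * coeff p 0) *s ?f 0 + (\<Sum>j\<le>degree p. (coeff p j - z * coeff p (Suc j)) *s ?f (Suc j))"
    unfolding sum.atMost_Suc_shift c0 cS ..
  also have "\<dots> = (\<Sum>j\<le>degree p. coeff p j *s ?f (Suc j))
      - (z *s (coeff p 0 *s ?f 0) + (\<Sum>j\<le>degree p. z *s (coeff p (Suc j) *s ?f (Suc j))))"
    by (simp add: vector_sub_rdistrib sum_subtractf vector_smult_assoc vec_eq_iff algebra_simps)
  also have "z *s (coeff p 0 *s ?f 0) + (\<Sum>j\<le>degree p. z *s (coeff p (Suc j) *s ?f (Suc j)))
      = (\<Sum>j\<le>Suc (degree p). z *s (coeff p j *s ?f j))"
    unfolding sum.atMost_Suc_shift ..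
  also have "\<dots> = z *s (\<Sum>j\<le>Suc (degree p). coeff p j *s ?f j)"
    by (simp only: vec_eq_iff sum_component vector_smult_component sum_distrib_left) simp
  also have "(\<Sum>j\<le>Suc (degree p). coeff p j *s ?f j) = poly_mat B p v"
    by (rule poly_mat_bound[symmetric]) simp
  also have "(\<Sum>j\<le>degree p. coeff p j *s ?f (Suc j)) = B *v poly_mat B p v"
    by (simp add: poly_mat_def matrix_vector_mult_sum)
  finally show ?thesis .
qed

text \<open>Polynomials in B commute with B - z. This moves a linear factor of an annihilating
  polynomial from the polynomial onto the vector.\<close>

lemma poly_mat_commute:
  "poly_mat B p (B *v v - z *s v) = B *v poly_mat B p v - z *s poly_mat B p v"
proof -
  have pw: "(((*v) B) ^^ j) (B *v v - z *s v) = B *v (((*v) B) ^^ j) v - z *s (((*v) B) ^^ j) v" for j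
    by (induction j) (simp_all add: matrix_vector_mult_diff_distrib vector_scalar_commute)
  show ?thesis
    unfolding poly_mat_def pw matrix_vector_mult_sum
    by (simp add: vec_eq_iff sum_subtractf[symmetric] sum_distrib_left algebra_simps)
qed

lemma eigen_ker:
  assumes "\<not> eigen A z" "cmat A *v w - z *s w = 0"
  shows "w = 0"
proof -
  have m: "mat z *v w = z *s w"
    by (simp add: vec_eq_iff matrix_vector_mult_def mat_def if_distrib[where f="\<lambda>x. x * _"] cong: if_cong)
  have inv: "invertible (mat z - cmat A)" using assms(1) by (simp add: eigen_def invertible_det_nz)
  then obtain B where B: "B ** (mat z - cmat A) = mat 1" unfolding invertible_def by blast
  have "(mat z - cmat A) *v w = 0" using assms(2) m by (simp add: matrix_vector_mult_diff_rdistrib)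
  then have "B *v ((mat z - cmat A) *v w) = 0" by simp
  then show ?thesis by (simp add: matrix_vector_mul_assoc B)
qed

lemma pCons_one_nz: "[:a, 1:] \<noteq> (0 :: complex poly)"
  by simp

text \<open>Induction on the degree replaces the Jordan form. Split off a root \<open>z\<close>. If
  \<open>z\<close> is no eigenvalue, B - z is injective and the cofactor already annihilates
  \<open>v\<close>. Otherwise the cofactor annihilates w = B v - z v, and B^(k+1) v = B^k w + z B^k
  v is a recursion whose solution stays below a multiple of R^k, since cmod z < R.\<close>

lemma annihilated_power_growth:
  fixes A :: "real^'n^'n"
  assumes R: "\<And>z. eigen A z \<Longrightarrow> cmod z < R"
  shows "p \<noteq> 0 \<Longrightarrow> poly_mat (cmat A) p v = 0 \<Longrightarrow>
    \<exists>C\<ge>0. \<forall>k. vnorm1 ((((*v) (cmat A)) ^^ k) v) \<le> C * R ^ k"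
proof (induction "degree p" arbitrary: p v)
  case 0
  then have "coeff p 0 *s v = 0" "coeff p 0 \<noteq> 0"
    using leading_coeff_0_iff[of p] by (auto simp: poly_mat_def)
  then have "v = 0" by simp
  moreover have "(((*v) (cmat A)) ^^ k) (0::complex^'n) = 0" for k by (induction k) auto
  ultimately show ?case by (intro exI[of _ 0]) (simp add: vnorm1_def)
next
  case (Suc n)
  let ?B = "cmat A"
  have "degree p > 0" using Suc.hyps(2) by simp
  then obtain z where "poly p z = 0" using alg_closed_imp_poly_has_root by blast
  then obtain p' where p': "p = [:- z, 1:] * p'" by (metis dvdE poly_eq_0_iff_dvd)
  have "p' \<noteq> 0" using Suc.prems p' by auto
  have "degree p = degree [:- z, 1:] + degree p'"
    unfolding p' by (rule degree_mult_eq) (rule pCons_one_nz, rule \<open>p' \<noteq> 0\<close>)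
  then have deg: "n = degree p'" using Suc.hyps(2) by simp
  have e: "?B *v poly_mat ?B p' v - z *s poly_mat ?B p' v = 0"
    using Suc.prems(2) unfolding p' poly_mat_linear_factor .
  show ?case
  proof (cases "eigen A z")
    case False
    then have "poly_mat ?B p' v = 0" using eigen_ker e by blast
    then show ?thesis using Suc.hyps(1)[OF deg \<open>p' \<noteq> 0\<close>] by blast
  next
    case True
    define w where "w = ?B *v v - z *s v"
    have "poly_mat ?B p' w = 0" unfolding w_def poly_mat_commute by (rule e)
    then obtain C where C: "C \<ge> 0" "\<And>k. vnorm1 ((((*v) ?B) ^^ k) w) \<le> C * R ^ k"
      using Suc.hyps(1)[OF deg \<open>p' \<noteq> 0\<close>] by blast
    \<comment> \<open>The first entry starts the induction at exponent 0; the second gives C + cmod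
      z * K \<le> K * R, which is its step.\<close>
    define K where "K = max (vnorm1 v) (C / (R - cmod z))"
    have zR: "cmod z < R" by (rule R[OF True])
    then have R0: "R > 0" using norm_ge_zero[of z] by linarith
    have K: "K \<ge> 0" "C \<le> K * (R - cmod z)"
      using zR by (auto simp: K_def vnorm1_nonneg le_max_iff_disj pos_divide_le_eq[symmetric])
    have "vnorm1 ((((*v) ?B) ^^ k) v) \<le> K * R ^ k" for k
    proof (induction k)
      case 0 then show ?case by (simp add: K_def)
    next
      case (Suc k)
      have sw: "(((*v) ?B) ^^ Suc k) v = (((*v) ?B) ^^ k) w + z *s (((*v) ?B) ^^ k) v"
        unfolding w_def by (induction k) (simp_all add: matrix_vector_right_distrib matrix_vector_mult_diff_distrib vector_scalar_commute)
      have "vnorm1 ((((*v) ?B) ^^ Suc k) v) \<le> C * R ^ k + cmod z * (K * R ^ k)"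
        unfolding sw by (rule order_trans[OF vnorm1_add]) (intro add_mono C, unfold vnorm1_scale, intro mult_left_mono Suc norm_ge_zero)
      also have "\<dots> = (C + cmod z * K) * R ^ k" by (simp add: algebra_simps)
      also have "\<dots> \<le> (K * R) * R ^ k" using K R0 by (intro mult_right_mono) (auto simp: algebra_simps)
      finally show ?case by (simp add: algebra_simps)
    qed
    then show ?thesis using K by blast
  qed
qed

text \<open>The first N + 1 iterates of \<open>v\<close> live in a real space of dimension N, so
  they satisfy a linear relation. Coinciding iterates would be lost when passing to the set of
  vectors; in that case a difference of two monomials annihilates.\<close>

lemma annihilator_exists:
  fixes B :: "complex^'n^'n"
  shows "\<exists>p. p \<noteq> 0 \<and> poly_mat B p v = 0"
proof -
  let ?N = "DIM(complex^'n)"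
  let ?f = "\<lambda>j. (((*v) B) ^^ j) v"
  have scale: "complex_of_real c *s w = c *\<^sub>R w" for c and w :: "complex^'n"
    by (simp only: vec_eq_iff vector_smult_component vector_scaleR_component) (simp add: scaleR_conv_of_real)
  show ?thesis
  proof (cases "inj_on ?f {..?N}")
    case False
    then obtain i j where ij: "i \<noteq> j" "?f i = ?f j" by (auto simp: inj_on_def)
    let ?p = "monom 1 i - monom 1 j :: complex poly"
    have "degree ?p \<le> max i j" by (rule degree_diff_le_max[THEN order_trans]) (simp add: degree_monom_eq)
    then have "poly_mat B ?p v = (\<Sum>k\<le>max i j. coeff ?p k *s ?f k)" by (rule poly_mat_bound)
    also have "\<dots> = (\<Sum>k\<le>max i j. (if k = i then ?f k else 0)) - (\<Sum>k\<le>max i j. (if k = j then ?f k else 0))"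
      unfolding sum_subtractf[symmetric] by (intro sum.cong) (use ij in auto)
    also have "\<dots> = 0" using ij by (simp add: sum.delta)
    finally have "poly_mat B ?p v = 0" .
    moreover have "coeff ?p i \<noteq> 0" using ij by simp
    then have "?p \<noteq> 0" by (metis coeff_0)
    ultimately show ?thesis by blast
  next
    case True
    then have "card (?f ` {..?N}) = Suc ?N" by (simp add: card_image)
    then have "dependent (?f ` {..?N})" using independent_bound[of "?f ` {..?N}"] by linarith
    then obtain u where u: "\<exists>w\<in>?f ` {..?N}. u w \<noteq> 0" "(\<Sum>w\<in>?f ` {..?N}. u w *\<^sub>R w) = 0"
      unfolding real_vector.dependent_finite[OF finite_imageI[OF finite_atMost]] by blast
    have s: "(\<Sum>j\<le>?N. u (?f j) *\<^sub>R ?f j) = 0"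
      using u(2) by (subst (asm) sum.reindex[OF True]) (simp add: o_def)
    define p where "p = (\<Sum>j\<le>?N. monom (complex_of_real (u (?f j))) j)"
    have co: "coeff p j = (if j \<le> ?N then complex_of_real (u (?f j)) else 0)" for j
      by (simp add: p_def coeff_sum)
    have "degree p \<le> ?N" by (rule degree_le) (simp add: co)
    then have "poly_mat B p v = (\<Sum>j\<le>?N. coeff p j *s ?f j)" by (rule poly_mat_bound)
    also have "\<dots> = (\<Sum>j\<le>?N. u (?f j) *\<^sub>R ?f j)" by (intro sum.cong) (simp_all add: co scale)
    finally have "poly_mat B p v = 0" using s by simp
    moreover obtain j where "j \<le> ?N" "u (?f j) \<noteq> 0" using u(1) by blast
    then have "coeff p j \<noteq> 0" by (simp add: co)
    then have "p \<noteq> 0" by (metis coeff_0)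
    ultimately show ?thesis by blast
  qed
qed

text \<open>Annihilators give a constant for each vector separately; adding up those of the standard
  basis makes it uniform.\<close>

lemma matrix_power_growth:
  fixes A :: "real^'n^'n"
  assumes R: "\<And>z. eigen A z \<Longrightarrow> cmod z < R"
  obtains C where "0 \<le> C" "\<And>k x. norm ((((*v) A) ^^ k) x) \<le> C * R ^ k * norm x"
proof -
  define cv :: "real^'n \<Rightarrow> complex^'n" where "cv x = (\<chi> i. complex_of_real (x $ i))" for x
  have cA: "cmat A *v cv x = cv (A *v x)" for x
    by (simp add: vec_eq_iff cmat_def cv_def matrix_vector_mult_def)
  have cpow: "(((*v) (cmat A)) ^^ k) (cv x) = cv ((((*v) A) ^^ k) x)" for k x
    by (induction k) (simp_all add: cA)
  have nv: "norm x \<le> vnorm1 (cv x)" for x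
    using norm_le_l1_cart[of x] by (simp add: vnorm1_def cv_def)
  have "\<exists>C\<ge>0. \<forall>k. norm ((((*v) A) ^^ k) x) \<le> C * R ^ k" for x
  proof -
    obtain p where "p \<noteq> 0" "poly_mat (cmat A) p (cv x) = 0" using annihilator_exists by blast
    from annihilated_power_growth[OF R this] obtain C where
      C: "C \<ge> 0" "\<And>k. vnorm1 ((((*v) (cmat A)) ^^ k) (cv x)) \<le> C * R ^ k" by blast
    show ?thesis
    proof (intro exI[of _ C] conjI allI C(1))
      fix k show "norm ((((*v) A) ^^ k) x) \<le> C * R ^ k"
        using order_trans[OF nv C(2)[of k, unfolded cpow]] .
    qed
  qed
  then obtain C where C: "\<And>x. C x \<ge> 0" "\<And>x k. norm ((((*v) A) ^^ k) x) \<le> C x * R ^ k" by metis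
  have lin: "linear (((*v) A) ^^ k)" for k
    by (induction k) (auto simp: linear_iff matrix_vector_right_distrib matrix_vector_mult_scaleR)
  show ?thesis
  proof (rule that[of "\<Sum>i\<in>UNIV. C (axis i 1)"])
    show "0 \<le> (\<Sum>i\<in>UNIV. C (axis i 1))" by (intro sum_nonneg C)
    fix k and x :: "real^'n"
    let ?L = "((*v) A) ^^ k"
    have "x = (\<Sum>i\<in>UNIV. x $ i *\<^sub>R axis i 1)"
      using basis_expansion[of x] by (simp add: scalar_mult_eq_scaleR)
    then have "?L x = ?L (\<Sum>i\<in>UNIV. x $ i *\<^sub>R axis i 1)" by (rule arg_cong)
    then have e: "?L x = (\<Sum>i\<in>UNIV. x $ i *\<^sub>R ?L (axis i 1))"
      unfolding linear_sum[OF lin] linear_scale[OF lin] .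
    have "norm (?L x) \<le> (\<Sum>i\<in>UNIV. norm (x $ i *\<^sub>R ?L (axis i 1)))" unfolding e by (rule norm_sum)
    also have "\<dots> \<le> (\<Sum>i\<in>UNIV. norm x * (C (axis i 1) * R ^ k))"
      by (intro sum_mono) (simp add: mult_mono component_le_norm_cart C)
    finally show "norm (?L x) \<le> (\<Sum>i\<in>UNIV. C (axis i 1)) * R ^ k * norm x"
      by (simp add: sum_distrib_left sum_distrib_right algebra_simps)
  qed
qed

context anisotropic begin

lemma T_nat: "T (int k) x = (((*v) A) ^^ k) x"
  by (simp add: dil_pow_def)

text \<open>Otherwise all eigenvalues have modulus below 1 and the powers of A are bounded. Then
  some small y \<noteq> 0 has all iterates in \<open>D\<close>, and contraction puts every r^i y
  into the bounded set \<open>D\<close>.\<close>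

lemma eigen_bound_gt_1:
  assumes R: "\<And>z. eigen A z \<Longrightarrow> cmod z < R"
  shows "1 < R"
proof (rule ccontr)
  assume "\<not> 1 < R"
  then have R1: "cmod z < 1" if "eigen A z" for z using R[OF that] by linarith
  obtain C where C: "0 \<le> C" "\<And>k x. norm ((((*v) A) ^^ k) x) \<le> C * 1 ^ k * norm x"
    using matrix_power_growth[OF R1] by blast
  obtain e where e: "e > 0" "ball 0 e \<subseteq> D" using open_D zero_in_D open_contains_ball by blast
  define y :: "real^'n" where "y = (e / (C + 1) / 2) *\<^sub>R axis undefined 1"
  have ny: "norm y = e / (C + 1) / 2" using e C(1) by (simp add: y_def)
  have "C * norm y < e"
  proof -
    have "C * norm y \<le> (C + 1) * norm y" using C(1) by (intro mult_right_mono) auto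
    also have "\<dots> = e / 2" using C(1) by (simp add: ny field_simps)
    finally show ?thesis using e by simp
  qed
  then have "T (int i) y \<in> D" for i
    using C(2)[of i y] by (intro subsetD[OF e(2)]) (simp add: T_nat)
  then have *: "r ^ i *\<^sub>R y \<in> D" for i using T_contracts[of "T (int i) y" i] by simp
  obtain K where K: "\<And>z. z \<in> D \<Longrightarrow> norm z \<le> K" using bounded_D bounded_iff by blast
  obtain i where "K / norm y < r ^ i" using real_arch_pow[OF r_gt_1] by blast
  moreover have "norm y > 0" using ny e C(1) by simp
  ultimately show False using K[OF *[of i]] r_gt_1 by (simp add: field_simps)
qed

end

section \<open>Polynomial projections\<close>

definition mono_fun :: "('n \<Rightarrow> nat) \<Rightarrow> real^'n \<Rightarrow> real" where
  "mono_fun \<alpha> x = (\<Prod>i\<in>UNIV. (x $ i) ^ \<alpha> i)"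

lemma finite_multi_indices: "finite {\<alpha>::'n::finite \<Rightarrow> nat. sum \<alpha> UNIV \<le> d}"
proof (rule finite_subset)
  show "{\<alpha>::'n \<Rightarrow> nat. sum \<alpha> UNIV \<le> d} \<subseteq> PiE UNIV (\<lambda>_. {..d})"
  proof (rule subsetI)
    fix \<alpha> :: "'n \<Rightarrow> nat" assume "\<alpha> \<in> {\<alpha>. sum \<alpha> UNIV \<le> d}"
    moreover have "\<alpha> i \<le> sum \<alpha> UNIV" for i by (rule member_le_sum) auto
    ultimately show "\<alpha> \<in> PiE UNIV (\<lambda>_. {..d})" by (auto intro: order_trans)
  qed
  show "finite (PiE (UNIV :: 'n set) (\<lambda>_. {..d}))" by (intro finite_PiE) auto
qed

lemma poly_le_iff:
  "P \<in> poly_le d \<longleftrightarrow> (\<exists>c. P = (\<lambda>x. \<Sum>\<alpha> | sum \<alpha> UNIV \<le> d. c \<alpha> * mono_fun \<alpha> x))"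
  by (auto simp: poly_le_def mono_fun_def fun_eq_iff)

lemma poly_le_add:
  assumes "P \<in> poly_le d" "Q \<in> poly_le d" shows "(\<lambda>x. P x + Q x) \<in> poly_le d"
proof -
  obtain c c' where "P = (\<lambda>x. \<Sum>\<alpha> | sum \<alpha> UNIV \<le> d. c \<alpha> * mono_fun \<alpha> x)"
    "Q = (\<lambda>x. \<Sum>\<alpha> | sum \<alpha> UNIV \<le> d. c' \<alpha> * mono_fun \<alpha> x)"
    using assms by (auto simp: poly_le_iff)
  then show ?thesis unfolding poly_le_iff
    by (intro exI[of _ "\<lambda>\<alpha>. c \<alpha> + c' \<alpha>"]) (simp add: sum.distrib algebra_simps)
qed

lemma poly_le_cmult:
  assumes "P \<in> poly_le d" shows "(\<lambda>x. a * P x) \<in> poly_le d"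
proof -
  obtain c where "P = (\<lambda>x. \<Sum>\<alpha> | sum \<alpha> UNIV \<le> d. c \<alpha> * mono_fun \<alpha> x)"
    using assms by (auto simp: poly_le_iff)
  then show ?thesis unfolding poly_le_iff
    by (intro exI[of _ "\<lambda>\<alpha>. a * c \<alpha>"]) (simp add: sum_distrib_left algebra_simps)
qed

lemma poly_le_0: "(\<lambda>x. 0) \<in> poly_le d"
  unfolding poly_le_iff by (rule exI[of _ "\<lambda>_. 0"]) simp

lemma poly_le_diff: "P \<in> poly_le d \<Longrightarrow> Q \<in> poly_le d \<Longrightarrow> (\<lambda>x. P x - Q x) \<in> poly_le d"
  using poly_le_add[of P d "\<lambda>x. (-1) * Q x"] poly_le_cmult[of Q d "-1"] by simp

lemma poly_le_sum:
  "(\<And>i. i \<in> S \<Longrightarrow> P i \<in> poly_le d) \<Longrightarrow> (\<lambda>x. \<Sum>i\<in>S. P i x) \<in> poly_le d"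
  by (induction S rule: infinite_finite_induct) (auto simp: poly_le_0 poly_le_add)

lemma mono_fun_in_poly_le:
  fixes \<alpha> :: "'n::finite \<Rightarrow> nat"
  assumes "sum \<alpha> UNIV \<le> d" shows "mono_fun \<alpha> \<in> poly_le d"
  unfolding poly_le_iff
proof (rule exI[of _ "\<lambda>\<beta>. if \<beta> = \<alpha> then 1 else 0"], rule ext)
  fix x :: "real^'n"
  have "(\<Sum>\<beta> | sum \<beta> UNIV \<le> d. (if \<beta> = \<alpha> then 1 else 0) * mono_fun \<beta> x)
      = (\<Sum>\<beta> | sum \<beta> UNIV \<le> d. if \<beta> = \<alpha> then mono_fun \<beta> x else 0)" by (intro sum.cong) auto
  also have "\<dots> = mono_fun \<alpha> x" using assms finite_multi_indices[where ?'n='n] by (simp add: sum.delta)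
  finally show "mono_fun \<alpha> x = (\<Sum>\<beta> | sum \<beta> UNIV \<le> d. (if \<beta> = \<alpha> then 1 else 0) * mono_fun \<beta> x)" ..
qed

lemma poly_le_mono:
  assumes "P \<in> poly_le d" "d \<le> d'" shows "P \<in> poly_le d'"
proof -
  obtain c where P: "P = (\<lambda>x. \<Sum>\<alpha> | sum \<alpha> UNIV \<le> d. c \<alpha> * mono_fun \<alpha> x)"
    using assms by (auto simp: poly_le_iff)
  show ?thesis unfolding P
    by (intro poly_le_sum poly_le_cmult mono_fun_in_poly_le) (use assms in auto)
qed

lemma poly_le_const: "(\<lambda>x. a) \<in> poly_le d"
  using poly_le_cmult[OF mono_fun_in_poly_le[of "\<lambda>_. 0" d], of a] by (simp add: mono_fun_def)

lemma poly_le_mult: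
  assumes "P \<in> poly_le d" "Q \<in> poly_le d'" shows "(\<lambda>x. P x * Q x) \<in> poly_le (d + d')"
proof -
  obtain c c' where P: "P = (\<lambda>x. \<Sum>\<alpha> | sum \<alpha> UNIV \<le> d. c \<alpha> * mono_fun \<alpha> x)"
    and Q: "Q = (\<lambda>x. \<Sum>\<alpha> | sum \<alpha> UNIV \<le> d'. c' \<alpha> * mono_fun \<alpha> x)"
    using assms by (auto simp: poly_le_iff)
  have m: "(c \<alpha> * mono_fun \<alpha> x) * (c' \<beta> * mono_fun \<beta> x) = (c \<alpha> * c' \<beta>) * mono_fun (\<lambda>i. \<alpha> i + \<beta> i) x" for \<alpha> \<beta> x
    by (simp add: mono_fun_def power_add prod.distrib)
  show ?thesis unfolding P Q sum_product m
    by (intro poly_le_sum poly_le_cmult mono_fun_in_poly_le) (auto simp: sum.distrib)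
qed

lemma poly_le_component: "(\<lambda>x. x $ i) \<in> poly_le 1"
proof -
  have "mono_fun (\<lambda>j. if j = i then 1 else 0) = (\<lambda>x. x $ i)"
    by (auto simp: mono_fun_def fun_eq_iff if_distrib[of "\<lambda>n. _ ^ n"] prod.delta cong: if_cong)
  then show ?thesis using mono_fun_in_poly_le[of "\<lambda>j. if j = i then 1 else 0" 1] by simp
qed

lemma poly_le_power: "P \<in> poly_le d \<Longrightarrow> (\<lambda>x. P x ^ k) \<in> poly_le (k * d)"
  by (induction k) (auto simp: poly_le_const poly_le_mult)

lemma poly_le_prod:
  "finite S \<Longrightarrow> (\<And>i. i \<in> S \<Longrightarrow> P i \<in> poly_le (e i)) \<Longrightarrow> (\<lambda>x. \<Prod>i\<in>S. P i x) \<in> poly_le (sum e S)"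
  by (induction S rule: finite_induct) (auto simp: poly_le_const poly_le_mult)

lemma poly_le_compose_affine:
  fixes M :: "real^'n^'n"
  assumes "P \<in> poly_le d" shows "(\<lambda>y. P (x + M *v y)) \<in> poly_le d"
proof -
  obtain c where P: "P = (\<lambda>x. \<Sum>\<alpha> | sum \<alpha> UNIV \<le> d. c \<alpha> * mono_fun \<alpha> x)"
    using assms by (auto simp: poly_le_iff)
  have comp: "(\<lambda>y. (x + M *v y) $ i) \<in> poly_le 1" for i
    unfolding vector_add_component matrix_vector_mult_def vec_lambda_beta
    by (intro poly_le_add poly_le_const poly_le_sum poly_le_cmult poly_le_component)
  have "(\<lambda>y. mono_fun \<alpha> (x + M *v y)) \<in> poly_le d" if "sum \<alpha> UNIV \<le> d" for \<alpha>
  proof -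
    have "(\<lambda>y. mono_fun \<alpha> (x + M *v y)) \<in> poly_le (\<Sum>i\<in>UNIV. \<alpha> i * 1)"
      unfolding mono_fun_def by (intro poly_le_prod poly_le_power comp) auto
    then show ?thesis using that poly_le_mono by auto
  qed
  then show ?thesis unfolding P by (intro poly_le_sum poly_le_cmult) auto
qed

lemma continuous_poly_le:
  assumes "P \<in> poly_le d" shows "continuous_on S P"
proof -
  obtain c where P: "P = (\<lambda>x. \<Sum>\<alpha> | sum \<alpha> UNIV \<le> d. c \<alpha> * mono_fun \<alpha> x)"
    using assms by (auto simp: poly_le_iff)
  show ?thesis unfolding P mono_fun_def by (intro continuous_intros)
qed

lemma poly_le_measurable: "P \<in> poly_le d \<Longrightarrow> P \<in> borel_measurable lebesgue"
proof -
  assume "P \<in> poly_le d"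
  then have "P \<in> borel_measurable borel" by (intro borel_measurable_continuous_onI continuous_poly_le)
  then show ?thesis by (simp add: measurable_completion)
qed

lemma poly_le_growth:
  assumes "P \<in> poly_le d"
  shows "\<exists>C\<ge>0. \<forall>x. \<bar>P x\<bar> \<le> C * (1 + norm x) ^ d"
proof -
  obtain c where P: "P = (\<lambda>x. \<Sum>\<alpha> | sum \<alpha> UNIV \<le> d. c \<alpha> * mono_fun \<alpha> x)"
    using assms by (auto simp: poly_le_iff)
  have m: "\<bar>mono_fun \<alpha> x\<bar> \<le> (1 + norm x) ^ d" if "sum \<alpha> UNIV \<le> d" for \<alpha> and x :: "real^'n"
  proof -
    have "\<bar>mono_fun \<alpha> x\<bar> = (\<Prod>i\<in>UNIV. \<bar>x $ i\<bar> ^ \<alpha> i)" by (simp add: mono_fun_def abs_prod power_abs)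
    also have "\<dots> \<le> (\<Prod>i\<in>UNIV. (1 + norm x) ^ \<alpha> i)"
      by (intro prod_mono) (auto intro!: power_mono order_trans[OF component_le_norm_cart])
    also have "\<dots> = (1 + norm x) ^ sum \<alpha> UNIV" by (simp add: power_sum)
    also have "\<dots> \<le> (1 + norm x) ^ d" using that by (intro power_increasing) auto
    finally show ?thesis .
  qed
  show ?thesis
  proof (intro exI[of _ "\<Sum>\<alpha> | sum \<alpha> UNIV \<le> d. \<bar>c \<alpha>\<bar>"] conjI allI)
    fix x
    have "\<bar>P x\<bar> \<le> (\<Sum>\<alpha> | sum \<alpha> UNIV \<le> d. \<bar>c \<alpha>\<bar> * \<bar>mono_fun \<alpha> x\<bar>)"
      unfolding P by (rule order_trans[OF sum_abs]) (simp add: abs_mult)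
    also have "\<dots> \<le> (\<Sum>\<alpha> | sum \<alpha> UNIV \<le> d. \<bar>c \<alpha>\<bar> * (1 + norm x) ^ d)"
      by (intro sum_mono mult_left_mono m) auto
    finally show "\<bar>P x\<bar> \<le> (\<Sum>\<alpha> | sum \<alpha> UNIV \<le> d. \<bar>c \<alpha>\<bar>) * (1 + norm x) ^ d"
      by (simp add: sum_distrib_right)
  qed (simp add: sum_nonneg)
qed

lemma poly_le_real_polynomial:
  assumes "P \<in> poly_le d" shows "real_polynomial_function P"
proof -
  obtain c where P: "P = (\<lambda>x. \<Sum>\<alpha> | sum \<alpha> UNIV \<le> d. c \<alpha> * mono_fun \<alpha> x)"
    using assms by (auto simp: poly_le_iff)
  have "real_polynomial_function (\<lambda>x::real^'n. x $ i)" for i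
    by (intro real_polynomial_function.intros(1) bounded_linear_vec_nth)
  then show ?thesis unfolding P mono_fun_def
    by (intro real_polynomial_function_sum real_polynomial_function.intros(2-4)
        real_polynomial_function_prod real_polynomial_function_power finite_multi_indices) auto
qed

text \<open>On the line through \<open>x0\<close> and \<open>x\<close> the polynomial has one
  variable and vanishes on an interval, so it has infinitely many roots and is zero.\<close>

lemma poly_le_zero_on_open:
  assumes P: "P \<in> poly_le d" and U: "open U" "x0 \<in> U" and 0: "\<And>x. x \<in> U \<Longrightarrow> P x = 0"
  shows "P x = 0"
proof -
  define g where "g t = P (x0 + t *\<^sub>R (x - x0))" for t :: real
  have "polynomial_function (\<lambda>t::real. x0 + t *\<^sub>R (x - x0))"
    by (intro polynomial_function_add polynomial_function_const polynomial_function_bounded_linear bounded_linear_scaleR_left)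
  then have "real_polynomial_function g"
    using real_polynomial_function_compose[OF _ poly_le_real_polynomial[OF P]] unfolding g_def[abs_def] o_def by blast
  then obtain a n where g: "g = (\<lambda>t. \<Sum>i\<le>n. a i * t ^ i)"
    using real_polynomial_function_iff_sum by blast
  have "isCont (\<lambda>t::real. x0 + t *\<^sub>R (x - x0)) 0" by (intro continuous_intros)
  then have "((\<lambda>t::real. x0 + t *\<^sub>R (x - x0)) \<longlongrightarrow> x0) (at 0)" by (simp add: isCont_def)
  then have "eventually (\<lambda>t::real. x0 + t *\<^sub>R (x - x0) \<in> U) (at 0)"
    using U topological_tendstoD by blast
  then obtain e where e: "e > 0" "\<And>t. t \<noteq> 0 \<Longrightarrow> \<bar>t\<bar> < e \<Longrightarrow> x0 + t *\<^sub>R (x - x0) \<in> U"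
    unfolding eventually_at by (auto simp: dist_real_def)
  have "{0<..<e} \<subseteq> {t. (\<Sum>i\<le>n. a i * t ^ i) = 0}"
  proof
    fix t assume "t \<in> {0<..<e}"
    then have "g t = 0" using e(2)[of t] 0 by (simp add: g_def)
    then show "t \<in> {t. (\<Sum>i\<le>n. a i * t ^ i) = 0}" by (simp add: g)
  qed
  moreover have "infinite {0<..<e}" using e(1) by simp
  ultimately have "infinite {t. (\<Sum>i\<le>n. a i * t ^ i) = 0}" using finite_subset by blast
  then have "\<forall>i\<le>n. a i = 0" using polyfun_finite_roots by blast
  then have "g 1 = 0" by (simp add: g)
  then show ?thesis by (simp add: g_def)
qed

section \<open>An orthonormal basis of the polynomials on the reference ellipsoid\<close>

context anisotropic begin

text \<open>The inner product of L^2(D). Every ball is pulled back to \<open>D\<close>, so one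
  orthonormal basis, with one set of constants, serves all balls.\<close>

definition ip :: "(real^'n \<Rightarrow> real) \<Rightarrow> (real^'n \<Rightarrow> real) \<Rightarrow> real" where
  "ip f g = set_lebesgue_integral lebesgue D (\<lambda>x. f x * g x)"

lemma poly_le_bounded_D:
  assumes "P \<in> poly_le d" obtains K where "0 \<le> K" "\<And>x. x \<in> D \<Longrightarrow> \<bar>P x\<bar> \<le> K"
proof -
  obtain R where R: "\<And>z. z \<in> D \<Longrightarrow> norm z \<le> R" using bounded_D bounded_iff by blast
  obtain C where C: "C \<ge> 0" "\<And>x. \<bar>P x\<bar> \<le> C * (1 + norm x) ^ d" using poly_le_growth[OF assms] by blast
  have R0: "0 \<le> R" using R[OF zero_in_D] by simp
  show ?thesis
  proof (rule that[of "C * (1 + R) ^ d"])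
    fix x assume "x \<in> D"
    have "(1 + norm x) ^ d \<le> (1 + R) ^ d" using R[OF \<open>x \<in> D\<close>] by (intro power_mono) auto
    then show "\<bar>P x\<bar> \<le> C * (1 + R) ^ d" using order_trans[OF C(2) mult_left_mono[OF _ C(1)]] by blast
  qed (use C R0 in simp)
qed

lemma set_integrable_mult_poly:
  assumes f: "set_integrable lebesgue D f" and P: "P \<in> poly_le d"
  shows "set_integrable lebesgue D (\<lambda>x. f x * P x)"
proof -
  obtain K where K: "0 \<le> K" "\<And>x. x \<in> D \<Longrightarrow> \<bar>P x\<bar> \<le> K" using poly_le_bounded_D[OF P] by blast
  have Pm: "P \<in> borel_measurable lebesgue" by (rule poly_le_measurable[OF P])
  show ?thesis unfolding set_integrable_def
  proof (rule Bochner_Integration.integrable_bound)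
    show "integrable lebesgue (\<lambda>x. K *\<^sub>R (indicator D x *\<^sub>R f x))"
      using f unfolding set_integrable_def by (intro integrable_scaleR_right)
    have "(\<lambda>x. (indicator D x *\<^sub>R f x) * P x) \<in> borel_measurable lebesgue"
      using f Pm unfolding set_integrable_def by (intro borel_measurable_times) auto
    then show "(\<lambda>x. indicator D x *\<^sub>R (f x * P x)) \<in> borel_measurable lebesgue" by (simp add: mult.assoc)
    show "AE x in lebesgue. norm (indicator D x *\<^sub>R (f x * P x)) \<le> norm (K *\<^sub>R (indicator D x *\<^sub>R f x))"
      using K by (auto simp: indicator_def abs_mult mult.commute intro!: mult_right_mono)
  qed
qed

lemma set_integrable_poly: "P \<in> poly_le d \<Longrightarrow> set_integrable lebesgue D P"
proof -
  assume P: "P \<in> poly_le d"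
  have "set_integrable lebesgue D (\<lambda>_. 1::real)"
    using vol by (simp add: set_integrable_def integrable_indicator_iff)
  from set_integrable_mult_poly[OF this P] show ?thesis by simp
qed

lemma ip_commute: "ip f g = ip g f"
  by (simp add: ip_def mult.commute)

lemma ip_add_left:
  assumes "set_integrable lebesgue D f" "set_integrable lebesgue D g" "P \<in> poly_le d"
  shows "ip (\<lambda>x. f x + g x) P = ip f P + ip g P"
  unfolding ip_def distrib_right
  by (intro set_integral_add set_integrable_mult_poly[OF assms(1,3)] set_integrable_mult_poly[OF assms(2,3)])

lemma ip_cmult_left: "ip (\<lambda>x. a * f x) P = a * ip f P"
  by (simp add: ip_def mult.assoc)

lemma ip_diff_left:
  assumes "set_integrable lebesgue D f" "set_integrable lebesgue D g" "P \<in> poly_le d"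
  shows "ip (\<lambda>x. f x - g x) P = ip f P - ip g P"
  unfolding ip_def left_diff_distrib
  by (intro set_integral_diff set_integrable_mult_poly[OF assms(1,3)] set_integrable_mult_poly[OF assms(2,3)])

lemma ip_sum_left:
  assumes "finite E" "\<And>e. e \<in> E \<Longrightarrow> e \<in> poly_le d" "P \<in> poly_le d'"
  shows "ip (\<lambda>x. \<Sum>e\<in>E. c e * e x) P = (\<Sum>e\<in>E. c e * ip e P)"
  using assms(1,2)
proof (induction E rule: finite_induct)
  case empty then show ?case by (simp add: ip_def)
next
  case (insert e E)
  have "set_integrable lebesgue D (\<lambda>x. \<Sum>e\<in>E. c e * e x)"
    by (rule set_integrable_poly, intro poly_le_sum poly_le_cmult) (use insert in auto)
  moreover have "set_integrable lebesgue D (\<lambda>x. c e * e x)"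
    by (rule set_integrable_poly, intro poly_le_cmult) (use insert in auto)
  ultimately show ?case using insert ip_add_left[OF _ _ assms(3)] by (simp add: ip_cmult_left)
qed

text \<open>The part of \<open>D\<close> on which \<open>P\<close> does not vanish is open and null,
  hence empty; a polynomial that vanishes on an open set is zero.\<close>

lemma ip_self_zero:
  assumes P: "P \<in> poly_le d" and 0: "ip P P = 0"
  shows "P x = 0"
proof -
  have int: "integrable lebesgue (\<lambda>x. indicator D x *\<^sub>R (P x * P x))"
    using set_integrable_mult_poly[OF set_integrable_poly[OF P] P] by (simp add: set_integrable_def)
  have "AE x in lebesgue. indicator D x *\<^sub>R (P x * P x) = 0"
    using 0 integral_nonneg_eq_0_iff_AE[OF int] by (simp add: ip_def set_lebesgue_integral_def)
  then have ae: "AE x in lebesgue. x \<in> D \<longrightarrow> P x = 0" by (rule AE_mp) (auto simp: indicator_def)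
  define U where "U = {x \<in> D. P x \<noteq> 0}"
  have "U = D \<inter> P -` (- {0})" by (auto simp: U_def)
  then have oU: "open U" using continuous_poly_le[OF P] open_D
    by (simp add: continuous_open_preimage open_Compl)
  have "U \<in> null_sets lebesgue"
  proof (rule AE_iff_null_sets[THEN iffD2])
    show "U \<in> sets lebesgue" using oU by simp
    show "AE x in lebesgue. x \<notin> U" using ae by (rule AE_mp) (auto simp: U_def)
  qed
  then have "negligible U" by (simp add: negligible_iff_null_sets)
  then have "U = {}" using oU open_not_negligible by blast
  then show ?thesis using poly_le_zero_on_open[OF P open_D zero_in_D] by (auto simp: U_def)
qed

lemma ip_self_nonneg: "0 \<le> ip P P"
  unfolding ip_def set_lebesgue_integral_def by (intro integral_nonneg_AE) (auto simp: indicator_def)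

text \<open>The reproducing identity on \<open>F\<close> plays the role of a statement about spans.
  A new member whose residual has norm 0 is already reproduced, since a polynomial of norm 0
  vanishes everywhere.\<close>

lemma gram_schmidt:
  assumes "finite F" "F \<subseteq> poly_le d"
  shows "\<exists>E. finite E \<and> E \<subseteq> poly_le d \<and> (\<forall>e\<in>E. \<forall>e'\<in>E. ip e e' = (if e = e' then 1 else 0)) \<and>
    (\<forall>P\<in>F. \<forall>x. (\<Sum>e\<in>E. ip P e * e x) = P x)"
  using assms
proof (induction F rule: finite_induct)
  case empty then show ?case by (intro exI[of _ "{}"]) auto
next
  case (insert P F)
  then have "F \<subseteq> poly_le d" by simp
  from insert.IH[OF this] obtain E where
    E0: "finite E \<and> E \<subseteq> poly_le d \<and> (\<forall>e\<in>E. \<forall>e'\<in>E. ip e e' = (if e = e' then 1 else 0)) \<and>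
      (\<forall>P\<in>F. \<forall>x. (\<Sum>e\<in>E. ip P e * e x) = P x)" by (elim exE)
  then have E: "finite E" "E \<subseteq> poly_le d" "\<And>e e'. e \<in> E \<Longrightarrow> e' \<in> E \<Longrightarrow> ip e e' = (if e = e' then 1 else 0)"
    "\<And>Q x. Q \<in> F \<Longrightarrow> (\<Sum>e\<in>E. ip Q e * e x) = Q x" by (blast+)
  have P: "P \<in> poly_le d" using insert by simp
  define S where "S = (\<lambda>x. \<Sum>e\<in>E. ip P e * e x)"
  define Q where "Q = (\<lambda>x. P x - S x)"
  have S: "S \<in> poly_le d" unfolding S_def by (intro poly_le_sum poly_le_cmult) (use E in auto)
  have Q: "Q \<in> poly_le d" unfolding Q_def by (intro poly_le_diff P S)
  have Qe: "ip Q e = 0" if e: "e \<in> E" for e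
  proof -
    have "ip S e = (\<Sum>e'\<in>E. ip P e' * ip e' e)"
      unfolding S_def using E e by (intro ip_sum_left) auto
    also have "\<dots> = (\<Sum>e'\<in>E. if e' = e then ip P e' else 0)"
      by (intro sum.cong) (use E e in auto)
    also have "\<dots> = ip P e" using E e by simp
    finally show ?thesis unfolding Q_def
      using ip_diff_left[OF set_integrable_poly[OF P] set_integrable_poly[OF S]] E(2) e by auto
  qed
  show ?case
  proof (cases "ip Q Q = 0")
    case True
    then have "S x = P x" for x using ip_self_zero[OF Q, of x] by (simp add: Q_def)
    then show ?thesis using E by (intro exI[of _ E]) (auto simp: S_def)
  next
    case False
    define a where "a = 1 / sqrt (ip Q Q)"
    define q where "q = (\<lambda>x. a * Q x)"
    have a: "a * a * ip Q Q = 1" "a \<noteq> 0" using False ip_self_nonneg[of Q] by (auto simp: a_def real_sqrt_mult[symmetric])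
    have q: "q \<in> poly_le d" unfolding q_def by (intro poly_le_cmult Q)
    have qq: "ip q q = 1" using a by (simp add: q_def ip_cmult_left ip_commute[of _ "\<lambda>x. a * Q x"] mult.assoc)
    have qe: "ip q e = 0" if "e \<in> E" for e using Qe[OF that] by (simp add: q_def ip_cmult_left)
    have eq: "ip e q = 0" if "e \<in> E" for e using qe[OF that] ip_commute[of e q] by (simp only:)
    have nq: "q \<notin> E" using qe qq by auto
    have Pq: "ip P q * a = 1"
    proof -
      have "ip P Q = ip Q Q + ip S Q"
        using ip_add_left[OF set_integrable_poly[OF Q] set_integrable_poly[OF S] Q] by (simp add: Q_def)
      also have "ip S Q = (\<Sum>e\<in>E. ip P e * ip e Q)" unfolding S_def using E Q by (intro ip_sum_left) auto
      also have "\<dots> = 0" using Qe by (simp add: ip_commute)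
      finally have PQ: "ip P Q = ip Q Q" by simp
      have "ip P q = ip q P" by (rule ip_commute)
      also have "\<dots> = a * ip Q P" unfolding q_def by (rule ip_cmult_left)
      also have "ip Q P = ip Q Q" using PQ ip_commute[of Q P] by simp
      finally have "ip P q = a * ip Q Q" .
      then show ?thesis using a by (simp add: mult.commute mult.left_commute)
    qed
    show ?thesis
    proof (intro exI[of _ "insert q E"] conjI ballI)
      show "finite (insert q E)" "insert q E \<subseteq> poly_le d" using E q by auto
      fix e e' assume "e \<in> insert q E" "e' \<in> insert q E"
      then show "ip e e' = (if e = e' then 1 else 0)"
        using E(3) qq qe eq nq by auto
    next
      fix R assume R: "R \<in> insert P F"
      show "\<forall>x. (\<Sum>e\<in>insert q E. ip R e * e x) = R x"
      proof (cases "R = P")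
        case True
        have "ip P q * q x = Q x" for x using Pq by (simp add: q_def mult.assoc[symmetric])
        then show ?thesis using True E(1) nq by (simp add: Q_def S_def)
      next
        case False
        then have "R \<in> F" using R by simp
        then have RE: "(\<lambda>x. \<Sum>e\<in>E. ip R e * e x) = R" by (intro ext E(4))
        have "ip R q = ip (\<lambda>x. \<Sum>e\<in>E. ip R e * e x) q" unfolding RE ..
        also have "\<dots> = (\<Sum>e\<in>E. ip R e * ip e q)" by (rule ip_sum_left) (use E q in auto)
        also have "\<dots> = 0" using qe by (simp add: ip_commute)
        finally show ?thesis using E(1) nq E(4)[OF \<open>R \<in> F\<close>] by simp
      qed
    qed
  qed
qed

lemma orthonormal_basis:
  obtains E :: "(real^'n \<Rightarrow> real) set" where "finite E" "E \<subseteq> poly_le d" "\<And>e e'. e \<in> E \<Longrightarrow> e' \<in> E \<Longrightarrow> ip e e' = (if e = e' then 1 else 0)"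
    "\<And>P x. P \<in> poly_le d \<Longrightarrow> P x = (\<Sum>e\<in>E. ip P e * e x)"
proof -
  let ?F = "mono_fun ` {\<alpha>::'n \<Rightarrow> nat. sum \<alpha> UNIV \<le> d}"
  have "finite ?F" "?F \<subseteq> poly_le d" using finite_multi_indices mono_fun_in_poly_le by auto
  from gram_schmidt[OF this] obtain E where
    E0: "finite E \<and> E \<subseteq> poly_le d \<and> (\<forall>e\<in>E. \<forall>e'\<in>E. ip e e' = (if e = e' then 1 else 0)) \<and>
      (\<forall>P\<in>?F. \<forall>x. (\<Sum>e\<in>E. ip P e * e x) = P x)" by (elim exE)
  then have E: "finite E" "E \<subseteq> poly_le d"
    "\<And>e e'. e \<in> E \<Longrightarrow> e' \<in> E \<Longrightarrow> ip e e' = (if e = e' then 1 else 0)"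
    "\<And>P x. P \<in> ?F \<Longrightarrow> (\<Sum>e\<in>E. ip P e * e x) = P x" by (blast+)
  show ?thesis
  proof (rule that[OF E(1-3)])
    fix P :: "real^'n \<Rightarrow> real" and x assume "P \<in> poly_le d"
    then obtain c where P: "P = (\<lambda>x. \<Sum>\<alpha> | sum \<alpha> UNIV \<le> d. c \<alpha> * mono_fun \<alpha> x)"
      by (auto simp: poly_le_iff)
    have ipP: "ip P e = (\<Sum>\<alpha> | sum \<alpha> UNIV \<le> d. c \<alpha> * ip (mono_fun \<alpha>) e)" if e: "e \<in> E" for e
    proof -
      have "ip P e = ip e P" by (rule ip_commute)
      have *: "ip (\<lambda>x. \<Sum>\<alpha>\<in>S. c \<alpha> * mono_fun \<alpha> x) e = (\<Sum>\<alpha>\<in>S. c \<alpha> * ip (mono_fun \<alpha>) e)"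
        if "finite S" "S \<subseteq> {\<alpha>. sum \<alpha> UNIV \<le> d}" for S
        using that
      proof (induction S rule: finite_induct)
        case empty then show ?case by (simp add: ip_def)
      next
        case (insert \<alpha> S)
        have "set_integrable lebesgue D (\<lambda>x. \<Sum>\<alpha>\<in>S. c \<alpha> * mono_fun \<alpha> x)"
          by (rule set_integrable_poly, intro poly_le_sum poly_le_cmult mono_fun_in_poly_le) (use insert in auto)
        moreover have "set_integrable lebesgue D (\<lambda>x. c \<alpha> * mono_fun \<alpha> x)"
          by (rule set_integrable_poly, intro poly_le_cmult mono_fun_in_poly_le) (use insert in auto)
        moreover have "e \<in> poly_le d" using e E by blast
        ultimately show ?case using insert ip_add_left by (simp add: ip_cmult_left)
      qed
      show ?thesis unfolding P by (rule *[OF finite_multi_indices subset_refl])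
    qed
    have "P x = (\<Sum>\<alpha> | sum \<alpha> UNIV \<le> d. c \<alpha> * (\<Sum>e\<in>E. ip (mono_fun \<alpha>) e * e x))"
      unfolding P using E(4) by (intro sum.cong refl arg_cong2[where f="(*)"]) (auto simp: E(4))
    also have "\<dots> = (\<Sum>e\<in>E. (\<Sum>\<alpha> | sum \<alpha> UNIV \<le> d. c \<alpha> * ip (mono_fun \<alpha>) e) * e x)"
      by (simp add: sum_distrib_left sum_distrib_right mult.assoc) (rule sum.swap)
    also have "\<dots> = (\<Sum>e\<in>E. ip P e * e x)" by (intro sum.cong) (simp_all add: ipP)
    finally show "P x = (\<Sum>e\<in>E. ip P e * e x)" .
  qed
qed

end

section \<open>Averages and polynomial projections over the anisotropic balls\<close>

context anisotropic begin

definition locint :: "(real^'n \<Rightarrow> real) \<Rightarrow> bool" where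
  "locint g \<longleftrightarrow> g \<in> borel_measurable lebesgue \<and> (\<forall>x k. (\<integral>\<^sup>+z\<in>Bl x k. ennreal \<bar>g z\<bar> \<partial>lebesgue) < top)"

text \<open>The mean of the absolute value over \<open>Bl x k\<close>: the reference ellipsoid has
  measure 1, so after pulling back no normalising factor is left.\<close>

definition av :: "real^'n \<Rightarrow> int \<Rightarrow> (real^'n \<Rightarrow> real) \<Rightarrow> ennreal" where
  "av x k g = (\<integral>\<^sup>+y\<in>D. ennreal \<bar>g (x + T k y)\<bar> \<partial>lebesgue)"

lemma nn_integral_Bl_av:
  "g \<in> borel_measurable lebesgue \<Longrightarrow> (\<integral>\<^sup>+z\<in>Bl x k. ennreal \<bar>g z\<bar> \<partial>lebesgue) = ennreal (b powr k) * av x k g"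
  unfolding av_def by (rule nn_integral_Bl) measurable

lemma b_neq_0 [simp]: "b \<noteq> 0"
  using b_pos by simp

lemma b_powr_pos: "0 < b powr u"
  by simp

lemma av_eq_nn_integral:
  assumes "g \<in> borel_measurable lebesgue"
  shows "av x k g = ennreal (b powr - k) * (\<integral>\<^sup>+z\<in>Bl x k. ennreal \<bar>g z\<bar> \<partial>lebesgue)"
proof -
  have "b powr - real_of_int k * b powr k = 1" using b_pos by (simp add: powr_minus field_simps)
  then show ?thesis
    unfolding nn_integral_Bl_av[OF assms] mult.assoc[symmetric]
    by (simp add: ennreal_mult'[symmetric])
qed

lemma locint_measurable: "locint g \<Longrightarrow> g \<in> borel_measurable lebesgue"
  by (simp add: locint_def)

lemma av_finite: "locint g \<Longrightarrow> av x k g < top"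
  by (subst av_eq_nn_integral) (auto simp: locint_def ennreal_mult_less_top)

lemma av_triangle:
  assumes "f \<in> borel_measurable lebesgue" "g \<in> borel_measurable lebesgue"
  shows "av x k (\<lambda>z. f z + g z) \<le> av x k f + av x k g"
proof -
  have [measurable]: "(\<lambda>y. f (x + T k y)) \<in> borel_measurable lebesgue" "(\<lambda>y. g (x + T k y)) \<in> borel_measurable lebesgue"
    using assms measurable_affine_T by auto
  have "av x k (\<lambda>z. f z + g z) \<le> (\<integral>\<^sup>+y. ennreal \<bar>f (x + T k y)\<bar> * indicator D y + ennreal \<bar>g (x + T k y)\<bar> * indicator D y \<partial>lebesgue)"
    unfolding av_def by (intro nn_integral_mono) (auto simp: indicator_def ennreal_plus[symmetric] simp del: ennreal_plus intro!: ennreal_leI)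
  also have "\<dots> = av x k f + av x k g"
    unfolding av_def by (intro nn_integral_add) measurable
  finally show ?thesis .
qed

lemma av_mono_fun: "(\<And>z. z \<in> Bl x k \<Longrightarrow> \<bar>f z\<bar> \<le> \<bar>g z\<bar>) \<Longrightarrow> av x k f \<le> av x k g"
  unfolding av_def by (intro nn_integral_mono) (auto simp: indicator_def intro!: ennreal_leI)

lemma av_const: "av x k (\<lambda>z. c) = ennreal \<bar>c\<bar>"
  using vol by (simp add: av_def nn_integral_cmult)

lemma av_bounded:
  assumes "\<And>z. z \<in> Bl x k \<Longrightarrow> ennreal \<bar>g z\<bar> \<le> c"
  shows "av x k g \<le> c"
proof -
  have "av x k g \<le> (\<integral>\<^sup>+y. c * indicator D y \<partial>lebesgue)"
    unfolding av_def by (intro nn_integral_mono) (use assms in \<open>auto simp: indicator_def\<close>)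
  then show ?thesis using vol by (simp add: nn_integral_cmult)
qed

lemma av_subset:
  assumes "Bl x k \<subseteq> Bl z l" "g \<in> borel_measurable lebesgue"
  shows "av x k g \<le> ennreal (b powr (l - k)) * av z l g"
proof -
  have "av x k g \<le> ennreal (b powr - k) * (\<integral>\<^sup>+w\<in>Bl z l. ennreal \<bar>g w\<bar> \<partial>lebesgue)"
    unfolding av_eq_nn_integral[OF assms(2)]
    by (intro mult_left_mono nn_integral_mono) (use assms(1) in \<open>auto simp: indicator_def\<close>)
  also have "\<dots> = ennreal (b powr (l - k)) * av z l g"
    unfolding nn_integral_Bl_av[OF assms(2)] mult.assoc[symmetric]
    by (simp add: ennreal_mult'[symmetric] powr_add[symmetric])
  finally show ?thesis .
qed

lemma poly_le_T: "P \<in> poly_le d \<Longrightarrow> (\<lambda>y. P (x + T k y)) \<in> poly_le d"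
  using poly_le_compose_affine[of P d x "matrix (T k)"] by (simp add: T_eq_matrix[symmetric])

lemma poly_le_T_inv:
  assumes "P \<in> poly_le d" shows "(\<lambda>z. P (T (- k) (z - x))) \<in> poly_le d"
proof -
  have "(\<lambda>z. P (T (- k) (- x) + T (- k) z)) \<in> poly_le d" by (rule poly_le_T[OF assms])
  then show ?thesis by (simp add: linear_diff[OF linear_T] linear_neg[OF linear_T])
qed

lemma poly_le_locint:
  assumes "P \<in> poly_le d" shows "locint P"
  unfolding locint_def
proof (intro conjI allI)
  show m: "P \<in> borel_measurable lebesgue" by (rule poly_le_measurable[OF assms])
  fix x k
  obtain K where K: "0 \<le> K" "\<And>y. y \<in> D \<Longrightarrow> \<bar>P (x + T k y)\<bar> \<le> K"
    using poly_le_bounded_D[OF poly_le_T[OF assms]] by blast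
  have "av x k P \<le> (\<integral>\<^sup>+y. ennreal K * indicator D y \<partial>lebesgue)"
    unfolding av_def by (intro nn_integral_mono) (use K in \<open>auto simp: indicator_def intro!: ennreal_leI\<close>)
  also have "\<dots> < top" using vol by (simp add: nn_integral_cmult)
  finally show "(\<integral>\<^sup>+z\<in>Bl x k. ennreal \<bar>P z\<bar> \<partial>lebesgue) < top"
    unfolding nn_integral_Bl_av[OF m] by (simp add: ennreal_mult_less_top)
qed

lemma locint_diff:
  assumes "locint f" "locint g" shows "locint (\<lambda>z. f z - g z)"
  unfolding locint_def
proof (intro conjI allI)
  have m: "f \<in> borel_measurable lebesgue" "g \<in> borel_measurable lebesgue" using assms locint_measurable by auto
  then show m': "(\<lambda>z. f z - g z) \<in> borel_measurable lebesgue" by measurable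
  fix x k
  have "av x k (\<lambda>z. f z + - g z) \<le> av x k f + av x k (\<lambda>z. - g z)"
    by (rule av_triangle) (use m in measurable)
  also have "\<dots> = av x k f + av x k g" by (simp add: av_def)
  also have "\<dots> < top" using assms av_finite by simp
  finally show "(\<integral>\<^sup>+z\<in>Bl x k. ennreal \<bar>f z - g z\<bar> \<partial>lebesgue) < top"
    unfolding nn_integral_Bl_av[OF m'] by (simp add: ennreal_mult_less_top)
qed

lemma set_integrable_locint:
  assumes "locint g" shows "set_integrable lebesgue D (\<lambda>y. g (x + T k y))"
  unfolding set_integrable_def
proof (rule integrableI_bounded)
  have "(\<lambda>y. g (x + T k y)) \<in> borel_measurable lebesgue"
    using assms locint_measurable measurable_affine_T by blast
  then show "(\<lambda>y. indicator D y *\<^sub>R g (x + T k y)) \<in> borel_measurable lebesgue" by measurable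
  have "(\<integral>\<^sup>+y. ennreal (norm (indicator D y *\<^sub>R g (x + T k y))) \<partial>lebesgue) = av x k g"
    unfolding av_def by (intro nn_integral_cong) (auto simp: indicator_def)
  then show "(\<integral>\<^sup>+y. ennreal (norm (indicator D y *\<^sub>R g (x + T k y))) \<partial>lebesgue) < \<infinity>"
    using av_finite[OF assms] by simp
qed

definition is_proj :: "nat \<Rightarrow> real^'n \<Rightarrow> int \<Rightarrow> (real^'n \<Rightarrow> real) \<Rightarrow> (real^'n \<Rightarrow> real) \<Rightarrow> bool" where
  "is_proj d x k g P \<longleftrightarrow> P \<in> poly_le d \<and> (\<forall>h\<in>poly_le d. ip (\<lambda>y. g (x + T k y) - P (x + T k y)) h = 0)"

text \<open>The affine map from \<open>D\<close> onto the ball permutes the polynomials of degree at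
  most \<open>d\<close>, so orthogonality may be tested on either side.\<close>

lemma is_proj_iff:
  assumes g: "locint g" and P: "P \<in> poly_le d"
  shows "is_proj d x k g P \<longleftrightarrow>
    (\<forall>h\<in>poly_le d. set_lebesgue_integral lebesgue (Bl x k) (\<lambda>z. (g z - P z) * h z) = 0)"
proof -
  have eq: "set_lebesgue_integral lebesgue (Bl x k) (\<lambda>z. (g z - P z) * h z) =
      b powr k * ip (\<lambda>y. g (x + T k y) - P (x + T k y)) (\<lambda>y. h (x + T k y))" if "h \<in> poly_le d" for h
    unfolding ip_def using locint_measurable[OF g] poly_le_measurable[OF P] poly_le_measurable[OF that]
    by (intro set_integral_Bl) measurable
  show ?thesis
  proof
    assume "is_proj d x k g P"
    then show "\<forall>h\<in>poly_le d. set_lebesgue_integral lebesgue (Bl x k) (\<lambda>z. (g z - P z) * h z) = 0"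
      using eq poly_le_T unfolding is_proj_def by simp
  next
    assume a: "\<forall>h\<in>poly_le d. set_lebesgue_integral lebesgue (Bl x k) (\<lambda>z. (g z - P z) * h z) = 0"
    have "ip (\<lambda>y. g (x + T k y) - P (x + T k y)) h = 0" if h: "h \<in> poly_le d" for h
    proof -
      let ?h = "\<lambda>z. h (T (- k) (z - x))"
      have h': "?h \<in> poly_le d" by (rule poly_le_T_inv[OF h])
      have "b powr k * ip (\<lambda>y. g (x + T k y) - P (x + T k y)) (\<lambda>y. ?h (x + T k y)) = 0"
        using a h' eq[OF h'] by metis
      then show ?thesis using b_pos by simp
    qed
    then show "is_proj d x k g P" using P by (simp add: is_proj_def)
  qed
qed

lemma is_proj_unique:
  assumes g: "locint g" and P: "is_proj d x k g P" and Q: "is_proj d x k g Q"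
  shows "P = Q"
proof
  fix z
  define S where "S = (\<lambda>y. P (x + T k y) - Q (x + T k y))"
  have PQ: "P \<in> poly_le d" "Q \<in> poly_le d" using P Q by (auto simp: is_proj_def)
  have S: "S \<in> poly_le d" unfolding S_def by (intro poly_le_diff poly_le_T PQ)
  have I: "set_integrable lebesgue D (\<lambda>y. g (x + T k y) - P (x + T k y))"
    "set_integrable lebesgue D (\<lambda>y. g (x + T k y) - Q (x + T k y))"
    using set_integrable_locint[OF locint_diff[OF g poly_le_locint]] PQ by auto
  have "ip S S = ip (\<lambda>y. (g (x + T k y) - Q (x + T k y)) - (g (x + T k y) - P (x + T k y))) S"
    by (simp add: S_def)
  also have "\<dots> = 0" using ip_diff_left[OF I(2,1) S] P Q S by (simp add: is_proj_def)
  finally have "S (T (- k) (z - x)) = 0" by (rule ip_self_zero[OF S])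
  then show "P z = Q z" by (simp add: S_def)
qed

lemma poly_proj_eq:
  assumes g: "locint g" and P: "is_proj d x k g P"
  shows "poly_proj d (Bl x k) g = P"
  unfolding poly_proj_def
proof (rule the_equality)
  show "P \<in> poly_le d \<and> (\<forall>h\<in>poly_le d. set_lebesgue_integral lebesgue (Bl x k) (\<lambda>z. (g z - P z) * h z) = 0)"
    using P is_proj_iff[OF g] by (auto simp: is_proj_def)
next
  fix Q assume "Q \<in> poly_le d \<and> (\<forall>h\<in>poly_le d. set_lebesgue_integral lebesgue (Bl x k) (\<lambda>z. (g z - Q z) * h z) = 0)"
  then have "is_proj d x k g Q" using is_proj_iff[OF g] by blast
  then show "Q = P" using is_proj_unique[OF g] P by blast
qed

abbreviation proj :: "nat \<Rightarrow> real^'n \<Rightarrow> int \<Rightarrow> (real^'n \<Rightarrow> real) \<Rightarrow> real^'n \<Rightarrow> real" where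
  "proj d x k g \<equiv> poly_proj d (Bl x k) g"

lemma ip_bound:
  assumes "\<And>y. y \<in> D \<Longrightarrow> \<bar>e y\<bar> \<le> K" "0 \<le> K" "g \<in> borel_measurable lebesgue" "e \<in> poly_le d"
  shows "ennreal \<bar>ip (\<lambda>y. g (x + T k y)) e\<bar> \<le> ennreal K * av x k g"
proof -
  have m[measurable]: "(\<lambda>y. g (x + T k y)) \<in> borel_measurable lebesgue" using assms(3) measurable_affine_T by blast
  have "ennreal \<bar>ip (\<lambda>y. g (x + T k y)) e\<bar> \<le> (\<integral>\<^sup>+y. ennreal (norm (indicator D y *\<^sub>R (g (x + T k y) * e y))) \<partial>lebesgue)"
  proof (cases "integrable lebesgue (\<lambda>y. indicator D y *\<^sub>R (g (x + T k y) * e y))")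
    case True
    from integral_norm_bound_ennreal[OF this] show ?thesis by (simp add: ip_def set_lebesgue_integral_def)
  next
    \<comment> \<open>A non-integrable function has Bochner integral 0, so the bound is trivial
      here.\<close>
    case False
    then show ?thesis by (simp add: ip_def set_lebesgue_integral_def not_integrable_integral_eq)
  qed
  also have "\<dots> \<le> (\<integral>\<^sup>+y. ennreal K * (ennreal \<bar>g (x + T k y)\<bar> * indicator D y) \<partial>lebesgue)"
    using assms(1,2) by (intro nn_integral_mono)
      (auto simp: indicator_def abs_mult ennreal_mult'[symmetric] mult.commute[of _ "\<bar>e _\<bar>"] intro!: ennreal_leI mult_right_mono)
  also have "\<dots> = ennreal K * av x k g" unfolding av_def by (intro nn_integral_cmult) measurable
  finally show ?thesis .
qed

text \<open>The projection is the Fourier sum over the orthonormal basis, transported from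
  \<open>D\<close>. The coefficients are bounded by the mean over the ball, while the growth of the
  basis controls the polynomial off the ball as well; \<open>C\<close> depends on the basis
  alone.\<close>

lemma proj_exists:
  fixes d :: nat
  obtains C where "0 \<le> C" "\<And>x k g. locint g \<Longrightarrow> is_proj d x k g (proj d x k g)"
    "\<And>x k g y. locint g \<Longrightarrow> ennreal \<bar>proj d x k g (x + T k y)\<bar> \<le> ennreal (C * (1 + norm y) ^ d) * av x k g"
proof -
  obtain E :: "(real^'n \<Rightarrow> real) set" where E: "finite E" "E \<subseteq> poly_le d" "\<And>e e'. e \<in> E \<Longrightarrow> e' \<in> E \<Longrightarrow> ip e e' = (if e = e' then 1 else 0)"
    "\<And>P x. P \<in> poly_le d \<Longrightarrow> P x = (\<Sum>e\<in>E. ip P e * e x)" using orthonormal_basis[of d] by blast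
  have "\<exists>K\<ge>0. \<forall>y\<in>D. \<bar>e y\<bar> \<le> K" if "e \<in> E" for e
    using poly_le_bounded_D E(2) that by (metis subsetD)
  then obtain K where K: "\<And>e. e \<in> E \<Longrightarrow> 0 \<le> K e" "\<And>e y. e \<in> E \<Longrightarrow> y \<in> D \<Longrightarrow> \<bar>e y\<bar> \<le> K e" by metis
  have "\<exists>C\<ge>0. \<forall>y. \<bar>e y\<bar> \<le> C * (1 + norm y) ^ d" if "e \<in> E" for e
    using poly_le_growth E(2) that by blast
  then obtain G where G: "\<And>e. e \<in> E \<Longrightarrow> 0 \<le> G e" "\<And>e y. e \<in> E \<Longrightarrow> \<bar>e y\<bar> \<le> G e * (1 + norm y) ^ d" by metis
  define Pr where "Pr x k g = (\<lambda>z. \<Sum>e\<in>E. ip (\<lambda>y. g (x + T k y)) e * e (T (- k) (z - x)))" for x k g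
  have Pr: "is_proj d x k g (Pr x k g)" if g: "locint g" for x k g
    unfolding is_proj_def
  proof (intro conjI ballI)
    show P: "Pr x k g \<in> poly_le d" unfolding Pr_def
      by (intro poly_le_sum poly_le_cmult poly_le_T_inv) (use E in auto)
    fix h :: "real^'n \<Rightarrow> real" assume h: "h \<in> poly_le d"
    let ?g = "\<lambda>y. g (x + T k y)"
    have PT: "(\<lambda>y. Pr x k g (x + T k y)) = (\<lambda>y. \<Sum>e\<in>E. ip ?g e * e y)" by (simp add: Pr_def)
    have gi: "set_integrable lebesgue D ?g" by (rule set_integrable_locint[OF g])
    have pi: "set_integrable lebesgue D (\<lambda>y. Pr x k g (x + T k y))"
      by (rule set_integrable_poly, rule poly_le_T[OF P])
    have e0: "ip (\<lambda>y. ?g y - Pr x k g (x + T k y)) e = 0" if e: "e \<in> E" for e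
    proof -
      have "ip (\<lambda>y. \<Sum>e\<in>E. ip ?g e * e y) e = (\<Sum>e'\<in>E. ip ?g e' * ip e' e)"
        using E e by (intro ip_sum_left) auto
      also have "\<dots> = (\<Sum>e'\<in>E. if e' = e then ip ?g e' else 0)" by (intro sum.cong) (use E e in auto)
      also have "\<dots> = ip ?g e" using E e by simp
      finally show ?thesis using ip_diff_left[OF gi pi] E(2) e PT by auto
    qed
    have di: "set_integrable lebesgue D (\<lambda>y. ?g y - Pr x k g (x + T k y))"
      using set_integrable_locint[OF locint_diff[OF g poly_le_locint[OF P]]] .
    have hE: "(\<lambda>y. \<Sum>e\<in>E. ip h e * e y) = h" using E(4)[OF h] by (intro ext) (rule sym)
    have *: "ip f (\<lambda>y. \<Sum>e\<in>S. c e * e y) = (\<Sum>e\<in>S. c e * ip f e)"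
      if "finite S" "S \<subseteq> poly_le d" "set_integrable lebesgue D f" for S f and c :: "(real^'n \<Rightarrow> real) \<Rightarrow> real"
      using that
    proof (induction S rule: finite_induct)
      case empty then show ?case by (simp add: ip_def)
    next
      case (insert e S)
      have "set_integrable lebesgue D (\<lambda>x. f x * (c e * e x))"
        by (rule set_integrable_mult_poly) (use insert in \<open>auto intro!: poly_le_cmult\<close>)
      moreover have "set_integrable lebesgue D (\<lambda>x. f x * (\<Sum>e\<in>S. c e * e x))"
        by (rule set_integrable_mult_poly) (use insert in \<open>auto intro!: poly_le_cmult poly_le_sum\<close>)
      ultimately have "ip f (\<lambda>y. c e * e y + (\<Sum>e\<in>S. c e * e y)) = ip f (\<lambda>y. c e * e y) + ip f (\<lambda>y. \<Sum>e\<in>S. c e * e y)"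
        unfolding ip_def distrib_left by (rule set_integral_add)
      moreover have "ip f (\<lambda>y. c e * e y) = c e * ip f e"
        unfolding ip_commute[of f] by (rule ip_cmult_left)
      ultimately show ?case using insert by simp
    qed
    have "ip (\<lambda>y. ?g y - Pr x k g (x + T k y)) (\<lambda>y. \<Sum>e\<in>E. ip h e * e y) = 0"
      unfolding *[OF E(1,2) di] by (intro sum.neutral ballI) (simp add: e0)
    then show "ip (\<lambda>y. ?g y - Pr x k g (x + T k y)) h = 0" unfolding hE .
  qed
  have eq: "proj d x k g = Pr x k g" if "locint g" for x k g
    using poly_proj_eq[OF that Pr[OF that]] .
  show ?thesis
  proof (rule that[of "\<Sum>e\<in>E. K e * G e"])
    show "0 \<le> (\<Sum>e\<in>E. K e * G e)" using K G by (intro sum_nonneg) auto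
    show "is_proj d x k g (proj d x k g)" if "locint g" for x k g using Pr eq that by simp
    fix x k g y assume g: "locint g"
    have "ennreal \<bar>proj d x k g (x + T k y)\<bar> = ennreal \<bar>\<Sum>e\<in>E. ip (\<lambda>y. g (x + T k y)) e * e y\<bar>"
      by (simp add: eq[OF g] Pr_def)
    also have "\<dots> \<le> ennreal (\<Sum>e\<in>E. \<bar>ip (\<lambda>y. g (x + T k y)) e\<bar> * \<bar>e y\<bar>)"
      by (intro ennreal_leI order_trans[OF sum_abs]) (simp add: abs_mult)
    also have "\<dots> = (\<Sum>e\<in>E. ennreal \<bar>ip (\<lambda>y. g (x + T k y)) e\<bar> * ennreal \<bar>e y\<bar>)"
      by (subst sum_ennreal[symmetric]) (auto simp: ennreal_mult)
    also have "\<dots> \<le> (\<Sum>e\<in>E. (ennreal (K e) * av x k g) * ennreal (G e * (1 + norm y) ^ d))"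
      using K G E(2) locint_measurable[OF g]
      by (intro sum_mono mult_mono ip_bound[where d=d] ennreal_leI) auto
    also have "\<dots> = (\<Sum>e\<in>E. ennreal (K e * (G e * (1 + norm y) ^ d)) * av x k g)"
      using K G by (intro sum.cong refl) (simp add: ennreal_mult mult_ac)
    also have "\<dots> = ennreal (\<Sum>e\<in>E. K e * (G e * (1 + norm y) ^ d)) * av x k g"
      unfolding sum_distrib_right[symmetric] by (subst sum_ennreal) (use K G in auto)
    finally show "ennreal \<bar>proj d x k g (x + T k y)\<bar> \<le> ennreal ((\<Sum>e\<in>E. K e * G e) * (1 + norm y) ^ d) * av x k g"
      by (simp add: sum_distrib_right mult.assoc)
  qed
qed

lemma is_proj_proj: "locint g \<Longrightarrow> is_proj d x k g (proj d x k g)"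
  by (rule proj_exists[of d]) blast

lemma proj_poly_le: "locint g \<Longrightarrow> proj d x k g \<in> poly_le d"
  using is_proj_proj[of g d x k] by (simp add: is_proj_def)

lemma locint_diff_proj: "locint g \<Longrightarrow> locint (\<lambda>z. g z - proj d x k g z)"
  using locint_diff poly_le_locint proj_poly_le by blast

lemma proj_diff_poly:
  assumes g: "locint g" and P: "P \<in> poly_le d"
  shows "proj d x k (\<lambda>z. g z - P z) = (\<lambda>z. proj d x k g z - P z)"
proof (rule poly_proj_eq)
  show "locint (\<lambda>z. g z - P z)" using locint_diff[OF g poly_le_locint[OF P]] .
  show "is_proj d x k (\<lambda>z. g z - P z) (\<lambda>z. proj d x k g z - P z)"
    using is_proj_proj[OF g, of d x k] poly_le_diff[OF proj_poly_le[OF g] P] by (simp add: is_proj_def)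
qed

text \<open>A point of the ball enlarged by \<open>i\<close> pulls back to A^i w with w \<in> D, of
  norm O(R^i), where a polynomial of degree \<open>d\<close> is O(R^(d i)).\<close>

lemma proj_growth:
  fixes d :: nat
  assumes R: "\<And>z. eigen A z \<Longrightarrow> cmod z < R"
  obtains C where "0 \<le> C" "\<And>x k g i z. locint g \<Longrightarrow> z \<in> Bl x (k + int i) \<Longrightarrow>
    ennreal \<bar>proj d x k g z\<bar> \<le> ennreal (C * R ^ (d * i)) * av x k g"
proof -
  obtain C where C: "0 \<le> C"
    "\<And>x k g y. locint g \<Longrightarrow> ennreal \<bar>proj d x k g (x + T k y)\<bar> \<le> ennreal (C * (1 + norm y) ^ d) * av x k g"
    by (rule proj_exists[of d]) blast
  obtain C1 where C1: "0 \<le> C1" "\<And>k x. norm ((((*v) A) ^^ k) x) \<le> C1 * R ^ k * norm x"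
    using matrix_power_growth[OF R] by blast
  obtain K where K: "\<And>z. z \<in> D \<Longrightarrow> norm z \<le> K" using bounded_D bounded_iff by blast
  have R1: "1 < R" by (rule eigen_bound_gt_1[OF R])
  have K0: "0 \<le> K" using K[OF zero_in_D] by simp
  show ?thesis
  proof (rule that[of "C * (1 + C1 * K) ^ d"])
    show "0 \<le> C * (1 + C1 * K) ^ d" using C C1 K0 by simp
    fix x k g z and i :: nat assume g: "locint g" and z: "z \<in> Bl x (k + int i)"
    define y where "y = T (- k) (z - x)"
    have zy: "z = x + T k y" by (simp add: y_def)
    define w where "w = T (- int i) y"
    have w: "w \<in> D" using z T_add[of "- int i" "- k" "z - x"] by (simp add: w_def y_def mem_Bl algebra_simps)
    have "norm y = norm ((((*v) A) ^^ i) w)" by (simp add: T_nat[symmetric] w_def)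
    also have "\<dots> \<le> C1 * R ^ i * norm w" by (rule C1)
    also have "\<dots> \<le> C1 * R ^ i * K" using K[OF w] C1 R1 by (intro mult_left_mono) auto
    finally have "1 + norm y \<le> R ^ i + C1 * R ^ i * K" using one_le_power[of R i] R1 by linarith
    then have "(1 + norm y) ^ d \<le> ((1 + C1 * K) * R ^ i) ^ d" by (intro power_mono) (auto simp: algebra_simps)
    also have "\<dots> = (1 + C1 * K) ^ d * R ^ (d * i)" by (simp add: power_mult_distrib power_mult[symmetric] mult.commute)
    finally have "C * (1 + norm y) ^ d \<le> C * (1 + C1 * K) ^ d * R ^ (d * i)"
      using C(1) by (simp add: mult_left_mono mult.assoc)
    then show "ennreal \<bar>proj d x k g z\<bar> \<le> ennreal (C * (1 + C1 * K) ^ d * R ^ (d * i)) * av x k g"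
      unfolding zy using C(2)[OF g, of x k y] by (meson ennreal_leI mult_right_mono order_trans zero_le)
  qed
qed

lemma proj_bound_Bl:
  fixes d :: nat
  obtains C where "1 \<le> C" "\<And>x k g z. locint g \<Longrightarrow> z \<in> Bl x k \<Longrightarrow> ennreal \<bar>proj d x k g z\<bar> \<le> ennreal C * av x k g"
proof -
  obtain C where C: "0 \<le> C"
    "\<And>x k g y. locint g \<Longrightarrow> ennreal \<bar>proj d x k g (x + T k y)\<bar> \<le> ennreal (C * (1 + norm y) ^ d) * av x k g"
    by (rule proj_exists[of d]) blast
  obtain K where K: "\<And>z. z \<in> D \<Longrightarrow> norm z \<le> K" using bounded_D bounded_iff by blast
  show ?thesis
  proof (rule that[of "max 1 (C * (1 + K) ^ d)"])
    fix x k g z assume g: "locint g" and z: "z \<in> Bl x k"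
    define y where "y = T (- k) (z - x)"
    have zy: "z = x + T k y" and y: "y \<in> D" using z by (simp_all add: y_def mem_Bl)
    have "C * (1 + norm y) ^ d \<le> max 1 (C * (1 + K) ^ d)"
      using K[OF y] C(1) by (intro order_trans[OF mult_left_mono[OF power_mono] max.cobounded2]) auto
    then show "ennreal \<bar>proj d x k g z\<bar> \<le> ennreal (max 1 (C * (1 + K) ^ d)) * av x k g"
      unfolding zy using C(2)[OF g, of x k y] by (meson ennreal_leI mult_right_mono order_trans zero_le)
  qed simp
qed

definition osc :: "nat \<Rightarrow> real^'n \<Rightarrow> int \<Rightarrow> (real^'n \<Rightarrow> real) \<Rightarrow> ennreal" where
  "osc d x k f = av x k (\<lambda>z. f z - proj d x k f z)"

text \<open>On the \<open>i\<close>-th enlargement the projection of the smallest ball is replaced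
  by that of the largest one, through all sizes in between. Each exchange costs one oscillation,
  amplified by the growth of the difference polynomial over the sizes that remain.\<close>

lemma proj_telescope:
  fixes d :: nat
  assumes R: "\<And>z. eigen A z \<Longrightarrow> cmod z < R"
  obtains C where "0 \<le> C" "\<And>x k f i. locint f \<Longrightarrow> av x (k + int i) (\<lambda>z. f z - proj d x k f z)
    \<le> ennreal C * (\<Sum>j\<le>i. ennreal (R ^ (d * (i - j))) * osc d x (k + int j) f)"
proof -
  obtain C where C: "0 \<le> C" "\<And>x k g i z. locint g \<Longrightarrow> z \<in> Bl x (k + int i) \<Longrightarrow>
    ennreal \<bar>proj d x k g z\<bar> \<le> ennreal (C * R ^ (d * i)) * av x k g"
    using proj_growth[OF R, where d=d] by blast
  have R1: "1 < R" by (rule eigen_bound_gt_1[OF R])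
  \<comment> \<open>The factor \<open>b\<close> pays for passing from the mean over one ball to the
    mean over the next larger one, and R ^ d for lowering the growth exponent from l - j to l - Suc
    j.\<close>
  define C' where "C' = C * b * R ^ d"
  have C'0: "0 \<le> C'" using C R1 b_pos by (simp add: C'_def)
  show ?thesis
  proof (rule that[of "1 + C'"])
    show "0 \<le> 1 + C'" using C'0 by simp
    fix x k f and i :: nat assume f: "locint f"
    let ?P = "\<lambda>j. proj d x (k + int j) f" and ?o = "\<lambda>j. osc d x (k + int j) f"
    have step: "ennreal \<bar>?P (Suc j) z - ?P j z\<bar> \<le> ennreal C' * (ennreal (R ^ (d * (l - Suc j))) * ?o (Suc j))"
      if z: "z \<in> Bl x (k + int l)" and jl: "Suc j \<le> l" for z j l
    proof -
      \<comment> \<open>Projections fix polynomials, so up to sign the difference of two consecutive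
        projections is the smaller ball's projection of \<open>f\<close> minus the larger ball's
        polynomial.\<close>
      have "\<bar>?P (Suc j) z - ?P j z\<bar> = \<bar>proj d x (k + int j) (\<lambda>z. f z - ?P (Suc j) z) z\<bar>"
        using proj_diff_poly[OF f proj_poly_le[OF f, of d x "k + int (Suc j)"], of x "k + int j"] by simp
      also have "ennreal \<dots> \<le> ennreal (C * R ^ (d * (l - j))) * av x (k + int j) (\<lambda>z. f z - ?P (Suc j) z)"
        using z jl by (intro C(2) locint_diff_proj f) (simp add: of_nat_diff)
      also have "\<dots> \<le> ennreal (C * R ^ (d * (l - j))) * (ennreal b * ?o (Suc j))"
      proof (rule mult_left_mono)
        have "av x (k + int j) (\<lambda>z. f z - ?P (Suc j) z)
            \<le> ennreal (b powr real_of_int (k + int (Suc j) - (k + int j))) * av x (k + int (Suc j)) (\<lambda>z. f z - ?P (Suc j) z)"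
          by (intro av_subset Bl_mono locint_measurable locint_diff_proj f) simp
        then show "av x (k + int j) (\<lambda>z. f z - ?P (Suc j) z) \<le> ennreal b * ?o (Suc j)"
          using b_pos by (simp add: osc_def)
      qed simp
      also have "\<dots> = ennreal C' * (ennreal (R ^ (d * (l - Suc j))) * ?o (Suc j))"
      proof -
        have "l - j = Suc (l - Suc j)" using jl by simp
        then have "C * R ^ (d * (l - j)) * b = C' * R ^ (d * (l - Suc j))"
          by (simp add: C'_def power_add[symmetric])
        then show ?thesis using C C'0 R1 b_pos
          unfolding mult.assoc[symmetric] by (simp add: ennreal_mult[symmetric])
      qed
      finally show ?thesis .
    qed
    have tele: "ennreal \<bar>?P j z - ?P 0 z\<bar> \<le> ennreal C' * (\<Sum>m\<in>{1..j}. ennreal (R ^ (d * (l - m))) * ?o m)"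
      if z: "z \<in> Bl x (k + int l)" and jl: "j \<le> l" for z j l
      using jl
    proof (induction j)
      case (Suc j)
      have "ennreal \<bar>?P (Suc j) z - ?P 0 z\<bar> \<le> ennreal \<bar>?P j z - ?P 0 z\<bar> + ennreal \<bar>?P (Suc j) z - ?P j z\<bar>"
        by (simp add: ennreal_plus[symmetric] ennreal_leI del: ennreal_plus)
      also have "\<dots> \<le> ennreal C' * (\<Sum>m\<in>{1..j}. ennreal (R ^ (d * (l - m))) * ?o m)
          + ennreal C' * (ennreal (R ^ (d * (l - Suc j))) * ?o (Suc j))"
        using Suc by (intro add_mono step[OF z]) auto
      finally show ?case by (simp add: distrib_left)
    qed simp
    let ?S = "\<Sum>j\<le>i. ennreal (R ^ (d * (i - j))) * ?o j"
    have sub: "(\<Sum>m\<in>{1..i}. ennreal (R ^ (d * (i - m))) * ?o m) \<le> ?S"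
      by (rule sum_mono2) auto
    have "av x (k + int i) (\<lambda>z. f z - ?P 0 z) = av x (k + int i) (\<lambda>z. (f z - ?P i z) + (?P i z - ?P 0 z))" by simp
    also have "\<dots> \<le> ?o i + av x (k + int i) (\<lambda>z. ?P i z - ?P 0 z)"
      unfolding osc_def
      by (intro av_triangle locint_measurable locint_diff_proj f locint_diff poly_le_locint[OF proj_poly_le[OF f]])
    also have "\<dots> \<le> ?S + ennreal C' * ?S"
    proof (rule add_mono)
      have "?o i = (\<Sum>j\<in>{i}. ennreal (R ^ (d * (i - j))) * ?o j)" by simp
      also have "\<dots> \<le> ?S" by (rule sum_mono2) auto
      finally show "?o i \<le> ?S" .
      show "av x (k + int i) (\<lambda>z. ?P i z - ?P 0 z) \<le> ennreal C' * ?S"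
        by (intro av_bounded order_trans[OF tele[OF _ order_refl]] mult_left_mono sub) auto
    qed
    also have "\<dots> = ennreal (1 + C') * ?S" using C'0 by (simp add: distrib_right)
    finally show "av x (k + int i) (\<lambda>z. f z - proj d x k f z) \<le> ennreal (1 + C') * ?S" by simp
  qed
qed

section \<open>The kernel integral of the star norm\<close>

definition kernel_int :: "nat \<Rightarrow> real \<Rightarrow> real^'n \<Rightarrow> int \<Rightarrow> (real^'n \<Rightarrow> real) \<Rightarrow> ennreal" where
  "kernel_int d \<beta> x k f = (\<integral>\<^sup>+ z. ennreal (b powr (\<beta> * real_of_int k) * \<bar>f z - proj d x k f z\<bar>
     / (b powr (real_of_int k * (1 + \<beta>)) + rho A D (z - x) powr (1 + \<beta>))) \<partial>lebesgue)"

text \<open>On the ball \<open>rho\<close> is at most b^k, so the two terms of the denominator are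
  comparable; this is the factor 2.\<close>

lemma osc_le_kernel_int:
  assumes f: "locint f" and \<beta>: "0 < \<beta>"
  shows "osc d x k f \<le> 2 * kernel_int d \<beta> x k f"
proof -
  let ?F = "\<lambda>z. f z - proj d x k f z"
  let ?K = "\<lambda>z. b powr (\<beta> * real_of_int k) * \<bar>?F z\<bar> / (b powr (real_of_int k * (1 + \<beta>)) + rho A D (z - x) powr (1 + \<beta>))"
  have m: "?F \<in> borel_measurable lebesgue" by (intro locint_measurable locint_diff_proj f)
  have pt: "ennreal (b powr - k / 2 * \<bar>?F z\<bar>) * indicator (Bl x k) z \<le> ennreal (?K z)" for z
  proof (cases "z \<in> Bl x k")
    case True
    have "rho A D (z - x) powr (1 + \<beta>) \<le> (b powr k) powr (1 + \<beta>)"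
      using rho_le[OF True] rho_nonneg \<beta> by (intro powr_mono2) auto
    then have "b powr (real_of_int k * (1 + \<beta>)) + rho A D (z - x) powr (1 + \<beta>) \<le> 2 * b powr (real_of_int k * (1 + \<beta>))"
      by (simp add: powr_powr)
    then have "b powr (\<beta> * real_of_int k) * \<bar>?F z\<bar> / (2 * b powr (real_of_int k * (1 + \<beta>))) \<le> ?K z"
      using b_pos by (intro divide_left_mono mult_pos_pos add_pos_nonneg) auto
    moreover have "b powr (\<beta> * real_of_int k) * \<bar>?F z\<bar> / (2 * b powr (real_of_int k * (1 + \<beta>))) = b powr - k / 2 * \<bar>?F z\<bar>"
      using b_pos by (simp add: powr_minus powr_add distrib_left field_simps)
    ultimately show ?thesis using True by (simp add: ennreal_leI)
  qed simp
  have "osc d x k f = ennreal (b powr - k) * (\<integral>\<^sup>+z\<in>Bl x k. ennreal \<bar>?F z\<bar> \<partial>lebesgue)"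
    unfolding osc_def by (rule av_eq_nn_integral[OF m])
  also have "\<dots> = 2 * (\<integral>\<^sup>+z. ennreal (b powr - k / 2) * (ennreal \<bar>?F z\<bar> * indicator (Bl x k) z) \<partial>lebesgue)"
    using m by (subst nn_integral_cmult) (auto simp: mult.assoc[symmetric] ennreal_mult'[symmetric] simp flip: ennreal_numeral)
  also have "\<dots> \<le> 2 * kernel_int d \<beta> x k f"
    unfolding kernel_int_def by (intro mult_left_mono nn_integral_mono)
      (use pt in \<open>auto simp: mult.assoc[symmetric] ennreal_mult'[symmetric]\<close>)
  finally show ?thesis .
qed

text \<open>On the \<open>i\<close>-th annulus the denominator is at least the (1 + \<beta>)-th
  power of b^(k+i-1), and the integral over the annulus is bounded by that over the full ball. The
  exponent lags by one, whence the factor b powr (1 + \<beta>).\<close>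

lemma kernel_int_le_annuli:
  assumes f: "locint f" and \<beta>: "0 < \<beta>"
  shows "kernel_int d \<beta> x k f \<le> (\<Sum>i. ennreal (b powr (1 + \<beta> - real i * \<beta>)) * av x (k + int i) (\<lambda>z. f z - proj d x k f z))"
proof -
  let ?F = "\<lambda>z. f z - proj d x k f z"
  let ?K = "\<lambda>z. b powr (\<beta> * real_of_int k) * \<bar>?F z\<bar> / (b powr (real_of_int k * (1 + \<beta>)) + rho A D (z - x) powr (1 + \<beta>))"
  let ?c = "\<lambda>i. b powr (1 + \<beta> - real i * (1 + \<beta>) - real_of_int k)"
  have m[measurable]: "?F \<in> borel_measurable lebesgue" by (intro locint_measurable locint_diff_proj f)
  have pt: "ennreal (?K z) \<le> (\<Sum>i. ennreal (?c i) * (ennreal \<bar>?F z\<bar> * indicator (Bl x (k + int i)) z))" for z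
  proof -
    obtain i where i: "z \<in> Bl x (k + int i)" "i \<noteq> 0 \<Longrightarrow> rho A D (z - x) = b powr (k + int i - 1)"
      using enclosing_Bl[of z x k] by blast
    have "?K z \<le> ?c i * \<bar>?F z\<bar>"
    proof (cases "i = 0")
      case True
      have "?K z \<le> b powr (\<beta> * real_of_int k) * \<bar>?F z\<bar> / b powr (real_of_int k * (1 + \<beta>))"
        using b_pos by (intro divide_left_mono mult_pos_pos add_pos_nonneg) auto
      also have "\<dots> = b powr - k * \<bar>?F z\<bar>" using b_pos by (simp add: powr_minus powr_add distrib_left field_simps)
      also have "\<dots> \<le> ?c i * \<bar>?F z\<bar>" using b_gt_1 \<beta> True by (intro mult_right_mono powr_mono) auto
      finally show ?thesis .
    next
      case False
      have "?K z \<le> b powr (\<beta> * real_of_int k) * \<bar>?F z\<bar> / (b powr (k + int i - 1)) powr (1 + \<beta>)"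
        unfolding i(2)[OF False] using b_pos by (intro divide_left_mono mult_pos_pos add_pos_nonneg) auto
      also have "\<dots> = b powr (\<beta> * real_of_int k - (k + int i - 1) * (1 + \<beta>)) * \<bar>?F z\<bar>"
        by (simp only: powr_powr powr_diff) simp
      also have "\<beta> * real_of_int k - (k + int i - 1) * (1 + \<beta>) = 1 + \<beta> - real i * (1 + \<beta>) - real_of_int k"
        by (simp add: algebra_simps)
      finally show ?thesis by simp
    qed
    then have "ennreal (?K z) \<le> ennreal (?c i) * (ennreal \<bar>?F z\<bar> * indicator (Bl x (k + int i)) z)"
      using i(1) by (simp add: ennreal_mult'[symmetric] ennreal_leI)
    also have "\<dots> \<le> (\<Sum>i. ennreal (?c i) * (ennreal \<bar>?F z\<bar> * indicator (Bl x (k + int i)) z))"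
      using sum_le_suminf[of "\<lambda>i. ennreal (?c i) * (ennreal \<bar>?F z\<bar> * indicator (Bl x (k + int i)) z)" "{i}"] by simp
    finally show ?thesis .
  qed
  have "kernel_int d \<beta> x k f \<le> (\<integral>\<^sup>+z. (\<Sum>i. ennreal (?c i) * (ennreal \<bar>?F z\<bar> * indicator (Bl x (k + int i)) z)) \<partial>lebesgue)"
    unfolding kernel_int_def by (intro nn_integral_mono pt)
  also have "\<dots> = (\<Sum>i. \<integral>\<^sup>+z. ennreal (?c i) * (ennreal \<bar>?F z\<bar> * indicator (Bl x (k + int i)) z) \<partial>lebesgue)"
    by (intro nn_integral_suminf) measurable
  also have "\<dots> = (\<Sum>i. ennreal (b powr (1 + \<beta> - real i * \<beta>)) * av x (k + int i) ?F)"
  proof (intro suminf_cong)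
    fix i
    have "(\<integral>\<^sup>+z. ennreal (?c i) * (ennreal \<bar>?F z\<bar> * indicator (Bl x (k + int i)) z) \<partial>lebesgue)
        = ennreal (?c i) * (ennreal (b powr (k + int i)) * av x (k + int i) ?F)"
      unfolding nn_integral_Bl_av[OF m, symmetric] by (intro nn_integral_cmult) measurable
    also have "\<dots> = ennreal (b powr (1 + \<beta> - real i * \<beta>)) * av x (k + int i) ?F"
      unfolding mult.assoc[symmetric]
      by (simp add: ennreal_mult'[symmetric] powr_add[symmetric] algebra_simps)
    finally show "(\<integral>\<^sup>+z. ennreal (?c i) * (ennreal \<bar>?F z\<bar> * indicator (Bl x (k + int i)) z) \<partial>lebesgue)
        = ennreal (b powr (1 + \<beta> - real i * \<beta>)) * av x (k + int i) ?F" .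
  qed
  finally show ?thesis .
qed

text \<open>The inner sums satisfy S (i + 1) = l S i + o' (i + 1), so the weighted total is at most
  its right-hand counterpart plus a l times itself. Induction on \<open>n\<close>, with the fixed
  point K = 1 + a l K, replaces a subtraction that is not allowed for infinite values.\<close>

lemma geometric_convolution_bound:
  fixes o' :: "nat \<Rightarrow> ennreal" and a l :: real
  assumes "0 \<le> a" "0 \<le> l" "a * l < 1"
  shows "(\<Sum>i<n. ennreal (a ^ i) * (\<Sum>j\<le>i. ennreal (l ^ (i - j)) * o' j))
    \<le> ennreal (1 / (1 - a * l)) * (\<Sum>i<n. ennreal (a ^ i) * o' i)"
proof -
  define S where "S i = (\<Sum>j\<le>i. ennreal (l ^ (i - j)) * o' j)" for i
  define K where "K = 1 / (1 - a * l)"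
  have K: "1 \<le> K" "1 + a * l * K = K" using assms by (auto simp: K_def field_simps)
  have S: "S (Suc i) = ennreal l * S i + o' (Suc i)" for i
  proof -
    have "ennreal l * S i = (\<Sum>j\<le>i. ennreal (l ^ (Suc i - j)) * o' j)"
      unfolding S_def sum_distrib_left using assms
      by (intro sum.cong refl) (simp add: Suc_diff_le ennreal_mult mult.assoc)
    then show ?thesis by (simp add: S_def)
  qed
  have "(\<Sum>i<n. ennreal (a ^ i) * S i) \<le> ennreal K * (\<Sum>i<n. ennreal (a ^ i) * o' i)"
  proof (induction n)
    case (Suc n)
    let ?V = "\<lambda>n. \<Sum>i<n. ennreal (a ^ i) * o' i"
    have "(\<Sum>i<Suc n. ennreal (a ^ i) * S i) = o' 0 + (\<Sum>i<n. ennreal (a ^ Suc i) * (ennreal l * S i + o' (Suc i)))"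
      unfolding sum.lessThan_Suc_shift S by (simp add: S_def)
    also have "\<dots> = ?V (Suc n) + (\<Sum>i<n. ennreal (a * l) * (ennreal (a ^ i) * S i))"
      unfolding sum.lessThan_Suc_shift using assms
      by (simp add: distrib_left sum.distrib ennreal_mult mult_ac add_ac)
    also have "\<dots> = ?V (Suc n) + ennreal (a * l) * (\<Sum>i<n. ennreal (a ^ i) * S i)"
      by (simp add: sum_distrib_left)
    also have "\<dots> \<le> ?V (Suc n) + ennreal (a * l) * (ennreal K * ?V (Suc n))"
      by (intro add_left_mono mult_left_mono order_trans[OF Suc.IH]) (auto intro!: sum_mono2)
    also have "\<dots> = ennreal (1 + a * l * K) * ?V (Suc n)"
    proof -
      have "ennreal (1 + a * l * K) = ennreal 1 + ennreal (a * l * K)"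
        using assms K(1) by (intro ennreal_plus) auto
      also have "ennreal (a * l * K) = ennreal (a * l) * ennreal K"
        using assms K(1) by (intro ennreal_mult) auto
      finally have "ennreal (1 + a * l * K) = 1 + ennreal (a * l) * ennreal K" by simp
      then show ?thesis by (simp add: distrib_right mult.assoc del: sum.lessThan_Suc)
    qed
    finally show ?case by (simp only: K)
  qed simp
  then show ?thesis by (simp add: S_def K_def)
qed

lemma kernel_int_le_osc:
  fixes d :: nat
  assumes R: "\<And>z. eigen A z \<Longrightarrow> cmod z < R" and \<beta>: "0 < \<beta>" and Rb: "R ^ d < b powr \<beta>"
  obtains C where "0 \<le> C" "\<And>x k f. locint f \<Longrightarrow>
    kernel_int d \<beta> x k f \<le> ennreal C * (\<Sum>i. ennreal (b powr - (real i * \<beta>)) * osc d x (k + int i) f)"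
proof -
  obtain C where C: "0 \<le> C" "\<And>x k f i. locint f \<Longrightarrow> av x (k + int i) (\<lambda>z. f z - proj d x k f z)
    \<le> ennreal C * (\<Sum>j\<le>i. ennreal (R ^ (d * (i - j))) * osc d x (k + int j) f)"
    using proj_telescope[OF R, where d=d] by blast
  have R1: "1 < R" by (rule eigen_bound_gt_1[OF R])
  \<comment> \<open>The decay of the kernel per enlargement. By \<open>Rb\<close> it beats the
    growth R ^ d of the polynomials, so the convolution has ratio below 1.\<close>
  define a where "a = b powr - \<beta>"
  have a0: "0 < a" by (simp add: a_def)
  have "a * R ^ d < a * b powr \<beta>" using Rb a0 by (rule mult_strict_left_mono)
  also have "a * b powr \<beta> = 1"
  proof -
    have "0 < b powr \<beta>" by (rule b_powr_pos)
    then show ?thesis unfolding a_def powr_minus by simp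
  qed
  finally have a: "0 < a" "a * R ^ d < 1" using a0 by auto
  have ai: "b powr - (real i * \<beta>) = a ^ i" for i
    by (simp add: a_def powr_powr[symmetric] powr_realpow[symmetric] mult.commute powr_powr)
  define K where "K = 1 / (1 - a * R ^ d)"
  have K0: "0 \<le> K" using a by (simp add: K_def)
  show ?thesis
  proof (rule that[of "b powr (1 + \<beta>) * C * K"])
    show "0 \<le> b powr (1 + \<beta>) * C * K" using C K0 by simp
    fix x k f assume f: "locint f"
    let ?o = "\<lambda>i. osc d x (k + int i) f"
    have "(\<Sum>i<n. ennreal (b powr (1 + \<beta> - real i * \<beta>)) * av x (k + int i) (\<lambda>z. f z - proj d x k f z))
        \<le> ennreal (b powr (1 + \<beta>) * C * K) * (\<Sum>i. ennreal (b powr - (real i * \<beta>)) * ?o i)" for n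
    proof -
      have co: "ennreal (b powr (1 + \<beta> - real i * \<beta>)) * (ennreal C * Z) = ennreal (b powr (1 + \<beta>) * C) * (ennreal (a ^ i) * Z)" for i Z
      proof -
        have "b powr (1 + \<beta> - real i * \<beta>) = b powr (1 + \<beta>) * a ^ i"
          unfolding ai[symmetric] powr_add[symmetric] by simp
        then show ?thesis using C a by (simp add: ennreal_mult mult_ac)
      qed
      have "(\<Sum>i<n. ennreal (b powr (1 + \<beta> - real i * \<beta>)) * av x (k + int i) (\<lambda>z. f z - proj d x k f z))
          \<le> (\<Sum>i<n. ennreal (b powr (1 + \<beta> - real i * \<beta>)) * (ennreal C * (\<Sum>j\<le>i. ennreal (R ^ (d * (i - j))) * ?o j)))"
        by (intro sum_mono mult_left_mono C(2) f) auto
      also have "\<dots> = ennreal (b powr (1 + \<beta>) * C) * (\<Sum>i<n. ennreal (a ^ i) * (\<Sum>j\<le>i. ennreal ((R ^ d) ^ (i - j)) * ?o j))"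
        unfolding co sum_distrib_left[symmetric] by (simp add: power_mult)
      also have "\<dots> \<le> ennreal (b powr (1 + \<beta>) * C) * (ennreal K * (\<Sum>i<n. ennreal (a ^ i) * ?o i))"
        unfolding K_def using a R1 by (intro mult_left_mono geometric_convolution_bound) auto
      also have "\<dots> \<le> ennreal (b powr (1 + \<beta>) * C) * (ennreal K * (\<Sum>i. ennreal (a ^ i) * ?o i))"
        by (intro mult_left_mono sum_le_suminf) auto
      finally show ?thesis using C K0 by (simp add: ai ennreal_mult mult.assoc)
    qed
    then show "kernel_int d \<beta> x k f \<le> ennreal (b powr (1 + \<beta>) * C * K) * (\<Sum>i. ennreal (b powr - (real i * \<beta>)) * ?o i)"
      by (intro order_trans[OF kernel_int_le_annuli[OF f \<beta>]]) (simp add: suminf_eq_SUP SUP_least)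
  qed
qed

end

section \<open>Families of balls in ball quasi-Banach function spaces\<close>

lemma epow_ennreal [simp]: "0 \<le> x \<Longrightarrow> epow (ennreal x) p = ennreal (x powr p)"
  by (simp add: epow_def)

lemma epow_top [simp]: "epow top p = top"
  by (simp add: epow_def)

lemma epow_0 [simp]: "epow 0 p = 0"
  by (simp add: epow_def)

lemma epow_eq_top_iff [simp]: "epow x p = top \<longleftrightarrow> x = top"
  by (simp add: epow_def)

lemma epow_mono: "x \<le> y \<Longrightarrow> 0 \<le> p \<Longrightarrow> epow x p \<le> epow y p"
  by (cases x; cases y) (auto simp: top_unique intro!: ennreal_leI powr_mono2)

lemma epow_epow: "epow (epow x p) q = epow x (p * q)"
  by (cases x) (auto simp: powr_powr)

lemma epow_1 [simp]: "epow x 1 = x"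
  by (cases x) auto

lemma epow_measurable [measurable]:
  assumes [measurable]: "f \<in> borel_measurable M"
  shows "(\<lambda>x. epow (f x) p) \<in> borel_measurable M"
proof -
  have "(\<lambda>x. ennreal (enn2real (f x) powr p)) \<in> borel_measurable M" by measurable
  moreover have "{x \<in> space M. f x = top} \<in> sets M" by measurable
  ultimately show ?thesis unfolding epow_def by (intro measurable_If) auto
qed

context anisotropic begin

lemma indicator_Bl_measurable [measurable]: "indicator (Bl x k) \<in> borel_measurable lebesgue"
  by (rule borel_measurable_indicator) simp

text \<open>The supremum runs over all balls that contain the point, so a superlevel set is a union
  of open balls. Measurability follows without any condition on \<open>f\<close>.\<close>

lemma open_maxf_greater: "open {x. a < maxf A D f x}"
proof -
  let ?v = "\<lambda>y k. (\<integral>\<^sup>+ z\<in>Bl y k. ennreal \<bar>f z\<bar> \<partial>lebesgue) / emeasure lebesgue (Bl y k)"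
  have "{x. a < maxf A D f x} = \<Union>{Bl y k | y k. a < ?v y k}"
    by (fastforce simp: maxf_def less_SUP_iff)
  then show ?thesis using open_Bl by auto
qed

lemma maxf_measurable [measurable]: "maxf A D f \<in> borel_measurable lebesgue"
proof (rule borel_measurableI_greater)
  fix a
  show "{x \<in> space lebesgue. a < maxf A D f x} \<in> sets lebesgue"
    using open_maxf_greater[of a f] by simp
qed

lemma maxf_ge:
  assumes "x \<in> Bl y k"
  shows "(\<integral>\<^sup>+ z\<in>Bl y k. ennreal \<bar>f z\<bar> \<partial>lebesgue) / emeasure lebesgue (Bl y k) \<le> maxf A D f x"
  unfolding maxf_def using assms by (intro SUP_upper2[of "(y, k)"]) auto

lemma divide_ennreal_powr:
  "x / ennreal (b powr u) = ennreal (b powr - u) * x"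
proof -
  have "inverse (ennreal (b powr u)) = ennreal (b powr - u)"
    using b_pos by (simp add: inverse_ennreal powr_minus)
  then show ?thesis by (simp add: divide_ennreal_def mult.commute)
qed

text \<open>The enlarged ball itself is a test ball, and \<open>Bl x k\<close> occupies the
  proportion b^-i of it.\<close>

lemma maxf_indicator_ge:
  assumes "z \<in> Bl x (k + int i)" "0 \<le> c"
  shows "ennreal (c * b powr - real i) \<le> maxf A D (\<lambda>w. c * indicator (Bl x k) w) z"
proof -
  have "(\<integral>\<^sup>+ w\<in>Bl x (k + int i). ennreal \<bar>c * indicator (Bl x k) w\<bar> \<partial>lebesgue) = ennreal (c * b powr k)"
  proof -
    have "Bl x k \<subseteq> Bl x (k + int i)" by (rule Bl_mono) simp
    then have "(\<integral>\<^sup>+ w\<in>Bl x (k + int i). ennreal \<bar>c * indicator (Bl x k) w\<bar> \<partial>lebesgue) = (\<integral>\<^sup>+ w. ennreal c * indicator (Bl x k) w \<partial>lebesgue)"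
      using assms(2) by (intro nn_integral_cong) (auto simp: indicator_def)
    also have "\<dots> = ennreal (c * b powr k)" using assms(2) by (simp add: nn_integral_cmult emeasure_Bl ennreal_mult)
    finally show ?thesis .
  qed
  then have "(\<integral>\<^sup>+ w\<in>Bl x (k + int i). ennreal \<bar>c * indicator (Bl x k) w\<bar> \<partial>lebesgue) / emeasure lebesgue (Bl x (k + int i))
      = ennreal (c * b powr - real i)"
    using assms(2) b_pos unfolding emeasure_Bl divide_ennreal_powr
    by (simp add: ennreal_mult'[symmetric] powr_add[symmetric] mult.commute mult.left_commute)
  then show ?thesis using maxf_ge[OF assms(1), of "\<lambda>w. c * indicator (Bl x k) w"] by simp
qed

end

section \<open>The common denominator of the two norms, and their comparison\<close>

locale qbfs = anisotropic A D r for A :: "real^'n^'n" and D r +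
  fixes N :: "(real^'n \<Rightarrow> real) \<Rightarrow> ennreal" and \<theta> :: real
  assumes X: "ball_qBfs A D N" and \<theta>_pos: "0 < \<theta>"
begin

lemma N_scale: "f \<in> borel_measurable lebesgue \<Longrightarrow> N (\<lambda>x. c * f x) = ennreal \<bar>c\<bar> * N f"
  using X unfolding ball_qBfs_def by blast

lemma N_quasi_triangle: "\<exists>K\<ge>1. \<forall>f g. f \<in> borel_measurable lebesgue \<longrightarrow> g \<in> borel_measurable lebesgue \<longrightarrow>
    N (\<lambda>x. f x + g x) \<le> ennreal K * (N f + N g)"
  using X unfolding ball_qBfs_def by blast

lemma N_eq_0: "f \<in> borel_measurable lebesgue \<Longrightarrow> N f = 0 \<Longrightarrow> AE x in lebesgue. f x = 0"
  using X unfolding ball_qBfs_def by blast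

lemma N_mono: "f \<in> borel_measurable lebesgue \<Longrightarrow> g \<in> borel_measurable lebesgue \<Longrightarrow>
    AE x in lebesgue. \<bar>g x\<bar> \<le> \<bar>f x\<bar> \<Longrightarrow> N g \<le> N f"
  using X unfolding ball_qBfs_def by blast

lemma N_ball_finite: "N (indicator (Bl x k)) < top"
  using X unfolding ball_qBfs_def by blast

lemma N_0: "N (\<lambda>x. 0) = 0"
  using N_scale[of "\<lambda>x. 0" 0] by simp

lemma N_finite_sum:
  assumes "finite J" "\<And>j. j \<in> J \<Longrightarrow> f j \<in> borel_measurable lebesgue" "\<And>j. j \<in> J \<Longrightarrow> N (f j) < top"
  shows "N (\<lambda>x. \<Sum>j\<in>J. f j x) < top"
  using assms
proof (induction J rule: finite_induct)
  case empty then show ?case by (simp add: N_0)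
next
  case (insert j J)
  obtain K where K: "\<And>f g. f \<in> borel_measurable lebesgue \<Longrightarrow> g \<in> borel_measurable lebesgue \<Longrightarrow>
    N (\<lambda>x. f x + g x) \<le> ennreal K * (N f + N g)" using N_quasi_triangle by blast
  have "(\<lambda>x. \<Sum>j\<in>J. f j x) \<in> borel_measurable lebesgue" by (rule borel_measurable_sum) (use insert in auto)
  then have "N (\<lambda>x. f j x + (\<Sum>j\<in>J. f j x)) \<le> ennreal K * (N (f j) + N (\<lambda>x. \<Sum>j\<in>J. f j x))"
    using insert by (intro K) auto
  also have "\<dots> < top" using insert by (simp add: ennreal_mult_less_top)
  finally show ?case using insert by simp
qed

lemma N_ball_pos: "0 < N (indicator (Bl x k))"
proof (rule ccontr)
  assume "\<not> ?thesis"
  then have "N (indicator (Bl x k)) = 0" by (simp add: not_gr_zero)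
  then have "AE z in lebesgue. indicator (Bl x k) z = (0::real)" by (intro N_eq_0) auto
  then have "AE z in lebesgue. z \<notin> Bl x k" by (rule AE_mp) (auto simp: indicator_def)
  then have "Bl x k \<in> null_sets lebesgue" by (subst AE_iff_null_sets) auto
  then show False using emeasure_Bl[of x k] by (auto simp: null_sets_def)
qed

lemma nX_pos: "0 < nX N (Bl x k)"
  unfolding nX_def using N_ball_pos N_ball_finite by (simp add: enn2real_positive_iff)

text \<open>The function inside the quasi-norm of the denominator, with c j standing for \<lambda>_j
  / nX of the \<open>j\<close>-th ball. Index sets are arbitrary, because later families are indexed
  by pairs.\<close>

definition fam :: "'i set \<Rightarrow> ('i \<Rightarrow> real^'n) \<Rightarrow> ('i \<Rightarrow> int) \<Rightarrow> ('i \<Rightarrow> real) \<Rightarrow> real^'n \<Rightarrow> real" where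
  "fam J xs ks c z = (\<Sum>j\<in>J. c j powr \<theta> * indicator (Bl (xs j) (ks j)) z) powr (1 / \<theta>)"

lemma fam_measurable [measurable]: "fam J xs ks c \<in> borel_measurable lebesgue"
  unfolding fam_def[abs_def] by measurable

lemma fam_nonneg: "0 \<le> fam J xs ks c z"
  by (simp add: fam_def)

lemma N_fam_finite:
  assumes "finite J" shows "N (fam J xs ks c) < top"
proof -
  define M where "M = (\<Sum>j\<in>J. c j powr \<theta>) powr (1 / \<theta>)"
  have "N (fam J xs ks c) \<le> N (\<lambda>z. M * (\<Sum>j\<in>J. indicator (Bl (xs j) (ks j)) z))"
  proof (rule N_mono)
    show "(\<lambda>z. M * (\<Sum>j\<in>J. indicator (Bl (xs j) (ks j)) z)) \<in> borel_measurable lebesgue" by measurable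
    have "fam J xs ks c z \<le> M * (\<Sum>j\<in>J. indicator (Bl (xs j) (ks j)) z)" for z
    proof (cases "\<exists>j\<in>J. z \<in> Bl (xs j) (ks j)")
      case True
      then obtain j where j: "j \<in> J" "z \<in> Bl (xs j) (ks j)" by blast
      have "1 = (indicator (Bl (xs j) (ks j)) z :: real)" using j by simp
      also have "\<dots> \<le> (\<Sum>j\<in>J. indicator (Bl (xs j) (ks j)) z)" using assms j by (intro member_le_sum) auto
      finally have "M * 1 \<le> M * (\<Sum>j\<in>J. indicator (Bl (xs j) (ks j)) z)" by (intro mult_left_mono) (auto simp: M_def)
      moreover have "fam J xs ks c z \<le> M"
        unfolding fam_def M_def using \<theta>_pos
        by (intro powr_mono2 sum_mono sum_nonneg) (auto simp: indicator_def)
      ultimately show ?thesis by simp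
    next
      case False
      then show ?thesis by (simp add: fam_def)
    qed
    moreover have "0 \<le> M * (\<Sum>j\<in>J. indicator (Bl (xs j) (ks j)) z)" for z by (simp add: M_def sum_nonneg)
    ultimately show "AE z in lebesgue. \<bar>fam J xs ks c z\<bar> \<le> \<bar>M * (\<Sum>j\<in>J. indicator (Bl (xs j) (ks j)) z)\<bar>"
      by (auto simp: fam_nonneg)
  qed simp
  also have "\<dots> = ennreal \<bar>M\<bar> * N (\<lambda>z. \<Sum>j\<in>J. indicator (Bl (xs j) (ks j)) z)"
    by (rule N_scale) measurable
  also have "\<dots> < top"
    using N_finite_sum[OF assms, of "\<lambda>j. indicator (Bl (xs j) (ks j))"] N_ball_finite by (simp add: ennreal_mult_less_top)
  finally show ?thesis .
qed

lemma N_fam_pos: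
  assumes "finite J" "j \<in> J" "0 < c j"
  shows "0 < N (fam J xs ks c)"
proof -
  have "0 < ennreal \<bar>c j\<bar> * N (indicator (Bl (xs j) (ks j)))"
    using assms(3) N_ball_pos by (simp add: ennreal_zero_less_mult_iff)
  also have "\<dots> = N (\<lambda>z. c j * indicator (Bl (xs j) (ks j)) z)" by (rule N_scale[symmetric]) measurable
  also have "\<dots> \<le> N (fam J xs ks c)"
  proof (rule N_mono)
    show "AE z in lebesgue. \<bar>c j * indicator (Bl (xs j) (ks j)) z\<bar> \<le> \<bar>fam J xs ks c z\<bar>"
    proof (rule AE_I2)
      fix z
      have "c j * indicator (Bl (xs j) (ks j)) z = (c j powr \<theta> * indicator (Bl (xs j) (ks j)) z) powr (1 / \<theta>)"
        using assms(3) \<theta>_pos by (auto simp: indicator_def powr_powr)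
      also have "\<dots> \<le> fam J xs ks c z"
        unfolding fam_def using \<theta>_pos assms(1,2)
        by (intro powr_mono2 member_le_sum[of j J "\<lambda>j. c j powr \<theta> * indicator (Bl (xs j) (ks j)) z"]) auto
      finally show "\<bar>c j * indicator (Bl (xs j) (ks j)) z\<bar> \<le> \<bar>fam J xs ks c z\<bar>"
        using assms(3) by (simp add: fam_nonneg)
    qed
  qed measurable
  finally show ?thesis .
qed

lemma fam_reindex:
  assumes "bij_betw h I J"
  shows "fam I (xs \<circ> h) (ks \<circ> h) (c \<circ> h) = fam J xs ks c"
  unfolding fam_def[abs_def] o_def
  using sum.reindex_bij_betw[OF assms, of "\<lambda>j. c j powr \<theta> * indicator (Bl (xs j) (ks j)) _"] by simp

definition oscq :: "real \<Rightarrow> nat \<Rightarrow> real^'n \<Rightarrow> int \<Rightarrow> (real^'n \<Rightarrow> real) \<Rightarrow> ennreal" where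
  "oscq t d x k f = epow ((\<integral>\<^sup>+ z\<in>Bl x k. ennreal (\<bar>f z - proj d x k f z\<bar> powr t) \<partial>lebesgue) / emeasure lebesgue (Bl x k)) (1 / t)"

text \<open>Clears the fraction in the Campanato supremum, since the denominator is positive and
  finite once a coefficient is positive. With \<open>camp_norm_leI\<close> as the converse, the norm
  is used only through inequalities for finite families.\<close>

lemma camp_norm_ge:
  assumes J: "finite J" and c: "\<And>j. j \<in> J \<Longrightarrow> 0 \<le> c j"
  shows "(\<Sum>j\<in>J. ennreal (c j * b powr ks j) * oscq t d (xs j) (ks j) f) \<le> camp_norm A D N t d \<theta> f * N (fam J xs ks c)"
proof (cases "\<exists>j\<in>J. 0 < c j")
  case False
  then have "c j = 0" if "j \<in> J" for j using c[OF that] that by force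
  then show ?thesis by simp
next
  case True
  obtain h where h: "bij_betw h {0..<card J} J" using ex_bij_betw_nat_finite[OF J] by blast
  then have h: "bij_betw h {..<card J} J" by (simp add: atLeast0LessThan)
  let ?m = "card J"
  let ?xs = "xs \<circ> h" and ?ks = "ks \<circ> h"
  define lam where "lam = (\<lambda>i. (c \<circ> h) i * nX N (Bl (?xs i) (?ks i)))"
  have lc: "lam i / nX N (Bl (?xs i) (?ks i)) = (c \<circ> h) i" for i
    using nX_pos[of "?xs i" "?ks i"] by (simp add: lam_def)
  have hJ: "h i \<in> J" if "i < ?m" for i using h that by (auto simp: bij_betw_def)
  have l0: "\<forall>i<?m. 0 \<le> lam i" using c hJ less_imp_le[OF nX_pos] by (auto simp: lam_def intro!: mult_nonneg_nonneg)
  obtain j where j: "j \<in> J" "0 < c j" using True by blast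
  have "j \<in> h ` {..<?m}" using h j(1) by (simp add: bij_betw_def)
  then obtain i where i: "i < ?m" "h i = j" by blast
  have "lam i > 0" using i j nX_pos by (simp add: lam_def)
  then have "(\<Sum>i<?m. lam i) > 0" using l0 i by (intro sum_pos2[of _ i]) auto
  then have ln: "(\<Sum>i<?m. lam i) \<noteq> 0" by simp
  let ?num = "\<Sum>i<?m. ennreal (lam i * measure lebesgue (Bl (?xs i) (?ks i)) / nX N (Bl (?xs i) (?ks i))) * oscq t d (?xs i) (?ks i) f"
  let ?den = "N (\<lambda>x. (\<Sum>i<?m. (lam i / nX N (Bl (?xs i) (?ks i))) powr \<theta> * indicator (Bl (?xs i) (?ks i)) x) powr (1 / \<theta>))"
  have "?num / ?den \<le> camp_norm A D N t d \<theta> f"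
    unfolding camp_norm_def oscq_def using l0 ln by (intro Sup_upper) blast
  moreover have "?den = N (fam J xs ks c)"
  proof -
    have "?den = N (fam {..<?m} ?xs ?ks (c \<circ> h))" unfolding lc fam_def[abs_def] ..
    then show ?thesis by (simp only: fam_reindex[OF h])
  qed
  moreover have "?num = (\<Sum>j\<in>J. ennreal (c j * b powr ks j) * oscq t d (xs j) (ks j) f)"
  proof -
    have "lam i * measure lebesgue (Bl (?xs i) (?ks i)) / nX N (Bl (?xs i) (?ks i)) = c (h i) * b powr ks (h i)" for i
      using lc[of i] by (simp add: measure_Bl times_divide_eq_left[symmetric] del: times_divide_eq_left)
    then have "?num = (\<Sum>i<?m. ennreal (c (h i) * b powr ks (h i)) * oscq t d (xs (h i)) (ks (h i)) f)" by simp
    also have "\<dots> = (\<Sum>j\<in>J. ennreal (c j * b powr ks j) * oscq t d (xs j) (ks j) f)"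
      by (rule sum.reindex_bij_betw[OF h])
    finally show ?thesis .
  qed
  ultimately have le: "(\<Sum>j\<in>J. ennreal (c j * b powr ks j) * oscq t d (xs j) (ks j) f) / N (fam J xs ks c) \<le> camp_norm A D N t d \<theta> f"
    by simp
  have n: "N (fam J xs ks c) \<noteq> 0" "N (fam J xs ks c) \<noteq> top"
    using N_fam_pos[of J j c xs ks] j J N_fam_finite[OF J, of xs ks c] by auto
  then have "(\<Sum>j\<in>J. ennreal (c j * b powr ks j) * oscq t d (xs j) (ks j) f)
      = (\<Sum>j\<in>J. ennreal (c j * b powr ks j) * oscq t d (xs j) (ks j) f) / N (fam J xs ks c) * N (fam J xs ks c)"
    by (simp add: ennreal_divide_times ennreal_divide_self less_top[symmetric])
  also have "\<dots> \<le> camp_norm A D N t d \<theta> f * N (fam J xs ks c)" by (intro mult_right_mono le) simp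
  finally show ?thesis .
qed

lemma camp_norm_leI:
  assumes "\<And>(m::nat) xs ks c. (\<And>i. i < m \<Longrightarrow> 0 \<le> c i) \<Longrightarrow>
    (\<Sum>i<m. ennreal (c i * b powr ks i) * oscq t d (xs i) (ks i) f) \<le> M * N (fam {..<m} xs ks c)"
  shows "camp_norm A D N t d \<theta> f \<le> M"
  unfolding camp_norm_def
proof (rule Sup_least, clarify)
  fix m :: nat and xs ks lam
  assume l: "\<forall>j<m. 0 \<le> lam j" "(\<Sum>j<m. lam j) \<noteq> (0::real)"
  define c where "c i = lam i / nX N (Bl (xs i) (ks i))" for i
  have c0: "0 \<le> c i" if "i < m" for i using l that nX_pos by (simp add: c_def less_imp_le)
  obtain i where i: "i < m" "lam i \<noteq> 0" using l(2) by (metis lessThan_iff sum.neutral)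
  then have "0 < c i" using l nX_pos by (auto simp: c_def order.order_iff_strict)
  then have pos: "0 < N (fam {..<m} xs ks c)" using i by (intro N_fam_pos) auto
  have eq: "lam j * measure lebesgue (Bl (xs j) (ks j)) / nX N (Bl (xs j) (ks j)) = c j * b powr ks j" for j
    by (simp add: c_def measure_Bl)
  have le: "(\<Sum>i<m. ennreal (c i * b powr ks i) * oscq t d (xs i) (ks i) f) \<le> N (fam {..<m} xs ks c) * M"
    unfolding mult.commute[of _ M] by (rule assms) (rule c0)
  show "(\<Sum>j<m. ennreal (lam j * measure lebesgue (Bl (xs j) (ks j)) / nX N (Bl (xs j) (ks j))) *
      epow ((\<integral>\<^sup>+ x\<in>Bl (xs j) (ks j). ennreal (\<bar>f x - proj d (xs j) (ks j) f x\<bar> powr t) \<partial>lebesgue)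
        / emeasure lebesgue (Bl (xs j) (ks j))) (1 / t))
    / N (\<lambda>x. (\<Sum>i<m. (lam i / nX N (Bl (xs i) (ks i))) powr \<theta> * indicator (Bl (xs i) (ks i)) x) powr (1 / \<theta>)) \<le> M"
    unfolding eq oscq_def[symmetric] c_def[symmetric]
    using pos le unfolding fam_def[abs_def] by (rule divide_le_posI_ennreal)
qed

text \<open>With finitely many nonzero coefficients the series in the denominator is a finite sum,
  which matches it with the denominator of the Campanato norm.\<close>

lemma star_denom_eq:
  assumes "\<And>i. c i = lam i / nX N (Bl (xs i) (ks i))" "\<And>i. m \<le> i \<Longrightarrow> lam i = 0"
  shows "star_denom A D N \<theta> xs ks lam = N (fam {..<m} xs ks c)"
proof -
  have s: "(\<Sum>i. ennreal ((lam i / nX N (Bl (xs i) (ks i))) powr \<theta> * indicator (Bl (xs i) (ks i)) z))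
      = ennreal (\<Sum>i<m. c i powr \<theta> * indicator (Bl (xs i) (ks i)) z)" for z
  proof -
    have "(\<Sum>i. ennreal ((lam i / nX N (Bl (xs i) (ks i))) powr \<theta> * indicator (Bl (xs i) (ks i)) z))
       = (\<Sum>i<m. ennreal (c i powr \<theta> * indicator (Bl (xs i) (ks i)) z))"
      unfolding assms(1) by (rule suminf_finite) (use assms(2) in \<open>auto simp: not_less\<close>)
    then show ?thesis by (simp add: sum_ennreal)
  qed
  have "epow (\<Sum>i. ennreal ((lam i / nX N (Bl (xs i) (ks i))) powr \<theta> * indicator (Bl (xs i) (ks i)) z)) (1 / \<theta>)
      = ennreal (fam {..<m} xs ks c z)" for z
    unfolding s fam_def by (rule epow_ennreal) (simp add: sum_nonneg)
  then show ?thesis unfolding star_denom_def Xext_def by (simp add: fam_nonneg)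
qed

lemma camp_norm_le_star_norm:
  assumes f: "locint f" and \<beta>: "0 < \<beta>"
  shows "camp_norm A D N 1 d \<theta> f \<le> 2 * star_norm A D N d \<theta> \<beta> f"
proof (rule camp_norm_leI)
  fix m :: nat and xs ks and c :: "nat \<Rightarrow> real" assume c: "\<And>i. i < m \<Longrightarrow> 0 \<le> c i"
  have o: "oscq 1 d x k f = osc d x k f" for x k
  proof -
    have "osc d x k f = ennreal (b powr - k) * (\<integral>\<^sup>+z\<in>Bl x k. ennreal \<bar>f z - proj d x k f z\<bar> \<partial>lebesgue)"
      unfolding osc_def by (intro av_eq_nn_integral locint_measurable locint_diff_proj f)
    then show ?thesis by (simp add: oscq_def emeasure_Bl divide_ennreal_powr)
  qed
  show "(\<Sum>i<m. ennreal (c i * b powr ks i) * oscq 1 d (xs i) (ks i) f) \<le> 2 * star_norm A D N d \<theta> \<beta> f * N (fam {..<m} xs ks c)"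
  proof (cases "\<exists>i<m. 0 < c i")
    case False
    then have "c i = 0" if "i < m" for i using c[OF that] that by force
    then show ?thesis by simp
  next
    case True
    then obtain i0 where i0: "i0 < m" "0 < c i0" by blast
    \<comment> \<open>Padding by zero coefficients turns the finite family into a sequence; the
      positive coefficient at \<open>i0\<close> makes it admissible for the star norm.\<close>
    define c' where "c' i = (if i < m then c i else 0)" for i
    define lam where "lam i = c' i * nX N (Bl (xs i) (ks i))" for i
    have lc: "c' i = lam i / nX N (Bl (xs i) (ks i))" for i
      using nX_pos[of "xs i" "ks i"] by (simp add: lam_def)
    have den: "star_denom A D N \<theta> xs ks lam = N (fam {..<m} xs ks c)"
    proof -
      have "star_denom A D N \<theta> xs ks lam = N (fam {..<m} xs ks c')"
        by (rule star_denom_eq[OF lc]) (simp add: lam_def c'_def)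
      also have "fam {..<m} xs ks c' = fam {..<m} xs ks c" by (auto simp: fam_def fun_eq_iff c'_def intro!: sum.cong arg_cong[where f="\<lambda>s. s powr _"])
      finally show ?thesis .
    qed
    have l0: "\<forall>j. 0 \<le> lam j" using c less_imp_le[OF nX_pos] by (auto simp: lam_def c'_def intro!: mult_nonneg_nonneg)
    have ln: "(\<Sum>j. ennreal (lam j)) \<noteq> 0"
    proof
      assume "(\<Sum>j. ennreal (lam j)) = 0"
      then have "ennreal (lam i0) = 0" by (subst (asm) suminf_eq_zero_iff) auto
      moreover have "lam i0 > 0" using i0 nX_pos by (simp add: lam_def c'_def)
      ultimately show False by simp
    qed
    have N: "0 < N (fam {..<m} xs ks c)" "N (fam {..<m} xs ks c) < top"
      using i0 by (auto intro!: N_fam_pos N_fam_finite)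
    let ?num = "\<Sum>j. ennreal (lam j * measure lebesgue (Bl (xs j) (ks j)) / nX N (Bl (xs j) (ks j))) * kernel_int d \<beta> (xs j) (ks j) f"
    have "?num / star_denom A D N \<theta> xs ks lam \<le> star_norm A D N d \<theta> \<beta> f"
      unfolding star_norm_def kernel_int_def
      by (intro Sup_upper) (use l0 ln N[folded den] in blast)
    moreover have "?num = (\<Sum>j<m. ennreal (c j * b powr ks j) * kernel_int d \<beta> (xs j) (ks j) f)"
    proof -
      have eq: "lam j * measure lebesgue (Bl (xs j) (ks j)) / nX N (Bl (xs j) (ks j)) = c' j * b powr ks j" for j
        unfolding lc by (simp add: measure_Bl)
      show ?thesis unfolding eq
        by (subst suminf_finite[of "{..<m}"]) (auto simp: c'_def)
    qed
    ultimately have le: "(\<Sum>j<m. ennreal (c j * b powr ks j) * kernel_int d \<beta> (xs j) (ks j) f) / N (fam {..<m} xs ks c)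
        \<le> star_norm A D N d \<theta> \<beta> f" by (simp add: den)
    have "(\<Sum>i<m. ennreal (c i * b powr ks i) * oscq 1 d (xs i) (ks i) f)
        \<le> (\<Sum>i<m. ennreal (c i * b powr ks i) * (2 * kernel_int d \<beta> (xs i) (ks i) f))"
      unfolding o by (intro sum_mono mult_left_mono osc_le_kernel_int f \<beta>) auto
    also have "\<dots> = 2 * (\<Sum>i<m. ennreal (c i * b powr ks i) * kernel_int d \<beta> (xs i) (ks i) f)"
      by (simp add: sum_distrib_left mult_ac)
    also have "\<dots> = 2 * ((\<Sum>i<m. ennreal (c i * b powr ks i) * kernel_int d \<beta> (xs i) (ks i) f) / N (fam {..<m} xs ks c) * N (fam {..<m} xs ks c))"
      using N by (simp add: ennreal_divide_times mult_divide_eq_ennreal)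
    also have "\<dots> \<le> 2 * star_norm A D N d \<theta> \<beta> f * N (fam {..<m} xs ks c)"
      unfolding mult.assoc by (intro mult_left_mono mult_right_mono le) auto
    finally show ?thesis .
  qed
qed

text \<open>Jensen's inequality, from Young's inequality with exponents 1/q and 1 - 1/q after
  dividing by the \<open>q\<close>-mean. A vanishing and an infinite \<open>q\<close>-mean are
  treated apart.\<close>

lemma av_le_powr_mean:
  assumes q: "1 \<le> q" and g: "g \<in> borel_measurable lebesgue"
  shows "av x k g \<le> epow ((\<integral>\<^sup>+ z\<in>Bl x k. ennreal (\<bar>g z\<bar> powr q) \<partial>lebesgue) / emeasure lebesgue (Bl x k)) (1 / q)"
proof -
  have gm[measurable]: "(\<lambda>y. g (x + T k y)) \<in> borel_measurable lebesgue" using g measurable_affine_T by blast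
  let ?I = "\<integral>\<^sup>+y\<in>D. ennreal (\<bar>g (x + T k y)\<bar> powr q) \<partial>lebesgue"
  have "(\<integral>\<^sup>+ z\<in>Bl x k. ennreal (\<bar>g z\<bar> powr q) \<partial>lebesgue) = ennreal (b powr k) * ?I"
    by (rule nn_integral_Bl) (use g in measurable)
  then have "(\<integral>\<^sup>+ z\<in>Bl x k. ennreal (\<bar>g z\<bar> powr q) \<partial>lebesgue) / emeasure lebesgue (Bl x k) = ennreal (b powr - k) * (ennreal (b powr k) * ?I)"
    by (simp add: emeasure_Bl divide_ennreal_powr)
  also have "\<dots> = ?I"
    unfolding mult.assoc[symmetric] by (simp add: ennreal_mult'[symmetric] powr_add[symmetric])
  finally have eq: "(\<integral>\<^sup>+ z\<in>Bl x k. ennreal (\<bar>g z\<bar> powr q) \<partial>lebesgue) / emeasure lebesgue (Bl x k) = ?I" .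
  show ?thesis
    unfolding eq
  proof (cases ?I)
    case (real I)
    show "av x k g \<le> epow ?I (1 / q)"
    proof (cases "I = 0")
      case True
      then have "?I = 0" using real by simp
      then have "AE y in lebesgue. ennreal (\<bar>g (x + T k y)\<bar> powr q) * indicator D y = 0"
        by (subst (asm) nn_integral_0_iff_AE) auto
      then have "AE y in lebesgue. ennreal \<bar>g (x + T k y)\<bar> * indicator D y = 0"
        by (rule AE_mp) (auto simp: indicator_def)
      then have "av x k g = 0" unfolding av_def by (subst nn_integral_0_iff_AE) auto
      then show ?thesis by simp
    next
      case False
      then have I: "0 < I" using real by simp
      define M where "M = I powr (1 / q)"
      have M: "0 < M" "M powr q = I" using I q by (auto simp: M_def powr_powr)
      have young: "\<bar>v\<bar> / M \<le> (1 / q / I) * \<bar>v\<bar> powr q + (1 - 1 / q)" for v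
      proof (cases "v = 0")
        case False
        have "(\<bar>v\<bar> powr q / I) powr (1 / q) * 1 powr (1 - 1 / q) \<le> (1 / q) * (\<bar>v\<bar> powr q / I) + (1 - 1 / q) * 1"
          by (rule Youngs_inequality_0) (use q I False in auto)
        moreover have "(\<bar>v\<bar> powr q / I) powr (1 / q) = \<bar>v\<bar> / M"
          using q I by (simp add: powr_divide powr_powr M_def)
        ultimately show ?thesis by (simp add: field_simps)
      qed (use q in auto)
      have "ennreal (1 / M) * av x k g = (\<integral>\<^sup>+y. ennreal (\<bar>g (x + T k y)\<bar> / M) * indicator D y \<partial>lebesgue)"
        unfolding av_def using M(1)
        by (subst nn_integral_cmult[symmetric]) (auto simp: ennreal_mult'[symmetric] mult.assoc[symmetric] intro!: nn_integral_cong)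
      also have "\<dots> \<le> (\<integral>\<^sup>+y. ennreal (1 / q / I) * (ennreal (\<bar>g (x + T k y)\<bar> powr q) * indicator D y)
          + ennreal (1 - 1 / q) * indicator D y \<partial>lebesgue)"
        using young q I by (intro nn_integral_mono)
          (auto simp: indicator_def ennreal_mult'[symmetric] ennreal_plus[symmetric] simp del: ennreal_plus intro!: ennreal_leI)
      also have "\<dots> = ennreal (1 / q / I) * ?I + ennreal (1 - 1 / q)"
        by (subst nn_integral_add) (auto simp: nn_integral_cmult vol)
      also have "\<dots> = ennreal (1 / q / I * I + (1 - 1 / q))"
        using q I real by (simp add: ennreal_mult'[symmetric] ennreal_plus[symmetric] del: ennreal_plus)
      also have "\<dots> = 1" using I by simp
      finally have *: "ennreal (1 / M) * av x k g \<le> 1" .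
      have "av x k g = ennreal M * (ennreal (1 / M) * av x k g)"
        using M(1) unfolding mult.assoc[symmetric] by (simp add: ennreal_mult'[symmetric])
      also have "\<dots> \<le> ennreal M * 1" by (intro mult_left_mono *) simp
      finally show ?thesis using real I by (simp add: M_def)
    qed
  qed simp
qed

lemma oscq_1: "locint f \<Longrightarrow> oscq 1 d x k f = osc d x k f"
  unfolding oscq_def osc_def
  by (subst av_eq_nn_integral) (auto simp: emeasure_Bl divide_ennreal_powr intro: locint_measurable locint_diff_proj)

lemma camp_norm_1_le:
  assumes f: "locint f" and q: "1 \<le> q"
  shows "camp_norm A D N 1 d \<theta> f \<le> camp_norm A D N q d \<theta> f"
proof (rule camp_norm_leI)
  fix m :: nat and xs ks and c :: "nat \<Rightarrow> real" assume c: "\<And>i. i < m \<Longrightarrow> 0 \<le> c i"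
  have "(\<Sum>i<m. ennreal (c i * b powr ks i) * oscq 1 d (xs i) (ks i) f)
      \<le> (\<Sum>i<m. ennreal (c i * b powr ks i) * oscq q d (xs i) (ks i) f)"
    unfolding oscq_1[OF f] unfolding osc_def oscq_def
    by (intro sum_mono mult_left_mono av_le_powr_mean q locint_measurable locint_diff_proj f) auto
  also have "\<dots> \<le> camp_norm A D N q d \<theta> f * N (fam {..<m} xs ks c)"
    by (rule camp_norm_ge) (use c in auto)
  finally show "(\<Sum>i<m. ennreal (c i * b powr ks i) * oscq 1 d (xs i) (ks i) f) \<le> camp_norm A D N q d \<theta> f * N (fam {..<m} xs ks c)" .
qed

end

section \<open>Absorbing dilated balls, and the star norm below the Campanato norm\<close>

locale fs_space = qbfs A D r N \<theta> for A :: "real^'n^'n" and D r N \<theta> +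
  fixes pm s :: real
  assumes FS: "assumption_FS A D N pm" and s: "0 < s" "s < \<theta>" and \<theta>_pm: "\<theta> < pm"
begin

lemma Lloc_indicator: "Lloc 1 (\<lambda>w. c * indicator (Bl x k) w)"
  unfolding Lloc_def
proof (intro conjI allI impI)
  fix K :: "(real^'n) set"
  have "(\<integral>\<^sup>+w\<in>K. ennreal (\<bar>c * indicator (Bl x k) w\<bar> powr 1) \<partial>lebesgue) \<le> (\<integral>\<^sup>+w. ennreal \<bar>c\<bar> * indicator (Bl x k) w \<partial>lebesgue)"
    by (intro nn_integral_mono) (auto simp: indicator_def)
  also have "\<dots> < top" by (simp add: nn_integral_cmult emeasure_Bl ennreal_mult_less_top)
  finally show "(\<integral>\<^sup>+w\<in>K. ennreal (\<bar>c * indicator (Bl x k) w\<bar> powr 1) \<partial>lebesgue) < top" .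
qed measurable

text \<open>On \<open>Bl x (k + i)\<close> the maximal function of \<open>indicator (Bl x k)\<close> is at least \<open>b powr - i\<close>;
  the Fefferman-Stein inequality with exponents \<open>s\<close> and \<open>\<theta> / s\<close> absorbs these dilations.\<close>

lemma dilated_family_bound:
  assumes \<gamma>: "\<theta> / s < \<gamma>"
  obtains C where "0 \<le> C" "\<And>(J :: 'i set) xs ks c n. finite J \<Longrightarrow> (\<And>j. j \<in> J \<Longrightarrow> 0 \<le> c j) \<Longrightarrow>
    N (\<lambda>z. (\<Sum>j\<in>J. c j powr \<theta> * (\<Sum>i<n. b powr - (real i * \<gamma>) * indicator (Bl (xs j) (ks j + int i)) z)) powr (1 / \<theta>))
    \<le> ennreal C * N (fam J xs ks c)"
proof -
  define u where "u = \<theta> / s"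
  have u: "1 < u" "0 < u" "u < \<gamma>" using s \<gamma> by (auto simp: u_def)
  obtain C0 where C0: "\<And>fs. (\<forall>k. Lloc 1 (fs k)) \<Longrightarrow>
      Xpow_ext N (1 / s) (\<lambda>x. epow (\<Sum>k. epow (maxf A D (fs k) x) u) (1 / u))
      \<le> ennreal C0 * Xpow_ext N (1 / s) (\<lambda>x. epow (\<Sum>k. ennreal (\<bar>fs k x\<bar> powr u)) (1 / u))"
    using FS s \<theta>_pm u(1) unfolding assumption_FS_def by (meson order_less_trans)
  \<comment> \<open>Assumption (FS) offers only some real constant, hence the maximum with 0; the
    exponent 1 / s undoes the \<open>s\<close>-th power on both sides.\<close>
  define C1 where "C1 = max C0 0 powr (1 / s)"
  \<comment> \<open>The surplus of \<gamma> over \<theta> / s turns the sum over the dilations into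
    a convergent geometric series.\<close>
  define a where "a = b powr - (\<gamma> - u)"
  have a: "0 < a" "a < 1" using u(3) b_gt_1 powr_less_cancel_iff[of b "- (\<gamma> - u)" 0] by (auto simp: a_def)
  define K0 where "K0 = 1 / (1 - a)"
  have K0: "0 < K0" using a by (simp add: K0_def)
  show ?thesis
  proof (rule that[of "K0 powr (1 / \<theta>) * C1"])
    show "0 \<le> K0 powr (1 / \<theta>) * C1" by (simp add: C1_def)
    fix J :: "'i set" and xs ks and c :: "'i \<Rightarrow> real" and n :: nat
    assume J: "finite J" and c: "\<And>j. j \<in> J \<Longrightarrow> 0 \<le> c j"
    obtain h where "bij_betw h {0..<card J} J" using ex_bij_betw_nat_finite[OF J] by blast
    then have h: "bij_betw h {..<card J} J" by (simp add: atLeast0LessThan)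
    let ?m = "card J"
    have hJ: "h i \<in> J" if "i < ?m" for i using h that by (auto simp: bij_betw_def)
    \<comment> \<open>The exponent \<open>s\<close> is chosen so that the \<open>u\<close>-th power,
      u = \<theta> / s, restores c j powr \<theta>.\<close>
    define g where "g j = (\<lambda>w. c j powr s * indicator (Bl (xs j) (ks j)) w)" for j
    define fs where "fs k = (if k < ?m then g (h k) else (\<lambda>w. 0))" for k
    have fsL: "\<forall>k. Lloc 1 (fs k)"
      using Lloc_indicator[of 0 0 0] by (auto simp: fs_def g_def Lloc_indicator)
    have max0: "maxf A D (\<lambda>w. 0) x = 0" for x
      unfolding maxf_def by (auto intro!: SUP_eq_const center_in_Bl)
    define S where "S x = (\<Sum>j\<in>J. epow (maxf A D (g j) x) u)" for x
    have S: "(\<Sum>k. epow (maxf A D (fs k) x) u) = S x" for x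
    proof -
      have "(\<Sum>k. epow (maxf A D (fs k) x) u) = (\<Sum>k<?m. epow (maxf A D (g (h k)) x) u)"
        by (subst suminf_finite[of "{..<?m}"]) (auto simp: fs_def max0)
      also have "\<dots> = S x" unfolding S_def by (rule sum.reindex_bij_betw[OF h])
      finally show ?thesis .
    qed
    have R: "(\<Sum>k. ennreal (\<bar>fs k x\<bar> powr u)) = ennreal (\<Sum>j\<in>J. c j powr \<theta> * indicator (Bl (xs j) (ks j)) x)" for x
    proof -
      have "(\<Sum>k. ennreal (\<bar>fs k x\<bar> powr u)) = (\<Sum>k<?m. ennreal (\<bar>g (h k) x\<bar> powr u))"
        by (subst suminf_finite[of "{..<?m}"]) (auto simp: fs_def)
      also have "\<dots> = (\<Sum>j\<in>J. ennreal (\<bar>g j x\<bar> powr u))" by (rule sum.reindex_bij_betw[OF h])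
      also have "\<dots> = (\<Sum>j\<in>J. ennreal (c j powr \<theta> * indicator (Bl (xs j) (ks j)) x))"
        using s by (intro sum.cong refl) (auto simp: g_def indicator_def powr_powr u_def)
      finally show ?thesis by (simp add: sum_ennreal)
    qed
    have us: "1 / u * (1 / s) = 1 / \<theta>" using s u by (simp add: u_def)
    have pe: "Xpow_ext N (1 / s) (\<lambda>x. epow (G x) (1 / u)) = epow (Xext N (\<lambda>x. epow (G x) (1 / \<theta>))) s" for G
      unfolding Xpow_ext_def epow_epow us using s by simp
    have XR: "Xext N (\<lambda>x. epow (ennreal (\<Sum>j\<in>J. c j powr \<theta> * indicator (Bl (xs j) (ks j)) x)) (1 / \<theta>)) = N (fam J xs ks c)"
    proof -
      have "epow (ennreal (\<Sum>j\<in>J. c j powr \<theta> * indicator (Bl (xs j) (ks j)) x)) (1 / \<theta>) = ennreal (fam J xs ks c x)" for x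
        unfolding fam_def by (rule epow_ennreal) (simp add: sum_nonneg)
      then show ?thesis by (simp add: Xext_def fam_nonneg)
    qed
    let ?L = "Xext N (\<lambda>x. epow (S x) (1 / \<theta>))"
    have "epow ?L s \<le> ennreal C0 * epow (N (fam J xs ks c)) s"
      using C0[OF fsL] unfolding S R pe XR .
    also have "\<dots> \<le> ennreal (max C0 0) * epow (N (fam J xs ks c)) s"
      by (intro mult_right_mono ennreal_leI) auto
    finally have le: "epow ?L s \<le> ennreal (max C0 0) * epow (N (fam J xs ks c)) s" .
    obtain v where v: "0 \<le> v" "N (fam J xs ks c) = ennreal v"
      using N_fam_finite[OF J, of xs ks c] by (cases "N (fam J xs ks c)") auto
    have le': "epow ?L s \<le> ennreal (max C0 0 * v powr s)"
      using le v by (simp add: ennreal_mult)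
    then have "?L \<noteq> top" by (metis epow_eq_top_iff ennreal_neq_top top_unique)
    then obtain l where l: "0 \<le> l" "?L = ennreal l" by (cases ?L) auto
    have "l powr s \<le> max C0 0 * v powr s" using le' l v by (simp add: ennreal_le_iff)
    then have "(l powr s) powr (1 / s) \<le> (max C0 0 * v powr s) powr (1 / s)" using s by (intro powr_mono2) auto
    then have "l \<le> C1 * v" using s l v by (simp add: powr_powr powr_mult C1_def)
    then have L: "?L \<le> ennreal C1 * N (fam J xs ks c)"
      using l v by (simp add: ennreal_mult'[symmetric] ennreal_leI C1_def)
    have ae: "AE x in lebesgue. epow (S x) (1 / \<theta>) \<noteq> top"
      using \<open>?L \<noteq> top\<close> unfolding Xext_def by (auto split: if_splits)
    then have XL: "?L = N (\<lambda>x. enn2real (epow (S x) (1 / \<theta>)))" by (simp add: Xext_def)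
    have Sm[measurable]: "S \<in> borel_measurable lebesgue" unfolding S_def[abs_def] by measurable
    let ?G = "\<lambda>z. \<Sum>j\<in>J. c j powr \<theta> * (\<Sum>i<n. b powr - (real i * \<gamma>) * indicator (Bl (xs j) (ks j + int i)) z)"
    have G0: "0 \<le> ?G z" for z by (intro sum_nonneg mult_nonneg_nonneg) auto
    have pt: "ennreal (?G z) \<le> ennreal K0 * S z" for z
    proof -
      have one: "ennreal (c j powr \<theta> * (\<Sum>i<n. b powr - (real i * \<gamma>) * indicator (Bl (xs j) (ks j + int i)) z))
          \<le> ennreal K0 * epow (maxf A D (g j) z) u" if j: "j \<in> J" for j
      proof -
        let ?E = "epow (maxf A D (g j) z) u"
        have i: "ennreal (c j powr \<theta> * (b powr - (real i * \<gamma>) * indicator (Bl (xs j) (ks j + int i)) z)) \<le> ennreal (a ^ i) * ?E" for i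
        proof (cases "z \<in> Bl (xs j) (ks j + int i)")
          case True
          have "ennreal (c j powr s * b powr - real i) \<le> maxf A D (g j) z"
            unfolding g_def by (rule maxf_indicator_ge[OF True]) simp
          then have "epow (ennreal (c j powr s * b powr - real i)) u \<le> ?E" using u by (intro epow_mono) auto
          then have "ennreal (c j powr \<theta> * b powr - (real i * u)) \<le> ?E"
            using s by (simp add: powr_mult powr_powr u_def)
          then have "ennreal (a ^ i) * ennreal (c j powr \<theta> * b powr - (real i * u)) \<le> ennreal (a ^ i) * ?E"
            by (intro mult_left_mono) auto
          moreover have "a ^ i = b powr - (real i * (\<gamma> - u))"
            by (simp add: a_def powr_realpow[symmetric] powr_powr algebra_simps)
          then have "a ^ i * (c j powr \<theta> * b powr - (real i * u)) = c j powr \<theta> * b powr - (real i * \<gamma>)"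
            by (simp add: powr_add[symmetric] algebra_simps)
          ultimately show ?thesis using True a by (simp add: ennreal_mult'[symmetric])
        qed simp
        have "ennreal (c j powr \<theta> * (\<Sum>i<n. b powr - (real i * \<gamma>) * indicator (Bl (xs j) (ks j + int i)) z))
            = (\<Sum>i<n. ennreal (c j powr \<theta> * (b powr - (real i * \<gamma>) * indicator (Bl (xs j) (ks j + int i)) z)))"
          unfolding sum_distrib_left by (rule sum_ennreal[symmetric]) auto
        also have "\<dots> \<le> (\<Sum>i<n. ennreal (a ^ i) * ?E)" by (intro sum_mono i)
        also have "\<dots> = ennreal (\<Sum>i<n. a ^ i) * ?E"
          using a by (simp add: sum_distrib_right[symmetric] sum_ennreal)
        also have "\<dots> \<le> ennreal K0 * ?E"
        proof (intro mult_right_mono ennreal_leI)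
          have "(\<Sum>i<n. a ^ i) = (1 - a ^ n) / (1 - a)" using a by (simp add: sum_gp_strict)
          also have "\<dots> \<le> K0" unfolding K0_def using a by (intro divide_right_mono) auto
          finally show "(\<Sum>i<n. a ^ i) \<le> K0" .
        qed simp
        finally show ?thesis .
      qed
      have "ennreal (?G z) = (\<Sum>j\<in>J. ennreal (c j powr \<theta> * (\<Sum>i<n. b powr - (real i * \<gamma>) * indicator (Bl (xs j) (ks j + int i)) z)))"
        by (rule sum_ennreal[symmetric]) (auto intro!: mult_nonneg_nonneg sum_nonneg)
      also have "\<dots> \<le> (\<Sum>j\<in>J. ennreal K0 * epow (maxf A D (g j) z) u)" by (intro sum_mono one)
      finally show ?thesis by (simp add: S_def sum_distrib_left)
    qed
    have "N (\<lambda>z. ?G z powr (1 / \<theta>)) \<le> N (\<lambda>z. K0 powr (1 / \<theta>) * enn2real (epow (S z) (1 / \<theta>)))"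
    proof (rule N_mono)
      show "AE z in lebesgue. \<bar>?G z powr (1 / \<theta>)\<bar> \<le> \<bar>K0 powr (1 / \<theta>) * enn2real (epow (S z) (1 / \<theta>))\<bar>"
        using ae
      proof (rule AE_mp, intro AE_I2 impI)
        fix z assume "epow (S z) (1 / \<theta>) \<noteq> top"
        then obtain w where w: "0 \<le> w" "S z = ennreal w" by (cases "S z") auto
        have "?G z \<le> K0 * w" using pt[of z] w K0 by (simp add: ennreal_mult'[symmetric] ennreal_le_iff)
        then have "?G z powr (1 / \<theta>) \<le> (K0 * w) powr (1 / \<theta>)" using \<theta>_pos G0 by (intro powr_mono2) auto
        then show "\<bar>?G z powr (1 / \<theta>)\<bar> \<le> \<bar>K0 powr (1 / \<theta>) * enn2real (epow (S z) (1 / \<theta>))\<bar>"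
          using w K0 by (simp add: powr_mult)
      qed
    qed measurable
    also have "\<dots> = ennreal \<bar>K0 powr (1 / \<theta>)\<bar> * ?L" unfolding XL by (rule N_scale) measurable
    also have "\<dots> \<le> ennreal (K0 powr (1 / \<theta>)) * (ennreal C1 * N (fam J xs ks c))"
      using L by (intro mult_mono) auto
    also have "\<dots> = ennreal (K0 powr (1 / \<theta>) * C1) * N (fam J xs ks c)"
      by (simp add: ennreal_mult' mult.assoc C1_def)
    finally show "N (\<lambda>z. ?G z powr (1 / \<theta>)) \<le> ennreal (K0 powr (1 / \<theta>) * C1) * N (fam J xs ks c)" .
  qed
qed

text \<open>The term with i = m in the sum over all dilations already contains the enlarged family,
  at the price of its weight b powr (m \<gamma>).\<close>

lemma enlarged_family_bound:
  fixes m :: nat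
  obtains C where "0 \<le> C" "\<And>(J :: 'i set) xs ks c. finite J \<Longrightarrow> (\<And>j. j \<in> J \<Longrightarrow> 0 \<le> c j) \<Longrightarrow>
    N (fam J xs (\<lambda>j. ks j + int m) c) \<le> ennreal C * N (fam J xs ks c)"
proof -
  define \<gamma> where "\<gamma> = \<theta> / s + 1"
  have "\<theta> / s < \<gamma>" by (simp add: \<gamma>_def)
  from dilated_family_bound[OF this, where 'i='i] obtain C where C: "0 \<le> C"
    "\<And>(J :: 'i set) xs ks c n. finite J \<Longrightarrow> (\<And>j. j \<in> J \<Longrightarrow> 0 \<le> c j) \<Longrightarrow>
    N (\<lambda>z. (\<Sum>j\<in>J. c j powr \<theta> * (\<Sum>i<n. b powr - (real i * \<gamma>) * indicator (Bl (xs j) (ks j + int i)) z)) powr (1 / \<theta>))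
    \<le> ennreal C * N (fam J xs ks c)" by blast
  define K where "K = b powr (real m * \<gamma>)"
  show ?thesis
  proof (rule that[of "K powr (1 / \<theta>) * C"])
    show "0 \<le> K powr (1 / \<theta>) * C" using C by simp
    fix J :: "'i set" and xs ks and c :: "'i \<Rightarrow> real" assume J: "finite J" and c: "\<And>j. j \<in> J \<Longrightarrow> 0 \<le> c j"
    let ?G = "\<lambda>z. \<Sum>j\<in>J. c j powr \<theta> * (\<Sum>i<Suc m. b powr - (real i * \<gamma>) * indicator (Bl (xs j) (ks j + int i)) z)"
    have CJ: "N (\<lambda>z. ?G z powr (1 / \<theta>)) \<le> ennreal C * N (fam J xs ks c)"
      by (rule C(2)[OF J]) (rule c)
    have pt: "(\<Sum>j\<in>J. c j powr \<theta> * indicator (Bl (xs j) (ks j + int m)) z) \<le> K * ?G z" for z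
      unfolding sum_distrib_left[of K]
    proof (rule sum_mono)
      fix j
      have "b powr - (real m * \<gamma>) * indicator (Bl (xs j) (ks j + int m)) z
          \<le> (\<Sum>i<Suc m. b powr - (real i * \<gamma>) * indicator (Bl (xs j) (ks j + int i)) z)"
        by (rule member_le_sum) auto
      then have "K * (b powr - (real m * \<gamma>) * indicator (Bl (xs j) (ks j + int m)) z)
          \<le> K * (\<Sum>i<Suc m. b powr - (real i * \<gamma>) * indicator (Bl (xs j) (ks j + int i)) z)"
        by (rule mult_left_mono) (simp add: K_def)
      moreover have "K * (b powr - (real m * \<gamma>) * v) = v" for v
        by (simp add: K_def powr_add[symmetric] mult.assoc[symmetric])
      ultimately have "indicator (Bl (xs j) (ks j + int m)) z \<le> K * (\<Sum>i<Suc m. b powr - (real i * \<gamma>) * indicator (Bl (xs j) (ks j + int i)) z)"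
        by metis
      then have "c j powr \<theta> * indicator (Bl (xs j) (ks j + int m)) z \<le> c j powr \<theta> * (K * (\<Sum>i<Suc m. b powr - (real i * \<gamma>) * indicator (Bl (xs j) (ks j + int i)) z))"
        by (rule mult_left_mono) simp
      then show "c j powr \<theta> * indicator (Bl (xs j) (ks j + int m)) z \<le> K * (c j powr \<theta> * (\<Sum>i<Suc m. b powr - (real i * \<gamma>) * indicator (Bl (xs j) (ks j + int i)) z))"
        by (simp only: mult.left_commute)
    qed
    have "N (fam J xs (\<lambda>j. ks j + int m) c) \<le> N (\<lambda>z. K powr (1 / \<theta>) * ?G z powr (1 / \<theta>))"
    proof (rule N_mono)
      show "AE z in lebesgue. \<bar>fam J xs (\<lambda>j. ks j + int m) c z\<bar> \<le> \<bar>K powr (1 / \<theta>) * ?G z powr (1 / \<theta>)\<bar>"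
      proof (rule AE_I2)
        fix z
        have "0 \<le> ?G z" by (intro sum_nonneg mult_nonneg_nonneg) auto
        moreover have "fam J xs (\<lambda>j. ks j + int m) c z \<le> (K * ?G z) powr (1 / \<theta>)"
          unfolding fam_def using \<theta>_pos by (intro powr_mono2 pt sum_nonneg) auto
        ultimately show "\<bar>fam J xs (\<lambda>j. ks j + int m) c z\<bar> \<le> \<bar>K powr (1 / \<theta>) * ?G z powr (1 / \<theta>)\<bar>"
          by (simp only: powr_mult K_def abs_of_nonneg[OF fam_nonneg])
      qed
    qed measurable
    also have "\<dots> = ennreal \<bar>K powr (1 / \<theta>)\<bar> * N (\<lambda>z. ?G z powr (1 / \<theta>))" by (rule N_scale) measurable
    also have "\<dots> \<le> ennreal (K powr (1 / \<theta>)) * (ennreal C * N (fam J xs ks c))"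
      using CJ by (intro mult_mono) auto
    also have "\<dots> = ennreal (K powr (1 / \<theta>) * C) * N (fam J xs ks c)"
      using C(1) by (simp add: ennreal_mult mult.assoc)
    finally show "N (fam J xs (\<lambda>j. ks j + int m) c) \<le> ennreal (K powr (1 / \<theta>) * C) * N (fam J xs ks c)" .
  qed
qed

text \<open>The balls together with their first \<open>n\<close> enlargements form one finite family
  for the Campanato norm. Its denominator is the dilated family bounded by the Fefferman-Stein
  inequality, uniformly in \<open>n\<close> and in the number of balls, so both truncations can be
  removed.\<close>

lemma star_norm_le_camp_norm:
  fixes d :: nat
  assumes R: "\<And>z. eigen A z \<Longrightarrow> cmod z < R" and \<beta>: "1 / s < 1 + \<beta>" "0 < \<beta>" and Rb: "R ^ d < b powr \<beta>"
  obtains C where "0 \<le> C" "\<And>f. locint f \<Longrightarrow> star_norm A D N d \<theta> \<beta> f \<le> ennreal C * camp_norm A D N 1 d \<theta> f"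
proof -
  obtain C1 where C1: "0 \<le> C1" "\<And>x k f. locint f \<Longrightarrow>
    kernel_int d \<beta> x k f \<le> ennreal C1 * (\<Sum>i. ennreal (b powr - (real i * \<beta>)) * osc d x (k + int i) f)"
    using kernel_int_le_osc[OF R \<beta>(2) Rb] by blast
  \<comment> \<open>The decay exponent 1 + \<beta> after taking \<theta>-th powers. The hypothesis 1
    / s < 1 + \<beta> says exactly that it exceeds \<theta> / s.\<close>
  define \<gamma> where "\<gamma> = (1 + \<beta>) * \<theta>"
  have "\<theta> / s < \<gamma>" using \<beta>(1) \<theta>_pos unfolding \<gamma>_def by (metis mult.commute mult_less_cancel_left_pos times_divide_eq_right mult.right_neutral)
  from dilated_family_bound[OF this, where 'i=nat] obtain C2 where C2: "0 \<le> C2"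
    "\<And>(J :: nat set) xs ks c n. finite J \<Longrightarrow> (\<And>j. j \<in> J \<Longrightarrow> 0 \<le> c j) \<Longrightarrow>
    N (\<lambda>z. (\<Sum>j\<in>J. c j powr \<theta> * (\<Sum>i<n. b powr - (real i * \<gamma>) * indicator (Bl (xs j) (ks j + int i)) z)) powr (1 / \<theta>))
    \<le> ennreal C2 * N (fam J xs ks c)" by blast
  show ?thesis
  proof (rule that[of "C1 * C2"])
    show "0 \<le> C1 * C2" using C1 C2 by simp
    fix f assume f: "locint f"
    let ?\<Phi> = "camp_norm A D N 1 d \<theta> f"
    have fin: "(\<Sum>j<m. ennreal (c j * b powr ks j) * kernel_int d \<beta> (xs j) (ks j) f) \<le> ennreal (C1 * C2) * ?\<Phi> * N (fam {..<m} xs ks c)"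
      if c: "\<And>j. 0 \<le> c j" for m :: nat and xs ks and c :: "nat \<Rightarrow> real"
    proof -
      have n: "(\<Sum>j<m. ennreal (c j * b powr ks j) * (\<Sum>i<n. ennreal (b powr - (real i * \<beta>)) * osc d (xs j) (ks j + int i) f))
          \<le> ?\<Phi> * (ennreal C2 * N (fam {..<m} xs ks c))" for n
      proof -
        \<comment> \<open>The measure of the \<open>i\<close>-th enlargement contributes b^i, which
          is compensated in the coefficient: this is why the decay is 1 + \<beta> and not
          \<beta>.\<close>
        let ?J = "{..<m} \<times> {..<n}"
        let ?xs = "\<lambda>(j, i::nat). xs j" and ?ks = "\<lambda>(j, i). ks j + int i" and ?c = "\<lambda>(j, i). c j * b powr - (real i * (1 + \<beta>))"
        have "(\<Sum>j<m. ennreal (c j * b powr ks j) * (\<Sum>i<n. ennreal (b powr - (real i * \<beta>)) * osc d (xs j) (ks j + int i) f))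
            = (\<Sum>p\<in>?J. ennreal (?c p * b powr ?ks p) * oscq 1 d (?xs p) (?ks p) f)"
          unfolding sum_distrib_left sum.cartesian_product oscq_1[OF f]
        proof (intro sum.cong refl, clarify)
          fix j i
          have e: "c j * b powr ks j * b powr - (real i * \<beta>) = c j * b powr - (real i * (1 + \<beta>)) * b powr real_of_int (ks j + int i)"
            by (simp add: powr_add[symmetric] algebra_simps)
          have h: "ennreal (c j * b powr ks j * b powr - (real i * \<beta>)) = ennreal (c j * b powr ks j) * ennreal (b powr - (real i * \<beta>))"
            using c by (intro ennreal_mult) auto
          show "ennreal (c j * b powr ks j) * (ennreal (b powr - (real i * \<beta>)) * osc d (xs j) (ks j + int i) f)
            = ennreal (c j * b powr - (real i * (1 + \<beta>)) * b powr real_of_int (ks j + int i)) * osc d (xs j) (ks j + int i) f"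
            unfolding e[symmetric] h by (rule mult.assoc[symmetric])
        qed
        also have "\<dots> \<le> ?\<Phi> * N (fam ?J ?xs ?ks ?c)"
          by (rule camp_norm_ge) (use c in auto)
        also have "fam ?J ?xs ?ks ?c = (\<lambda>z. (\<Sum>j<m. c j powr \<theta> * (\<Sum>i<n. b powr - (real i * \<gamma>) * indicator (Bl (xs j) (ks j + int i)) z)) powr (1 / \<theta>))"
        proof -
          have "(c j * b powr - (real i * (1 + \<beta>))) powr \<theta> = c j powr \<theta> * b powr - (real i * \<gamma>)" for j i
            using c by (simp add: powr_mult powr_powr \<gamma>_def mult.assoc)
          then show ?thesis unfolding fam_def[abs_def]
            by (simp only: sum_distrib_left sum.cartesian_product case_prod_unfold mult.assoc)
        qed
        also have "?\<Phi> * N \<dots> \<le> ?\<Phi> * (ennreal C2 * N (fam {..<m} xs ks c))"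
          by (intro mult_left_mono C2(2)) (use c in auto)
        finally show ?thesis .
      qed
      have "(\<Sum>j<m. ennreal (c j * b powr ks j) * kernel_int d \<beta> (xs j) (ks j) f)
          \<le> (\<Sum>j<m. ennreal (c j * b powr ks j) * (ennreal C1 * (\<Sum>i. ennreal (b powr - (real i * \<beta>)) * osc d (xs j) (ks j + int i) f)))"
        by (intro sum_mono mult_left_mono C1 f) auto
      also have "\<dots> = ennreal C1 * (\<Sum>i. \<Sum>j<m. ennreal (c j * b powr ks j) * (ennreal (b powr - (real i * \<beta>)) * osc d (xs j) (ks j + int i) f))"
      proof -
        have "(\<Sum>i. \<Sum>j<m. ennreal (c j * b powr ks j) * (ennreal (b powr - (real i * \<beta>)) * osc d (xs j) (ks j + int i) f))
            = (\<Sum>j<m. \<Sum>i. ennreal (c j * b powr ks j) * (ennreal (b powr - (real i * \<beta>)) * osc d (xs j) (ks j + int i) f))"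
          by (rule suminf_sum) auto
        also have "\<dots> = (\<Sum>j<m. ennreal (c j * b powr ks j) * (\<Sum>i. ennreal (b powr - (real i * \<beta>)) * osc d (xs j) (ks j + int i) f))"
          by (intro sum.cong refl ennreal_suminf_cmult)
        finally show ?thesis by (simp only: sum_distrib_left mult.left_commute[of _ "ennreal C1"])
      qed
      also have "\<dots> \<le> ennreal C1 * (?\<Phi> * (ennreal C2 * N (fam {..<m} xs ks c)))"
      proof (intro mult_left_mono)
        show "(\<Sum>i. \<Sum>j<m. ennreal (c j * b powr ks j) * (ennreal (b powr - (real i * \<beta>)) * osc d (xs j) (ks j + int i) f))
            \<le> ?\<Phi> * (ennreal C2 * N (fam {..<m} xs ks c))"
          unfolding suminf_eq_SUP
        proof (rule SUP_least)
          fix n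
          show "(\<Sum>i<n. \<Sum>j<m. ennreal (c j * b powr ks j) * (ennreal (b powr - (real i * \<beta>)) * osc d (xs j) (ks j + int i) f))
            \<le> ?\<Phi> * (ennreal C2 * N (fam {..<m} xs ks c))"
            using n[of n] by (subst sum.swap) (simp only: sum_distrib_left)
        qed
      qed simp
      also have "\<dots> = ennreal (C1 * C2) * ?\<Phi> * N (fam {..<m} xs ks c)"
        using C1 C2 by (simp add: ennreal_mult mult_ac)
      finally show ?thesis .
    qed
    show "star_norm A D N d \<theta> \<beta> f \<le> ennreal (C1 * C2) * ?\<Phi>"
      unfolding star_norm_def
    proof (rule Sup_least, clarify)
      fix xs ks and lam :: "nat \<Rightarrow> real"
      assume l: "\<forall>j. 0 \<le> lam j" and den: "0 < star_denom A D N \<theta> xs ks lam" "star_denom A D N \<theta> xs ks lam < top"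
      define c where "c i = lam i / nX N (Bl (xs i) (ks i))" for i
      have c0: "0 \<le> c i" for i using l nX_pos by (simp add: c_def less_imp_le)
      have eq: "lam j * measure lebesgue (Bl (xs j) (ks j)) / nX N (Bl (xs j) (ks j)) = c j * b powr ks j" for j
        by (simp add: c_def measure_Bl)
      let ?S = "\<lambda>x. \<Sum>i. ennreal (c i powr \<theta> * indicator (Bl (xs i) (ks i)) x)"
      have dd: "star_denom A D N \<theta> xs ks lam = Xext N (\<lambda>x. epow (?S x) (1 / \<theta>))"
        unfolding star_denom_def c_def ..
      have ae: "AE x in lebesgue. epow (?S x) (1 / \<theta>) \<noteq> top"
        using den(2) unfolding dd Xext_def by (auto split: if_splits)
      then have dN: "star_denom A D N \<theta> xs ks lam = N (\<lambda>x. enn2real (epow (?S x) (1 / \<theta>)))"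
        unfolding dd by (simp add: Xext_def)
      \<comment> \<open>A finite part of the series has a smaller denominator, so the bounds for
        finite families extend to sequences.\<close>
      have Nle: "N (fam {..<m} xs ks c) \<le> star_denom A D N \<theta> xs ks lam" for m
        unfolding dN
      proof (rule N_mono)
        show "AE x in lebesgue. \<bar>fam {..<m} xs ks c x\<bar> \<le> \<bar>enn2real (epow (?S x) (1 / \<theta>))\<bar>"
          using ae
        proof (rule AE_mp, intro AE_I2 impI)
          fix x assume "epow (?S x) (1 / \<theta>) \<noteq> top"
          then have "?S x \<noteq> top" by (simp only: epow_eq_top_iff not_False_eq_True)
          then have lt: "?S x < top" by (rule less_top[THEN iffD1])
          define w where "w = enn2real (?S x)"
          have w: "0 \<le> w" "?S x = ennreal w"
            unfolding w_def by (rule enn2real_nonneg) (rule ennreal_enn2real[OF lt, symmetric])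
          have "ennreal (\<Sum>i<m. c i powr \<theta> * indicator (Bl (xs i) (ks i)) x) = (\<Sum>i<m. ennreal (c i powr \<theta> * indicator (Bl (xs i) (ks i)) x))"
            by (simp add: sum_ennreal)
          also have "\<dots> \<le> ?S x" by (rule sum_le_suminf) auto
          finally have "(\<Sum>i<m. c i powr \<theta> * indicator (Bl (xs i) (ks i)) x) \<le> w"
            unfolding w(2) using w(1) by (simp only: ennreal_le_iff)
          then have "fam {..<m} xs ks c x \<le> w powr (1 / \<theta>)"
            unfolding fam_def using \<theta>_pos by (intro powr_mono2 sum_nonneg) auto
          then show "\<bar>fam {..<m} xs ks c x\<bar> \<le> \<bar>enn2real (epow (?S x) (1 / \<theta>))\<bar>"
            unfolding w(2) epow_ennreal[OF w(1)] by (simp add: fam_nonneg)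
        qed
      qed measurable
      have "(\<Sum>j. ennreal (c j * b powr ks j) * kernel_int d \<beta> (xs j) (ks j) f) \<le> star_denom A D N \<theta> xs ks lam * (ennreal (C1 * C2) * ?\<Phi>)"
        unfolding suminf_eq_SUP
      proof (rule SUP_least)
        fix m
        show "(\<Sum>j<m. ennreal (c j * b powr ks j) * kernel_int d \<beta> (xs j) (ks j) f) \<le> star_denom A D N \<theta> xs ks lam * (ennreal (C1 * C2) * ?\<Phi>)"
          using order_trans[OF fin[OF c0] mult_left_mono[OF Nle]] by (simp add: mult.commute)
      qed
      with den(1) show "(\<Sum>j. ennreal (lam j * measure lebesgue (Bl (xs j) (ks j)) / nX N (Bl (xs j) (ks j))) *
           (\<integral>\<^sup>+ x. ennreal (b powr (\<beta> * real_of_int (ks j)) * \<bar>f x - proj d (xs j) (ks j) f x\<bar> /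
             (b powr (real_of_int (ks j) * (1 + \<beta>)) + rho A D (x - xs j) powr (1 + \<beta>))) \<partial>lebesgue))
          / star_denom A D N \<theta> xs ks lam \<le> ennreal (C1 * C2) * ?\<Phi>"
        unfolding eq kernel_int_def by (rule divide_le_posI_ennreal)
    qed
  qed
qed

end

section \<open>Minimal sublinear functionals\<close>

definition sublinear_on :: "('a \<Rightarrow> real) set \<Rightarrow> (('a \<Rightarrow> real) \<Rightarrow> real) \<Rightarrow> bool" where
  "sublinear_on V p \<longleftrightarrow> (\<forall>f\<in>V. \<forall>g\<in>V. p (\<lambda>x. f x + g x) \<le> p f + p g) \<and>
    (\<forall>c\<ge>0. \<forall>f\<in>V. p (\<lambda>x. c * f x) = c * p f)"

definition function_subspace :: "('a \<Rightarrow> real) set \<Rightarrow> bool" where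
  "function_subspace V \<longleftrightarrow> (\<forall>f\<in>V. \<forall>g\<in>V. (\<lambda>x. f x + g x) \<in> V) \<and> (\<forall>c. \<forall>f\<in>V. (\<lambda>x. c * f x) \<in> V)"

lemma function_subspace_add: "function_subspace V \<Longrightarrow> f \<in> V \<Longrightarrow> g \<in> V \<Longrightarrow> (\<lambda>x. f x + g x) \<in> V"
  by (simp add: function_subspace_def)

lemma function_subspace_scale: "function_subspace V \<Longrightarrow> f \<in> V \<Longrightarrow> (\<lambda>x. c * f x) \<in> V"
  by (simp add: function_subspace_def)

lemma function_subspace_uminus: "function_subspace V \<Longrightarrow> f \<in> V \<Longrightarrow> (\<lambda>x. - f x) \<in> V"
  using function_subspace_scale[of V f "-1"] by simp

lemma sublinear_on_add: "sublinear_on V p \<Longrightarrow> f \<in> V \<Longrightarrow> g \<in> V \<Longrightarrow> p (\<lambda>x. f x + g x) \<le> p f + p g"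
  by (simp add: sublinear_on_def)

lemma sublinear_on_0:
  assumes "function_subspace V" "sublinear_on V p" "f \<in> V" shows "p (\<lambda>x. 0) = 0"
proof -
  have "p (\<lambda>x. 0 * f x) = 0 * p f" using assms unfolding sublinear_on_def by blast
  then show ?thesis by simp
qed

lemma sublinear_on_uminus:
  assumes V: "function_subspace V" and p: "sublinear_on V p" and f: "f \<in> V"
  shows "- p (\<lambda>x. - f x) \<le> p f"
proof -
  have "p (\<lambda>x. f x + - f x) \<le> p f + p (\<lambda>x. - f x)"
    by (rule sublinear_on_add[OF p f function_subspace_uminus[OF V f]])
  then show ?thesis using sublinear_on_0[OF V p f] by simp
qed

text \<open>The largest sublinear functional below \<open>p\<close> whose value at \<open>- x\<close> is at most \<open>- p x\<close>.\<close>

definition sublinear_push :: "(('a \<Rightarrow> real) \<Rightarrow> real) \<Rightarrow> ('a \<Rightarrow> real) \<Rightarrow> ('a \<Rightarrow> real) \<Rightarrow> real" where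
  "sublinear_push p x f = (INF t\<in>{0..}. p (\<lambda>y. f y + t * x y) - t * p x)"

context
  fixes V :: "('a \<Rightarrow> real) set" and p x
  assumes V: "function_subspace V" and p: "sublinear_on V p" and x: "x \<in> V"
begin

lemma push_in_V: "f \<in> V \<Longrightarrow> (\<lambda>y. f y + t * x y) \<in> V"
  using V x by (simp add: function_subspace_def)

lemma push_lower:
  assumes f: "f \<in> V" and t: "0 \<le> t"
  shows "- p (\<lambda>y. - f y) \<le> p (\<lambda>y. f y + t * x y) - t * p x"
proof -
  have "p (\<lambda>y. (f y + t * x y) + - f y) \<le> p (\<lambda>y. f y + t * x y) + p (\<lambda>y. - f y)"
    by (rule sublinear_on_add[OF p push_in_V[OF f] function_subspace_uminus[OF V f]])
  moreover have "p (\<lambda>y. t * x y) = t * p x" using p x t unfolding sublinear_on_def by blast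
  ultimately show ?thesis by simp
qed

lemma push_bdd: "f \<in> V \<Longrightarrow> bdd_below ((\<lambda>t. p (\<lambda>y. f y + t * x y) - t * p x) ` {0..})"
  using push_lower by (intro bdd_belowI2[where m="- p (\<lambda>y. - f y)"]) auto

lemma push_le_at: "f \<in> V \<Longrightarrow> 0 \<le> t \<Longrightarrow> sublinear_push p x f \<le> p (\<lambda>y. f y + t * x y) - t * p x"
  unfolding sublinear_push_def by (rule cINF_lower[OF push_bdd]) auto

lemma push_greatest: "(\<And>t. 0 \<le> t \<Longrightarrow> z \<le> p (\<lambda>y. f y + t * x y) - t * p x) \<Longrightarrow> z \<le> sublinear_push p x f"
  unfolding sublinear_push_def by (rule cINF_greatest) auto

lemma push_le: "f \<in> V \<Longrightarrow> sublinear_push p x f \<le> p f"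
  using push_le_at[of f 0] by simp

lemma push_uminus: "sublinear_push p x (\<lambda>y. - x y) \<le> - p x"
  using push_le_at[OF function_subspace_uminus[OF V x], of 1] sublinear_on_0[OF V p x] by simp

lemma push_scale_le:
  assumes f: "f \<in> V" and c: "0 < c"
  shows "sublinear_push p x (\<lambda>y. c * f y) \<le> c * sublinear_push p x f"
proof -
  have "sublinear_push p x (\<lambda>y. c * f y) / c \<le> sublinear_push p x f"
  proof (rule push_greatest)
    fix t :: real assume t: "0 \<le> t"
    have "p (\<lambda>y. c * (f y + t * x y)) = c * p (\<lambda>y. f y + t * x y)"
      using p push_in_V[OF f] c unfolding sublinear_on_def by (meson less_imp_le)
    moreover have "sublinear_push p x (\<lambda>y. c * f y) \<le> p (\<lambda>y. c * f y + (c * t) * x y) - (c * t) * p x"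
      using f c t V by (intro push_le_at function_subspace_scale) auto
    ultimately have "sublinear_push p x (\<lambda>y. c * f y) \<le> c * (p (\<lambda>y. f y + t * x y) - t * p x)"
      by (simp add: algebra_simps)
    then show "sublinear_push p x (\<lambda>y. c * f y) / c \<le> p (\<lambda>y. f y + t * x y) - t * p x"
      using c by (simp add: pos_divide_le_eq mult.commute)
  qed
  then show ?thesis using c by (simp add: pos_divide_le_eq mult.commute)
qed

lemma push_sublinear: "sublinear_on V (sublinear_push p x)"
  unfolding sublinear_on_def
proof (intro conjI ballI allI impI)
  fix f g assume f: "f \<in> V" and g: "g \<in> V"
  have "sublinear_push p x (\<lambda>y. f y + g y) - (p (\<lambda>y. f y + t * x y) - t * p x) \<le> sublinear_push p x g" if t: "0 \<le> t" for t
  proof (rule push_greatest)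
    fix s :: real assume s: "0 \<le> s"
    have "sublinear_push p x (\<lambda>y. f y + g y) \<le> p (\<lambda>y. (f y + g y) + (t + s) * x y) - (t + s) * p x"
      using f g V t s by (intro push_le_at function_subspace_add) auto
    moreover have "p (\<lambda>y. (f y + t * x y) + (g y + s * x y)) \<le> p (\<lambda>y. f y + t * x y) + p (\<lambda>y. g y + s * x y)"
      by (rule sublinear_on_add[OF p push_in_V[OF f] push_in_V[OF g]])
    ultimately show "sublinear_push p x (\<lambda>y. f y + g y) - (p (\<lambda>y. f y + t * x y) - t * p x) \<le> p (\<lambda>y. g y + s * x y) - s * p x"
      by (simp add: algebra_simps)
  qed
  then have "sublinear_push p x (\<lambda>y. f y + g y) - sublinear_push p x g \<le> sublinear_push p x f"
    by (intro push_greatest) (simp add: algebra_simps)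
  then show "sublinear_push p x (\<lambda>y. f y + g y) \<le> sublinear_push p x f + sublinear_push p x g" by simp
next
  fix c :: real and f assume c: "0 \<le> c" and f: "f \<in> V"
  show "sublinear_push p x (\<lambda>y. c * f y) = c * sublinear_push p x f"
  proof (cases "c = 0")
    case True
    have "p (\<lambda>y. t * x y) = t * p x" if "0 \<le> t" for t using p x that unfolding sublinear_on_def by blast
    then have "sublinear_push p x (\<lambda>y. 0) = (INF t\<in>{0::real..}. 0)"
      unfolding sublinear_push_def by (intro INF_cong) auto
    then show ?thesis using True by simp
  next
    case False
    then have c: "0 < c" using c by simp
    have "sublinear_push p x (\<lambda>y. (1 / c) * (c * f y)) \<le> (1 / c) * sublinear_push p x (\<lambda>y. c * f y)"
      using f c V by (intro push_scale_le function_subspace_scale) auto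
    then have "c * sublinear_push p x f \<le> sublinear_push p x (\<lambda>y. c * f y)"
      using c by (simp add: field_simps)
    then show ?thesis using push_scale_le[OF f c] by simp
  qed
qed

end

text \<open>Pushing \<open>m\<close> at \<open>f\<close> gives a sublinear functional below
  \<open>m\<close>, so by minimality nothing changes; hence m (- f) = - m f. An odd sublinear
  functional is linear.\<close>

lemma minimal_sublinear_linear:
  assumes V: "function_subspace V" and m: "sublinear_on V m"
    and min: "\<And>q. sublinear_on V q \<Longrightarrow> (\<And>f. f \<in> V \<Longrightarrow> q f \<le> m f) \<Longrightarrow> (\<And>f. f \<in> V \<Longrightarrow> q f = m f)"
    and f: "f \<in> V" and g: "g \<in> V"
  shows "m (\<lambda>x. f x + g x) = m f + m g" "m (\<lambda>x. c * f x) = c * m f"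
proof -
  have neg: "m (\<lambda>x. - f x) = - m f" if f: "f \<in> V" for f
  proof -
    have "sublinear_push m f (\<lambda>x. - f x) = m (\<lambda>x. - f x)"
      using push_sublinear[OF V m f] push_le[OF V m f] function_subspace_uminus[OF V f] by (intro min)
    then show ?thesis using push_uminus[OF V m f] sublinear_on_uminus[OF V m f] by simp
  qed
  have add: "m (\<lambda>x. f x + g x) \<le> m f + m g" if "f \<in> V" "g \<in> V" for f g
    using m that unfolding sublinear_on_def by blast
  have fg: "(\<lambda>x. f x + g x) \<in> V" using V f g function_subspace_add by blast
  have "m (\<lambda>x. (f x + g x) + - g x) \<le> m (\<lambda>x. f x + g x) + m (\<lambda>x. - g x)"
    by (rule add[OF fg function_subspace_uminus[OF V g]])
  then show "m (\<lambda>x. f x + g x) = m f + m g" using add[OF f g] neg[OF g] by simp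
  show "m (\<lambda>x. c * f x) = c * m f"
  proof (cases "0 \<le> c")
    case True then show ?thesis using m f unfolding sublinear_on_def by blast
  next
    case False
    then have "m (\<lambda>x. (- c) * f x) = (- c) * m f" using m f unfolding sublinear_on_def by (metis linear neg_0_le_iff_le)
    moreover have "m (\<lambda>x. - (c * f x)) = - m (\<lambda>x. c * f x)" by (rule neg[OF function_subspace_scale[OF V f]])
    ultimately show ?thesis by simp
  qed
qed

text \<open>Zorn's lemma with the pointwise infimum of a chain as its bound. The infimum is finite,
  because q \<le> p forces q f \<ge> - p (- f).\<close>

lemma minimal_sublinear_exists:
  assumes V: "function_subspace V" and p: "sublinear_on V p"
  obtains m where "sublinear_on V m" "\<And>f. f \<in> V \<Longrightarrow> m f \<le> p f"
    "\<And>q f. sublinear_on V q \<Longrightarrow> (\<And>f. f \<in> V \<Longrightarrow> q f \<le> m f) \<Longrightarrow> f \<in> V \<Longrightarrow> q f = m f"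
proof -
  define S where "S = {q. sublinear_on V q \<and> (\<forall>f\<in>V. q f \<le> p f) \<and> (\<forall>f. f \<notin> V \<longrightarrow> q f = 0)}"
  define P where "P q q' \<longleftrightarrow> (\<forall>f. q' f \<le> q f)" for q q' :: "('a \<Rightarrow> real) \<Rightarrow> real"
  \<comment> \<open>Functionals are set to 0 off \<open>V\<close>, so that agreement on
    \<open>V\<close> is equality and the pointwise order is antisymmetric.\<close>
  define cut where "cut q = (\<lambda>f. if f \<in> V then q f else (0::real))" for q
  have cutS: "sublinear_on V (cut q)" if "sublinear_on V q" for q
    using that V unfolding sublinear_on_def cut_def function_subspace_def by simp
  have po: "partial_order_on S (relation_of P S)"
    by (rule partial_order_on_relation_ofI) (auto simp: P_def intro: order_trans intro!: order_antisym ext)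
  have "\<exists>m\<in>S. \<forall>a\<in>S. P m a \<longrightarrow> a = m"
  proof (rule predicate_Zorn[OF po])
    fix C assume C: "C \<in> Chains (relation_of P S)"
    then have CS: "C \<subseteq> S" and tot: "\<And>q q'. q \<in> C \<Longrightarrow> q' \<in> C \<Longrightarrow> P q q' \<or> P q' q"
      unfolding Chains_def relation_of_def by blast+
    show "\<exists>u\<in>S. \<forall>a\<in>C. P a u"
    proof (cases "C = {}")
      case True
      have "cut p \<in> S" using cutS[OF p] by (simp add: S_def cut_def)
      then show ?thesis using True by blast
    next
      case False
      define u where "u f = (if f \<in> V then INF q\<in>C. q f else 0)" for f
      have bdd: "bdd_below ((\<lambda>q. q f) ` C)" if f: "f \<in> V" for f
      proof (rule bdd_belowI2)
        fix q assume "q \<in> C"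
        then have q: "sublinear_on V q" "\<forall>f\<in>V. q f \<le> p f" using CS by (auto simp: S_def)
        have "- p (\<lambda>x. - f x) \<le> - q (\<lambda>x. - f x)" using q(2) function_subspace_uminus[OF V f] by simp
        also have "\<dots> \<le> q f" by (rule sublinear_on_uminus[OF V q(1) f])
        finally show "- p (\<lambda>x. - f x) \<le> q f" .
      qed
      have u_le: "u f \<le> q f" if "f \<in> V" "q \<in> C" for f q
        using that cINF_lower[OF bdd] by (simp add: u_def)
      have u_ge: "z \<le> u f" if "f \<in> V" "\<And>q. q \<in> C \<Longrightarrow> z \<le> q f" for z f
        using that cINF_greatest[OF False, of z "\<lambda>q. q f"] by (simp add: u_def)
      have sub: "sublinear_on V u"
        unfolding sublinear_on_def
      proof (intro conjI ballI allI impI)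
        fix f g assume f: "f \<in> V" and g: "g \<in> V"
        have fg: "(\<lambda>x. f x + g x) \<in> V" using V f g function_subspace_add by blast
        \<comment> \<open>Subadditivity of the infimum needs one functional for both arguments; in a
          chain the smaller of the two will do.\<close>
        have two: "u (\<lambda>x. f x + g x) \<le> q f + q' g" if q: "q \<in> C" "q' \<in> C" for q q'
        proof -
          have *: "u (\<lambda>x. f x + g x) \<le> q0 f + q0 g" if "q0 \<in> C" for q0
          proof -
            have "sublinear_on V q0" using that CS by (auto simp: S_def)
            then have "q0 (\<lambda>x. f x + g x) \<le> q0 f + q0 g" using f g unfolding sublinear_on_def by blast
            then show ?thesis using u_le[OF fg that] by linarith
          qed
          from tot[OF q] show ?thesis
          proof
            assume "P q q'" then have "q' f \<le> q f" by (simp add: P_def)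
            then show ?thesis using *[OF q(2)] by linarith
          next
            assume "P q' q" then have "q g \<le> q' g" by (simp add: P_def)
            then show ?thesis using *[OF q(1)] by linarith
          qed
        qed
        have "u (\<lambda>x. f x + g x) - q f \<le> u g" if "q \<in> C" for q
          using two[OF that] by (intro u_ge g) (simp add: algebra_simps)
        then have "u (\<lambda>x. f x + g x) - u g \<le> u f" by (intro u_ge f) (simp add: algebra_simps)
        then show "u (\<lambda>x. f x + g x) \<le> u f + u g" by simp
      next
        fix c :: real and f assume c: "0 \<le> c" and f: "f \<in> V"
        have cf: "(\<lambda>x. c * f x) \<in> V" using V f function_subspace_scale by blast
        have h: "q (\<lambda>x. c * f x) = c * q f" if "q \<in> C" for q
          using that CS c f unfolding S_def sublinear_on_def by blast
        show "u (\<lambda>x. c * f x) = c * u f"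
        proof (cases "c = 0")
          case True
          have "(INF q\<in>C. q (\<lambda>x. c * f x)) = (INF q\<in>C. 0)" using h True by (intro INF_cong) auto
          then show ?thesis using True False cf by (simp add: u_def)
        next
          case F: False
          then have c: "0 < c" using c by simp
          show ?thesis
          proof (rule antisym)
            have "u (\<lambda>x. c * f x) / c \<le> u f"
            proof (rule u_ge[OF f])
              fix q assume "q \<in> C"
              then show "u (\<lambda>x. c * f x) / c \<le> q f" using u_le[OF cf] h c by (simp add: pos_divide_le_eq mult.commute)
            qed
            then show "u (\<lambda>x. c * f x) \<le> c * u f" using c by (simp add: pos_divide_le_eq mult.commute)
            show "c * u f \<le> u (\<lambda>x. c * f x)"
            proof (rule u_ge[OF cf])
              fix q assume q: "q \<in> C"
              show "c * u f \<le> q (\<lambda>x. c * f x)"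
                unfolding h[OF q] using c by (intro mult_left_mono u_le f q) auto
            qed
          qed
        qed
      qed
      obtain q where q: "q \<in> C" using False by blast
      have "u \<in> S" unfolding S_def
      proof (intro CollectI conjI ballI allI impI)
        fix f assume f: "f \<in> V"
        have "q f \<le> p f" using q CS f by (auto simp: S_def)
        then show "u f \<le> p f" using u_le[OF f q] by linarith
      qed (use sub in \<open>auto simp: u_def\<close>)
      moreover have "\<forall>a\<in>C. P a u"
      proof (intro ballI, unfold P_def, intro allI)
        fix a f assume a: "a \<in> C"
        show "u f \<le> a f"
        proof (cases "f \<in> V")
          case True then show ?thesis using u_le a by blast
        next
          case False
          then have "a f = 0" using a CS by (auto simp: S_def)
          then show ?thesis using False by (simp add: u_def)
        qed
      qed
      ultimately show ?thesis by blast
    qed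
  qed
  then obtain m where m: "m \<in> S" and mm: "\<And>a. a \<in> S \<Longrightarrow> P m a \<Longrightarrow> a = m" by blast
  show ?thesis
  proof (rule that[of m])
    show "sublinear_on V m" "\<And>f. f \<in> V \<Longrightarrow> m f \<le> p f" using m by (auto simp: S_def)
    fix q f assume q: "sublinear_on V q" and le: "\<And>f. f \<in> V \<Longrightarrow> q f \<le> m f" and f: "f \<in> V"
    have mp: "\<And>f. f \<in> V \<Longrightarrow> m f \<le> p f" "\<And>f. f \<notin> V \<Longrightarrow> m f = 0" using m by (auto simp: S_def)
    have "cut q \<in> S" using cutS[OF q] le mp(1) by (force simp: S_def cut_def)
    moreover have "P m (cut q)" using le mp(2) by (simp add: P_def cut_def)
    ultimately have "cut q = m" by (rule mm)
    then show "q f = m f" using f by (metis cut_def)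
  qed
qed

text \<open>A minimal functional is taken below the push of \<open>p\<close> at \<open>F\<close>,
  rather than below \<open>p\<close>. Its value at - F is then at most - p F, which forces equality
  at \<open>F\<close>.\<close>

theorem hahn_banach_dominated:
  assumes V: "function_subspace V" and p: "sublinear_on V p" and F: "F \<in> V"
  obtains L where "\<And>f g. f \<in> V \<Longrightarrow> g \<in> V \<Longrightarrow> L (\<lambda>x. f x + g x) = L f + L g"
    "\<And>c f. f \<in> V \<Longrightarrow> L (\<lambda>x. c * f x) = c * L f" "\<And>f. f \<in> V \<Longrightarrow> L f \<le> p f" "L F = p F"
proof -
  obtain m where m: "sublinear_on V m" "\<And>f. f \<in> V \<Longrightarrow> m f \<le> sublinear_push p F f"
    "\<And>q f. sublinear_on V q \<Longrightarrow> (\<And>f. f \<in> V \<Longrightarrow> q f \<le> m f) \<Longrightarrow> f \<in> V \<Longrightarrow> q f = m f"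
    using minimal_sublinear_exists[OF V push_sublinear[OF V p F]] by blast
  have mp: "m f \<le> p f" if "f \<in> V" for f using m(2)[OF that] push_le[OF V p F that] by linarith
  have lin: "m (\<lambda>x. f x + g x) = m f + m g" if "f \<in> V" "g \<in> V" for f g
    by (rule minimal_sublinear_linear(1)[OF V m(1) _ that]) (rule m(3))
  have lin2: "m (\<lambda>x. c * f x) = c * m f" if "f \<in> V" for f c
    by (rule minimal_sublinear_linear(2)[OF V m(1) _ that that]) (rule m(3))
  have "m (\<lambda>x. - F x) \<le> - p F"
    using m(2)[OF function_subspace_uminus[OF V F]] push_uminus[OF V p F] by linarith
  moreover have "m (\<lambda>x. - F x) = - m F" using lin2[OF F, of "-1"] by simp
  ultimately have "m F = p F" using mp[OF F] by linarith
  then show ?thesis using lin lin2 mp by (intro that[of m]) auto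
qed

section \<open>Sigma-finiteness and Hoelder inequalities for finite sums\<close>

lemma sigma_finite_lebesgue: "sigma_finite_measure (lebesgue :: 'a::euclidean_space measure)"
proof
  let ?A = "range (\<lambda>n. cball (0::'a) (real n))"
  have U: "\<Union>?A = (UNIV :: 'a set)"
    using real_arch_simple by fastforce
  have fin: "emeasure lebesgue (cball (0::'a) (real n)) \<noteq> \<infinity>" for n
    unfolding infinity_ennreal_def by (intro fmeasurableD2 lmeasurable_compact compact_cball)
  show "\<exists>A. countable A \<and> A \<subseteq> sets lebesgue \<and> \<Union>A = space (lebesgue :: 'a measure) \<and> (\<forall>a\<in>A. emeasure lebesgue a \<noteq> (\<infinity>::ennreal))"
  proof (intro exI[of _ ?A] conjI)
    show "\<Union>?A = space lebesgue" unfolding U by simp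
    show "\<forall>a\<in>?A. emeasure lebesgue a \<noteq> \<infinity>" using fin by blast
  qed auto
qed

lemma holder_sum:
  fixes x y :: "'i \<Rightarrow> real"
  assumes J: "finite J" and x: "\<And>j. j \<in> J \<Longrightarrow> 0 \<le> x j" and y: "\<And>j. j \<in> J \<Longrightarrow> 0 \<le> y j"
    and \<alpha>: "0 < \<alpha>" and \<beta>: "0 < \<beta>" and \<alpha>\<beta>: "\<alpha> + \<beta> = 1"
  shows "(\<Sum>j\<in>J. x j powr \<alpha> * y j powr \<beta>) \<le> (\<Sum>j\<in>J. x j) powr \<alpha> * (\<Sum>j\<in>J. y j) powr \<beta>"
proof -
  define a where "a = (\<Sum>j\<in>J. x j)"
  define b where "b = (\<Sum>j\<in>J. y j)"
  have a0: "0 \<le> a" and b0: "0 \<le> b" using x y by (auto simp: a_def b_def sum_nonneg)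
  show ?thesis
  proof (cases "a = 0 \<or> b = 0")
    case True
    then have "x j powr \<alpha> * y j powr \<beta> = 0" if "j \<in> J" for j
      using that x y J by (auto simp: a_def b_def sum_nonneg_eq_0_iff)
    then have "(\<Sum>j\<in>J. x j powr \<alpha> * y j powr \<beta>) = 0" by (intro sum.neutral) blast
    then show ?thesis by simp
  next
    case False
    then have ab: "0 < a" "0 < b" using a0 b0 by auto
    have le: "x j powr \<alpha> * y j powr \<beta> \<le> a powr \<alpha> * b powr \<beta> * (\<alpha> * (x j / a) + \<beta> * (y j / b))" if j: "j \<in> J" for j
    proof (cases "x j = 0 \<or> y j = 0")
      case True
      then show ?thesis using x[OF j] y[OF j] ab \<alpha> \<beta> by auto
    next
      case False
      then have "0 < x j / a" "0 < y j / b" using x[OF j] y[OF j] ab by auto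
      then have "(x j / a) powr \<alpha> * (y j / b) powr \<beta> \<le> \<alpha> * (x j / a) + \<beta> * (y j / b)"
        using \<alpha> \<beta> \<alpha>\<beta> by (intro Youngs_inequality_0) auto
      then have "a powr \<alpha> * b powr \<beta> * ((x j / a) powr \<alpha> * (y j / b) powr \<beta>) \<le> a powr \<alpha> * b powr \<beta> * (\<alpha> * (x j / a) + \<beta> * (y j / b))"
        by (intro mult_left_mono) auto
      moreover have "a powr \<alpha> * b powr \<beta> * ((x j / a) powr \<alpha> * (y j / b) powr \<beta>) = x j powr \<alpha> * y j powr \<beta>"
        using ab x[OF j] y[OF j] by (simp add: powr_divide)
      ultimately show ?thesis by simp
    qed
    have "(\<Sum>j\<in>J. x j powr \<alpha> * y j powr \<beta>) \<le> (\<Sum>j\<in>J. a powr \<alpha> * b powr \<beta> * (\<alpha> * (x j / a) + \<beta> * (y j / b)))"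
      by (rule sum_mono[OF le])
    also have "\<dots> = a powr \<alpha> * b powr \<beta> * (\<alpha> * (a / a) + \<beta> * (b / b))"
      by (simp add: sum_distrib_left[symmetric] sum.distrib sum_divide_distrib[symmetric] a_def b_def)
    also have "\<dots> = a powr \<alpha> * b powr \<beta>" using ab \<alpha>\<beta> by simp
    finally show ?thesis by (simp add: a_def b_def)
  qed
qed

lemma holder_sum3:
  fixes x y z :: "'i \<Rightarrow> real"
  assumes J: "finite J" and x: "\<And>j. j \<in> J \<Longrightarrow> 0 \<le> x j" and y: "\<And>j. j \<in> J \<Longrightarrow> 0 \<le> y j" and z: "\<And>j. j \<in> J \<Longrightarrow> 0 \<le> z j"
    and abc: "0 < \<alpha>" "0 < \<beta>" "0 < \<gamma>" "\<alpha> + \<beta> + \<gamma> = 1"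
  shows "(\<Sum>j\<in>J. x j powr \<alpha> * y j powr \<beta> * z j powr \<gamma>)
    \<le> (\<Sum>j\<in>J. x j) powr \<alpha> * (\<Sum>j\<in>J. y j) powr \<beta> * (\<Sum>j\<in>J. z j) powr \<gamma>"
proof -
  \<comment> \<open>The last two factors are grouped under the exponent \<delta>; the two-term
    inequality is then applied twice.\<close>
  define \<delta> where "\<delta> = \<beta> + \<gamma>"
  have \<delta>: "0 < \<delta>" "\<alpha> + \<delta> = 1" "\<beta> / \<delta> + \<gamma> / \<delta> = 1" "0 < \<beta> / \<delta>" "0 < \<gamma> / \<delta>" using abc by (auto simp: \<delta>_def add_divide_distrib[symmetric])
  let ?w = "\<lambda>j. y j powr (\<beta> / \<delta>) * z j powr (\<gamma> / \<delta>)"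
  have "(\<Sum>j\<in>J. x j powr \<alpha> * y j powr \<beta> * z j powr \<gamma>) = (\<Sum>j\<in>J. x j powr \<alpha> * ?w j powr \<delta>)"
    using \<delta>(1) y z by (intro sum.cong refl) (simp add: powr_mult powr_powr)
  also have "\<dots> \<le> (\<Sum>j\<in>J. x j) powr \<alpha> * (\<Sum>j\<in>J. ?w j) powr \<delta>"
    using J x \<delta> abc by (intro holder_sum) auto
  also have "\<dots> \<le> (\<Sum>j\<in>J. x j) powr \<alpha> * ((\<Sum>j\<in>J. y j) powr (\<beta> / \<delta>) * (\<Sum>j\<in>J. z j) powr (\<gamma> / \<delta>)) powr \<delta>"
    using J y z \<delta> by (intro mult_left_mono powr_mono2 holder_sum) (auto intro: sum_nonneg)
  also have "\<dots> = (\<Sum>j\<in>J. x j) powr \<alpha> * (\<Sum>j\<in>J. y j) powr \<beta> * (\<Sum>j\<in>J. z j) powr \<gamma>"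
    using \<delta>(1) y z by (simp add: powr_mult powr_powr sum_nonneg)
  finally show ?thesis .
qed

section \<open>Norming functions and packings\<close>

locale dual_space = fs_space A D r N \<theta> pm s for A :: "real^'n^'n" and D r N \<theta> pm s +
  fixes p0 :: real
  assumes ac: "abs_cont_norm N" and \<theta>1: "\<theta> < 1" and p0: "\<theta> < p0" and AA: "assumption_A A D N \<theta> p0"
begin

text \<open>The space X^(1/\<theta>), in which Assumption (A) provides a genuine norm. On the sum
  inside \<open>fam\<close> it equals the \<theta>-th power of the quasi-norm of the family.\<close>

definition Y :: "(real^'n \<Rightarrow> real) \<Rightarrow> ennreal" where
  "Y = Xpow N (1 / \<theta>)"

lemma Y_eq: "Y g = epow (N (\<lambda>x. \<bar>g x\<bar> powr (1 / \<theta>))) \<theta>"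
  using \<theta>_pos by (simp add: Y_def Xpow_def Xpow_ext_def Xext_def)

lemma Y_Bfs: "ball_Bfs A D Y"
  using AA by (simp add: assumption_A_def Y_def)

lemma Y_scale: "f \<in> borel_measurable lebesgue \<Longrightarrow> Y (\<lambda>x. c * f x) = ennreal \<bar>c\<bar> * Y f"
  using Y_Bfs unfolding ball_Bfs_def ball_qBfs_def by blast

lemma Y_triangle: "f \<in> borel_measurable lebesgue \<Longrightarrow> g \<in> borel_measurable lebesgue \<Longrightarrow> Y (\<lambda>x. f x + g x) \<le> Y f + Y g"
  using Y_Bfs unfolding ball_Bfs_def by blast

lemma Y_mono: "f \<in> borel_measurable lebesgue \<Longrightarrow> g \<in> borel_measurable lebesgue \<Longrightarrow>
    AE x in lebesgue. \<bar>g x\<bar> \<le> \<bar>f x\<bar> \<Longrightarrow> Y g \<le> Y f"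
  using Y_Bfs unfolding ball_Bfs_def ball_qBfs_def by blast

lemma Y_ball_finite: "Y (indicator (Bl x k)) < top"
  using Y_Bfs unfolding ball_Bfs_def ball_qBfs_def by blast

lemma Y_0: "Y (\<lambda>x. 0) = 0"
  using Y_scale[of "\<lambda>x. 0" 0] by simp

lemma Y_indicator: "Y (indicator E) = epow (N (indicator E)) \<theta>"
proof -
  have "(\<lambda>x. \<bar>indicator E x\<bar> powr (1 / \<theta>)) = indicator E" using \<theta>_pos by (auto simp: indicator_def fun_eq_iff)
  then show ?thesis by (simp add: Y_eq)
qed

lemma Y_abs_cont:
  assumes E: "\<And>j. E j \<in> sets lebesgue" and dec: "decseq E" and emp: "(\<Inter>j. E j) = {}"
  shows "(\<lambda>j. enn2real (Y (indicator (E j \<inter> Bl x k)))) \<longlonglongrightarrow> 0"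
proof -
  have "(\<lambda>j. N (\<lambda>z. indicator (Bl x k) z * indicator (E j) z)) \<longlonglongrightarrow> 0"
    using ac E dec emp N_ball_finite[of x k] indicator_Bl_measurable[of x k] unfolding abs_cont_norm_def by blast
  moreover have "(\<lambda>z. indicator (Bl x k) z * indicator (E j) z) = (indicator (E j \<inter> Bl x k) :: _ \<Rightarrow> real)" for j
    by (auto simp: indicator_def fun_eq_iff)
  ultimately have "(\<lambda>j. N (indicator (E j \<inter> Bl x k))) \<longlonglongrightarrow> 0" by simp
  then have "(\<lambda>j. enn2real (N (indicator (E j \<inter> Bl x k)))) \<longlonglongrightarrow> enn2real 0"
    by (intro tendsto_enn2real) auto
  then have "(\<lambda>j. enn2real (N (indicator (E j \<inter> Bl x k))) powr \<theta>) \<longlonglongrightarrow> 0 powr \<theta>"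
    using \<theta>_pos by (intro tendsto_powr') auto
  moreover have "enn2real (Y (indicator (E j \<inter> Bl x k))) = enn2real (N (indicator (E j \<inter> Bl x k))) powr \<theta>" for j
    by (simp add: Y_indicator epow_def)
  ultimately show ?thesis by simp
qed

definition YV :: "(real^'n \<Rightarrow> real) set" where
  "YV = {g. g \<in> borel_measurable lebesgue \<and> Y g < top}"

text \<open>Taking the norm of the positive part makes every functional dominated by
  \<open>Yp\<close> positive, so that it can become a measure.\<close>

definition Yp :: "(real^'n \<Rightarrow> real) \<Rightarrow> real" where
  "Yp g = enn2real (Y (\<lambda>x. max 0 (g x)))"

lemma YV_subspace: "function_subspace YV"
  unfolding function_subspace_def YV_def
proof (intro conjI ballI allI CollectI)
  fix f g assume "f \<in> {g. g \<in> borel_measurable lebesgue \<and> Y g < top}" "g \<in> {g. g \<in> borel_measurable lebesgue \<and> Y g < top}"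
  then have m: "f \<in> borel_measurable lebesgue" "g \<in> borel_measurable lebesgue" "Y f < top" "Y g < top" by auto
  then show "(\<lambda>x. f x + g x) \<in> borel_measurable lebesgue" by measurable
  show "Y (\<lambda>x. f x + g x) < top" using Y_triangle[OF m(1,2)] m(3,4) by (meson ennreal_add_less_top le_less_trans)
next
  fix c f assume "f \<in> {g. g \<in> borel_measurable lebesgue \<and> Y g < top}"
  then have m: "f \<in> borel_measurable lebesgue" "Y f < top" by auto
  then show "(\<lambda>x. c * f x) \<in> borel_measurable lebesgue" by measurable
  show "Y (\<lambda>x. c * f x) < top" using Y_scale[OF m(1)] m(2) by (simp add: ennreal_mult_less_top)
qed

lemma Y_pos_part:
  assumes "g \<in> YV" shows "Y (\<lambda>x. max 0 (g x)) \<le> Y g" "Y (\<lambda>x. max 0 (g x)) < top"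
proof -
  have m: "g \<in> borel_measurable lebesgue" "Y g < top" using assms by (auto simp: YV_def)
  show "Y (\<lambda>x. max 0 (g x)) \<le> Y g"
    by (rule Y_mono) (use m in \<open>auto intro!: borel_measurable_max\<close>)
  then show "Y (\<lambda>x. max 0 (g x)) < top" using m by simp
qed

lemma Yp_sublinear: "sublinear_on YV Yp"
  unfolding sublinear_on_def
proof (intro conjI ballI allI impI)
  fix f g assume f: "f \<in> YV" and g: "g \<in> YV"
  have m[measurable]: "f \<in> borel_measurable lebesgue" "g \<in> borel_measurable lebesgue" using f g by (auto simp: YV_def)
  have "Y (\<lambda>x. max 0 (f x + g x)) \<le> Y (\<lambda>x. max 0 (f x) + max 0 (g x))"
  proof (rule Y_mono)
    show "AE x in lebesgue. \<bar>max 0 (f x + g x)\<bar> \<le> \<bar>max 0 (f x) + max 0 (g x)\<bar>" by auto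
  qed measurable
  also have "\<dots> \<le> Y (\<lambda>x. max 0 (f x)) + Y (\<lambda>x. max 0 (g x))" by (rule Y_triangle) measurable
  finally have "Yp (\<lambda>x. f x + g x) \<le> enn2real (Y (\<lambda>x. max 0 (f x)) + Y (\<lambda>x. max 0 (g x)))"
    unfolding Yp_def using Y_pos_part[OF f] Y_pos_part[OF g] by (intro enn2real_mono) auto
  also have "\<dots> = Yp f + Yp g" unfolding Yp_def using Y_pos_part[OF f] Y_pos_part[OF g] by (intro enn2real_plus) auto
  finally show "Yp (\<lambda>x. f x + g x) \<le> Yp f + Yp g" .
next
  fix c :: real and f assume c: "0 \<le> c" and f: "f \<in> YV"
  have m: "(\<lambda>x. max 0 (f x)) \<in> borel_measurable lebesgue" using f by (auto simp: YV_def)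
  have "(\<lambda>x. max 0 (c * f x)) = (\<lambda>x. c * max 0 (f x))" using c by (auto simp: fun_eq_iff max_def zero_le_mult_iff mult_le_0_iff)
  then show "Yp (\<lambda>x. c * f x) = c * Yp f" unfolding Yp_def using Y_scale[OF m, of c] c by (simp add: enn2real_mult)
qed

lemma simple_in_YV:
  assumes "finite I" "\<And>i. i \<in> I \<Longrightarrow> E i \<in> sets lebesgue"
  shows "(\<lambda>x. \<Sum>i\<in>I. w i * indicator (E i \<inter> Bl x0 k0) x) \<in> YV"
  using assms
proof (induction I rule: finite_induct)
  case empty then show ?case by (simp add: YV_def Y_0)
next
  case (insert i I)
  have "Y (indicator (E i \<inter> Bl x0 k0)) \<le> Y (indicator (Bl x0 k0))"
    by (rule Y_mono) (use insert in \<open>auto simp: indicator_def\<close>)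
  then have "indicator (E i \<inter> Bl x0 k0) \<in> YV"
    using Y_ball_finite[of x0 k0] insert by (auto simp: YV_def)
  then have "(\<lambda>x. w i * indicator (E i \<inter> Bl x0 k0) x + (\<Sum>i\<in>I. w i * indicator (E i \<inter> Bl x0 k0) x)) \<in> YV"
    by (intro function_subspace_add[OF YV_subspace] function_subspace_scale[OF YV_subspace] insert.IH) (use insert.prems in auto)
  then show ?case by (simp only: sum.insert[OF insert.hyps])
qed

text \<open>The norming functional given by Hahn-Banach is, by absolute continuity of the norm, a measure
  absolutely continuous with respect to Lebesgue measure; its density is the norming function.\<close>

lemma norming_function:
  assumes I: "finite I" and Q: "\<And>i. i \<in> I \<Longrightarrow> Q i \<in> sets lebesgue" "\<And>i. i \<in> I \<Longrightarrow> Q i \<subseteq> Bl x0 k0"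
    and v: "\<And>i. i \<in> I \<Longrightarrow> 0 \<le> v i"
  obtains h :: "real^'n \<Rightarrow> real" where "h \<in> borel_measurable lebesgue" "\<And>x. 0 \<le> h x"
    "\<And>g. g \<in> borel_measurable lebesgue \<Longrightarrow> (\<integral>\<^sup>+x. ennreal (h x) * ennreal \<bar>g x\<bar> \<partial>lebesgue) \<le> Y g"
    "(\<Sum>i\<in>I. ennreal (v i) * (\<integral>\<^sup>+x. ennreal (h x) * indicator (Q i) x \<partial>lebesgue)) = Y (\<lambda>x. \<Sum>i\<in>I. v i * indicator (Q i) x)"
proof -
  define F where "F = (\<lambda>x. \<Sum>i\<in>I. v i * indicator (Q i) x)"
  have QB: "Q i \<inter> Bl x0 k0 = Q i" if "i \<in> I" for i using Q(2)[OF that] by blast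
  have F: "F \<in> YV"
  proof -
    have "F = (\<lambda>x. \<Sum>i\<in>I. v i * indicator (Q i \<inter> Bl x0 k0) x)" unfolding F_def using QB by simp
    then show ?thesis using simple_in_YV[OF I Q(1)] by simp
  qed
  have F0: "0 \<le> F x" for x unfolding F_def using v by (intro sum_nonneg) auto
  obtain L where L: "\<And>f g. f \<in> YV \<Longrightarrow> g \<in> YV \<Longrightarrow> L (\<lambda>x. f x + g x) = L f + L g"
    "\<And>c f. f \<in> YV \<Longrightarrow> L (\<lambda>x. c * f x) = c * L f" "\<And>f. f \<in> YV \<Longrightarrow> L f \<le> Yp f" "L F = Yp F"
    using hahn_banach_dominated[OF YV_subspace Yp_sublinear F] by blast
  have Lneg: "L f \<le> 0" if f: "f \<in> YV" and le: "AE x in lebesgue. f x \<le> 0" for f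
  proof -
    have "Y (\<lambda>x. max 0 (f x)) \<le> Y (\<lambda>x. 0)"
      by (rule Y_mono) (use f le in \<open>auto simp: YV_def max_def\<close>)
    then have "Yp f = 0" by (simp add: Yp_def Y_0)
    then show ?thesis using L(3)[OF f] by simp
  qed
  have Lpos: "0 \<le> L f" if f: "f \<in> YV" and ge: "AE x in lebesgue. 0 \<le> f x" for f
  proof -
    have "L (\<lambda>x. (-1) * f x) \<le> 0"
      by (rule Lneg) (use f ge function_subspace_scale[OF YV_subspace, of f "-1"] in auto)
    then show ?thesis using L(2)[OF f, of "-1"] by simp
  qed
  have L_le_Y: "ennreal (L f) \<le> Y f" if f: "f \<in> YV" for f
  proof -
    have "ennreal (L f) \<le> ennreal (enn2real (Y (\<lambda>x. max 0 (f x))))"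
      using L(3)[OF f] by (intro ennreal_leI) (simp add: Yp_def)
    also have "\<dots> = Y (\<lambda>x. max 0 (f x))" using Y_pos_part(2)[OF f] by simp
    also have "\<dots> \<le> Y f" by (rule Y_pos_part(1)[OF f])
    finally show ?thesis .
  qed
  \<comment> \<open>Inside a fixed ball every indicator has finite norm, so \<open>L\<close> is
    defined for all Lebesgue sets.\<close>
  define ind where "ind E = (indicator (E \<inter> Bl x0 k0) :: real^'n \<Rightarrow> real)" for E
  have ind: "ind E \<in> YV" if "E \<in> sets lebesgue" for E
    using simple_in_YV[of "{()}" "\<lambda>_. E" "\<lambda>_. 1" x0 k0] that by (simp add: ind_def)
  have ind0: "0 \<le> L (ind E)" if "E \<in> sets lebesgue" for E
    using Lpos[OF ind[OF that]] by (simp add: ind_def)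
  define \<nu> where "\<nu> E = ennreal (L (ind E))" for E
  have add: "L (ind (E \<union> E')) = L (ind E) + L (ind E')"
    if "E \<in> sets lebesgue" "E' \<in> sets lebesgue" "E \<inter> E' = {}" for E E'
  proof -
    have "ind (E \<union> E') = (\<lambda>x. ind E x + ind E' x)" using that(3) by (auto simp: ind_def indicator_def fun_eq_iff)
    then show ?thesis using L(1)[OF ind[OF that(1)] ind[OF that(2)]] by simp
  qed
  have emp: "L (ind {}) = 0" using add[of "{}" "{}"] by simp
  have ind_empty: "ind {} = (\<lambda>x. 0)" by (auto simp: ind_def)
  interpret S: sigma_algebra UNIV "sets (lebesgue :: (real^'n) measure)"
    using sets.sigma_algebra_axioms[of "lebesgue :: (real^'n) measure"] by simp
  \<comment> \<open>For a finite additive set function, continuity at the empty set gives countable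
    additivity; that continuity is the absolute continuity of the norm.\<close>
  have ca: "countably_additive (sets lebesgue) \<nu>"
  proof (rule S.empty_continuous_imp_countably_additive)
    show "positive (sets lebesgue) \<nu>" by (simp add: positive_def \<nu>_def emp)
    show "Measure_Space.additive (sets lebesgue) \<nu>"
      unfolding Measure_Space.additive_def \<nu>_def using add ind0 by (simp add: ennreal_plus[symmetric] del: ennreal_plus)
    show "\<forall>E\<in>sets lebesgue. \<nu> E \<noteq> \<infinity>" by (simp add: \<nu>_def)
    fix E :: "nat \<Rightarrow> (real^'n) set"
    assume E: "range E \<subseteq> sets lebesgue" "decseq E" "(\<Inter>i. E i) = {}"
    then have Em: "E i \<in> sets lebesgue" for i by blast
    have "(\<lambda>i. L (ind (E i))) \<longlonglongrightarrow> 0"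
    proof (rule tendsto_sandwich[OF _ _ tendsto_const Y_abs_cont[OF Em E(2,3), of x0 k0]])
      show "\<forall>\<^sub>F i in sequentially. 0 \<le> L (ind (E i))" using ind0[OF Em] by simp
      show "\<forall>\<^sub>F i in sequentially. L (ind (E i)) \<le> enn2real (Y (indicator (E i \<inter> Bl x0 k0)))"
      proof (rule always_eventually, rule allI)
        fix i
        have "(\<lambda>x. max 0 (ind (E i) x)) = indicator (E i \<inter> Bl x0 k0)" by (auto simp: ind_def indicator_def fun_eq_iff)
        then show "L (ind (E i)) \<le> enn2real (Y (indicator (E i \<inter> Bl x0 k0)))"
          using L(3)[OF ind[OF Em, of i]] by (simp add: Yp_def)
      qed
    qed
    then show "(\<lambda>i. \<nu> (E i)) \<longlonglongrightarrow> 0" unfolding \<nu>_def by (metis ennreal_0 tendsto_ennrealI)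
  qed
  define M where "M = measure_of UNIV (sets (lebesgue :: (real^'n) measure)) \<nu>"
  have setsM: "sets M = sets lebesgue" unfolding M_def by (simp add: S.sets_measure_of_eq)
  have eM: "emeasure M E = \<nu> E" if "E \<in> sets lebesgue" for E
    unfolding M_def by (rule emeasure_measure_of_sigma[OF S.sigma_algebra_axioms _ ca that]) (simp add: positive_def \<nu>_def emp)
  have "absolutely_continuous lebesgue M"
    unfolding absolutely_continuous_def
  proof
    fix E :: "(real^'n) set" assume E: "E \<in> null_sets lebesgue"
    then have Em: "E \<in> sets lebesgue" by auto
    have "AE x in lebesgue. ind E x \<le> 0"
      by (rule AE_mp[OF AE_not_in[OF E]]) (auto simp: ind_def indicator_def)
    then have "L (ind E) = 0" using Lneg[OF ind[OF Em]] ind0[OF Em] by simp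
    then show "E \<in> null_sets M" using Em eM[OF Em] setsM by (auto simp: null_sets_def \<nu>_def)
  qed
  from sigma_finite_measure.Radon_Nikodym[OF sigma_finite_lebesgue this setsM]
  obtain h' where h': "h' \<in> borel_measurable lebesgue" "density lebesgue h' = M" by blast
  have h'E: "(\<integral>\<^sup>+x. h' x * indicator E x \<partial>lebesgue) = ennreal (L (ind E))" if "E \<in> sets lebesgue" for E
    using emeasure_density[OF h'(1) that] eM[OF that] h'(2) by (simp add: \<nu>_def)
  have "(\<integral>\<^sup>+x. h' x \<partial>lebesgue) \<noteq> \<infinity>" using h'E[of UNIV] by simp
  \<comment> \<open>The Radon-Nikodym density has values in [0,\<infinity>]; its total mass is a
    real number, so it is finite almost everywhere.\<close>
  then have fin: "AE x in lebesgue. h' x \<noteq> \<infinity>" by (rule nn_integral_PInf_AE[OF h'(1)])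
  define h where "h x = enn2real (h' x)" for x
  have hm[measurable]: "h \<in> borel_measurable lebesgue" unfolding h_def[abs_def] using h'(1) by measurable
  have h0: "0 \<le> h x" for x by (simp add: h_def)
  have hh': "AE x in lebesgue. ennreal (h x) = h' x" using fin by (rule AE_mp) (auto simp: h_def less_top)
  have hE: "(\<integral>\<^sup>+x. ennreal (h x) * indicator E x \<partial>lebesgue) = ennreal (L (ind E))" if "E \<in> sets lebesgue" for E
    unfolding h'E[OF that, symmetric] by (rule nn_integral_cong_AE) (use hh' in auto)
  have hs: "(\<integral>\<^sup>+x. ennreal (h x) * ennreal (\<Sum>i\<in>J. w i * indicator (E i) x) \<partial>lebesgue)
      = ennreal (L (\<lambda>x. \<Sum>i\<in>J. w i * indicator (E i \<inter> Bl x0 k0) x))"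
    if J: "finite J" and w: "\<And>i. i \<in> J \<Longrightarrow> 0 \<le> w i" and E: "\<And>i. i \<in> J \<Longrightarrow> E i \<in> sets lebesgue"
    for J :: "real set" and w E
  proof -
    have LL: "L (\<lambda>x. \<Sum>i\<in>J. w i * indicator (E i \<inter> Bl x0 k0) x) = (\<Sum>i\<in>J. w i * L (ind (E i)))"
      using J E
    proof (induction J rule: finite_induct)
      case empty then show ?case using emp ind_empty by simp
    next
      case (insert i J)
      have "(\<lambda>x. w i * ind (E i) x) \<in> YV" using insert by (intro function_subspace_scale[OF YV_subspace] ind) auto
      then have "L (\<lambda>x. w i * ind (E i) x + (\<Sum>i\<in>J. w i * indicator (E i \<inter> Bl x0 k0) x)) = w i * L (ind (E i)) + (\<Sum>i\<in>J. w i * L (ind (E i)))"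
        using insert L(1)[OF _ simple_in_YV[of J E w x0 k0]] L(2)[OF ind] by (simp del: sum_mult_indicator)
      then show ?case by (simp only: sum.insert[OF insert.hyps] ind_def)
    qed
    have "(\<integral>\<^sup>+x. ennreal (h x) * ennreal (\<Sum>i\<in>J. w i * indicator (E i) x) \<partial>lebesgue)
        = (\<integral>\<^sup>+x. (\<Sum>i\<in>J. ennreal (w i) * (ennreal (h x) * indicator (E i) x)) \<partial>lebesgue)"
    proof (intro nn_integral_cong)
      fix x
      have "ennreal (\<Sum>i\<in>J. w i * indicator (E i) x) = (\<Sum>i\<in>J. ennreal (w i) * indicator (E i) x)"
      proof -
        have "ennreal (\<Sum>i\<in>J. w i * indicator (E i) x) = (\<Sum>i\<in>J. ennreal (w i * indicator (E i) x))"
          by (rule sum_ennreal[symmetric]) (use w in simp)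
        also have "\<dots> = (\<Sum>i\<in>J. ennreal (w i) * indicator (E i) x)"
        proof (intro sum.cong refl)
          fix i show "ennreal (w i * indicator (E i) x) = ennreal (w i) * indicator (E i) x"
            by (cases "x \<in> E i") auto
        qed
        finally show ?thesis .
      qed
      then show "ennreal (h x) * ennreal (\<Sum>i\<in>J. w i * indicator (E i) x) = (\<Sum>i\<in>J. ennreal (w i) * (ennreal (h x) * indicator (E i) x))"
        by (simp add: sum_distrib_left mult.left_commute)
    qed
    also have "\<dots> = (\<Sum>i\<in>J. \<integral>\<^sup>+x. ennreal (w i) * (ennreal (h x) * indicator (E i) x) \<partial>lebesgue)"
    proof (rule nn_integral_sum)
      fix i assume "i \<in> J"
      then have [measurable]: "E i \<in> sets lebesgue" by (rule E)
      show "(\<lambda>x. ennreal (w i) * (ennreal (h x) * indicator (E i) x)) \<in> borel_measurable lebesgue" by measurable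
    qed
    also have "\<dots> = (\<Sum>i\<in>J. ennreal (w i) * ennreal (L (ind (E i))))"
    proof (intro sum.cong refl)
      fix i assume "i \<in> J"
      then have Ei[measurable]: "E i \<in> sets lebesgue" by (rule E)
      show "(\<integral>\<^sup>+x. ennreal (w i) * (ennreal (h x) * indicator (E i) x) \<partial>lebesgue) = ennreal (w i) * ennreal (L (ind (E i)))"
        unfolding hE[OF Ei, symmetric] by (rule nn_integral_cmult) measurable
    qed
    also have "\<dots> = ennreal (\<Sum>i\<in>J. w i * L (ind (E i)))"
      using w E ind0 by (subst sum_ennreal[symmetric]) (auto simp: ennreal_mult intro!: sum.cong)
    finally show ?thesis unfolding LL .
  qed
  show ?thesis
  proof (rule that[OF hm h0])
    fix g :: "real^'n \<Rightarrow> real" assume g: "g \<in> borel_measurable lebesgue"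
    then have "(\<lambda>x. \<bar>g x\<bar>) \<in> borel_measurable lebesgue \<and> (\<forall>x. 0 \<le> \<bar>g x\<bar>)" by auto
    then obtain u where u: "\<And>n x. 0 \<le> u n x \<and> u n x \<le> \<bar>g x\<bar>" "\<And>n x. u n x \<le> (u (Suc n) x :: real)"
      "\<And>n. u n \<in> borel_measurable lebesgue" "\<And>n. finite (range (u n))" "\<And>x. (\<lambda>n. u n x) \<longlonglongrightarrow> \<bar>g x\<bar>"
      unfolding borel_measurable_simple_function_limit_increasing by blast
    \<comment> \<open>For a simple function the integral against \<open>h\<close> is
      \<open>L\<close> of its restriction to the fixed ball. Monotone convergence then reaches every
      measurable \<open>g\<close>, whether or not \<open>Y g\<close> is finite.\<close>
    have le: "(\<integral>\<^sup>+x. ennreal (h x) * ennreal (u n x) \<partial>lebesgue) \<le> Y g" for n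
    proof -
      let ?E = "\<lambda>a. u n -` {a}"
      have E: "?E a \<in> sets lebesgue" for a using measurable_sets[OF u(3)[of n], of "{a}"] by simp
      have rep: "(\<Sum>a\<in>range (u n). a * indicator (?E a) x) = u n x" for x
      proof -
        have "(\<Sum>a\<in>range (u n). a * indicator (?E a) x) = (\<Sum>a\<in>range (u n). if a = u n x then a else 0)"
          by (intro sum.cong) (auto simp: indicator_def)
        then show ?thesis using u(4)[of n] by simp
      qed
      have rep2: "(\<Sum>a\<in>range (u n). a * indicator (?E a \<inter> Bl x0 k0) x) = u n x * indicator (Bl x0 k0) x" for x
      proof -
        have "(\<Sum>a\<in>range (u n). a * indicator (?E a \<inter> Bl x0 k0) x) = (\<Sum>a\<in>range (u n). a * indicator (?E a) x * indicator (Bl x0 k0) x)"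
          by (intro sum.cong refl) (simp only: indicator_inter_arith mult.assoc)
        then show ?thesis by (simp only: sum_distrib_right[symmetric] rep)
      qed
      have V: "(\<lambda>x. \<Sum>a\<in>range (u n). a * indicator (?E a \<inter> Bl x0 k0) x) \<in> YV"
        by (rule simple_in_YV) (use u(4) E in auto)
      have "(\<integral>\<^sup>+x. ennreal (h x) * ennreal (\<Sum>a\<in>range (u n). a * indicator (?E a) x) \<partial>lebesgue)
          = ennreal (L (\<lambda>x. \<Sum>a\<in>range (u n). a * indicator (?E a \<inter> Bl x0 k0) x))"
        by (rule hs) (use u E in auto)
      then have "(\<integral>\<^sup>+x. ennreal (h x) * ennreal (u n x) \<partial>lebesgue)
          = ennreal (L (\<lambda>x. \<Sum>a\<in>range (u n). a * indicator (?E a \<inter> Bl x0 k0) x))"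
        by (simp only: rep)
      also have "\<dots> \<le> Y (\<lambda>x. \<Sum>a\<in>range (u n). a * indicator (?E a \<inter> Bl x0 k0) x)" by (rule L_le_Y[OF V])
      also have "\<dots> \<le> Y g"
        unfolding rep2 using u g by (intro Y_mono) (auto simp: indicator_def)
      finally show ?thesis .
    qed
    have mono: "ennreal (h x) * ennreal (u n x) \<le> ennreal (h x) * ennreal (u (Suc n) x)" for n x
      using u by (intro mult_left_mono ennreal_leI) auto
    have lim: "(\<lambda>n. ennreal (h x) * ennreal (u n x)) \<longlonglongrightarrow> ennreal (h x) * ennreal \<bar>g x\<bar>" for x
      using u h0[of x] by (simp add: ennreal_mult[symmetric] tendsto_ennrealI tendsto_mult_left)
    have "(\<lambda>n. \<integral>\<^sup>+x. ennreal (h x) * ennreal (u n x) \<partial>lebesgue) \<longlonglongrightarrow> (\<integral>\<^sup>+x. ennreal (h x) * ennreal \<bar>g x\<bar> \<partial>lebesgue)"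
      by (rule nn_integral_LIMSEQ) (use mono u(3) lim in \<open>auto simp: incseq_Suc_iff le_fun_def\<close>)
    then show "(\<integral>\<^sup>+x. ennreal (h x) * ennreal \<bar>g x\<bar> \<partial>lebesgue) \<le> Y g"
      by (rule LIMSEQ_le_const2) (use le in auto)
  next
    have LF: "L F = (\<Sum>i\<in>I. v i * L (ind (Q i)))"
    proof -
      have "L (\<lambda>x. \<Sum>i\<in>J. v i * indicator (Q i \<inter> Bl x0 k0) x) = (\<Sum>i\<in>J. v i * L (ind (Q i)))" if "J \<subseteq> I" for J
        using finite_subset[OF that I] that
      proof (induction J rule: finite_induct)
        case empty then show ?case using emp ind_empty by simp
      next
        case (insert i J)
        have "(\<lambda>x. v i * ind (Q i) x) \<in> YV" using insert Q by (intro function_subspace_scale[OF YV_subspace] ind) auto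
        then have "L (\<lambda>x. v i * ind (Q i) x + (\<Sum>i\<in>J. v i * indicator (Q i \<inter> Bl x0 k0) x)) = v i * L (ind (Q i)) + (\<Sum>i\<in>J. v i * L (ind (Q i)))"
          using insert Q L(1)[OF _ simple_in_YV[of J Q v x0 k0]] L(2)[OF ind] by (simp add: subset_iff del: sum_mult_indicator)
        then show ?case by (simp only: sum.insert[OF insert.hyps] ind_def)
      qed
      from this[OF subset_refl] show ?thesis unfolding F_def using QB by simp
    qed
    have "(\<lambda>x. max 0 (F x)) = F" using F0 by (auto simp: fun_eq_iff max_def)
    then have "ennreal (L F) = Y F" using F unfolding L(4) Yp_def YV_def by simp
    moreover have "ennreal (L F) = (\<Sum>i\<in>I. ennreal (v i) * (\<integral>\<^sup>+x. ennreal (h x) * indicator (Q i) x \<partial>lebesgue))"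
      unfolding LF using v Q ind0 by (subst sum_ennreal[symmetric]) (auto simp: ennreal_mult hE intro!: sum.cong)
    ultimately show "(\<Sum>i\<in>I. ennreal (v i) * (\<integral>\<^sup>+x. ennreal (h x) * indicator (Q i) x \<partial>lebesgue)) = Y (\<lambda>x. \<Sum>i\<in>I. v i * indicator (Q i) x)"
      by (simp add: F_def)
  qed
qed

end

lemma epow_le_root:
  assumes "0 < p" "0 \<le> K" "y < top" "epow x p \<le> ennreal K * epow y p"
  shows "x \<le> ennreal (K powr (1 / p)) * y"
proof -
  obtain v where v: "0 \<le> v" "y = ennreal v" using assms(3) by (cases y) auto
  have le: "epow x p \<le> ennreal (K * v powr p)" using assms(2,4) v by (simp add: ennreal_mult)
  then have "x \<noteq> top" by (metis epow_eq_top_iff ennreal_neq_top top_unique)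
  then obtain l where l: "0 \<le> l" "x = ennreal l" by (cases x) auto
  have "l powr p \<le> K * v powr p" using le l v assms(2) by (simp add: ennreal_le_iff)
  then have "(l powr p) powr (1 / p) \<le> (K * v powr p) powr (1 / p)" using assms(1) by (intro powr_mono2) auto
  then have "l \<le> K powr (1 / p) * v" using assms(1,2) l v by (simp add: powr_powr powr_mult)
  then show ?thesis using l v by (simp add: ennreal_mult'[symmetric] ennreal_leI)
qed

context anisotropic begin

lemma finite_balls_in_ball:
  assumes "finite P" shows "\<exists>k0. \<forall>p\<in>P. Bl (Qx p) (Qk p) \<subseteq> Bl 0 k0"
  using assms
proof (induction P rule: finite_induct)
  case (insert p P)
  then obtain k0 where k0: "\<And>p. p \<in> P \<Longrightarrow> Bl (Qx p) (Qk p) \<subseteq> Bl 0 k0" by blast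
  obtain i where i: "Qx p \<in> Bl 0 (int i)" using Bl_absorbing by blast
  define k where "k = max (int i) (Qk p)"
  have "Qx p \<in> Bl 0 k" using i Bl_mono[of "int i" k 0] by (auto simp: k_def)
  then have "Bl (Qx p) (Qk p) \<subseteq> Bl 0 (k + int sig)"
    by (rule Bl_engulf[OF _ center_in_Bl]) (simp add: k_def)
  moreover have "Bl 0 (k + int sig) \<subseteq> Bl 0 (max k0 (k + int sig))" "Bl 0 k0 \<subseteq> Bl 0 (max k0 (k + int sig))"
    by (auto intro!: Bl_mono)
  ultimately show ?case using k0 by (intro exI[of _ "max k0 (k + int sig)"]) blast
qed simp

end

section \<open>The packing estimate\<close>

context dual_space begin

lemma Y_eq_fam:
  "Y (\<lambda>x. \<Sum>j\<in>J. c j powr \<theta> * indicator (Bl (xs j) (ks j)) x) = epow (N (fam J xs ks c)) \<theta>"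
proof -
  have "(\<lambda>x. \<bar>\<Sum>j\<in>J. c j powr \<theta> * indicator (Bl (xs j) (ks j)) x\<bar> powr (1 / \<theta>)) = fam J xs ks c"
  proof
    fix x
    have "0 \<le> (\<Sum>j\<in>J. c j powr \<theta> * indicator (Bl (xs j) (ks j)) x)" by (intro sum_nonneg mult_nonneg_nonneg) auto
    then show "\<bar>\<Sum>j\<in>J. c j powr \<theta> * indicator (Bl (xs j) (ks j)) x\<bar> powr (1 / \<theta>) = fam J xs ks c x"
      by (simp only: fam_def abs_of_nonneg)
  qed
  then show ?thesis unfolding Y_eq by simp
qed

definition \<rho>0 :: real where "\<rho>0 = conj_exp (p0 / \<theta>)"

lemma \<rho>0: "1 < \<rho>0" "1 / \<rho>0 = 1 - \<theta> / p0"
proof -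
  have eq: "\<rho>0 = p0 / (p0 - \<theta>)" using \<theta>_pos p0 by (simp add: \<rho>0_def conj_exp_def field_simps)
  show "1 < \<rho>0" unfolding eq using \<theta>_pos p0 by simp
  show "1 / \<rho>0 = 1 - \<theta> / p0" unfolding eq using \<theta>_pos p0 by (simp add: diff_divide_distrib)
qed

lemma maxf_pow_bounded:
  obtains C where "0 \<le> C" "\<And>f. f \<in> borel_measurable lebesgue \<Longrightarrow>
    assoc_norm Y (maxf_pow A D \<rho>0 f) \<le> ennreal C * assoc_norm Y (\<lambda>x. ennreal \<bar>f x\<bar>)"
proof -
  obtain C where C: "\<And>f. f \<in> borel_measurable lebesgue \<Longrightarrow>
    assoc_norm Y (maxf_pow A D \<rho>0 f) \<le> ennreal C * assoc_norm Y (\<lambda>x. ennreal \<bar>f x\<bar>)"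
    using AA unfolding assumption_A_def Y_def \<rho>0_def by blast
  have "ennreal C * z \<le> ennreal (max 0 C) * z" for z by (intro mult_right_mono ennreal_leI) auto
  then show ?thesis using C by (intro that[of "max 0 C"]) (auto intro: order_trans)
qed

text \<open>With a norming function \<open>h\<close>, the \<theta>-th power of the left side is a
  sum of integrals of \<open>h\<close> over the small balls. Hoelder with exponent
  \<open>\<rho>0\<close> on each of them, and then over the balls inside one large ball, leaves the
  mean of h^\<rho>0 over the enlarged large ball, which the maximal function bounds pointwise. The
  measures of the small balls carry the exponent \<theta> / p0 - \<theta> / t, positive by p0 < t;
  dividing it by \<theta> gives \<kappa>.\<close>

lemma packing_bound:
  fixes t :: real
  assumes t: "p0 < t"
  obtains C \<kappa> where "0 \<le> C" "0 < \<kappa>"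
    "\<And>(J :: 'i set) (I :: 'i \<Rightarrow> 'k set) xs ks c Qx Qk w \<eta>. finite J \<Longrightarrow> (\<And>j. j \<in> J \<Longrightarrow> finite (I j)) \<Longrightarrow>
      (\<And>j. j \<in> J \<Longrightarrow> 0 \<le> c j) \<Longrightarrow>
      (\<And>j i. j \<in> J \<Longrightarrow> i \<in> I j \<Longrightarrow> Bl (Qx j i) (Qk j i) \<subseteq> Bl (xs j) (ks j + int sig)) \<Longrightarrow>
      (\<And>j i. j \<in> J \<Longrightarrow> i \<in> I j \<Longrightarrow> 0 \<le> w j i) \<Longrightarrow>
      (\<And>j. j \<in> J \<Longrightarrow> disjoint_family_on (\<lambda>i. Bl (Qx j i) (Qk j i)) (I j)) \<Longrightarrow>
      (\<And>j. j \<in> J \<Longrightarrow> (\<Sum>i\<in>I j. b powr Qk j i) \<le> \<eta> * b powr ks j) \<Longrightarrow>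
      (\<And>j. j \<in> J \<Longrightarrow> (\<Sum>i\<in>I j. w j i powr t) \<le> 1) \<Longrightarrow> 0 < \<eta> \<Longrightarrow>
      N (fam (Sigma J I) (\<lambda>p. Qx (fst p) (snd p)) (\<lambda>p. Qk (fst p) (snd p))
        (\<lambda>p. c (fst p) * (b powr ks (fst p) / b powr Qk (fst p) (snd p)) powr (1 / t) * w (fst p) (snd p)))
      \<le> ennreal (C * \<eta> powr \<kappa>) * N (fam J xs ks c)"
proof -
  obtain CA where CA: "0 \<le> CA" "\<And>f. f \<in> borel_measurable lebesgue \<Longrightarrow>
    assoc_norm Y (maxf_pow A D \<rho>0 f) \<le> ennreal CA * assoc_norm Y (\<lambda>x. ennreal \<bar>f x\<bar>)"
    using maxf_pow_bounded by blast
  define a' where "a' = \<theta> / p0"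
  define a where "a = \<theta> / t"
  have t0: "0 < t" using t p0 \<theta>_pos by simp
  have a: "0 < a" "a < a'" "a' < 1" "0 < a'" using \<theta>_pos p0 t t0 by (auto simp: a_def a'_def field_simps)
  have r1: "1 / \<rho>0 = 1 - a'" using \<rho>0 by (simp add: a'_def)
  define \<kappa> where "\<kappa> = (a' - a) / \<theta>"
  define K where "K = CA * b powr sig"
  show ?thesis
  proof (rule that[of "K powr (1 / \<theta>)" \<kappa>])
    show "0 < \<kappa>" using a \<theta>_pos by (simp add: \<kappa>_def)
    show "0 \<le> K powr (1 / \<theta>)" by simp
    fix J :: "'i set" and I :: "'i \<Rightarrow> 'k set" and xs ks and c :: "'i \<Rightarrow> real" and Qx Qk and w :: "'i \<Rightarrow> 'k \<Rightarrow> real" and \<eta> :: real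
    assume J: "finite J" and I: "\<And>j. j \<in> J \<Longrightarrow> finite (I j)" and c: "\<And>j. j \<in> J \<Longrightarrow> 0 \<le> c j"
      and Q: "\<And>j i. j \<in> J \<Longrightarrow> i \<in> I j \<Longrightarrow> Bl (Qx j i) (Qk j i) \<subseteq> Bl (xs j) (ks j + int sig)"
      and w: "\<And>j i. j \<in> J \<Longrightarrow> i \<in> I j \<Longrightarrow> 0 \<le> w j i"
      and dis: "\<And>j. j \<in> J \<Longrightarrow> disjoint_family_on (\<lambda>i. Bl (Qx j i) (Qk j i)) (I j)"
      and meas: "\<And>j. j \<in> J \<Longrightarrow> (\<Sum>i\<in>I j. b powr Qk j i) \<le> \<eta> * b powr ks j"
      and wt: "\<And>j. j \<in> J \<Longrightarrow> (\<Sum>i\<in>I j. w j i powr t) \<le> 1" and \<eta>: "0 < \<eta>"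
    define cc where "cc j i = c j * (b powr ks j / b powr Qk j i) powr (1 / t) * w j i" for j i
    let ?P = "Sigma J I"
    let ?fQ = "fam ?P (\<lambda>p. Qx (fst p) (snd p)) (\<lambda>p. Qk (fst p) (snd p)) (\<lambda>p. cc (fst p) (snd p))"
    define G where "G = (\<lambda>x. \<Sum>j\<in>J. c j powr \<theta> * indicator (Bl (xs j) (ks j)) x)"
    have fP: "finite ?P" using J I by blast
    have YG: "Y G = epow (N (fam J xs ks c)) \<theta>" unfolding G_def by (rule Y_eq_fam)
    have "N ?fQ \<le> ennreal (K powr (1 / \<theta>) * \<eta> powr \<kappa>) * N (fam J xs ks c)"
    proof (cases "\<exists>j\<in>J. 0 < c j")
      case False
      then have c0: "c j = 0" if "j \<in> J" for j using c[OF that] that by force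
      have "?fQ = (\<lambda>x. 0)"
        unfolding fam_def[abs_def] by (intro ext) (subst sum.neutral, auto simp: cc_def c0)
      then show ?thesis by (simp add: N_0)
    next
      case True
      then have Npos: "0 < N (fam J xs ks c)" using N_fam_pos[OF J] by blast
      have Nfin: "N (fam J xs ks c) < top" by (rule N_fam_finite[OF J])
      obtain k0 where k0: "\<And>p. p \<in> ?P \<Longrightarrow> Bl (Qx (fst p) (snd p)) (Qk (fst p) (snd p)) \<subseteq> Bl 0 k0"
        using finite_balls_in_ball[OF fP, of "\<lambda>p. Qx (fst p) (snd p)" "\<lambda>p. Qk (fst p) (snd p)"] by blast
      obtain h :: "real^'n \<Rightarrow> real" where h: "h \<in> borel_measurable lebesgue" "\<And>x. 0 \<le> h x"
        "\<And>g. g \<in> borel_measurable lebesgue \<Longrightarrow> (\<integral>\<^sup>+x. ennreal (h x) * ennreal \<bar>g x\<bar> \<partial>lebesgue) \<le> Y g"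
        "(\<Sum>p\<in>?P. ennreal (cc (fst p) (snd p) powr \<theta>) * (\<integral>\<^sup>+x. ennreal (h x) * indicator (Bl (Qx (fst p) (snd p)) (Qk (fst p) (snd p))) x \<partial>lebesgue))
          = Y (\<lambda>x. \<Sum>p\<in>?P. cc (fst p) (snd p) powr \<theta> * indicator (Bl (Qx (fst p) (snd p)) (Qk (fst p) (snd p))) x)"
        by (rule norming_function[OF fP, of "\<lambda>p. Bl (Qx (fst p) (snd p)) (Qk (fst p) (snd p))" 0 k0 "\<lambda>p. cc (fst p) (snd p) powr \<theta>"])
          (use k0 in auto)
      note hm[measurable] = h(1)
      have YF: "epow (N ?fQ) \<theta> = (\<Sum>p\<in>?P. ennreal (cc (fst p) (snd p) powr \<theta>) * (\<integral>\<^sup>+x. ennreal (h x) * indicator (Bl (Qx (fst p) (snd p)) (Qk (fst p) (snd p))) x \<partial>lebesgue))"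
        unfolding h(4) by (rule Y_eq_fam[symmetric])
      define MA where "MA = maxf_pow A D \<rho>0 h"
      have "assoc_norm Y (\<lambda>x. ennreal \<bar>h x\<bar>) \<le> 1"
        unfolding assoc_norm_def
      proof (rule SUP_least)
        fix g assume "g \<in> {g. g \<in> borel_measurable lebesgue \<and> Y g = 1}"
        then show "(\<integral>\<^sup>+x. ennreal \<bar>h x\<bar> * ennreal \<bar>g x\<bar> \<partial>lebesgue) \<le> 1"
          using h(3)[of g] h(2) by simp
      qed
      then have "ennreal CA * assoc_norm Y (\<lambda>x. ennreal \<bar>h x\<bar>) \<le> ennreal CA * 1" by (intro mult_left_mono) auto
      then have MA: "assoc_norm Y MA \<le> ennreal CA" using CA(2)[OF h(1)] unfolding MA_def by simp
      have Gm[measurable]: "G \<in> borel_measurable lebesgue" unfolding G_def by measurable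
      have G0: "0 \<le> G x" for x unfolding G_def by (intro sum_nonneg mult_nonneg_nonneg) auto
      \<comment> \<open>The associate norm is a supremum over functions of norm exactly 1, so
        \<open>G\<close> is divided by its norm, which is positive and finite here.\<close>
      have pair: "(\<integral>\<^sup>+x. MA x * ennreal (G x) \<partial>lebesgue) \<le> ennreal CA * Y G"
      proof -
        obtain l where l: "0 < l" "N (fam J xs ks c) = ennreal l"
          using Npos Nfin by (cases "N (fam J xs ks c)") auto
        define y where "y = l powr \<theta>"
        have y: "0 < y" "Y G = ennreal y" using YG l by (auto simp: y_def)
        have MAm[measurable]: "MA \<in> borel_measurable lebesgue"
          unfolding MA_def maxf_pow_def[abs_def] by measurable
        have "Y (\<lambda>x. (1 / y) * G x) = 1" using Y_scale[OF Gm, of "1 / y"] y by (simp add: ennreal_mult'[symmetric])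
        then have "(\<integral>\<^sup>+x. MA x * ennreal \<bar>(1 / y) * G x\<bar> \<partial>lebesgue) \<le> assoc_norm Y MA"
          unfolding assoc_norm_def by (intro SUP_upper) auto
        then have le: "(\<integral>\<^sup>+x. MA x * ennreal \<bar>(1 / y) * G x\<bar> \<partial>lebesgue) \<le> ennreal CA" using MA by (rule order_trans)
        have "(\<integral>\<^sup>+x. MA x * ennreal (G x) \<partial>lebesgue) = (\<integral>\<^sup>+x. ennreal y * (MA x * ennreal \<bar>(1 / y) * G x\<bar>) \<partial>lebesgue)"
        proof (intro nn_integral_cong)
          fix x
          have "ennreal (G x) = ennreal y * ennreal \<bar>(1 / y) * G x\<bar>" using y G0[of x] by (simp add: ennreal_mult'[symmetric])
          then show "MA x * ennreal (G x) = ennreal y * (MA x * ennreal \<bar>(1 / y) * G x\<bar>)" by (simp only: mult.left_commute)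
        qed
        also have "\<dots> = ennreal y * (\<integral>\<^sup>+x. MA x * ennreal \<bar>(1 / y) * G x\<bar> \<partial>lebesgue)" by (intro nn_integral_cmult) measurable
        also have "\<dots> \<le> ennreal y * ennreal CA" by (intro mult_left_mono le) simp
        finally show ?thesis using y by (simp add: mult.commute)
      qed
      \<comment> \<open>The mean is over the enlarged ball, since the small balls may leave the
        original one; it remains a lower bound for the maximal function at every point of the
        original ball.\<close>
      define H where "H j = (\<integral>\<^sup>+z\<in>Bl (xs j) (ks j + int sig). ennreal (\<bar>h z\<bar> powr \<rho>0) \<partial>lebesgue)
          / emeasure lebesgue (Bl (xs j) (ks j + int sig))" for j
      have HM: "epow (H j) (1 / \<rho>0) \<le> MA x" if "x \<in> Bl (xs j) (ks j)" for j x
      proof -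
        have "x \<in> Bl (xs j) (ks j + int sig)" using that Bl_mono[of "ks j" "ks j + int sig" "xs j"] by auto
        from maxf_ge[OF this, of "\<lambda>z. \<bar>h z\<bar> powr \<rho>0"] have "H j \<le> maxf A D (\<lambda>z. \<bar>h z\<bar> powr \<rho>0) x" by (simp add: H_def)
        then show ?thesis unfolding MA_def maxf_pow_def using \<rho>0(1) by (intro epow_mono) auto
      qed
      define K0 where "K0 = b powr sig * \<eta> powr (a' - a)"
      have claim: "(\<Sum>i\<in>I j. ennreal (cc j i powr \<theta>) * (\<integral>\<^sup>+x. ennreal (h x) * indicator (Bl (Qx j i) (Qk j i)) x \<partial>lebesgue))
          \<le> ennreal (K0 * (c j powr \<theta> * b powr ks j)) * epow (H j) (1 / \<rho>0)" if j: "j \<in> J" for j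
      proof (cases "c j = 0")
        case True
        then show ?thesis by (simp add: cc_def)
      next
        case False
        then have cj: "0 < c j" using c[OF j] by simp
        show ?thesis
        \<comment> \<open>When \<open>H j\<close> is infinite so is the right-hand side, because
          \<open>c j\<close> and \<eta> are positive.\<close>
        proof (cases "H j = top")
          case True
          then show ?thesis using cj \<eta> by (simp add: K0_def ennreal_mult_top)
        next
          case False
          define Hr where "Hr = enn2real (H j)"
          have Hr: "0 \<le> Hr" "H j = ennreal Hr" using False by (auto simp: Hr_def less_top)
          define \<beta> where "\<beta> = b powr ks j"
          define m where "m i = b powr Qk j i" for i
          have \<beta>0: "0 < \<beta>" and m0: "0 < m i" for i by (simp_all add: \<beta>_def m_def)
          let ?Bs = "Bl (xs j) (ks j + int sig)"
          have IB: "(\<integral>\<^sup>+z\<in>?Bs. ennreal (\<bar>h z\<bar> powr \<rho>0) \<partial>lebesgue) = ennreal (b powr sig * \<beta> * Hr)"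
          proof -
            have "ennreal (b powr (ks j + int sig)) * H j = (\<integral>\<^sup>+z\<in>?Bs. ennreal (\<bar>h z\<bar> powr \<rho>0) \<partial>lebesgue)"
              unfolding H_def emeasure_Bl divide_ennreal_powr mult.assoc[symmetric]
              by (simp add: ennreal_mult'[symmetric] powr_add[symmetric])
            moreover have "b powr (ks j + int sig) = b powr sig * \<beta>" by (simp add: \<beta>_def powr_add mult.commute)
            ultimately show ?thesis using Hr \<beta>0 by (simp add: ennreal_mult)
          qed
          define S where "S i = enn2real (\<integral>\<^sup>+z\<in>Bl (Qx j i) (Qk j i). ennreal (\<bar>h z\<bar> powr \<rho>0) \<partial>lebesgue)" for i
          have Sfin: "(\<integral>\<^sup>+z\<in>Bl (Qx j i) (Qk j i). ennreal (\<bar>h z\<bar> powr \<rho>0) \<partial>lebesgue) = ennreal (S i)" if i: "i \<in> I j" for i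
          proof -
            have "(\<integral>\<^sup>+z\<in>Bl (Qx j i) (Qk j i). ennreal (\<bar>h z\<bar> powr \<rho>0) \<partial>lebesgue) \<le> (\<integral>\<^sup>+z\<in>?Bs. ennreal (\<bar>h z\<bar> powr \<rho>0) \<partial>lebesgue)"
              using Q[OF j i] by (intro nn_integral_mono mult_left_mono) (auto simp: indicator_def)
            then have "(\<integral>\<^sup>+z\<in>Bl (Qx j i) (Qk j i). ennreal (\<bar>h z\<bar> powr \<rho>0) \<partial>lebesgue) < top"
              unfolding IB using le_less_trans ennreal_less_top by blast
            then show ?thesis by (simp add: S_def)
          qed
          have S0: "0 \<le> S i" for i by (simp add: S_def)
          have Ssum: "(\<Sum>i\<in>I j. S i) \<le> b powr sig * \<beta> * Hr"
          proof -
            have "ennreal (\<Sum>i\<in>I j. S i) = (\<Sum>i\<in>I j. \<integral>\<^sup>+z\<in>Bl (Qx j i) (Qk j i). ennreal (\<bar>h z\<bar> powr \<rho>0) \<partial>lebesgue)"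
            proof -
              have "ennreal (\<Sum>i\<in>I j. S i) = (\<Sum>i\<in>I j. ennreal (S i))" by (rule sum_ennreal[symmetric]) (rule S0)
              also have "\<dots> = (\<Sum>i\<in>I j. \<integral>\<^sup>+z\<in>Bl (Qx j i) (Qk j i). ennreal (\<bar>h z\<bar> powr \<rho>0) \<partial>lebesgue)"
                by (intro sum.cong refl Sfin[symmetric])
              finally show ?thesis .
            qed
            also have "\<dots> = (\<integral>\<^sup>+z. (\<Sum>i\<in>I j. ennreal (\<bar>h z\<bar> powr \<rho>0) * indicator (Bl (Qx j i) (Qk j i)) z) \<partial>lebesgue)"
              by (rule nn_integral_sum[symmetric]) measurable
            also have "\<dots> \<le> (\<integral>\<^sup>+z\<in>?Bs. ennreal (\<bar>h z\<bar> powr \<rho>0) \<partial>lebesgue)"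
            proof (intro nn_integral_mono)
              fix z
              have "(\<Sum>i\<in>I j. indicator (Bl (Qx j i) (Qk j i)) z) = (indicator (\<Union>i\<in>I j. Bl (Qx j i) (Qk j i)) z :: ennreal)"
                by (rule indicator_UN_disjoint[OF I[OF j] dis[OF j], symmetric])
              also have "\<dots> \<le> indicator ?Bs z" using Q[OF j] by (auto simp: indicator_def)
              finally show "(\<Sum>i\<in>I j. ennreal (\<bar>h z\<bar> powr \<rho>0) * indicator (Bl (Qx j i) (Qk j i)) z) \<le> ennreal (\<bar>h z\<bar> powr \<rho>0) * indicator ?Bs z"
                unfolding sum_distrib_left[symmetric] by (intro mult_left_mono) auto
            qed
            finally show ?thesis unfolding IB using \<beta>0 Hr by (simp add: ennreal_le_iff)
          qed
          have summand: "ennreal (cc j i powr \<theta>) * (\<integral>\<^sup>+x. ennreal (h x) * indicator (Bl (Qx j i) (Qk j i)) x \<partial>lebesgue)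
              \<le> ennreal (c j powr \<theta> * \<beta> powr a * (m i powr (a' - a) * (w j i powr t) powr a * S i powr (1 - a')))" if i: "i \<in> I j" for i
          proof -
            have wi: "0 \<le> w j i" by (rule w[OF j i])
            have "(\<integral>\<^sup>+x. ennreal (h x) * indicator (Bl (Qx j i) (Qk j i)) x \<partial>lebesgue) = ennreal (m i) * av (Qx j i) (Qk j i) h"
              using nn_integral_Bl_av[OF hm, of "Qx j i" "Qk j i"] h(2) by (simp add: m_def)
            also have "\<dots> \<le> ennreal (m i) * epow ((\<integral>\<^sup>+ z\<in>Bl (Qx j i) (Qk j i). ennreal (\<bar>h z\<bar> powr \<rho>0) \<partial>lebesgue) / emeasure lebesgue (Bl (Qx j i) (Qk j i))) (1 / \<rho>0)"
              using \<rho>0(1) by (intro mult_left_mono av_le_powr_mean hm) auto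
            also have "\<dots> = ennreal (m i * (S i / m i) powr (1 - a'))"
            proof -
              have "(\<integral>\<^sup>+ z\<in>Bl (Qx j i) (Qk j i). ennreal (\<bar>h z\<bar> powr \<rho>0) \<partial>lebesgue) / emeasure lebesgue (Bl (Qx j i) (Qk j i)) = ennreal (S i / m i)"
                unfolding Sfin[OF i] emeasure_Bl m_def[symmetric] using S0 m0 by (simp add: divide_ennreal)
              then show ?thesis using S0[of i] m0[of i] r1 by (simp add: ennreal_mult)
            qed
            also have "m i * (S i / m i) powr (1 - a') = m i powr a' * S i powr (1 - a')"
              using S0[of i] m0[of i] by (simp add: powr_divide powr_diff field_simps)
            finally have I1: "(\<integral>\<^sup>+x. ennreal (h x) * indicator (Bl (Qx j i) (Qk j i)) x \<partial>lebesgue) \<le> ennreal (m i powr a' * S i powr (1 - a'))" .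
            have "cc j i powr \<theta> = c j powr \<theta> * (\<beta> / m i) powr a * (w j i powr t) powr a"
              using cj \<beta>0 m0[of i] wi t0 unfolding cc_def \<beta>_def[symmetric] m_def[symmetric]
              by (simp add: powr_mult powr_powr a_def)
            then have eq: "cc j i powr \<theta> * (m i powr a' * S i powr (1 - a')) = c j powr \<theta> * \<beta> powr a * (m i powr (a' - a) * (w j i powr t) powr a * S i powr (1 - a'))"
              using \<beta>0 m0[of i] by (simp add: powr_divide powr_diff)
            have "ennreal (cc j i powr \<theta>) * (\<integral>\<^sup>+x. ennreal (h x) * indicator (Bl (Qx j i) (Qk j i)) x \<partial>lebesgue)
                \<le> ennreal (cc j i powr \<theta>) * ennreal (m i powr a' * S i powr (1 - a'))" by (intro mult_left_mono I1) simp
            also have "\<dots> = ennreal (cc j i powr \<theta> * (m i powr a' * S i powr (1 - a')))" by (simp add: ennreal_mult)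
            finally show ?thesis unfolding eq .
          qed
          have "(\<Sum>i\<in>I j. ennreal (cc j i powr \<theta>) * (\<integral>\<^sup>+x. ennreal (h x) * indicator (Bl (Qx j i) (Qk j i)) x \<partial>lebesgue))
              \<le> (\<Sum>i\<in>I j. ennreal (c j powr \<theta> * \<beta> powr a * (m i powr (a' - a) * (w j i powr t) powr a * S i powr (1 - a'))))"
            by (rule sum_mono[OF summand])
          also have "\<dots> = ennreal (c j powr \<theta> * \<beta> powr a * (\<Sum>i\<in>I j. m i powr (a' - a) * (w j i powr t) powr a * S i powr (1 - a')))"
            unfolding sum_distrib_left by (rule sum_ennreal) simp
          also have "\<dots> \<le> ennreal (c j powr \<theta> * \<beta> powr a * ((\<eta> * \<beta>) powr (a' - a) * 1 powr a * (b powr sig * \<beta> * Hr) powr (1 - a')))"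
          proof (intro ennreal_leI mult_left_mono)
            \<comment> \<open>The exponents a' - a, a and 1 - a' add up to 1. The first factor
              bounds the total measure and yields the gain, the second is the normalised weight, the
              third is controlled by disjointness.\<close>
            have "(\<Sum>i\<in>I j. m i powr (a' - a) * (w j i powr t) powr a * S i powr (1 - a'))
                \<le> (\<Sum>i\<in>I j. m i) powr (a' - a) * (\<Sum>i\<in>I j. w j i powr t) powr a * (\<Sum>i\<in>I j. S i) powr (1 - a')"
              using I[OF j] m0 S0 a by (intro holder_sum3) (auto intro: less_imp_le)
            also have "\<dots> \<le> (\<eta> * \<beta>) powr (a' - a) * 1 powr a * (b powr sig * \<beta> * Hr) powr (1 - a')"
              using meas[OF j] wt[OF j] Ssum a m0 S0
              by (intro mult_mono powr_mono2 sum_nonneg mult_nonneg_nonneg) (auto simp: m_def \<beta>_def intro: less_imp_le)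
            finally show "(\<Sum>i\<in>I j. m i powr (a' - a) * (w j i powr t) powr a * S i powr (1 - a'))
              \<le> (\<eta> * \<beta>) powr (a' - a) * 1 powr a * (b powr sig * \<beta> * Hr) powr (1 - a')" .
          qed simp
          also have "\<dots> \<le> ennreal (K0 * (c j powr \<theta> * \<beta>) * Hr powr (1 - a'))"
          proof (rule ennreal_leI)
            have "c j powr \<theta> * \<beta> powr a * ((\<eta> * \<beta>) powr (a' - a) * 1 powr a * (b powr sig * \<beta> * Hr) powr (1 - a'))
                = c j powr \<theta> * \<eta> powr (a' - a) * (\<beta> powr a * \<beta> powr (a' - a) * \<beta> powr (1 - a')) * (b powr sig) powr (1 - a') * Hr powr (1 - a')"
              using \<eta> \<beta>0 Hr by (simp add: powr_mult)
            also have "\<beta> powr a * \<beta> powr (a' - a) * \<beta> powr (1 - a') = \<beta>" using \<beta>0 by (simp add: powr_add[symmetric])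
            also have "c j powr \<theta> * \<eta> powr (a' - a) * \<beta> * (b powr sig) powr (1 - a') * Hr powr (1 - a')
                \<le> c j powr \<theta> * \<eta> powr (a' - a) * \<beta> * b powr sig * Hr powr (1 - a')"
            proof (intro mult_right_mono mult_left_mono)
              have "(b powr sig) powr (1 - a') \<le> (b powr sig) powr 1"
                using b_gt_1 a by (intro powr_mono) (auto simp: ge_one_powr_ge_zero)
              then show "(b powr sig) powr (1 - a') \<le> b powr sig" by simp
            qed (use \<beta>0 in auto)
            finally show "c j powr \<theta> * \<beta> powr a * ((\<eta> * \<beta>) powr (a' - a) * 1 powr a * (b powr sig * \<beta> * Hr) powr (1 - a'))
              \<le> K0 * (c j powr \<theta> * \<beta>) * Hr powr (1 - a')" by (simp add: K0_def mult_ac)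
          qed
          also have "\<dots> = ennreal (K0 * (c j powr \<theta> * b powr ks j)) * epow (H j) (1 / \<rho>0)"
            using Hr r1 \<beta>0 by (simp add: ennreal_mult' \<beta>_def[symmetric] K0_def)
          finally show ?thesis .
        qed
      qed
      have "epow (N ?fQ) \<theta> = (\<Sum>j\<in>J. \<Sum>i\<in>I j. ennreal (cc j i powr \<theta>) * (\<integral>\<^sup>+x. ennreal (h x) * indicator (Bl (Qx j i) (Qk j i)) x \<partial>lebesgue))"
        unfolding YF by (subst sum.Sigma) (use J I in \<open>auto simp: case_prod_unfold\<close>)
      also have "\<dots> \<le> (\<Sum>j\<in>J. ennreal (K0 * (c j powr \<theta> * b powr ks j)) * epow (H j) (1 / \<rho>0))"
        by (rule sum_mono[OF claim])
      also have "\<dots> = ennreal K0 * (\<Sum>j\<in>J. ennreal (c j powr \<theta>) * epow (H j) (1 / \<rho>0) * emeasure lebesgue (Bl (xs j) (ks j)))"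
        by (simp add: sum_distrib_left ennreal_mult' emeasure_Bl K0_def mult_ac)
      also have "(\<Sum>j\<in>J. ennreal (c j powr \<theta>) * epow (H j) (1 / \<rho>0) * emeasure lebesgue (Bl (xs j) (ks j)))
          = (\<integral>\<^sup>+x. (\<Sum>j\<in>J. ennreal (c j powr \<theta>) * epow (H j) (1 / \<rho>0) * indicator (Bl (xs j) (ks j)) x) \<partial>lebesgue)"
        by (subst nn_integral_sum) (auto simp: nn_integral_cmult)
      also have "\<dots> \<le> (\<integral>\<^sup>+x. MA x * ennreal (G x) \<partial>lebesgue)"
      proof (intro nn_integral_mono)
        fix x
        have "(\<Sum>j\<in>J. ennreal (c j powr \<theta>) * epow (H j) (1 / \<rho>0) * indicator (Bl (xs j) (ks j)) x)
            \<le> (\<Sum>j\<in>J. MA x * ennreal (c j powr \<theta> * indicator (Bl (xs j) (ks j)) x))"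
        proof (rule sum_mono)
          fix j
          show "ennreal (c j powr \<theta>) * epow (H j) (1 / \<rho>0) * indicator (Bl (xs j) (ks j)) x \<le> MA x * ennreal (c j powr \<theta> * indicator (Bl (xs j) (ks j)) x)"
            using HM[of x j] by (cases "x \<in> Bl (xs j) (ks j)") (auto simp: mult.commute[of "MA x"] intro: mult_left_mono)
        qed
        also have "\<dots> = MA x * ennreal (G x)"
          unfolding sum_distrib_left[symmetric] G_def by (subst sum_ennreal) auto
        finally show "(\<Sum>j\<in>J. ennreal (c j powr \<theta>) * epow (H j) (1 / \<rho>0) * indicator (Bl (xs j) (ks j)) x) \<le> MA x * ennreal (G x)" .
      qed
      also have "\<dots> \<le> ennreal CA * Y G" by (rule pair)
      finally have "epow (N ?fQ) \<theta> \<le> ennreal K0 * (ennreal CA * epow (N (fam J xs ks c)) \<theta>)"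
        unfolding YG by (simp add: mult_left_mono)
      also have "\<dots> = ennreal (K0 * CA) * epow (N (fam J xs ks c)) \<theta>"
        using CA(1) by (simp add: ennreal_mult' mult.assoc K0_def)
      finally have "N ?fQ \<le> ennreal ((K0 * CA) powr (1 / \<theta>)) * N (fam J xs ks c)"
        using \<theta>_pos CA(1) Nfin by (intro epow_le_root) (auto simp: K0_def)
      also have "(K0 * CA) powr (1 / \<theta>) = K powr (1 / \<theta>) * \<eta> powr \<kappa>"
        using CA(1) by (simp add: K0_def K_def \<kappa>_def powr_mult powr_powr mult_ac)
      finally show ?thesis .
    qed
    then show "N (fam (Sigma J I) (\<lambda>p. Qx (fst p) (snd p)) (\<lambda>p. Qk (fst p) (snd p))
        (\<lambda>p. c (fst p) * (b powr ks (fst p) / b powr Qk (fst p) (snd p)) powr (1 / t) * w (fst p) (snd p)))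
      \<le> ennreal (K powr (1 / \<theta>) * \<eta> powr \<kappa>) * N (fam J xs ks c)" by (simp only: cc_def)
  qed
qed

end

section \<open>Covering lemmas and Lebesgue points\<close>

context anisotropic begin

text \<open>A maximal ball, enlarged, engulfs every ball that meets it.\<close>

lemma finite_vitali:
  assumes "finite P"
  shows "\<exists>G\<subseteq>P. (\<forall>p\<in>G. \<forall>p'\<in>G. p \<noteq> p' \<longrightarrow> Bl (fst p) (snd p) \<inter> Bl (fst p') (snd p') = {}) \<and>
    (\<Union>p\<in>P. Bl (fst p) (snd p)) \<subseteq> (\<Union>p\<in>G. Bl (fst p) (snd p + int sig))"
  using assms
proof (induction "card P" arbitrary: P rule: less_induct)
  case less
  show ?case
  proof (cases "P = {}")
    case True then show ?thesis by auto
  next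
    case False
    have "Max (snd ` P) \<in> snd ` P" using less.prems False by (intro Max_in) auto
    then obtain p0 where p0: "p0 \<in> P" "snd p0 = Max (snd ` P)" by auto
    have mx: "snd p \<le> snd p0" if "p \<in> P" for p using that less.prems by (simp add: p0)
    define P' where "P' = {p \<in> P. Bl (fst p) (snd p) \<inter> Bl (fst p0) (snd p0) = {}}"
    have "p0 \<notin> P'" using center_in_Bl by (auto simp: P'_def)
    moreover have "P' \<subseteq> P" by (auto simp: P'_def)
    ultimately have "P' \<subset> P" using p0(1) by blast
    then have "card P' < card P" "finite P'" using less.prems by (auto intro: psubset_card_mono finite_subset)
    from less.hyps[OF this] obtain G where G0: "G \<subseteq> P' \<and>
      (\<forall>p\<in>G. \<forall>p'\<in>G. p \<noteq> p' \<longrightarrow> Bl (fst p) (snd p) \<inter> Bl (fst p') (snd p') = {}) \<and>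
      (\<Union>p\<in>P'. Bl (fst p) (snd p)) \<subseteq> (\<Union>p\<in>G. Bl (fst p) (snd p + int sig))" by (elim exE)
    have G: "G \<subseteq> P'" "(\<Union>p\<in>P'. Bl (fst p) (snd p)) \<subseteq> (\<Union>p\<in>G. Bl (fst p) (snd p + int sig))"
      by (rule conjunct1[OF G0], rule conjunct2[OF conjunct2[OF G0]])
    have Gd: "Bl (fst p) (snd p) \<inter> Bl (fst p') (snd p') = {}" if "p \<in> G" "p' \<in> G" "p \<noteq> p'" for p p'
      using G0 that by (elim conjE ballE) auto
    have eng: "Bl (fst p) (snd p) \<subseteq> Bl (fst p0) (snd p0 + int sig)" if p: "p \<in> P" "p \<notin> P'" for p
    proof -
      obtain y where "y \<in> Bl (fst p) (snd p)" "y \<in> Bl (fst p0) (snd p0)" using p by (auto simp: P'_def)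
      then show ?thesis using Bl_engulf mx[OF p(1)] by blast
    qed
    show ?thesis
    proof (intro exI[of _ "insert p0 G"] conjI)
      show "insert p0 G \<subseteq> P" using p0 G(1) by (auto simp: P'_def)
      show "\<forall>p\<in>insert p0 G. \<forall>p'\<in>insert p0 G. p \<noteq> p' \<longrightarrow> Bl (fst p) (snd p) \<inter> Bl (fst p') (snd p') = {}"
      proof (intro ballI impI)
        fix p p' assume a: "p \<in> insert p0 G" "p' \<in> insert p0 G" "p \<noteq> p'"
        have d: "Bl (fst q) (snd q) \<inter> Bl (fst p0) (snd p0) = {}" if "q \<in> G" for q using that G(1) by (auto simp: P'_def)
        show "Bl (fst p) (snd p) \<inter> Bl (fst p') (snd p') = {}"
          using a d[of p] d[of p'] Gd[of p p'] by (metis Int_commute insertE)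
      qed
      show "(\<Union>p\<in>P. Bl (fst p) (snd p)) \<subseteq> (\<Union>p\<in>insert p0 G. Bl (fst p) (snd p + int sig))"
      proof
        fix z assume "z \<in> (\<Union>p\<in>P. Bl (fst p) (snd p))"
        then obtain p where p: "p \<in> P" "z \<in> Bl (fst p) (snd p)" by blast
        show "z \<in> (\<Union>p\<in>insert p0 G. Bl (fst p) (snd p + int sig))"
        proof (cases "p \<in> P'")
          case True
          then have "z \<in> (\<Union>p\<in>P'. Bl (fst p) (snd p))" using p(2) by (rule UN_I)
          then have "z \<in> (\<Union>p\<in>G. Bl (fst p) (snd p + int sig))" by (rule subsetD[OF G(2)])
          then show ?thesis by simp
        next
          case False
          then have "z \<in> Bl (fst p0) (snd p0 + int sig)" using eng[OF p(1)] p(2) by (rule_tac subsetD)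
          then show ?thesis by simp
        qed
      qed
    qed
  qed
qed

text \<open>Compactness reduces to finitely many balls. As the size is a function of the centre, the
  selection can be reported by centres alone.\<close>

lemma compact_vitali:
  assumes K: "compact K" "K \<subseteq> (\<Union>y\<in>S. Bl y (j y))"
  obtains G where "finite G" "G \<subseteq> S" "disjoint_family_on (\<lambda>y. Bl y (j y)) G" "K \<subseteq> (\<Union>y\<in>G. Bl y (j y + int sig))"
proof -
  obtain S' where S': "S' \<subseteq> S" "finite S'" "K \<subseteq> (\<Union>y\<in>S'. Bl y (j y))"
    using compactE_image[OF K(1), of S "\<lambda>y. Bl y (j y)"] open_Bl K(2) by auto
  let ?P = "(\<lambda>y. (y, j y)) ` S'"
  obtain G where G: "G \<subseteq> ?P" "\<And>p p'. p \<in> G \<Longrightarrow> p' \<in> G \<Longrightarrow> p \<noteq> p' \<Longrightarrow> Bl (fst p) (snd p) \<inter> Bl (fst p') (snd p') = {}"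
    "(\<Union>p\<in>?P. Bl (fst p) (snd p)) \<subseteq> (\<Union>p\<in>G. Bl (fst p) (snd p + int sig))"
  proof -
    have "finite ?P" using S'(2) by simp
    from finite_vitali[OF this] show ?thesis using that by (elim exE conjE) (metis (no_types, lifting))
  qed
  show ?thesis
  proof (rule that[of "fst ` G"])
    show "finite (fst ` G)" using finite_subset[OF G(1)] S'(2) by simp
    show "fst ` G \<subseteq> S" using G(1) S'(1) by auto
    show "disjoint_family_on (\<lambda>y. Bl y (j y)) (fst ` G)"
      unfolding disjoint_family_on_def
    proof (intro ballI impI)
      fix y y' assume "y \<in> fst ` G" "y' \<in> fst ` G" "y \<noteq> y'"
      moreover from this have "(y, j y) \<in> G" "(y', j y') \<in> G" using G(1) by auto
      ultimately show "Bl y (j y) \<inter> Bl y' (j y') = {}" using G(2)[of "(y, j y)" "(y', j y')"] by simp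
    qed
    show "K \<subseteq> (\<Union>y\<in>fst ` G. Bl y (j y + int sig))"
    proof
      fix z assume "z \<in> K"
      then have "z \<in> (\<Union>p\<in>?P. Bl (fst p) (snd p))" using S'(3) by auto
      then obtain p where p: "p \<in> G" "z \<in> Bl (fst p) (snd p + int sig)" using G(3) by blast
      then have "p = (fst p, j (fst p))" using G(1) by auto
      then have "snd p = j (fst p)" by (metis snd_conv)
      then show "z \<in> (\<Union>y\<in>fst ` G. Bl y (j y + int sig))" using p by (intro UN_I[of "fst p"]) auto
    qed
  qed
qed

lemma disjoint_balls_mass:
  assumes e: "e \<in> borel_measurable lebesgue" and G: "finite G" "disjoint_family_on (\<lambda>y. Bl y (j y)) G"
    and W: "\<And>y. y \<in> G \<Longrightarrow> Bl y (j y) \<subseteq> W" and t: "\<And>y. y \<in> G \<Longrightarrow> t \<le> av y (j y) e"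
  shows "t * (\<Sum>y\<in>G. ennreal (b powr j y)) \<le> (\<integral>\<^sup>+z\<in>W. ennreal \<bar>e z\<bar> \<partial>lebesgue)"
proof -
  note e[measurable]
  have "t * (\<Sum>y\<in>G. ennreal (b powr j y)) \<le> (\<Sum>y\<in>G. ennreal (b powr j y) * av y (j y) e)"
    unfolding sum_distrib_left by (rule sum_mono) (metis mult.commute mult_left_mono t zero_le)
  also have "\<dots> = (\<Sum>y\<in>G. \<integral>\<^sup>+z\<in>Bl y (j y). ennreal \<bar>e z\<bar> \<partial>lebesgue)"
    by (simp add: nn_integral_Bl_av[OF e])
  also have "\<dots> = (\<integral>\<^sup>+z. (\<Sum>y\<in>G. ennreal \<bar>e z\<bar> * indicator (Bl y (j y)) z) \<partial>lebesgue)"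
    by (rule nn_integral_sum[symmetric]) measurable
  also have "\<dots> \<le> (\<integral>\<^sup>+z\<in>W. ennreal \<bar>e z\<bar> \<partial>lebesgue)"
  proof (intro nn_integral_mono)
    fix z
    have "(\<Sum>y\<in>G. indicator (Bl y (j y)) z) = (indicator (\<Union>y\<in>G. Bl y (j y)) z :: ennreal)"
      by (rule indicator_UN_disjoint[OF G, symmetric])
    also have "\<dots> \<le> indicator W z" using W by (auto simp: indicator_def)
    finally show "(\<Sum>y\<in>G. ennreal \<bar>e z\<bar> * indicator (Bl y (j y)) z) \<le> ennreal \<bar>e z\<bar> * indicator W z"
      unfolding sum_distrib_left[symmetric] by (intro mult_left_mono) auto
  qed
  finally show ?thesis .
qed

lemma open_compact_exhaustion:
  assumes "open (U :: (real^'n) set)"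
  obtains K where "\<And>n::nat. compact (K n)" "incseq K" "(\<Union>n. K n) = U"
proof -
  obtain C where C: "\<And>n. compact (C n)" "\<And>n. C n \<subseteq> U" "\<And>n. C n \<subseteq> interior (C (Suc n))" "\<Union> (range C) = U"
    using open_Union_compact_subsets[OF assms] by metis
  have "C n \<subseteq> C (Suc n)" for n using C(3)[of n] interior_subset by blast
  then show ?thesis using C by (intro that[of C]) (auto simp: incseq_Suc_iff)
qed

lemma compact_sets_lebesgue: "compact K \<Longrightarrow> K \<in> sets (lebesgue :: (real^'n) measure)"
  by (simp add: compact_imp_closed)

lemma emeasure_UN_Bl_le:
  assumes "finite G"
  shows "emeasure lebesgue (\<Union>y\<in>G. Bl y (k y + int m)) \<le> ennreal (b powr m) * (\<Sum>y\<in>G. ennreal (b powr k y))"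
proof -
  have "emeasure lebesgue (\<Union>y\<in>G. Bl y (k y + int m)) \<le> (\<Sum>y\<in>G. emeasure lebesgue (Bl y (k y + int m)))"
    by (rule emeasure_subadditive_finite[OF assms]) auto
  also have "\<dots> = ennreal (b powr m) * (\<Sum>y\<in>G. ennreal (b powr k y))"
    by (simp add: emeasure_Bl sum_distrib_left ennreal_mult'[symmetric] powr_add mult.commute)
  finally show ?thesis .
qed

text \<open>The weak (1,1) estimate for averages over a chosen ball at each point. The covering
  lemma is for compact sets, so the open union is exhausted from inside; disjointness bounds the
  selected mass, and the enlargement costs b powr sig.\<close>

lemma weak_type:
  assumes e: "e \<in> borel_measurable lebesgue"
    and W: "\<And>y. y \<in> S \<Longrightarrow> Bl y (j y) \<subseteq> W" and t: "\<And>y. y \<in> S \<Longrightarrow> t \<le> av y (j y) e"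
  shows "t * emeasure lebesgue (\<Union>y\<in>S. Bl y (j y)) \<le> ennreal (b powr sig) * (\<integral>\<^sup>+z\<in>W. ennreal \<bar>e z\<bar> \<partial>lebesgue)"
proof -
  let ?U = "\<Union>y\<in>S. Bl y (j y)"
  have "open ?U" using open_Bl by blast
  then obtain K where K: "\<And>n::nat. compact (K n)" "incseq K" "(\<Union>n. K n) = ?U" by (rule open_compact_exhaustion) blast
  have le: "t * emeasure lebesgue (K n) \<le> ennreal (b powr sig) * (\<integral>\<^sup>+z\<in>W. ennreal \<bar>e z\<bar> \<partial>lebesgue)" for n
  proof -
    have "K n \<subseteq> ?U" using K(3) by blast
    then obtain G where G: "finite G" "G \<subseteq> S" "disjoint_family_on (\<lambda>y. Bl y (j y)) G" "K n \<subseteq> (\<Union>y\<in>G. Bl y (j y + int sig))"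
      by (rule compact_vitali[OF K(1)])
    have "emeasure lebesgue (K n) \<le> emeasure lebesgue (\<Union>y\<in>G. Bl y (j y + int sig))"
      using G by (intro emeasure_mono) auto
    also have "\<dots> \<le> ennreal (b powr sig) * (\<Sum>y\<in>G. ennreal (b powr j y))" by (rule emeasure_UN_Bl_le[OF G(1)])
    finally have "t * emeasure lebesgue (K n) \<le> ennreal (b powr sig) * (t * (\<Sum>y\<in>G. ennreal (b powr j y)))"
      by (metis mult.left_commute mult_left_mono zero_le)
    also have "\<dots> \<le> ennreal (b powr sig) * (\<integral>\<^sup>+z\<in>W. ennreal \<bar>e z\<bar> \<partial>lebesgue)"
      using G W t by (intro mult_left_mono disjoint_balls_mass e) auto
    finally show ?thesis .
  qed
  have "emeasure lebesgue ?U = (SUP n. emeasure lebesgue (K n))"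
    unfolding K(3)[symmetric] using K(1,2) compact_sets_lebesgue by (intro SUP_emeasure_incseq[symmetric]) auto
  then have "t * emeasure lebesgue ?U = (SUP n. t * emeasure lebesgue (K n))" by (simp add: SUP_mult_left_ennreal)
  also have "\<dots> \<le> ennreal (b powr sig) * (\<integral>\<^sup>+z\<in>W. ennreal \<bar>e z\<bar> \<partial>lebesgue)" by (intro SUP_least le)
  finally show ?thesis .
qed

section \<open>Continuous approximation and Lebesgue points\<close>

lemma Bl_small:
  assumes "0 < \<delta>" shows "\<exists>i::nat. Bl z (- int i) \<subseteq> ball z \<delta>"
proof -
  obtain R where R: "\<And>z. z \<in> D \<Longrightarrow> norm z \<le> R" using bounded_D bounded_iff by blast
  obtain i where i: "R / \<delta> < r ^ i" using real_arch_pow[OF r_gt_1] by blast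
  have "norm (y - z) < \<delta>" if "y \<in> Bl z (- int i)" for y
  proof -
    have "T (int i) (y - z) \<in> D" using that by (simp add: mem_Bl)
    then have "r ^ i *\<^sub>R (y - z) \<in> D" using T_contracts[of "T (int i) (y - z)" i] by simp
    then have "r ^ i * norm (y - z) \<le> R" using R r_gt_1 by fastforce
    also have "R < r ^ i * \<delta>" using i assms by (simp add: pos_divide_less_eq)
    finally show ?thesis using r_gt_1 by simp
  qed
  then have "Bl z (- int i) \<subseteq> ball z \<delta>" by (auto simp: dist_norm norm_minus_commute)
  then show ?thesis by blast
qed

text \<open>A measurable function is an almost everywhere limit of continuous ones; once these are
  clipped to the range of \<open>f\<close>, dominated convergence applies.\<close>

lemma bounded_continuous_approx:
  fixes f :: "real^'n \<Rightarrow> real"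
  assumes f: "f \<in> borel_measurable lebesgue" and fM: "\<And>x. 0 \<le> f x \<and> f x \<le> M"
    and W: "W \<in> sets lebesgue" "emeasure lebesgue W < top" and \<epsilon>: "0 < \<epsilon>"
  obtains g where "continuous_on UNIV g" "(\<integral>\<^sup>+z\<in>W. ennreal \<bar>f z - g z\<bar> \<partial>lebesgue) < \<epsilon>"
proof -
  have M0: "0 \<le> M" using fM[of 0] by linarith
  have "f measurable_on UNIV" using f by (intro lebesgue_measurable_imp_measurable_on) auto
  then obtain Z g where Z: "negligible Z" "\<And>n. continuous_on UNIV (g n)" "\<And>x. x \<notin> Z \<Longrightarrow> (\<lambda>n. g n x) \<longlonglongrightarrow> f x"
    unfolding measurable_on_def by auto
  \<comment> \<open>Clipping to [0, M] keeps continuity and the pointwise limit, and supplies the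
    dominating constant.\<close>
  define h where "h n x = max 0 (min M (g n x))" for n x
  have hc: "continuous_on UNIV (h n)" for n unfolding h_def[abs_def] by (intro continuous_intros Z)
  have hm[measurable]: "h n \<in> borel_measurable lebesgue" for n
    using borel_measurable_continuous_onI[OF hc] by (simp add: measurable_completion)
  note f[measurable] W(1)[measurable]
  have lim: "(\<lambda>n. h n x) \<longlonglongrightarrow> f x" if "x \<notin> Z" for x
  proof -
    have "(\<lambda>n. max 0 (min M (g n x))) \<longlonglongrightarrow> max 0 (min M (f x))" by (intro tendsto_intros Z that)
    then show ?thesis using fM[of x] by (simp add: h_def)
  qed
  have "(\<lambda>n. \<integral>\<^sup>+z\<in>W. ennreal \<bar>f z - h n z\<bar> \<partial>lebesgue) \<longlonglongrightarrow> (\<integral>\<^sup>+z. 0 \<partial>(lebesgue :: (real^'n) measure))"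
  proof (rule nn_integral_dominated_convergence[where w="\<lambda>z. ennreal M * indicator W z" and u="\<lambda>n z. ennreal \<bar>f z - h n z\<bar> * indicator W z"])
    show "(\<integral>\<^sup>+z. ennreal M * indicator W z \<partial>lebesgue) < \<infinity>"
      using W by (simp add: nn_integral_cmult ennreal_mult_less_top)
    show "AE z in lebesgue. ennreal \<bar>f z - h n z\<bar> * indicator W z \<le> ennreal M * indicator W z" for n
    proof (rule AE_I2)
      fix z
      have "\<bar>f z - h n z\<bar> \<le> M" using fM[of z] M0 by (auto simp: h_def max_def min_def)
      then show "ennreal \<bar>f z - h n z\<bar> * indicator W z \<le> ennreal M * indicator W z"
        by (intro mult_right_mono ennreal_leI) auto
    qed
    have "AE z in lebesgue. z \<notin> Z" using Z(1) by (intro AE_not_in) (simp add: negligible_iff_null_sets)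
    then show "AE z in lebesgue. (\<lambda>n. ennreal \<bar>f z - h n z\<bar> * indicator W z) \<longlonglongrightarrow> 0"
    proof (rule AE_mp, intro AE_I2 impI)
      fix z assume "z \<notin> Z"
      have "(\<lambda>n. \<bar>f z - h n z\<bar>) \<longlonglongrightarrow> \<bar>f z - f z\<bar>" by (intro tendsto_intros lim \<open>z \<notin> Z\<close>)
      then have "(\<lambda>n. ennreal \<bar>f z - h n z\<bar>) \<longlonglongrightarrow> ennreal 0" by (intro tendsto_ennrealI) simp
      then show "(\<lambda>n. ennreal \<bar>f z - h n z\<bar> * indicator W z) \<longlonglongrightarrow> 0"
        by (cases "z \<in> W") auto
    qed
  qed measurable
  then have "(\<lambda>n. \<integral>\<^sup>+z\<in>W. ennreal \<bar>f z - h n z\<bar> \<partial>lebesgue) \<longlonglongrightarrow> 0" by simp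
  then have "eventually (\<lambda>n. (\<integral>\<^sup>+z\<in>W. ennreal \<bar>f z - h n z\<bar> \<partial>lebesgue) < \<epsilon>) sequentially"
    using \<epsilon> by (rule order_tendstoD(2))
  then obtain n where "(\<integral>\<^sup>+z\<in>W. ennreal \<bar>f z - h n z\<bar> \<partial>lebesgue) < \<epsilon>"
    using eventually_happens'[OF sequentially_bot] by blast
  then show ?thesis using hc by (intro that[of "h n"])
qed

text \<open>Truncation at height \<open>n\<close> costs little in L^1 and reduces to the bounded
  case; each of the two errors gets \<epsilon> / 2.\<close>

lemma integrable_continuous_approx:
  fixes f :: "real^'n \<Rightarrow> real"
  assumes f: "f \<in> borel_measurable lebesgue" and f0: "\<And>x. 0 \<le> f x"
    and W: "W \<in> sets lebesgue" "emeasure lebesgue W < top" and fin: "(\<integral>\<^sup>+z\<in>W. ennreal (f z) \<partial>lebesgue) < top"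
    and \<epsilon>: "0 < (\<epsilon> :: real)"
  obtains g where "continuous_on UNIV g" "(\<integral>\<^sup>+z\<in>W. ennreal \<bar>f z - g z\<bar> \<partial>lebesgue) < ennreal \<epsilon>"
proof -
  note f[measurable] W(1)[measurable]
  have "(\<lambda>n. \<integral>\<^sup>+z\<in>W. ennreal (f z - min (f z) (real n)) \<partial>lebesgue) \<longlonglongrightarrow> (\<integral>\<^sup>+z. 0 \<partial>(lebesgue :: (real^'n) measure))"
  proof (rule nn_integral_dominated_convergence[where w="\<lambda>z. ennreal (f z) * indicator W z" and u="\<lambda>n z. ennreal (f z - min (f z) (real n)) * indicator W z"])
    show "AE z in lebesgue. ennreal (f z - min (f z) (real n)) * indicator W z \<le> ennreal (f z) * indicator W z" for n
      using f0 by (intro AE_I2 mult_right_mono ennreal_leI) (auto simp: min_def)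
    show "AE z in lebesgue. (\<lambda>n. ennreal (f z - min (f z) (real n)) * indicator W z) \<longlonglongrightarrow> 0"
    proof (rule AE_I2)
      fix z
      obtain n0 where n0: "f z \<le> real n0" using real_arch_simple by blast
      have "eventually (\<lambda>n. ennreal (f z - min (f z) (real n)) * indicator W z = 0) sequentially"
        using eventually_ge_at_top[of n0]
      proof (rule eventually_mono)
        fix n assume "n0 \<le> n"
        then have "f z \<le> real n" using n0 by linarith
        then show "ennreal (f z - min (f z) (real n)) * indicator W z = 0" by simp
      qed
      then show "(\<lambda>n. ennreal (f z - min (f z) (real n)) * indicator W z) \<longlonglongrightarrow> 0" by (rule tendsto_eventually)
    qed
    show "(\<integral>\<^sup>+z. ennreal (f z) * indicator W z \<partial>lebesgue) < \<infinity>" using fin by simp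
  qed measurable
  then have "(\<lambda>n. \<integral>\<^sup>+z\<in>W. ennreal (f z - min (f z) (real n)) \<partial>lebesgue) \<longlonglongrightarrow> 0" by simp
  moreover have e2: "0 < ennreal (\<epsilon> / 2)" using \<epsilon> by simp
  ultimately have "eventually (\<lambda>n. (\<integral>\<^sup>+z\<in>W. ennreal (f z - min (f z) (real n)) \<partial>lebesgue) < ennreal (\<epsilon> / 2)) sequentially"
    by (rule order_tendstoD(2))
  then obtain n where n: "(\<integral>\<^sup>+z\<in>W. ennreal (f z - min (f z) (real n)) \<partial>lebesgue) < ennreal (\<epsilon> / 2)"
    using eventually_happens'[OF sequentially_bot] by blast
  let ?m = "\<lambda>z. min (f z) (real n)"
  have mm[measurable]: "?m \<in> borel_measurable lebesgue" by measurable
  obtain g where g: "continuous_on UNIV g" "(\<integral>\<^sup>+z\<in>W. ennreal \<bar>?m z - g z\<bar> \<partial>lebesgue) < ennreal (\<epsilon> / 2)"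
    using bounded_continuous_approx[OF mm _ W e2, of "real n"] f0 by auto
  have gm[measurable]: "g \<in> borel_measurable lebesgue"
    using borel_measurable_continuous_onI[OF g(1)] by (simp add: measurable_completion)
  have "(\<integral>\<^sup>+z\<in>W. ennreal \<bar>f z - g z\<bar> \<partial>lebesgue) \<le> (\<integral>\<^sup>+z. ennreal (f z - ?m z) * indicator W z + ennreal \<bar>?m z - g z\<bar> * indicator W z \<partial>lebesgue)"
    by (intro nn_integral_mono) (auto simp: indicator_def ennreal_plus[symmetric] simp del: ennreal_plus intro!: ennreal_leI)
  also have "\<dots> = (\<integral>\<^sup>+z\<in>W. ennreal (f z - ?m z) \<partial>lebesgue) + (\<integral>\<^sup>+z\<in>W. ennreal \<bar>?m z - g z\<bar> \<partial>lebesgue)"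
    by (rule nn_integral_add) measurable
  also have "\<dots> < ennreal (\<epsilon> / 2) + ennreal (\<epsilon> / 2)" by (rule add_strict_mono[OF n g(2)])
  also have "\<dots> = ennreal \<epsilon>" using \<epsilon> by (simp add: ennreal_plus[symmetric] del: ennreal_plus)
  finally show ?thesis using g(1) by (intro that)
qed

text \<open>The one-sided differentiation theorem that the stopping argument uses. The bound
  \<open>a\<close> may depend on the point, so it is quantified inside the almost everywhere
  statement, and the exceptional set \<open>Bad t\<close> is formed over all \<open>a\<close> at
  once. That set is covered by sets of small measure, obtained from a continuous approximation of
  the absolute value and the weak-type estimate for the error.\<close>

lemma lebesgue_points_bound:
  assumes F: "locint F"
  shows "AE z in lebesgue. z \<in> Bl x k \<longrightarrow> (\<forall>a::real. (\<forall>j\<le>k. av z j F \<le> ennreal a) \<longrightarrow> 0 \<le> a \<longrightarrow> \<bar>F z\<bar> \<le> a)"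
proof -
  have Fm[measurable]: "F \<in> borel_measurable lebesgue" by (rule locint_measurable[OF F])
  let ?W = "Bl x (k + int sig)"
  have sub: "Bl z j \<subseteq> ?W" if "z \<in> Bl x k" "j \<le> k" for z j
    by (rule Bl_engulf[OF that(1) center_in_Bl that(2)])
  have Bsub: "Bl x k \<subseteq> ?W" by (rule Bl_mono) simp
  \<comment> \<open>Of the excess 3 t, one t is lost to the pointwise error, one to the averaged
    error, and the third yields the contradiction.\<close>
  define Bad where "Bad t = {z \<in> Bl x k. \<exists>a\<ge>0. (\<forall>j\<le>k. av z j F \<le> ennreal a) \<and> \<bar>F z\<bar> > a + 3 * t}" for t :: real
  have cov: "\<exists>V\<in>sets lebesgue. Bad t \<subseteq> V \<and> emeasure lebesgue V \<le> ennreal \<epsilon>" if t: "0 < t" and \<epsilon>: "0 < \<epsilon>" for t \<epsilon>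
  proof -
    \<comment> \<open>The summand 1 comes from Chebyshev's inequality for \<open>V1\<close>, and b
      powr sig from the weak-type estimate for \<open>V2\<close>.\<close>
    define C where "C = 1 + b powr sig"
    have C: "0 < C" by (simp add: C_def add_pos_pos)
    have Wfin: "emeasure lebesgue ?W < top" by (simp add: emeasure_Bl)
    have Ffin: "(\<integral>\<^sup>+z\<in>?W. ennreal \<bar>F z\<bar> \<partial>lebesgue) < top" using F by (simp add: locint_def)
    have \<epsilon>': "0 < \<epsilon> * t / C" using t \<epsilon> C by simp
    obtain g where g: "continuous_on UNIV g" "(\<integral>\<^sup>+z\<in>?W. ennreal \<bar>\<bar>F z\<bar> - g z\<bar> \<partial>lebesgue) < ennreal (\<epsilon> * t / C)"
      using integrable_continuous_approx[OF _ _ _ Wfin Ffin \<epsilon>'] by auto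
    have gm[measurable]: "g \<in> borel_measurable lebesgue"
      using borel_measurable_continuous_onI[OF g(1)] by (simp add: measurable_completion)
    define e where "e z = \<bar>F z\<bar> - g z" for z
    have em[measurable]: "e \<in> borel_measurable lebesgue" unfolding e_def[abs_def] by measurable
    define I where "I = (\<integral>\<^sup>+z\<in>?W. ennreal \<bar>e z\<bar> \<partial>lebesgue)"
    have I: "I \<le> ennreal (\<epsilon> * t / C)" using g(2) by (simp add: I_def e_def)
    define V1 where "V1 = {z \<in> ?W. t \<le> \<bar>e z\<bar>}"
    define S where "S = {z \<in> Bl x k. \<exists>j\<le>k. ennreal t \<le> av z j e}"
    define jj where "jj z = (SOME j. j \<le> k \<and> ennreal t \<le> av z j e)" for z
    have jj: "jj z \<le> k" "ennreal t \<le> av z (jj z) e" if "z \<in> S" for z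
      using that someI_ex[of "\<lambda>j. j \<le> k \<and> ennreal t \<le> av z j e"] by (auto simp: S_def jj_def)
    define V2 where "V2 = (\<Union>z\<in>S. Bl z (jj z))"
    have "{z. t \<le> \<bar>e z\<bar>} \<in> sets lebesgue"
      using borel_measurable_le[of "\<lambda>_. t" lebesgue "\<lambda>z. \<bar>e z\<bar>"] by simp
    moreover have "V1 = ?W \<inter> {z. t \<le> \<bar>e z\<bar>}" by (auto simp: V1_def)
    ultimately have V1m: "V1 \<in> sets lebesgue" by simp
    have "open V2" unfolding V2_def using open_Bl by blast
    then have V2m: "V2 \<in> sets lebesgue" by simp
    have m1: "ennreal t * emeasure lebesgue V1 \<le> I"
    proof -
      have "ennreal t * emeasure lebesgue V1 = (\<integral>\<^sup>+z. ennreal t * indicator V1 z \<partial>lebesgue)"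
        using V1m by (simp add: nn_integral_cmult)
      also have "\<dots> \<le> I" unfolding I_def
        by (intro nn_integral_mono) (auto simp: indicator_def V1_def intro!: ennreal_leI)
      finally show ?thesis .
    qed
    have m2: "ennreal t * emeasure lebesgue V2 \<le> ennreal (b powr sig) * I"
      unfolding V2_def I_def using jj sub by (intro weak_type) (auto simp: S_def)
    have "ennreal t * emeasure lebesgue (V1 \<union> V2) \<le> ennreal t * (emeasure lebesgue V1 + emeasure lebesgue V2)"
      using V1m V2m by (intro mult_left_mono emeasure_subadditive) auto
    also have "\<dots> \<le> I + ennreal (b powr sig) * I" unfolding distrib_left by (intro add_mono m1 m2)
    also have "\<dots> = ennreal C * I" by (simp add: C_def distrib_right)
    also have "\<dots> \<le> ennreal C * ennreal (\<epsilon> * t / C)" by (intro mult_left_mono I) simp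
    also have "\<dots> = ennreal t * ennreal \<epsilon>" using C t \<epsilon> by (simp add: ennreal_mult'[symmetric] mult.commute)
    finally have mV: "ennreal t * emeasure lebesgue (V1 \<union> V2) \<le> ennreal t * ennreal \<epsilon>" .
    have "emeasure lebesgue (V1 \<union> V2) \<le> ennreal \<epsilon>"
    proof -
      have "ennreal (1 / t) * (ennreal t * emeasure lebesgue (V1 \<union> V2)) \<le> ennreal (1 / t) * (ennreal t * ennreal \<epsilon>)"
        by (intro mult_left_mono mV) simp
      then show ?thesis using t unfolding mult.assoc[symmetric] by (simp add: ennreal_mult'[symmetric])
    qed
    moreover have "Bad t \<subseteq> V1 \<union> V2"
    proof
      fix z assume "z \<in> Bad t"
      then obtain a where z: "z \<in> Bl x k" and a: "0 \<le> a" "\<And>j. j \<le> k \<Longrightarrow> av z j F \<le> ennreal a" "\<bar>F z\<bar> > a + 3 * t"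
        by (auto simp: Bad_def)
      show "z \<in> V1 \<union> V2"
      proof (rule ccontr)
        assume n: "z \<notin> V1 \<union> V2"
        have zS: "z \<notin> S" using n center_in_Bl by (auto simp: V2_def)
        have "\<not> t \<le> \<bar>e z\<bar>" using n z Bsub by (auto simp: V1_def)
        then have gz: "g z > a + 2 * t" using a(3) by (auto simp: e_def abs_if split: if_splits)
        have "isCont g z" using g(1) by (simp add: continuous_on_eq_continuous_at)
        then have "eventually (\<lambda>y. g y > a + 2 * t) (nhds z)"
          using gz unfolding isCont_def tendsto_at_iff_tendsto_nhds by (rule order_tendstoD(1))
        then obtain \<delta> where \<delta>: "\<delta> > 0" "\<And>y. dist y z < \<delta> \<Longrightarrow> g y > a + 2 * t"
          unfolding eventually_nhds_metric by blast
        obtain i where i: "Bl z (- int i) \<subseteq> ball z \<delta>" using Bl_small[OF \<delta>(1)] by blast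
        define j where "j = min k (- int i)"
        have jk: "j \<le> k" "Bl z j \<subseteq> ball z \<delta>" using i Bl_mono[of j "- int i" z] by (auto simp: j_def)
        have "ennreal (a + 2 * t) = av z j (\<lambda>_. a + 2 * t)" using a t by (simp add: av_const)
        also have "\<dots> \<le> av z j g"
        proof (rule av_mono_fun)
          fix y assume "y \<in> Bl z j"
          then have "g y > a + 2 * t" using jk(2) \<delta>(2)[of y] by (auto simp: dist_commute)
          then show "\<bar>a + 2 * t\<bar> \<le> \<bar>g y\<bar>" using a t by simp
        qed
        also have "\<dots> = av z j (\<lambda>y. \<bar>F y\<bar> + - e y)" by (simp add: e_def)
        also have "\<dots> \<le> av z j (\<lambda>y. \<bar>F y\<bar>) + av z j (\<lambda>y. - e y)" by (rule av_triangle) measurable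
        also have "\<dots> = av z j F + av z j e" by (simp add: av_def)
        also have "\<dots> \<le> ennreal a + ennreal t"
        proof (intro add_mono a(2) jk(1))
          have "\<not> ennreal t \<le> av z j e" using zS z jk(1) by (auto simp: S_def)
          then show "av z j e \<le> ennreal t" by simp
        qed
        also have "\<dots> = ennreal (a + t)" using a t by simp
        finally show False using a t by (simp add: ennreal_le_iff)
      qed
    qed
    ultimately show ?thesis using V1m V2m by blast
  qed
  have null: "AE z in lebesgue. z \<notin> Bad t" if t: "0 < t" for t
  proof -
    have "\<forall>n. \<exists>V\<in>sets lebesgue. Bad t \<subseteq> V \<and> emeasure lebesgue V \<le> ennreal (1 / real (Suc n))"
      using cov[OF t] by simp
    then obtain V where V: "\<And>n. V n \<in> sets lebesgue" "\<And>n. Bad t \<subseteq> V n" "\<And>n. emeasure lebesgue (V n) \<le> ennreal (1 / real (Suc n))"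
      by metis
    have "emeasure lebesgue (\<Inter>n. V n) \<le> ennreal (1 / real (Suc n))" for n
      using V by (intro order_trans[OF emeasure_mono V(3)]) auto
    moreover have "(\<lambda>n. ennreal (1 / real (Suc n))) \<longlonglongrightarrow> ennreal 0"
      by (intro tendsto_ennrealI LIMSEQ_Suc lim_1_over_n)
    ultimately have "emeasure lebesgue (\<Inter>n. V n) \<le> ennreal 0" by (intro LIMSEQ_le_const) auto
    then have "(\<Inter>n. V n) \<in> null_sets lebesgue" using V(1) by (auto simp: null_sets_def)
    from AE_not_in[OF this] show ?thesis by (rule AE_mp) (use V(2) in blast)
  qed
  have "AE z in lebesgue. \<forall>n::nat. z \<notin> Bad (1 / real (Suc n))"
    unfolding AE_all_countable using null by simp
  then show ?thesis
  proof (rule AE_mp, intro AE_I2 impI allI)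
    fix z a assume n: "\<forall>n::nat. z \<notin> Bad (1 / real (Suc n))" and z: "z \<in> Bl x k" and a: "\<forall>j\<le>k. av z j F \<le> ennreal a" "0 \<le> a"
    show "\<bar>F z\<bar> \<le> a"
    proof (rule ccontr)
      assume "\<not> \<bar>F z\<bar> \<le> a"
      then have "0 < (\<bar>F z\<bar> - a) / 3" by simp
      then obtain n :: nat where "1 / real (Suc n) < (\<bar>F z\<bar> - a) / 3" by (rule nat_approx_posE)
      then have "z \<in> Bad (1 / real (Suc n))" using z a by (auto simp: Bad_def)
      then show False using n by blast
    qed
  qed
qed

end

section \<open>Stopping balls\<close>

lemma powr_add_subadditive:
  fixes x y p :: real
  assumes "0 \<le> x" "0 \<le> y" "0 < p" "p \<le> 1"
  shows "(x + y) powr p \<le> x powr p + y powr p"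
proof (cases "x + y = 0")
  case True
  then show ?thesis using assms by simp
next
  case False
  define s where "s = x + y"
  have s: "0 < s" using assms False by (simp add: s_def)
  have le: "u / s \<le> (u / s) powr p" if "0 \<le> u" "u \<le> s" for u
  proof (cases "u = 0")
    case False
    then have "(u / s) powr 1 \<le> (u / s) powr p" using that s assms by (intro powr_mono') auto
    then show ?thesis using that s by simp
  qed simp
  have "1 = x / s + y / s" using s by (simp add: s_def add_divide_distrib[symmetric])
  also have "\<dots> \<le> (x / s) powr p + (y / s) powr p" using assms by (intro add_mono le) (auto simp: s_def)
  finally have "s powr p * 1 \<le> s powr p * ((x / s) powr p + (y / s) powr p)" by (intro mult_left_mono) auto
  also have "\<dots> = x powr p + y powr p" using assms s by (simp add: distrib_left powr_divide)
  finally show ?thesis by (simp add: s_def)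
qed

lemma powr_abs_add_le:
  fixes x y q :: real
  assumes "0 < q"
  shows "\<bar>x + y\<bar> powr q \<le> 2 powr q * (\<bar>x\<bar> powr q + \<bar>y\<bar> powr q)"
proof -
  have "\<bar>x + y\<bar> powr q \<le> (2 * max \<bar>x\<bar> \<bar>y\<bar>) powr q" using assms by (intro powr_mono2) auto
  also have "\<dots> = 2 powr q * (max \<bar>x\<bar> \<bar>y\<bar>) powr q" by (simp add: powr_mult)
  also have "\<dots> \<le> 2 powr q * (\<bar>x\<bar> powr q + \<bar>y\<bar> powr q)" by (intro mult_left_mono) (auto simp: max_def)
  finally show ?thesis .
qed

text \<open>The extremal sequence in the duality of l^q and l^q', namely the (q - 1)-th power of the
  normalised \<open>v\<close>. It linearises an l^q norm, so that the sum can be tested as a family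
  of balls.\<close>

lemma lq_dual_weights:
  fixes v :: "'i \<Rightarrow> real"
  assumes I: "finite I" and v: "\<And>i. i \<in> I \<Longrightarrow> 0 \<le> v i" and q: "1 < q"
  obtains w where "\<And>i. 0 \<le> w i" "(\<Sum>i\<in>I. w i powr (q / (q - 1))) \<le> 1"
    "(\<Sum>i\<in>I. v i powr q) powr (1 / q) = (\<Sum>i\<in>I. v i * w i)"
proof -
  define V where "V = (\<Sum>i\<in>I. v i powr q)"
  show ?thesis
  proof (cases "V = 0")
    case True
    then have "v i powr q = 0" if "i \<in> I" for i using that I by (simp add: V_def sum_nonneg_eq_0_iff)
    then show ?thesis using q True by (intro that[of "\<lambda>_. 0"]) (auto simp: V_def)
  next
    case False
    moreover have "0 \<le> V" unfolding V_def by (intro sum_nonneg) simp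
    ultimately have V: "0 < V" by simp
    define w where "w i = (v i / V powr (1 / q)) powr (q - 1)" for i
    show ?thesis
    proof (rule that[of w])
      show "0 \<le> w i" for i by (simp add: w_def)
      have "w i powr (q / (q - 1)) = v i powr q / V" if "i \<in> I" for i
        using v[OF that] q V by (simp add: w_def powr_powr powr_divide)
      then have "(\<Sum>i\<in>I. w i powr (q / (q - 1))) = (\<Sum>i\<in>I. v i powr q / V)" by (intro sum.cong) auto
      also have "\<dots> = 1" using V by (simp add: sum_divide_distrib[symmetric] V_def)
      finally show "(\<Sum>i\<in>I. w i powr (q / (q - 1))) \<le> 1" by simp
      have "v i * w i = v i powr q / V powr ((q - 1) / q)" if i: "i \<in> I" for i
      proof (cases "v i = 0")
        case False
        then have vi: "0 < v i" using v[OF i] by simp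
        have "v i * v i powr (q - 1) = v i powr q" using vi powr_add[of "v i" 1 "q - 1"] by simp
        then show ?thesis using vi V by (simp add: w_def powr_divide powr_powr)
      qed (use q in simp)
      then have "(\<Sum>i\<in>I. v i * w i) = (\<Sum>i\<in>I. v i powr q / V powr ((q - 1) / q))" by (intro sum.cong) auto
      also have "\<dots> = V / V powr ((q - 1) / q)" by (simp add: sum_divide_distrib[symmetric] V_def)
      also have "\<dots> = V powr (1 - (q - 1) / q)" using V by (simp add: powr_diff)
      also have "1 - (q - 1) / q = 1 / q" using q by (simp add: field_simps)
      finally show "(\<Sum>i\<in>I. v i powr q) powr (1 / q) = (\<Sum>i\<in>I. v i * w i)" by (simp add: V_def)
    qed
  qed
qed

context anisotropic begin

lemma sig_pos: "0 < sig"
  using sig by (cases "sig = 0") auto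

lemma Lloc_locint:
  assumes f: "Lloc q f" and q: "1 \<le> q"
  shows "locint f"
  unfolding locint_def
proof (intro conjI allI)
  show m[measurable]: "f \<in> borel_measurable lebesgue" by (rule Lloc_measurable[OF f])
  fix x k
  have le: "\<bar>v\<bar> \<le> 1 + \<bar>v\<bar> powr q" for v :: real
  proof (cases "\<bar>v\<bar> \<le> 1")
    case False
    then have "\<bar>v\<bar> powr 1 \<le> \<bar>v\<bar> powr q" using q by (intro powr_mono) auto
    then show ?thesis by simp
  qed (simp add: add_increasing2)
  have "(\<integral>\<^sup>+z\<in>Bl x k. ennreal \<bar>f z\<bar> \<partial>lebesgue) \<le> (\<integral>\<^sup>+z. indicator (Bl x k) z + ennreal (\<bar>f z\<bar> powr q) * indicator (Bl x k) z \<partial>lebesgue)"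
  proof (intro nn_integral_mono)
    fix z
    have "ennreal \<bar>f z\<bar> \<le> 1 + ennreal (\<bar>f z\<bar> powr q)"
      using le[of "f z"] by (simp add: ennreal_plus[symmetric] ennreal_leI del: ennreal_plus flip: ennreal_1)
    then show "ennreal \<bar>f z\<bar> * indicator (Bl x k) z \<le> indicator (Bl x k) z + ennreal (\<bar>f z\<bar> powr q) * indicator (Bl x k) z"
      by (simp add: indicator_def)
  qed
  also have "\<dots> = emeasure lebesgue (Bl x k) + (\<integral>\<^sup>+z\<in>Bl x k. ennreal (\<bar>f z\<bar> powr q) \<partial>lebesgue)"
    by (subst nn_integral_add) auto
  also have "\<dots> < top" using set_nn_integral_Bl_Lloc[OF f] by (simp add: emeasure_Bl)
  finally show "(\<integral>\<^sup>+z\<in>Bl x k. ennreal \<bar>f z\<bar> \<partial>lebesgue) < top" .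
qed

lemma Lq_diff_poly_finite:
  assumes f: "Lloc q f" and q: "1 \<le> q" and P: "P \<in> poly_le d"
  shows "(\<integral>\<^sup>+z\<in>Bl x k. ennreal (\<bar>f z - P z\<bar> powr q) \<partial>lebesgue) < top"
proof -
  have m[measurable]: "f \<in> borel_measurable lebesgue" by (rule Lloc_measurable[OF f])
  have [measurable]: "P \<in> borel_measurable lebesgue" by (rule poly_le_measurable[OF P])
  obtain K where K: "0 \<le> K" "\<And>y. y \<in> D \<Longrightarrow> \<bar>P (x + T k y)\<bar> \<le> K"
    using poly_le_bounded_D[OF poly_le_T[OF P]] by blast
  have PK: "\<bar>P z\<bar> \<le> K" if "z \<in> Bl x k" for z
    using K(2)[of "T (- k) (z - x)"] that by (simp add: mem_Bl)
  have "(\<integral>\<^sup>+z\<in>Bl x k. ennreal (\<bar>f z - P z\<bar> powr q) \<partial>lebesgue)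
      \<le> (\<integral>\<^sup>+z. ennreal (2 powr q) * (ennreal (\<bar>f z\<bar> powr q) * indicator (Bl x k) z) + ennreal (2 powr q * K powr q) * indicator (Bl x k) z \<partial>lebesgue)"
  proof (intro nn_integral_mono)
    fix z
    show "ennreal (\<bar>f z - P z\<bar> powr q) * indicator (Bl x k) z
        \<le> ennreal (2 powr q) * (ennreal (\<bar>f z\<bar> powr q) * indicator (Bl x k) z) + ennreal (2 powr q * K powr q) * indicator (Bl x k) z"
    proof (cases "z \<in> Bl x k")
      case True
      have "\<bar>f z - P z\<bar> powr q \<le> 2 powr q * (\<bar>f z\<bar> powr q + \<bar>- P z\<bar> powr q)"
        using powr_abs_add_le[of q "f z" "- P z"] q by simp
      also have "\<dots> \<le> 2 powr q * \<bar>f z\<bar> powr q + 2 powr q * K powr q"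
        using PK[OF True] q unfolding distrib_left by (intro add_mono mult_left_mono powr_mono2) auto
      finally have "ennreal (\<bar>f z - P z\<bar> powr q) \<le> ennreal (2 powr q * \<bar>f z\<bar> powr q + 2 powr q * K powr q)" by (rule ennreal_leI)
      then show ?thesis using True by (simp add: ennreal_mult)
    qed simp
  qed
  also have "\<dots> = ennreal (2 powr q) * (\<integral>\<^sup>+z\<in>Bl x k. ennreal (\<bar>f z\<bar> powr q) \<partial>lebesgue) + ennreal (2 powr q * K powr q) * ennreal (b powr k)"
    by (subst nn_integral_add) (auto simp: nn_integral_cmult emeasure_Bl)
  also have "\<dots> < top" using set_nn_integral_Bl_Lloc[OF f, of x k] by (simp add: ennreal_mult_less_top)
  finally show ?thesis .
qed

text \<open>The selected points \<open>y\<close> carry the largest balls \<open>Bl y (j y)\<close> on which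
  the mean of the oscillation exceeds the threshold.\<close>

lemma stopping_step:
  fixes d :: nat
  obtains C1 where "0 \<le> C1" "\<And>f x k m \<tau>. locint f \<Longrightarrow> 2 * sig \<le> m \<Longrightarrow> 0 < (\<tau>::real) \<Longrightarrow>
    \<exists>G j R. finite G \<and> disjoint_family_on (\<lambda>y. Bl y (j y)) G \<and>
      (\<forall>y\<in>G. Bl y (j y) \<subseteq> Bl x (k + int sig)) \<and>
      (\<Sum>y\<in>G. b powr j y) \<le> b powr - real m * b powr k \<and>
      R \<in> sets lebesgue \<and> emeasure lebesgue R \<le> ennreal \<tau> \<and>
      (AE z in lebesgue. z \<in> Bl x k \<longrightarrow> z \<notin> R \<longrightarrow> z \<notin> (\<Union>y\<in>G. Bl y (j y + int sig)) \<longrightarrow>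
        ennreal \<bar>f z - proj d x (k + int sig) f z\<bar> \<le> ennreal (b powr (real m + real sig)) * osc d x (k + int sig) f) \<and>
      (\<forall>y\<in>G. \<forall>z\<in>Bl y (j y + int sig). ennreal \<bar>proj d y (j y + int sig + int sig) f z - proj d x (k + int sig) f z\<bar>
        \<le> ennreal (C1 * b powr (real m + real sig)) * osc d x (k + int sig) f)"
proof -
  obtain C1 where C1: "1 \<le> C1" "\<And>x k g z. locint g \<Longrightarrow> z \<in> Bl x k \<Longrightarrow> ennreal \<bar>proj d x k g z\<bar> \<le> ennreal C1 * av x k g"
    by (rule proj_bound_Bl[of d]) blast
  show ?thesis
  proof (rule that[of C1])
    show "0 \<le> C1" using C1 by simp
    fix f x k and m :: nat and \<tau> :: real
    assume f: "locint f" and m: "2 * sig \<le> m" and \<tau>: "0 < \<tau>"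
    let ?ks = "k + int sig"
    let ?P = "proj d x ?ks f"
    define F where "F = (\<lambda>z. f z - ?P z)"
    define L where "L = b powr (real m + real sig)"
    define e0 where "e0 = osc d x ?ks f"
    have L0: "0 < L" by (simp add: L_def)
    have F: "locint F" unfolding F_def by (rule locint_diff_proj[OF f])
    have Fm: "F \<in> borel_measurable lebesgue" by (rule locint_measurable[OF F])
    have e0: "e0 = av x ?ks F" by (simp add: e0_def osc_def F_def)
    have e0fin: "e0 < top" unfolding e0 by (rule av_finite[OF F])
    define S where "S = {y \<in> Bl x k. \<exists>j\<le>k. ennreal L * e0 < av y j F}"
    have sub: "Bl y j \<subseteq> Bl x ?ks" if "y \<in> Bl x k" "j \<le> k" for y j
      by (rule Bl_engulf[OF that(1) center_in_Bl that(2)])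
    define n where "n y = (LEAST n::nat. ennreal L * e0 < av y (k - int n) F)" for y
    define j where "j y = k - int (n y)" for y
    have n1: "ennreal L * e0 < av y (j y) F" if y: "y \<in> S" for y
    proof -
      obtain i where i: "i \<le> k" "ennreal L * e0 < av y i F" using y by (auto simp: S_def)
      then have "ennreal L * e0 < av y (k - int (nat (k - i))) F" by simp
      then show ?thesis unfolding j_def n_def by (rule LeastI)
    qed
    have n2: "av y i F \<le> ennreal L * e0" if "j y < i" "i \<le> k" for y i
    proof -
      have "nat (k - i) < n y" using that by (simp add: j_def)
      then have "\<not> ennreal L * e0 < av y (k - int (nat (k - i))) F" unfolding n_def by (rule not_less_Least)
      then show ?thesis using that by simp
    qed
    have jk: "j y \<le> k" for y by (simp add: j_def)
    \<comment> \<open>Passing from the enlarged ball to one of level at least k - m raises a mean by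
      at most b^(m + sig), the factor in the threshold. So stopping balls are more than
      \<open>m\<close> levels smaller.\<close>
    have jm: "j y < k - int m" if y: "y \<in> S" for y
    proof (rule ccontr)
      assume "\<not> j y < k - int m"
      then have "real_of_int (?ks - j y) \<le> real m + real sig" by simp
      then have "b powr (?ks - j y) \<le> L" unfolding L_def using b_gt_1 by (intro powr_mono) auto
      have "y \<in> Bl x k" using y by (simp add: S_def)
      then have "av y (j y) F \<le> ennreal (b powr (?ks - j y)) * e0"
        unfolding e0 by (intro av_subset sub jk Fm)
      also have "\<dots> \<le> ennreal L * e0" using \<open>b powr (?ks - j y) \<le> L\<close> by (intro mult_right_mono ennreal_leI) auto
      finally show False using n1[OF y] by simp
    qed
    define U where "U = (\<Union>y\<in>S. Bl y (j y))"
    have "open (U \<inter> Bl x k)" unfolding U_def using open_Bl by blast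
    then obtain Kc where Kc: "\<And>i::nat. compact (Kc i)" "incseq Kc" "(\<Union>i. Kc i) = U \<inter> Bl x k"
      by (rule open_compact_exhaustion) blast
    have Um: "U \<inter> Bl x k \<in> sets lebesgue" using \<open>open (U \<inter> Bl x k)\<close> by simp
    have Km: "Kc i \<in> sets lebesgue" for i using Kc(1) compact_sets_lebesgue by blast
    \<comment> \<open>Only compact parts of the stopping set admit a finite selection; what is left
      over has measure at most \<tau> and becomes \<open>R\<close>.\<close>
    have "\<exists>i. emeasure lebesgue (U \<inter> Bl x k - Kc i) \<le> ennreal \<tau>"
    proof -
      have dec: "decseq (\<lambda>i. U \<inter> Bl x k - Kc i)" using Kc(2) by (auto simp: decseq_def incseq_def)
      have fin: "emeasure lebesgue (U \<inter> Bl x k - Kc i) \<noteq> \<infinity>" for i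
      proof -
        have "emeasure lebesgue (U \<inter> Bl x k - Kc i) \<le> emeasure lebesgue (Bl x k)" by (intro emeasure_mono) auto
        also have "\<dots> < top" by (simp add: emeasure_Bl)
        finally show ?thesis by simp
      qed
      have "(\<lambda>i. emeasure lebesgue (U \<inter> Bl x k - Kc i)) \<longlonglongrightarrow> emeasure lebesgue (\<Inter>i. U \<inter> Bl x k - Kc i)"
        using Um Km by (intro Lim_emeasure_decseq dec fin) auto
      moreover have em: "(\<Inter>i. U \<inter> Bl x k - Kc i) = {}" using Kc(3) by blast
      ultimately have "(\<lambda>i. emeasure lebesgue (U \<inter> Bl x k - Kc i)) \<longlonglongrightarrow> 0" by (simp only: em emeasure_empty)
      moreover have "0 < ennreal \<tau>" using \<tau> by simp
      ultimately have "eventually (\<lambda>i. emeasure lebesgue (U \<inter> Bl x k - Kc i) < ennreal \<tau>) sequentially" by (rule order_tendstoD(2))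
      then obtain i where "emeasure lebesgue (U \<inter> Bl x k - Kc i) < ennreal \<tau>"
        using eventually_happens'[OF sequentially_bot] by blast
      then show ?thesis by (auto intro: less_imp_le)
    qed
    then obtain i where i: "emeasure lebesgue (U \<inter> Bl x k - Kc i) \<le> ennreal \<tau>" by blast
    have "Kc i \<subseteq> (\<Union>y\<in>S. Bl y (j y))" using Kc(3) by (auto simp: U_def)
    then obtain G where G: "finite G" "G \<subseteq> S" "disjoint_family_on (\<lambda>y. Bl y (j y)) G" "Kc i \<subseteq> (\<Union>y\<in>G. Bl y (j y + int sig))"
      by (rule compact_vitali[OF Kc(1)])
    define R where "R = U \<inter> Bl x k - Kc i"
    have Gsub: "Bl y (j y) \<subseteq> Bl x ?ks" if "y \<in> G" for y
      using that G(2) by (intro sub jk) (auto simp: S_def)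
    \<comment> \<open>The mean over each selected ball exceeds L e0 while the total integral is b^(k
      + sig) e0. The \<open>sig\<close> in the threshold cancels the enlargement, leaving b^-m
      b^k.\<close>
    have mass: "(\<Sum>y\<in>G. b powr j y) \<le> b powr - real m * b powr k"
    proof (cases "G = {}")
      case False
      then obtain y where y: "y \<in> S" using G(2) by blast
      have "e0 \<noteq> 0"
      proof
        assume "e0 = 0"
        have "av y (j y) F \<le> ennreal (b powr (?ks - j y)) * e0"
          unfolding e0 using y by (intro av_subset sub jk Fm) (auto simp: S_def)
        then show False using n1[OF y] \<open>e0 = 0\<close> by simp
      qed
      then obtain er where er: "0 < er" "e0 = ennreal er" using e0fin by (cases e0) (auto simp: order.order_iff_strict)
      have "ennreal L * e0 * (\<Sum>y\<in>G. ennreal (b powr j y)) \<le> (\<integral>\<^sup>+z\<in>Bl x ?ks. ennreal \<bar>F z\<bar> \<partial>lebesgue)"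
        using G(1,3) Gsub less_imp_le[OF n1] G(2) by (intro disjoint_balls_mass Fm) blast+
      also have "\<dots> = ennreal (b powr ?ks) * e0" unfolding e0 by (rule nn_integral_Bl_av[OF Fm])
      finally have "ennreal (L * er * (\<Sum>y\<in>G. b powr j y)) \<le> ennreal (b powr ?ks * er)"
        using er L0 by (simp add: ennreal_mult sum_nonneg)
      then have "L * er * (\<Sum>y\<in>G. b powr j y) \<le> b powr ?ks * er" using er by (simp add: ennreal_le_iff)
      then have "L * (\<Sum>y\<in>G. b powr j y) \<le> b powr ?ks" using er by (simp add: mult.commute mult.left_commute)
      moreover have "b powr ?ks = L * (b powr - real m * b powr k)" by (simp add: L_def powr_add[symmetric] add.commute)
      ultimately show ?thesis using L0 by (simp only: mult_le_cancel_left_pos)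
    qed simp
    have ae: "AE z in lebesgue. z \<in> Bl x k \<longrightarrow> z \<notin> R \<longrightarrow> z \<notin> (\<Union>y\<in>G. Bl y (j y + int sig)) \<longrightarrow> ennreal \<bar>F z\<bar> \<le> ennreal L * e0"
      using lebesgue_points_bound[OF F, of x k]
    proof (rule AE_mp, intro AE_I2 impI)
      fix z
      assume lp: "z \<in> Bl x k \<longrightarrow> (\<forall>a::real. (\<forall>j\<le>k. av z j F \<le> ennreal a) \<longrightarrow> 0 \<le> a \<longrightarrow> \<bar>F z\<bar> \<le> a)"
        and z: "z \<in> Bl x k" "z \<notin> R" "z \<notin> (\<Union>y\<in>G. Bl y (j y + int sig))"
      have "z \<notin> Kc i" using z(3) G(4) by blast
      then have "z \<notin> U" using z by (auto simp: R_def)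
      then have "z \<notin> S" using center_in_Bl by (auto simp: U_def)
      then have le: "\<forall>j\<le>k. av z j F \<le> ennreal L * e0" using z(1) by (auto simp: S_def not_less)
      define a where "a = enn2real (ennreal L * e0)"
      have a: "ennreal L * e0 = ennreal a" using e0fin by (simp add: a_def ennreal_mult_less_top)
      have "\<bar>F z\<bar> \<le> a" using lp z(1) le unfolding a by (simp add: a_def)
      then show "ennreal \<bar>F z\<bar> \<le> ennreal L * e0" unfolding a by (rule ennreal_leI)
    qed
    \<comment> \<open>The ball at \<open>y\<close> enlarged by 2 sig is larger than the stopping
      ball, hence below the threshold; by \<open>jm\<close> and 2 sig \<le> m it is still among the
      balls tested at \<open>y\<close>.\<close>
    have pr: "ennreal \<bar>proj d y (j y + int sig + int sig) f z - ?P z\<bar> \<le> ennreal (C1 * L) * e0"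
      if y: "y \<in> G" and z: "z \<in> Bl y (j y + int sig)" for y z
    proof -
      let ?jj = "j y + int sig + int sig"
      have z': "z \<in> Bl y ?jj" using z Bl_mono[of "j y + int sig" ?jj y] by auto
      have "proj d y ?jj F = (\<lambda>z. proj d y ?jj f z - ?P z)"
        unfolding F_def by (rule proj_diff_poly[OF f proj_poly_le[OF f]])
      then have "ennreal \<bar>proj d y ?jj f z - ?P z\<bar> = ennreal \<bar>proj d y ?jj F z\<bar>" by simp
      also have "\<dots> \<le> ennreal C1 * av y ?jj F" by (rule C1(2)[OF F z'])
      also have "\<dots> \<le> ennreal C1 * (ennreal L * e0)"
      proof (intro mult_left_mono n2)
        show "j y < ?jj" using sig_pos by simp
        show "?jj \<le> k" using jm[of y] y G(2) m by auto
      qed simp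
      finally show ?thesis using C1(1) L0 by (simp add: ennreal_mult mult.assoc)
    qed
    show "\<exists>G j R. finite G \<and> disjoint_family_on (\<lambda>y. Bl y (j y)) G \<and>
      (\<forall>y\<in>G. Bl y (j y) \<subseteq> Bl x (k + int sig)) \<and>
      (\<Sum>y\<in>G. b powr j y) \<le> b powr - real m * b powr k \<and>
      R \<in> sets lebesgue \<and> emeasure lebesgue R \<le> ennreal \<tau> \<and>
      (AE z in lebesgue. z \<in> Bl x k \<longrightarrow> z \<notin> R \<longrightarrow> z \<notin> (\<Union>y\<in>G. Bl y (j y + int sig)) \<longrightarrow>
        ennreal \<bar>f z - proj d x (k + int sig) f z\<bar> \<le> ennreal (b powr (real m + real sig)) * osc d x (k + int sig) f) \<and>
      (\<forall>y\<in>G. \<forall>z\<in>Bl y (j y + int sig). ennreal \<bar>proj d y (j y + int sig + int sig) f z - proj d x (k + int sig) f z\<bar>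
        \<le> ennreal (C1 * b powr (real m + real sig)) * osc d x (k + int sig) f)"
      using G(1,3) Gsub mass Um Km[of i] i ae pr
      unfolding F_def L_def[symmetric] e0_def[symmetric] R_def
      by (intro exI[of _ G] exI[of _ j] exI[of _ "U \<inter> Bl x k - Kc i"] conjI) auto
  qed
qed

text \<open>The polynomial is that of the enlarged ball, which contains all stopping balls. Only the
  subset \<open>G\<close> is tested, but the normalisation is by the measure of the whole
  ball.\<close>

definition osc_on :: "real \<Rightarrow> nat \<Rightarrow> (real^'n \<Rightarrow> real) \<Rightarrow> real^'n \<Rightarrow> int \<Rightarrow> (real^'n) set \<Rightarrow> ennreal" where
  "osc_on q d f x k G = epow (ennreal (b powr - k) *
    (\<integral>\<^sup>+z\<in>G. ennreal (\<bar>f z - proj d x (k + int sig) f z\<bar> powr q) \<partial>lebesgue)) (1 / q)"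

lemma osc_on_finite:
  assumes f: "Lloc q f" and q: "1 \<le> q" and G: "G \<subseteq> Bl x k"
  shows "(\<integral>\<^sup>+z\<in>G. ennreal (\<bar>f z - proj d x (k + int sig) f z\<bar> powr q) \<partial>lebesgue) < top"
proof -
  have "(\<integral>\<^sup>+z\<in>G. ennreal (\<bar>f z - proj d x (k + int sig) f z\<bar> powr q) \<partial>lebesgue)
      \<le> (\<integral>\<^sup>+z\<in>Bl x k. ennreal (\<bar>f z - proj d x (k + int sig) f z\<bar> powr q) \<partial>lebesgue)"
    using G by (intro nn_integral_mono mult_left_mono) (auto simp: indicator_def)
  also have "\<dots> < top" by (rule Lq_diff_poly_finite[OF f q proj_poly_le[OF Lloc_locint[OF f q]]])
  finally show ?thesis .
qed

text \<open>Off the sets \<open>Gq y\<close> the deviation is bounded; on \<open>Gq y\<close> the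
  polynomial of the large ball is exchanged for that of the ball at \<open>y\<close>, at a bounded
  cost. After integrating \<open>q\<close>-th powers and taking the root, the l^q sum over the small
  balls is written as a weighted sum by duality, which makes the recursion linear.\<close>

lemma oscillation_recursion:
  fixes d :: nat
  assumes q: "1 < q"
  obtains C where "0 \<le> C" "\<And>f x k G Q jj Gq E L. Lloc q f \<Longrightarrow> finite Q \<Longrightarrow> 0 \<le> L \<Longrightarrow> E < top \<Longrightarrow>
    G \<in> sets lebesgue \<Longrightarrow> (\<And>y. y \<in> Q \<Longrightarrow> Gq y \<in> sets lebesgue) \<Longrightarrow> (\<And>y. y \<in> Q \<Longrightarrow> Gq y \<subseteq> Bl y (jj y)) \<Longrightarrow>
    G \<subseteq> Bl x k \<Longrightarrow> (\<Sum>y\<in>Q. b powr jj y) \<le> b powr k \<Longrightarrow>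
    (AE z in lebesgue. z \<in> G \<longrightarrow> z \<notin> (\<Union>y\<in>Q. Gq y) \<longrightarrow> ennreal \<bar>f z - proj d x (k + int sig) f z\<bar> \<le> ennreal L * E) \<Longrightarrow>
    (\<And>y z. y \<in> Q \<Longrightarrow> z \<in> Gq y \<Longrightarrow> ennreal \<bar>proj d y (jj y + int sig) f z - proj d x (k + int sig) f z\<bar> \<le> ennreal L * E) \<Longrightarrow>
    \<exists>w. (\<forall>y. 0 \<le> w y) \<and> (\<Sum>y\<in>Q. w y powr (q / (q - 1))) \<le> 1 \<and>
      ennreal (b powr k) * osc_on q d f x k G \<le> ennreal (C * L) * (ennreal (b powr k) * E) +
        2 * (\<Sum>y\<in>Q. ennreal ((b powr k / b powr jj y) powr ((q - 1) / q) * w y * b powr jj y) * osc_on q d f y (jj y) (Gq y))"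
proof -
  \<comment> \<open>The bounded part enters once outside the sets \<open>Gq y\<close> and, with
    factor 2 powr q, once more over the balls at \<open>Q\<close>, whose total measure is at most
    that of the large ball.\<close>
  define C where "C = (1 + 2 powr q) powr (1 / q)"
  show ?thesis
  proof (rule that[of C])
    show "0 \<le> C" by (simp add: C_def)
    fix f x k G and Q :: "(real^'n) set" and jj Gq E and L :: real
    assume f: "Lloc q f" and Q: "finite Q" and L: "0 \<le> L" and E: "E < top" and Gm[measurable]: "G \<in> sets lebesgue"
      and Gqm: "\<And>y. y \<in> Q \<Longrightarrow> Gq y \<in> sets lebesgue" and Gqs: "\<And>y. y \<in> Q \<Longrightarrow> Gq y \<subseteq> Bl y (jj y)"
      and Gs: "G \<subseteq> Bl x k" and mass: "(\<Sum>y\<in>Q. b powr jj y) \<le> b powr k"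
      and ae: "AE z in lebesgue. z \<in> G \<longrightarrow> z \<notin> (\<Union>y\<in>Q. Gq y) \<longrightarrow> ennreal \<bar>f z - proj d x (k + int sig) f z\<bar> \<le> ennreal L * E"
      and pr: "\<And>y z. y \<in> Q \<Longrightarrow> z \<in> Gq y \<Longrightarrow> ennreal \<bar>proj d y (jj y + int sig) f z - proj d x (k + int sig) f z\<bar> \<le> ennreal L * E"
    have q1: "1 \<le> q" using q by simp
    have fl: "locint f" by (rule Lloc_locint[OF f q1])
    define e where "e = L * enn2real E"
    have e: "0 \<le> e" "ennreal L * E = ennreal e" using L E by (auto simp: e_def ennreal_mult)
    define \<beta> where "\<beta> = b powr k"
    define \<beta>' where "\<beta>' y = b powr jj y" for y
    have \<beta>: "0 < \<beta>" "0 < \<beta>' y" for y by (simp_all add: \<beta>_def \<beta>'_def)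
    let ?F = "\<lambda>z. f z - proj d x (k + int sig) f z"
    let ?Fy = "\<lambda>y z. f z - proj d y (jj y + int sig) f z"
    have [measurable]: "?F \<in> borel_measurable lebesgue" "?Fy y \<in> borel_measurable lebesgue" for y
      by (intro locint_measurable locint_diff_proj fl)+
    define I where "I y = enn2real (\<integral>\<^sup>+z\<in>Gq y. ennreal (\<bar>?Fy y z\<bar> powr q) \<partial>lebesgue)" for y
    have I: "0 \<le> I y" for y by (simp add: I_def)
    have I': "(\<integral>\<^sup>+z\<in>Gq y. ennreal (\<bar>?Fy y z\<bar> powr q) \<partial>lebesgue) = ennreal (I y)" if "y \<in> Q" for y
      unfolding I_def using osc_on_finite[OF f q1 Gqs[OF that], of d] by simp
    have oy: "osc_on q d f y (jj y) (Gq y) = ennreal ((I y / \<beta>' y) powr (1 / q))" if "y \<in> Q" for y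
      unfolding osc_on_def I'[OF that] using I[of y] \<beta>(2)[of y]
      by (simp add: ennreal_mult[symmetric] powr_minus \<beta>'_def divide_inverse mult.commute)
    have "(\<integral>\<^sup>+z\<in>G. ennreal (\<bar>?F z\<bar> powr q) \<partial>lebesgue)
        \<le> (\<integral>\<^sup>+z. ennreal (e powr q) * indicator (Bl x k) z + (\<Sum>y\<in>Q. ennreal (2 powr q) * (ennreal (\<bar>?Fy y z\<bar> powr q) * indicator (Gq y) z)
            + ennreal (2 powr q * e powr q) * indicator (Bl y (jj y)) z) \<partial>lebesgue)"
    proof (rule nn_integral_mono_AE, rule AE_mp[OF ae], intro AE_I2 impI)
      fix z assume aez: "z \<in> G \<longrightarrow> z \<notin> (\<Union>y\<in>Q. Gq y) \<longrightarrow> ennreal \<bar>?F z\<bar> \<le> ennreal L * E"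
      let ?s = "\<lambda>y. ennreal (2 powr q) * (ennreal (\<bar>?Fy y z\<bar> powr q) * indicator (Gq y) z) + ennreal (2 powr q * e powr q) * indicator (Bl y (jj y)) z"
      show "ennreal (\<bar>?F z\<bar> powr q) * indicator G z \<le> ennreal (e powr q) * indicator (Bl x k) z + (\<Sum>y\<in>Q. ?s y)"
      proof (cases "z \<in> G")
        case True
        show ?thesis
        proof (cases "z \<in> (\<Union>y\<in>Q. Gq y)")
          case False
          then have "ennreal \<bar>?F z\<bar> \<le> ennreal e" using aez True e by simp
          then have "\<bar>?F z\<bar> \<le> e" using e by (simp add: ennreal_le_iff)
          then have le: "ennreal (\<bar>?F z\<bar> powr q) \<le> ennreal (e powr q)" using q by (intro ennreal_leI powr_mono2) auto
          have zB: "z \<in> Bl x k" using True Gs by blast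
          show ?thesis using True zB add_increasing2[OF zero_le le] by simp
        next
          case True
          then obtain y where y: "y \<in> Q" "z \<in> Gq y" by blast
          have zB: "z \<in> Bl y (jj y)" using y Gqs by blast
          have "ennreal \<bar>proj d y (jj y + int sig) f z - proj d x (k + int sig) f z\<bar> \<le> ennreal e" using pr[OF y] e by simp
          then have de: "\<bar>proj d y (jj y + int sig) f z - proj d x (k + int sig) f z\<bar> \<le> e" using e by (simp add: ennreal_le_iff)
          have "\<bar>?F z\<bar> powr q = \<bar>?Fy y z + (proj d y (jj y + int sig) f z - proj d x (k + int sig) f z)\<bar> powr q" by simp
          also have "\<dots> \<le> 2 powr q * (\<bar>?Fy y z\<bar> powr q + \<bar>proj d y (jj y + int sig) f z - proj d x (k + int sig) f z\<bar> powr q)"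
            by (rule powr_abs_add_le) (use q in simp)
          also have "\<dots> \<le> 2 powr q * \<bar>?Fy y z\<bar> powr q + 2 powr q * e powr q"
            unfolding distrib_left using de q by (intro add_mono mult_left_mono powr_mono2) auto
          finally have "ennreal (\<bar>?F z\<bar> powr q) \<le> ennreal (2 powr q * \<bar>?Fy y z\<bar> powr q + 2 powr q * e powr q)" by (rule ennreal_leI)
          also have "\<dots> = ?s y" using y(2) zB by (simp add: ennreal_mult)
          also have "\<dots> \<le> (\<Sum>y\<in>Q. ?s y)" using Q y(1) by (intro member_le_sum) auto
          finally show ?thesis by (auto simp: indicator_def intro: add_increasing)
        qed
      qed simp
    qed
    also have "\<dots> = ennreal (e powr q) * ennreal \<beta> + (\<Sum>y\<in>Q. ennreal (2 powr q) * ennreal (I y) + ennreal (2 powr q * e powr q) * ennreal (\<beta>' y))"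
    proof -
      have y1: "(\<integral>\<^sup>+z. ennreal (2 powr q) * (ennreal (\<bar>?Fy y z\<bar> powr q) * indicator (Gq y) z) + ennreal (2 powr q * e powr q) * indicator (Bl y (jj y)) z \<partial>lebesgue)
          = ennreal (2 powr q) * ennreal (I y) + ennreal (2 powr q * e powr q) * ennreal (\<beta>' y)" if y: "y \<in> Q" for y
      proof -
        note Gqm[OF y, measurable]
        show ?thesis unfolding I'[OF y, symmetric] \<beta>'_def emeasure_Bl[symmetric, of "jj y" y]
          by (subst nn_integral_add) (auto simp: nn_integral_cmult)
      qed
      have ym: "(\<lambda>z. ennreal (2 powr q) * (ennreal (\<bar>?Fy y z\<bar> powr q) * indicator (Gq y) z) + ennreal (2 powr q * e powr q) * indicator (Bl y (jj y)) z) \<in> borel_measurable lebesgue"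
        if y: "y \<in> Q" for y
      proof -
        note Gqm[OF y, measurable]
        show ?thesis by measurable
      qed
      have i1: "(\<integral>\<^sup>+z. ennreal (e powr q) * indicator (Bl x k) z \<partial>lebesgue) = ennreal (e powr q) * ennreal \<beta>"
        by (simp add: nn_integral_cmult emeasure_Bl \<beta>_def)
      have am: "(\<lambda>z. ennreal (e powr q) * indicator (Bl x k) z) \<in> borel_measurable lebesgue" by measurable
      have i2: "(\<integral>\<^sup>+z. (\<Sum>y\<in>Q. ennreal (2 powr q) * (ennreal (\<bar>?Fy y z\<bar> powr q) * indicator (Gq y) z) + ennreal (2 powr q * e powr q) * indicator (Bl y (jj y)) z) \<partial>lebesgue)
          = (\<Sum>y\<in>Q. ennreal (2 powr q) * ennreal (I y) + ennreal (2 powr q * e powr q) * ennreal (\<beta>' y))"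
        by (rule trans[OF nn_integral_sum[OF ym] sum.cong[OF refl y1]])
      show ?thesis
        unfolding i1[symmetric] i2[symmetric] by (rule nn_integral_add[OF am borel_measurable_sum[OF ym]])
    qed
    also have "\<dots> = ennreal (e powr q * \<beta> + (\<Sum>y\<in>Q. 2 powr q * I y + 2 powr q * e powr q * \<beta>' y))"
    proof -
      have "(\<Sum>y\<in>Q. ennreal (2 powr q) * ennreal (I y) + ennreal (2 powr q * e powr q) * ennreal (\<beta>' y))
          = (\<Sum>y\<in>Q. ennreal (2 powr q * I y + 2 powr q * e powr q * \<beta>' y))"
        using I \<beta>(2) by (intro sum.cong refl) (simp add: ennreal_mult less_imp_le)
      also have "\<dots> = ennreal (\<Sum>y\<in>Q. 2 powr q * I y + 2 powr q * e powr q * \<beta>' y)"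
        using I \<beta>(2) by (intro sum_ennreal) (simp add: less_imp_le)
      finally show ?thesis using I \<beta> by (simp add: ennreal_mult less_imp_le sum_nonneg)
    qed
    also have "\<dots> \<le> ennreal ((C * e) powr q * \<beta> + 2 powr q * (\<Sum>y\<in>Q. I y))"
    proof (rule ennreal_leI)
      have "(\<Sum>y\<in>Q. 2 powr q * I y + 2 powr q * e powr q * \<beta>' y) = 2 powr q * (\<Sum>y\<in>Q. I y) + 2 powr q * e powr q * (\<Sum>y\<in>Q. \<beta>' y)"
        by (simp add: sum.distrib sum_distrib_left)
      also have "\<dots> \<le> 2 powr q * (\<Sum>y\<in>Q. I y) + 2 powr q * e powr q * \<beta>"
        using mass by (intro add_left_mono mult_left_mono) (auto simp: \<beta>'_def \<beta>_def)
      finally have "e powr q * \<beta> + (\<Sum>y\<in>Q. 2 powr q * I y + 2 powr q * e powr q * \<beta>' y) \<le> (1 + 2 powr q) * e powr q * \<beta> + 2 powr q * (\<Sum>y\<in>Q. I y)"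
        by (simp add: algebra_simps)
      also have "(1 + 2 powr q) * e powr q = (C * e) powr q"
        using q e(1) by (simp add: C_def powr_mult powr_powr add_nonneg_nonneg)
      finally show "e powr q * \<beta> + (\<Sum>y\<in>Q. 2 powr q * I y + 2 powr q * e powr q * \<beta>' y) \<le> (C * e) powr q * \<beta> + 2 powr q * (\<Sum>y\<in>Q. I y)" .
    qed
    finally have int: "(\<integral>\<^sup>+z\<in>G. ennreal (\<bar>?F z\<bar> powr q) \<partial>lebesgue) \<le> ennreal ((C * e) powr q * \<beta> + 2 powr q * (\<Sum>y\<in>Q. I y))" .
    \<comment> \<open>The \<open>q\<close>-oscillation on \<open>Gq y\<close> times the 1/q-th power
      of the ball's share of measure; the l^q norm of \<open>v\<close> is what the small sets
      contribute to the \<open>q\<close>-mean on the large ball.\<close>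
    define v where "v y = (\<beta>' y / \<beta>) powr (1 / q) * (I y / \<beta>' y) powr (1 / q)" for y
    have vq: "v y powr q = I y / \<beta>" for y
      using I[of y] \<beta>(1) \<beta>(2)[of y] q by (simp add: v_def powr_mult powr_powr)
    have v0: "0 \<le> v y" for y by (simp add: v_def)
    obtain w where w: "\<And>y. 0 \<le> w y" "(\<Sum>y\<in>Q. w y powr (q / (q - 1))) \<le> 1"
      "(\<Sum>y\<in>Q. v y powr q) powr (1 / q) = (\<Sum>y\<in>Q. v y * w y)"
      by (rule lq_dual_weights[of Q v q, OF Q v0 q]) blast
    have C0: "0 \<le> C" by (simp add: C_def)
    have sI: "0 \<le> (\<Sum>y\<in>Q. I y)" using I by (intro sum_nonneg)
    have "osc_on q d f x k G \<le> epow (ennreal (inverse \<beta>) * ennreal ((C * e) powr q * \<beta> + 2 powr q * (\<Sum>y\<in>Q. I y))) (1 / q)"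
      unfolding osc_on_def using int q by (intro epow_mono mult_mono) (auto simp: \<beta>_def powr_minus)
    also have "\<dots> = ennreal (((C * e) powr q + 2 powr q * (\<Sum>y\<in>Q. v y powr q)) powr (1 / q))"
    proof -
      have "inverse \<beta> * ((C * e) powr q * \<beta> + 2 powr q * (\<Sum>y\<in>Q. I y)) = (C * e) powr q + 2 powr q * (\<Sum>y\<in>Q. v y powr q)"
        unfolding vq sum_divide_distrib[symmetric] using \<beta>(1) by (simp add: field_simps)
      moreover have "0 \<le> (C * e) powr q + 2 powr q * (\<Sum>y\<in>Q. v y powr q)" by (intro add_nonneg_nonneg mult_nonneg_nonneg sum_nonneg) auto
      ultimately show ?thesis using \<beta>(1) by (subst ennreal_mult'[symmetric]) (simp_all only: epow_ennreal, simp)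
    qed
    also have "\<dots> \<le> ennreal (C * e + 2 * (\<Sum>y\<in>Q. v y * w y))"
    proof (rule ennreal_leI)
      have "((C * e) powr q + 2 powr q * (\<Sum>y\<in>Q. v y powr q)) powr (1 / q) \<le> ((C * e) powr q) powr (1 / q) + (2 powr q * (\<Sum>y\<in>Q. v y powr q)) powr (1 / q)"
        using q by (intro powr_add_subadditive) (auto intro!: mult_nonneg_nonneg sum_nonneg)
      also have "\<dots> = C * e + 2 * (\<Sum>y\<in>Q. v y * w y)"
        using q C0 e(1) by (simp add: powr_mult powr_powr sum_nonneg w(3))
      finally show "((C * e) powr q + 2 powr q * (\<Sum>y\<in>Q. v y powr q)) powr (1 / q) \<le> C * e + 2 * (\<Sum>y\<in>Q. v y * w y)" .
    qed
    finally have "ennreal \<beta> * osc_on q d f x k G \<le> ennreal \<beta> * ennreal (C * e + 2 * (\<Sum>y\<in>Q. v y * w y))"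
      by (intro mult_left_mono) auto
    also have "\<dots> = ennreal (C * (\<beta> * e) + 2 * (\<Sum>y\<in>Q. \<beta> * (v y * w y)))"
      using \<beta>(1) by (simp add: ennreal_mult'[symmetric] distrib_left sum_distrib_left mult_ac)
    also have "\<dots> = ennreal (C * (\<beta> * e)) + 2 * (\<Sum>y\<in>Q. ennreal (\<beta> * (v y * w y)))"
    proof -
      have "(\<Sum>y\<in>Q. ennreal (\<beta> * (v y * w y))) = ennreal (\<Sum>y\<in>Q. \<beta> * (v y * w y))"
        using \<beta>(1) v0 w(1) by (intro sum_ennreal) simp
      moreover have "0 \<le> (\<Sum>y\<in>Q. \<beta> * (v y * w y))" using \<beta>(1) v0 w(1) by (intro sum_nonneg) simp
      ultimately show ?thesis using C0 \<beta>(1) e(1) by (simp add: ennreal_mult flip: ennreal_numeral)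
    qed
    also have "ennreal (C * (\<beta> * e)) = ennreal (C * L) * (ennreal \<beta> * E)"
      using C0 L \<beta>(1) E by (simp add: e_def ennreal_mult mult_ac)
    also have "(\<Sum>y\<in>Q. ennreal (\<beta> * (v y * w y))) = (\<Sum>y\<in>Q. ennreal ((\<beta> / \<beta>' y) powr ((q - 1) / q) * w y * \<beta>' y) * osc_on q d f y (jj y) (Gq y))"
    proof (intro sum.cong refl)
      fix y assume y: "y \<in> Q"
      have "\<beta> * (\<beta>' y / \<beta>) powr (1 / q) = (\<beta> / \<beta>' y) powr ((q - 1) / q) * \<beta>' y"
      proof -
        have "(\<beta> / \<beta>' y) powr ((q - 1) / q) = (\<beta> / \<beta>' y) powr (1 + - (1 / q))" using q by (simp add: field_simps)
        also have "\<dots> = \<beta> / \<beta>' y * (\<beta> / \<beta>' y) powr - (1 / q)" using \<beta>(1) \<beta>(2)[of y] by (subst powr_add) simp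
        also have "(\<beta> / \<beta>' y) powr - (1 / q) = (\<beta>' y / \<beta>) powr (1 / q)"
          using \<beta>(1) \<beta>(2)[of y] by (simp add: powr_minus powr_divide)
        finally show ?thesis using \<beta>(2)[of y] by simp
      qed
      then have eq: "\<beta> * (v y * w y) = (\<beta> / \<beta>' y) powr ((q - 1) / q) * w y * \<beta>' y * (I y / \<beta>' y) powr (1 / q)"
        by (simp add: v_def mult_ac)
      show "ennreal (\<beta> * (v y * w y)) = ennreal ((\<beta> / \<beta>' y) powr ((q - 1) / q) * w y * \<beta>' y) * osc_on q d f y (jj y) (Gq y)"
        unfolding oy[OF y] eq using w(1)[of y] \<beta>(2)[of y] by (intro ennreal_mult') (simp add: less_imp_le)
    qed
    finally show "\<exists>w. (\<forall>y. 0 \<le> w y) \<and> (\<Sum>y\<in>Q. w y powr (q / (q - 1))) \<le> 1 \<and>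
      ennreal (b powr k) * osc_on q d f x k G \<le> ennreal (C * L) * (ennreal (b powr k) * E) +
        2 * (\<Sum>y\<in>Q. ennreal ((b powr k / b powr jj y) powr ((q - 1) / q) * w y * b powr jj y) * osc_on q d f y (jj y) (Gq y))"
      using w(1,2) unfolding \<beta>_def \<beta>'_def by blast
  qed
qed

end

section \<open>The exponent of the oscillation\<close>

context anisotropic begin

text \<open>The missing part is measured relative to each ball, so that the defects of the stopping
  balls add up to \<delta> times their small total measure.\<close>

definition good_cover :: "real \<Rightarrow> (real^'n \<Rightarrow> int \<Rightarrow> (real^'n) set) \<Rightarrow> bool" where
  "good_cover \<delta> G \<longleftrightarrow> (\<forall>x k. G x k \<in> sets lebesgue \<and> G x k \<subseteq> Bl x k \<and>
     emeasure lebesgue (Bl x k - G x k) \<le> ennreal (\<delta> * b powr k))"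

lemma osc_finite: "locint f \<Longrightarrow> osc d x k f < top"
  unfolding osc_def by (intro av_finite locint_diff_proj)

text \<open>Sets \<open>H\<close> that already work on the enlarged stopping balls are carried back
  to the original ball. The new set misses \<open>R\<close> and the defects of \<open>H\<close>, and
  the latter are scaled by the small share b^(sig - m) of the stopping balls.\<close>

lemma good_cover_step:
  fixes d m :: nat
  assumes q: "1 < q" and m: "2 * sig \<le> m"
  obtains K where "0 \<le> K" "\<And>f \<delta> \<tau> H x k. Lloc q f \<Longrightarrow> good_cover \<delta> H \<Longrightarrow> 0 \<le> \<delta> \<Longrightarrow> 0 < (\<tau>::real) \<Longrightarrow>
    \<exists>G Q j w. G \<in> sets lebesgue \<and> G \<subseteq> Bl x k \<and>
      emeasure lebesgue (Bl x k - G) \<le> ennreal ((\<tau> + \<delta> * b powr (real sig - real m)) * b powr k) \<and>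
      finite Q \<and> disjoint_family_on (\<lambda>y. Bl y (j y)) Q \<and> (\<forall>y\<in>Q. Bl y (j y) \<subseteq> Bl x (k + int sig)) \<and>
      (\<Sum>y\<in>Q. b powr j y) \<le> b powr - real m * b powr k \<and>
      (\<forall>y. 0 \<le> w y) \<and> (\<Sum>y\<in>Q. w y powr (q / (q - 1))) \<le> 1 \<and>
      ennreal (b powr k) * osc_on q d f x k G \<le> ennreal K * (ennreal (b powr k) * osc d x (k + int sig) f) +
        2 * (\<Sum>y\<in>Q. ennreal ((b powr k / b powr j y) powr ((q - 1) / q) * w y * b powr (j y + int sig)) *
          osc_on q d f y (j y + int sig) (H y (j y + int sig)))"
proof -
  obtain C1 where C1: "0 \<le> C1" "\<And>f x k m \<tau>. locint f \<Longrightarrow> 2 * sig \<le> m \<Longrightarrow> 0 < (\<tau>::real) \<Longrightarrow>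
    \<exists>G j R. finite G \<and> disjoint_family_on (\<lambda>y. Bl y (j y)) G \<and>
      (\<forall>y\<in>G. Bl y (j y) \<subseteq> Bl x (k + int sig)) \<and>
      (\<Sum>y\<in>G. b powr j y) \<le> b powr - real m * b powr k \<and>
      R \<in> sets lebesgue \<and> emeasure lebesgue R \<le> ennreal \<tau> \<and>
      (AE z in lebesgue. z \<in> Bl x k \<longrightarrow> z \<notin> R \<longrightarrow> z \<notin> (\<Union>y\<in>G. Bl y (j y + int sig)) \<longrightarrow>
        ennreal \<bar>f z - proj d x (k + int sig) f z\<bar> \<le> ennreal (b powr (real m + real sig)) * osc d x (k + int sig) f) \<and>
      (\<forall>y\<in>G. \<forall>z\<in>Bl y (j y + int sig). ennreal \<bar>proj d y (j y + int sig + int sig) f z - proj d x (k + int sig) f z\<bar>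
        \<le> ennreal (C1 * b powr (real m + real sig)) * osc d x (k + int sig) f)"
    by (rule stopping_step[of d]) (rule that)
  obtain C3 where C3: "0 \<le> C3" "\<And>f x k G Q jj Gq E L. Lloc q f \<Longrightarrow> finite Q \<Longrightarrow> 0 \<le> L \<Longrightarrow> E < top \<Longrightarrow>
    G \<in> sets lebesgue \<Longrightarrow> (\<And>y. y \<in> Q \<Longrightarrow> Gq y \<in> sets lebesgue) \<Longrightarrow> (\<And>y. y \<in> Q \<Longrightarrow> Gq y \<subseteq> Bl y (jj y)) \<Longrightarrow>
    G \<subseteq> Bl x k \<Longrightarrow> (\<Sum>y\<in>Q. b powr jj y) \<le> b powr k \<Longrightarrow>
    (AE z in lebesgue. z \<in> G \<longrightarrow> z \<notin> (\<Union>y\<in>Q. Gq y) \<longrightarrow> ennreal \<bar>f z - proj d x (k + int sig) f z\<bar> \<le> ennreal L * E) \<Longrightarrow>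
    (\<And>y z. y \<in> Q \<Longrightarrow> z \<in> Gq y \<Longrightarrow> ennreal \<bar>proj d y (jj y + int sig) f z - proj d x (k + int sig) f z\<bar> \<le> ennreal L * E) \<Longrightarrow>
    \<exists>w. (\<forall>y. 0 \<le> w y) \<and> (\<Sum>y\<in>Q. w y powr (q / (q - 1))) \<le> 1 \<and>
      ennreal (b powr k) * osc_on q d f x k G \<le> ennreal (C3 * L) * (ennreal (b powr k) * E) +
        2 * (\<Sum>y\<in>Q. ennreal ((b powr k / b powr jj y) powr ((q - 1) / q) * w y * b powr jj y) * osc_on q d f y (jj y) (Gq y))"
  proof (rule oscillation_recursion[OF q, of d], goal_cases)
    case (1 C)
    show thesis by (rule that[of C]) (fact 1)+
  qed
  define L where "L = max 1 C1 * b powr (real m + real sig)"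
  have L: "0 \<le> L" "b powr (real m + real sig) \<le> L" "C1 * b powr (real m + real sig) \<le> L"
    by (auto simp: L_def intro: mult_right_mono order_trans[OF _ mult_right_mono[of 1]])
  show ?thesis
  proof (rule that[of "C3 * L"])
    show "0 \<le> C3 * L" using C3(1) L(1) by simp
    fix f :: "real^'n \<Rightarrow> real" and \<delta> \<tau> and H :: "real^'n \<Rightarrow> int \<Rightarrow> (real^'n) set" and x and k :: int
    assume f: "Lloc q f" and H: "good_cover \<delta> H" and \<delta>: "0 \<le> \<delta>" and \<tau>: "0 < (\<tau>::real)"
    have fl: "locint f" using Lloc_locint[OF f] q by simp
    have Hm: "H y i \<in> sets lebesgue" and Hs: "H y i \<subseteq> Bl y i"
      and He: "emeasure lebesgue (Bl y i - H y i) \<le> ennreal (\<delta> * b powr i)" for y i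
      using H by (auto simp: good_cover_def)
    have \<tau>': "0 < \<tau> * b powr k" using \<tau> b_powr_pos by simp
    let ?E = "osc d x (k + int sig) f"
    obtain Q j R where Q: "finite Q" "disjoint_family_on (\<lambda>y. Bl y (j y)) Q" "\<forall>y\<in>Q. Bl y (j y) \<subseteq> Bl x (k + int sig)"
      "(\<Sum>y\<in>Q. b powr j y) \<le> b powr - real m * b powr k" "R \<in> sets lebesgue" "emeasure lebesgue R \<le> ennreal (\<tau> * b powr k)"
      and ae: "AE z in lebesgue. z \<in> Bl x k \<longrightarrow> z \<notin> R \<longrightarrow> z \<notin> (\<Union>y\<in>Q. Bl y (j y + int sig)) \<longrightarrow>
        ennreal \<bar>f z - proj d x (k + int sig) f z\<bar> \<le> ennreal (b powr (real m + real sig)) * ?E"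
      and pr: "\<forall>y\<in>Q. \<forall>z\<in>Bl y (j y + int sig). ennreal \<bar>proj d y (j y + int sig + int sig) f z - proj d x (k + int sig) f z\<bar>
        \<le> ennreal (C1 * b powr (real m + real sig)) * ?E"
      using C1(2)[OF fl m \<tau>', of x k] by blast
    define jj where "jj y = j y + int sig" for y
    define Gq where "Gq y = H y (jj y)" for y
    define B where "B = (\<Union>y\<in>Q. Bl y (jj y))"
    define G where "G = Bl x k \<inter> ((- R - B) \<union> (\<Union>y\<in>Q. Gq y))"
    have Bm: "B \<in> sets lebesgue" unfolding B_def by (rule sets.finite_UN[OF Q(1)]) auto
    have GQm: "(\<Union>y\<in>Q. Gq y) \<in> sets lebesgue" unfolding Gq_def by (rule sets.finite_UN[OF Q(1) Hm])
    have Gm: "G \<in> sets lebesgue"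
    proof -
      have "- R \<in> sets lebesgue" using sets.compl_sets[OF Q(5)] by (simp add: Compl_eq_Diff_UNIV)
      then show ?thesis unfolding G_def using Bm GQm by (intro sets.Int sets.Un sets.Diff) auto
    qed
    have sumjj: "(\<Sum>y\<in>Q. b powr jj y) \<le> b powr (real sig - real m) * b powr k"
    proof -
      have "(\<Sum>y\<in>Q. b powr jj y) = b powr real sig * (\<Sum>y\<in>Q. b powr j y)"
        unfolding sum_distrib_left jj_def by (simp add: powr_add[symmetric] add.commute)
      also have "\<dots> \<le> b powr real sig * (b powr - real m * b powr k)" by (intro mult_left_mono Q(4)) simp
      finally show ?thesis by (simp add: powr_diff powr_minus divide_inverse)
    qed
    have s1: "b powr (real sig - real m) \<le> 1"
      using m b_gt_1 powr_mono[of "real sig - real m" 0 b] by simp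
    have sumk: "(\<Sum>y\<in>Q. b powr jj y) \<le> b powr k"
      using order_trans[OF sumjj mult_right_mono[OF s1]] by simp
    have em: "emeasure lebesgue (Bl x k - G) \<le> ennreal ((\<tau> + \<delta> * b powr (real sig - real m)) * b powr k)"
    proof -
      have "emeasure lebesgue (Bl x k - G) \<le> emeasure lebesgue (R \<union> (\<Union>y\<in>Q. Bl y (jj y) - Gq y))"
        unfolding G_def B_def using Q(1,5) Hm by (intro emeasure_mono) (auto simp: Gq_def intro!: sets.Un sets.finite_UN)
      also have "\<dots> \<le> emeasure lebesgue R + emeasure lebesgue (\<Union>y\<in>Q. Bl y (jj y) - Gq y)"
        using Q(1,5) Hm by (intro emeasure_subadditive) (auto simp: Gq_def intro!: sets.finite_UN)
      also have "\<dots> \<le> ennreal (\<tau> * b powr k) + (\<Sum>y\<in>Q. emeasure lebesgue (Bl y (jj y) - Gq y))"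
        using Q(1,6) Hm by (intro add_mono emeasure_subadditive_finite) (auto simp: Gq_def)
      also have "\<dots> \<le> ennreal (\<tau> * b powr k) + (\<Sum>y\<in>Q. ennreal (\<delta> * b powr jj y))"
        unfolding Gq_def by (intro add_left_mono sum_mono He)
      also have "(\<Sum>y\<in>Q. ennreal (\<delta> * b powr jj y)) = ennreal (\<Sum>y\<in>Q. \<delta> * b powr jj y)"
        using \<delta> by (intro sum_ennreal) simp
      also have "(\<Sum>y\<in>Q. \<delta> * b powr jj y) = \<delta> * (\<Sum>y\<in>Q. b powr jj y)" by (simp add: sum_distrib_left)
      also have "ennreal (\<tau> * b powr k) + ennreal (\<delta> * (\<Sum>y\<in>Q. b powr jj y)) = ennreal (\<tau> * b powr k + \<delta> * (\<Sum>y\<in>Q. b powr jj y))"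
        using \<tau> \<delta> by (intro ennreal_plus[symmetric]) (auto intro!: mult_nonneg_nonneg sum_nonneg)
      also have "\<dots> \<le> ennreal (\<tau> * b powr k + \<delta> * (b powr (real sig - real m) * b powr k))"
        by (intro ennreal_leI add_left_mono mult_left_mono sumjj \<delta>)
      finally show ?thesis by (simp add: algebra_simps)
    qed
    have LE: "ennreal c * ?E \<le> ennreal L * ?E" if "c \<le> L" for c
      using that by (intro mult_right_mono ennreal_leI) auto
    have ae': "AE z in lebesgue. z \<in> G \<longrightarrow> z \<notin> (\<Union>y\<in>Q. Gq y) \<longrightarrow> ennreal \<bar>f z - proj d x (k + int sig) f z\<bar> \<le> ennreal L * ?E"
      using ae by (rule AE_mp) (auto simp: G_def B_def jj_def intro!: AE_I2 order_trans[OF _ LE[OF L(2)]])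
    have pr': "ennreal \<bar>proj d y (jj y + int sig) f z - proj d x (k + int sig) f z\<bar> \<le> ennreal L * ?E" if "y \<in> Q" "z \<in> Gq y" for y z
    proof -
      have "z \<in> Bl y (j y + int sig)" using that(2) Hs[of y "jj y"] by (auto simp: Gq_def jj_def)
      then show ?thesis using pr that(1) LE[OF L(3)] unfolding jj_def by (blast intro: order_trans)
    qed
    have Gs: "G \<subseteq> Bl x k" by (auto simp: G_def)
    obtain w where w: "\<And>y. 0 \<le> w y" "(\<Sum>y\<in>Q. w y powr (q / (q - 1))) \<le> 1"
      and wo: "ennreal (b powr k) * osc_on q d f x k G \<le> ennreal (C3 * L) * (ennreal (b powr k) * ?E) +
        2 * (\<Sum>y\<in>Q. ennreal ((b powr k / b powr jj y) powr ((q - 1) / q) * w y * b powr jj y) * osc_on q d f y (jj y) (Gq y))"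
      using C3(2)[OF f Q(1) L(1) osc_finite[OF fl] Gm _ _ Gs sumk ae' pr'] Hm Hs unfolding Gq_def by blast
    \<comment> \<open>The packing estimate concerns the disjoint balls before enlargement, so the
      ratio is rewritten with \<open>j\<close>, which only increases it.\<close>
    have "(\<Sum>y\<in>Q. ennreal ((b powr k / b powr jj y) powr ((q - 1) / q) * w y * b powr jj y) * osc_on q d f y (jj y) (Gq y))
        \<le> (\<Sum>y\<in>Q. ennreal ((b powr k / b powr j y) powr ((q - 1) / q) * w y * b powr jj y) * osc_on q d f y (jj y) (Gq y))"
    proof (intro sum_mono mult_right_mono ennreal_leI powr_mono2)
      fix y
      show "b powr k / b powr jj y \<le> b powr k / b powr j y"
        using b_gt_1 by (intro divide_left_mono powr_mono) (auto simp: jj_def)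
    qed (use q w(1) in auto)
    then have "2 * (\<Sum>y\<in>Q. ennreal ((b powr k / b powr jj y) powr ((q - 1) / q) * w y * b powr jj y) * osc_on q d f y (jj y) (Gq y))
        \<le> 2 * (\<Sum>y\<in>Q. ennreal ((b powr k / b powr j y) powr ((q - 1) / q) * w y * b powr jj y) * osc_on q d f y (jj y) (Gq y))"
      by (intro mult_left_mono) auto
    then have "ennreal (b powr k) * osc_on q d f x k G \<le> ennreal (C3 * L) * (ennreal (b powr k) * ?E) +
        2 * (\<Sum>y\<in>Q. ennreal ((b powr k / b powr j y) powr ((q - 1) / q) * w y * b powr jj y) * osc_on q d f y (jj y) (Gq y))"
      by (intro order_trans[OF wo] add_left_mono)
    then show "\<exists>G Q j w. G \<in> sets lebesgue \<and> G \<subseteq> Bl x k \<and>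
      emeasure lebesgue (Bl x k - G) \<le> ennreal ((\<tau> + \<delta> * b powr (real sig - real m)) * b powr k) \<and>
      finite Q \<and> disjoint_family_on (\<lambda>y. Bl y (j y)) Q \<and> (\<forall>y\<in>Q. Bl y (j y) \<subseteq> Bl x (k + int sig)) \<and>
      (\<Sum>y\<in>Q. b powr j y) \<le> b powr - real m * b powr k \<and>
      (\<forall>y. 0 \<le> w y) \<and> (\<Sum>y\<in>Q. w y powr (q / (q - 1))) \<le> 1 \<and>
      ennreal (b powr k) * osc_on q d f x k G \<le> ennreal (C3 * L) * (ennreal (b powr k) * osc d x (k + int sig) f) +
        2 * (\<Sum>y\<in>Q. ennreal ((b powr k / b powr j y) powr ((q - 1) / q) * w y * b powr (j y + int sig)) *
          osc_on q d f y (j y + int sig) (H y (j y + int sig)))"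
      using Gm Gs em Q(1-4) w unfolding jj_def Gq_def
      by (intro exI[of _ G] exI[of _ Q] exI[of _ j] exI[of _ w] conjI) auto
  qed
qed

text \<open>The defects 2^-n are summable, so by Borel-Cantelli almost every point of the ball lies
  in \<open>G n x k\<close> from some \<open>n\<close> on. The sets need not be monotone in
  \<open>n\<close>; dominated convergence suffices.\<close>

lemma osc_on_limit:
  assumes f: "Lloc q f" and q: "1 \<le> q" and G: "\<And>n::nat. good_cover ((1 / 2) ^ n) (G n)"
  shows "(\<lambda>n. osc_on q d f x k (G n x k)) \<longlonglongrightarrow> osc_on q d f x k (Bl x k)"
proof -
  have Gm[measurable]: "G n x k \<in> sets lebesgue" and Gs: "G n x k \<subseteq> Bl x k"
    and Ge: "emeasure lebesgue (Bl x k - G n x k) \<le> ennreal ((1 / 2) ^ n * b powr k)" for n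
    using G[of n] by (auto simp: good_cover_def)
  define F where "F = (\<lambda>z. f z - proj d x (k + int sig) f z)"
  have [measurable]: "F \<in> borel_measurable lebesgue"
    unfolding F_def by (intro locint_measurable locint_diff_proj Lloc_locint[OF f q])
  have fin: "(\<integral>\<^sup>+z\<in>E. ennreal (\<bar>F z\<bar> powr q) \<partial>lebesgue) < top" if "E \<subseteq> Bl x k" for E
    unfolding F_def by (rule osc_on_finite[OF f q that])
  have Gfin: "emeasure lebesgue (Bl x k - G n x k) < \<infinity>" for n
    using le_less_trans[OF Ge ennreal_less_top] by simp
  have "AE z in lebesgue. eventually (\<lambda>n. z \<in> space lebesgue - (Bl x k - G n x k)) sequentially"
  proof (rule borel_cantelli_AE1)
    have "summable (\<lambda>n. (1 / 2) ^ n * b powr k)" by (intro summable_mult2 summable_geometric) simp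
    moreover have "norm (measure lebesgue (Bl x k - G n x k)) \<le> (1 / 2) ^ n * b powr k" for n
      using Ge[of n] by (simp add: measure_def enn2real_leI)
    ultimately show "summable (\<lambda>n. measure lebesgue (Bl x k - G n x k))" by (rule summable_comparison_test')
  qed (use Gfin in auto)
  then have "AE z in lebesgue. (\<lambda>n. ennreal (\<bar>F z\<bar> powr q) * indicator (G n x k) z) \<longlonglongrightarrow> ennreal (\<bar>F z\<bar> powr q) * indicator (Bl x k) z"
  proof (rule AE_mp, intro AE_I2 impI)
    fix z assume "eventually (\<lambda>n. z \<in> space lebesgue - (Bl x k - G n x k)) sequentially"
    then have "eventually (\<lambda>n. ennreal (\<bar>F z\<bar> powr q) * indicator (G n x k) z = ennreal (\<bar>F z\<bar> powr q) * indicator (Bl x k) z) sequentially"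
      by eventually_elim (use Gs in \<open>auto simp: indicator_def\<close>)
    then show "(\<lambda>n. ennreal (\<bar>F z\<bar> powr q) * indicator (G n x k) z) \<longlonglongrightarrow> ennreal (\<bar>F z\<bar> powr q) * indicator (Bl x k) z"
      by (rule tendsto_eventually)
  qed
  then have "(\<lambda>n. \<integral>\<^sup>+z\<in>G n x k. ennreal (\<bar>F z\<bar> powr q) \<partial>lebesgue) \<longlonglongrightarrow> (\<integral>\<^sup>+z\<in>Bl x k. ennreal (\<bar>F z\<bar> powr q) \<partial>lebesgue)"
    using fin[OF order_refl] Gs
    by (intro nn_integral_dominated_convergence[where w="\<lambda>z. ennreal (\<bar>F z\<bar> powr q) * indicator (Bl x k) z"]) (auto simp: indicator_def)
  moreover define J where "J E = enn2real (\<integral>\<^sup>+z\<in>E. ennreal (\<bar>F z\<bar> powr q) \<partial>lebesgue)" for E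
  have J: "(\<integral>\<^sup>+z\<in>E. ennreal (\<bar>F z\<bar> powr q) \<partial>lebesgue) = ennreal (J E)" if "E \<subseteq> Bl x k" for E
    using fin[OF that] by (simp add: J_def)
  ultimately have "(\<lambda>n. ennreal (J (G n x k))) \<longlonglongrightarrow> ennreal (J (Bl x k))" using Gs by simp
  then have "(\<lambda>n. J (G n x k)) \<longlonglongrightarrow> J (Bl x k)" by (rule tendsto_ennrealD) (auto simp: J_def)
  then have "(\<lambda>n. ennreal ((b powr - k * J (G n x k)) powr (1 / q))) \<longlonglongrightarrow> ennreal ((b powr - k * J (Bl x k)) powr (1 / q))"
    using q by (intro tendsto_ennrealI tendsto_powr' tendsto_mult tendsto_const) (auto simp: J_def)
  moreover have "osc_on q d f x k E = ennreal ((b powr - k * J E) powr (1 / q))" if "E \<subseteq> Bl x k" for E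
  proof -
    have "osc_on q d f x k E = epow (ennreal (b powr - k) * ennreal (J E)) (1 / q)"
      unfolding osc_on_def J[OF that, symmetric] by (simp add: F_def)
    moreover have "0 \<le> J E" by (simp add: J_def)
    ultimately show ?thesis by (simp add: ennreal_mult'[symmetric])
  qed
  ultimately show ?thesis using Gs by simp
qed

end

context qbfs begin

text \<open>Exchanging the polynomial of the enlarged ball for that of the ball itself costs the
  projection of the difference \<open>F\<close>, which is bounded by the mean of \<open>F\<close>
  and so by its \<open>q\<close>-mean.\<close>

lemma oscq_le_osc_on:
  fixes d :: nat
  assumes q: "1 \<le> q"
  obtains C where "0 \<le> C" "\<And>f x k. Lloc q f \<Longrightarrow>
    oscq q d x k f \<le> ennreal C * osc_on q d f x k (Bl x k)"
proof -
  obtain C where C: "1 \<le> C" "\<And>x k g z. locint g \<Longrightarrow> z \<in> Bl x k \<Longrightarrow> ennreal \<bar>proj d x k g z\<bar> \<le> ennreal C * av x k g"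
    by (rule proj_bound_Bl[of d]) blast
  show ?thesis
  proof (rule that[of "2 * (1 + C powr q) powr (1 / q)"])
    show "0 \<le> 2 * (1 + C powr q) powr (1 / q)" by simp
    fix f :: "real^'n \<Rightarrow> real" and x k assume f: "Lloc q f"
    have fl: "locint f" by (rule Lloc_locint[OF f q])
    define F where "F = (\<lambda>z. f z - proj d x (k + int sig) f z)"
    have F: "locint F" unfolding F_def by (rule locint_diff_proj[OF fl])
    have [measurable]: "F \<in> borel_measurable lebesgue" by (rule locint_measurable[OF F])
    have pF: "proj d x k F = (\<lambda>z. proj d x k f z - proj d x (k + int sig) f z)"
      unfolding F_def by (rule proj_diff_poly[OF fl proj_poly_le[OF fl]])
    define I where "I = enn2real (\<integral>\<^sup>+z\<in>Bl x k. ennreal (\<bar>F z\<bar> powr q) \<partial>lebesgue)"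
    have I: "(\<integral>\<^sup>+z\<in>Bl x k. ennreal (\<bar>F z\<bar> powr q) \<partial>lebesgue) = ennreal I" "0 \<le> I"
      using osc_on_finite[OF f q order_refl, of d x k] by (simp_all add: I_def F_def)
    define e where "e = (b powr - real_of_int k * I) powr (1 / q)"
    have e0: "0 \<le> e" by (simp add: e_def)
    have eq: "e powr q = b powr - real_of_int k * I" using q I(2) by (simp add: e_def powr_powr)
    have oe: "osc_on q d f x k (Bl x k) = ennreal e"
      unfolding osc_on_def F_def[symmetric] using I by (simp add: F_def e_def ennreal_mult'[symmetric])
    have "av x k F \<le> ennreal e"
      using av_le_powr_mean[OF q locint_measurable[OF F], of x k] I
      by (simp add: emeasure_Bl divide_ennreal_powr e_def ennreal_mult'[symmetric])
    then have PB: "\<bar>proj d x k F z\<bar> \<le> C * e" if "z \<in> Bl x k" for z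
    proof -
      have "ennreal \<bar>proj d x k F z\<bar> \<le> ennreal C * ennreal e"
        using C(2)[OF F that] mult_left_mono[OF \<open>av x k F \<le> ennreal e\<close>, of "ennreal C"] by (blast intro: order_trans zero_le)
      then show ?thesis using C(1) e0 by (simp add: ennreal_mult'[symmetric] ennreal_le_iff)
    qed
    have "(\<integral>\<^sup>+ z\<in>Bl x k. ennreal (\<bar>f z - proj d x k f z\<bar> powr q) \<partial>lebesgue)
        \<le> (\<integral>\<^sup>+ z. ennreal (2 powr q) * (ennreal (\<bar>F z\<bar> powr q) * indicator (Bl x k) z) + ennreal (2 powr q * (C * e) powr q) * indicator (Bl x k) z \<partial>lebesgue)"
    proof (intro nn_integral_mono)
      fix z
      show "ennreal (\<bar>f z - proj d x k f z\<bar> powr q) * indicator (Bl x k) z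
        \<le> ennreal (2 powr q) * (ennreal (\<bar>F z\<bar> powr q) * indicator (Bl x k) z) + ennreal (2 powr q * (C * e) powr q) * indicator (Bl x k) z"
      proof (cases "z \<in> Bl x k")
        case True
        have "\<bar>f z - proj d x k f z\<bar> powr q = \<bar>F z + - proj d x k F z\<bar> powr q" unfolding pF by (simp add: F_def)
        also have "\<dots> \<le> 2 powr q * (\<bar>F z\<bar> powr q + \<bar>- proj d x k F z\<bar> powr q)"
          by (rule powr_abs_add_le) (use q in simp)
        also have "\<dots> \<le> 2 powr q * \<bar>F z\<bar> powr q + 2 powr q * (C * e) powr q"
          unfolding distrib_left using PB[OF True] q by (intro add_mono mult_left_mono powr_mono2) auto
        finally have "ennreal (\<bar>f z - proj d x k f z\<bar> powr q) \<le> ennreal (2 powr q * \<bar>F z\<bar> powr q + 2 powr q * (C * e) powr q)"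
          by (rule ennreal_leI)
        then show ?thesis using True by (simp add: ennreal_mult)
      qed simp
    qed
    also have "\<dots> = ennreal (2 powr q) * ennreal I + ennreal (2 powr q * (C * e) powr q) * ennreal (b powr k)"
      by (subst nn_integral_add) (simp_all add: nn_integral_cmult emeasure_Bl I)
    also have "\<dots> = ennreal (2 powr q * I + 2 powr q * (C * e) powr q * b powr k)"
      using I(2) by (simp add: ennreal_mult)
    finally have "(\<integral>\<^sup>+ z\<in>Bl x k. ennreal (\<bar>f z - proj d x k f z\<bar> powr q) \<partial>lebesgue) / emeasure lebesgue (Bl x k)
        \<le> ennreal (b powr - real_of_int k) * ennreal (2 powr q * I + 2 powr q * (C * e) powr q * b powr k)"
      unfolding emeasure_Bl divide_ennreal_powr by (intro mult_left_mono) auto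
    also have "\<dots> = ennreal (b powr - real_of_int k * (2 powr q * I + 2 powr q * (C * e) powr q * b powr k))"
      by (simp only: ennreal_mult' powr_ge_zero)
    also have "b powr - real_of_int k * (2 powr q * I + 2 powr q * (C * e) powr q * b powr k) = (2 * (1 + C powr q) powr (1 / q) * e) powr q"
    proof -
      have "(2 * (1 + C powr q) powr (1 / q) * e) powr q = 2 powr q * (1 + C powr q) * e powr q"
        using q e0 C(1) by (simp add: powr_mult powr_powr add_nonneg_nonneg)
      also have "\<dots> = 2 powr q * e powr q + 2 powr q * (C powr q * e powr q)" by (simp add: algebra_simps)
      also have "C powr q * e powr q = (C * e) powr q" using C(1) e0 by (simp add: powr_mult)
      also have "2 powr q * e powr q + 2 powr q * (C * e) powr q = b powr - real_of_int k * (2 powr q * I) + (b powr - real_of_int k * b powr k) * (2 powr q * (C * e) powr q)"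
        using b_pos by (simp add: eq powr_minus)
      finally show ?thesis by (simp add: algebra_simps)
    qed
    finally have "oscq q d x k f \<le> epow (ennreal ((2 * (1 + C powr q) powr (1 / q) * e) powr q)) (1 / q)"
      unfolding oscq_def using q by (intro epow_mono) auto
    also have "\<dots> = ennreal (2 * (1 + C powr q) powr (1 / q) * e)" using q e0 by (simp add: powr_powr)
    finally show "oscq q d x k f \<le> ennreal (2 * (1 + C powr q) powr (1 / q)) * osc_on q d f x k (Bl x k)"
      unfolding oe by (simp add: ennreal_mult')
  qed
qed

end

context qbfs begin

text \<open>Testing on sets that only nearly exhaust the balls makes the empty cover available as a start of the
  iteration and avoids any a priori finiteness of the \<open>q\<close>-norm.\<close>

definition osc_tested :: "real \<Rightarrow> nat \<Rightarrow> (real^'n \<Rightarrow> real) \<Rightarrow> ennreal \<Rightarrow> (real^'n \<Rightarrow> int \<Rightarrow> (real^'n) set) \<Rightarrow> bool" where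
  "osc_tested q d f M G \<longleftrightarrow> (\<forall>(n::nat) xs ks c. (\<forall>i<n. 0 \<le> c i) \<longrightarrow>
     (\<Sum>i<n. ennreal (c i * b powr ks i) * osc_on q d f (xs i) (ks i) (G (xs i) (ks i))) \<le> M * N (fam {..<n} xs ks c))"

lemma osc_tested_sum:
  assumes t: "osc_tested q d f M G" and J: "finite J" and c: "\<And>j. j \<in> J \<Longrightarrow> 0 \<le> c j"
  shows "(\<Sum>j\<in>J. ennreal (c j * b powr ks j) * osc_on q d f (xs j) (ks j) (G (xs j) (ks j))) \<le> M * N (fam J xs ks c)"
proof -
  obtain h where h: "bij_betw h {..<card J} J"
    using ex_bij_betw_nat_finite[OF J] by (auto simp: atLeast0LessThan)
  have "(\<Sum>i<card J. ennreal ((c \<circ> h) i * b powr (ks \<circ> h) i) * osc_on q d f ((xs \<circ> h) i) ((ks \<circ> h) i) (G ((xs \<circ> h) i) ((ks \<circ> h) i)))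
      \<le> M * N (fam {..<card J} (xs \<circ> h) (ks \<circ> h) (c \<circ> h))"
    by (rule t[unfolded osc_tested_def, rule_format]) (use c bij_betwE[OF h] in auto)
  then show ?thesis
    unfolding fam_reindex[OF h]
    using sum.reindex_bij_betw[OF h, of "\<lambda>j. ennreal (c j * b powr ks j) * osc_on q d f (xs j) (ks j) (G (xs j) (ks j))"] by simp
qed

lemma osc_tested_limit:
  assumes f: "Lloc q f" and q: "1 \<le> q" and G: "\<And>n::nat. good_cover ((1 / 2) ^ n) (G n)" "\<And>n. osc_tested q d f M (G n)"
  shows "osc_tested q d f M Bl"
  unfolding osc_tested_def
proof (intro allI impI)
  fix n :: nat and xs ks and c :: "nat \<Rightarrow> real" assume c: "\<forall>i<n. 0 \<le> c i"
  show "(\<Sum>i<n. ennreal (c i * b powr ks i) * osc_on q d f (xs i) (ks i) (Bl (xs i) (ks i))) \<le> M * N (fam {..<n} xs ks c)"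
  proof (rule LIMSEQ_le_const2)
    show "(\<lambda>l. \<Sum>i<n. ennreal (c i * b powr ks i) * osc_on q d f (xs i) (ks i) (G l (xs i) (ks i)))
        \<longlonglongrightarrow> (\<Sum>i<n. ennreal (c i * b powr ks i) * osc_on q d f (xs i) (ks i) (Bl (xs i) (ks i)))"
      by (intro tendsto_sum ennreal_tendsto_cmult osc_on_limit[OF f q G(1)]) auto
    show "\<exists>l0. \<forall>l\<ge>l0. (\<Sum>i<n. ennreal (c i * b powr ks i) * osc_on q d f (xs i) (ks i) (G l (xs i) (ks i))) \<le> M * N (fam {..<n} xs ks c)"
      using G(2) c unfolding osc_tested_def by blast
  qed
qed

lemma camp_norm_le_tested:
  fixes d :: nat
  assumes q: "1 \<le> q"
  obtains C where "0 \<le> C" "\<And>f M. Lloc q f \<Longrightarrow> osc_tested q d f M Bl \<Longrightarrow> camp_norm A D N q d \<theta> f \<le> ennreal C * M"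
proof -
  obtain C where C: "0 \<le> C" "\<And>f x k. Lloc q f \<Longrightarrow> oscq q d x k f \<le> ennreal C * osc_on q d f x k (Bl x k)"
    by (rule oscq_le_osc_on[OF q, of d]) blast
  show ?thesis
  proof (rule that[OF C(1)])
    fix f M assume f: "Lloc q f" and t: "osc_tested q d f M Bl"
    show "camp_norm A D N q d \<theta> f \<le> ennreal C * M"
    proof (rule camp_norm_leI)
      fix m :: nat and xs ks and c :: "nat \<Rightarrow> real" assume c: "\<And>i. i < m \<Longrightarrow> 0 \<le> c i"
      have "(\<Sum>i<m. ennreal (c i * b powr ks i) * oscq q d (xs i) (ks i) f)
          \<le> (\<Sum>i<m. ennreal (c i * b powr ks i) * (ennreal C * osc_on q d f (xs i) (ks i) (Bl (xs i) (ks i))))"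
        by (intro sum_mono mult_left_mono C(2) f) auto
      also have "\<dots> = ennreal C * (\<Sum>i<m. ennreal (c i * b powr ks i) * osc_on q d f (xs i) (ks i) (Bl (xs i) (ks i)))"
        by (simp add: sum_distrib_left mult_ac)
      also have "\<dots> \<le> ennreal C * (M * N (fam {..<m} xs ks c))"
        using t c by (intro mult_left_mono) (auto simp: osc_tested_def)
      finally show "(\<Sum>i<m. ennreal (c i * b powr ks i) * oscq q d (xs i) (ks i) f) \<le> ennreal C * M * N (fam {..<m} xs ks c)"
        by (simp add: mult.assoc)
    qed
  qed
qed

end

context dual_space begin

text \<open>\<open>m\<close> is taken so large that the packing gain \<open>b powr (- m \<kappa>)\<close> turns the contribution of the stopped
  balls into half of the bound, so the constant \<open>K\<close> reproduces itself.\<close>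

lemma osc_tested_step:
  fixes d :: nat
  assumes q: "1 < q" "p0 < q / (q - 1)"
  obtains K \<eta> where "0 \<le> K" "0 \<le> \<eta>" "\<eta> \<le> 1 / 2"
    "\<And>f \<delta> \<tau> H. Lloc q f \<Longrightarrow> good_cover \<delta> H \<Longrightarrow> osc_tested q d f (ennreal K * camp_norm A D N 1 d \<theta> f) H \<Longrightarrow>
      0 \<le> \<delta> \<Longrightarrow> 0 < (\<tau>::real) \<Longrightarrow> \<exists>G. good_cover (\<tau> + \<delta> * \<eta>) G \<and> osc_tested q d f (ennreal K * camp_norm A D N 1 d \<theta> f) G"
proof -
  define t where "t = q / (q - 1)"
  have t: "(q - 1) / q = 1 / t" by (simp add: t_def)
  obtain Cp \<kappa> where Cp: "0 \<le> Cp" "0 < \<kappa>"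
    "\<And>(J :: nat set) (I :: nat \<Rightarrow> (real^'n) set) xs ks c Qx Qk w \<eta>. finite J \<Longrightarrow> (\<And>j. j \<in> J \<Longrightarrow> finite (I j)) \<Longrightarrow>
      (\<And>j. j \<in> J \<Longrightarrow> 0 \<le> c j) \<Longrightarrow>
      (\<And>j i. j \<in> J \<Longrightarrow> i \<in> I j \<Longrightarrow> Bl (Qx j i) (Qk j i) \<subseteq> Bl (xs j) (ks j + int sig)) \<Longrightarrow>
      (\<And>j i. j \<in> J \<Longrightarrow> i \<in> I j \<Longrightarrow> 0 \<le> w j i) \<Longrightarrow>
      (\<And>j. j \<in> J \<Longrightarrow> disjoint_family_on (\<lambda>i. Bl (Qx j i) (Qk j i)) (I j)) \<Longrightarrow>
      (\<And>j. j \<in> J \<Longrightarrow> (\<Sum>i\<in>I j. b powr Qk j i) \<le> \<eta> * b powr ks j) \<Longrightarrow>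
      (\<And>j. j \<in> J \<Longrightarrow> (\<Sum>i\<in>I j. w j i powr t) \<le> 1) \<Longrightarrow> 0 < \<eta> \<Longrightarrow>
      N (fam (Sigma J I) (\<lambda>p. Qx (fst p) (snd p)) (\<lambda>p. Qk (fst p) (snd p))
        (\<lambda>p. c (fst p) * (b powr ks (fst p) / b powr Qk (fst p) (snd p)) powr (1 / t) * w (fst p) (snd p)))
      \<le> ennreal (Cp * \<eta> powr \<kappa>) * N (fam J xs ks c)"
  proof (rule packing_bound[OF q(2)[folded t_def], where 'i=nat and 'k="real^'n"], goal_cases)
    case (1 C \<kappa>)
    show thesis by (rule that[of C \<kappa>]) (fact 1)+
  qed
  obtain Ce where Ce: "0 \<le> Ce" "\<And>(J :: nat set) xs ks c. finite J \<Longrightarrow> (\<And>j. j \<in> J \<Longrightarrow> 0 \<le> c j) \<Longrightarrow>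
    N (fam J xs (\<lambda>j. ks j + int sig) c) \<le> ennreal Ce * N (fam J xs ks c)"
    by (rule enlarged_family_bound[of sig, where 'i=nat]) blast
  obtain Ce' where Ce': "0 \<le> Ce'" "\<And>(J :: (nat \<times> (real^'n)) set) xs ks c. finite J \<Longrightarrow> (\<And>j. j \<in> J \<Longrightarrow> 0 \<le> c j) \<Longrightarrow>
    N (fam J xs (\<lambda>j. ks j + int sig) c) \<le> ennreal Ce' * N (fam J xs ks c)"
    by (rule enlarged_family_bound[of sig, where 'i="nat \<times> (real^'n)"]) blast
  have lim: "(\<lambda>m::nat. b powr (u - real m * v)) \<longlonglongrightarrow> 0" if "0 < v" for u v
  proof -
    have "(\<lambda>m. b powr u * (b powr - v) ^ m) \<longlonglongrightarrow> b powr u * 0"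
      using b_gt_1 that by (intro tendsto_mult LIMSEQ_power_zero tendsto_const) (simp add: powr_less_one)
    moreover have "b powr u * (b powr - v) ^ m = b powr (u - real m * v)" for m
      using b_pos by (simp add: powr_realpow[symmetric] powr_powr powr_add[symmetric] mult.commute)
    ultimately show ?thesis by simp
  qed
  have l1: "eventually (\<lambda>m::nat. b powr (real sig - real m) < 1 / 2) sequentially"
    using order_tendstoD(2)[OF lim[of 1 "real sig"], of "1 / 2"] by simp
  have "(\<lambda>m::nat. 2 * Ce' * Cp * b powr (0 - real m * \<kappa>)) \<longlonglongrightarrow> 2 * Ce' * Cp * 0"
    by (intro tendsto_mult tendsto_const lim Cp)
  then have l2: "eventually (\<lambda>m::nat. 2 * Ce' * Cp * b powr (0 - real m * \<kappa>) < 1 / 2) sequentially"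
    by (rule order_tendstoD(2)) simp
  \<comment> \<open>The first condition is required by the stopping construction, the second halves
    the uncovered proportion, the third halves the contribution of the stopped balls.\<close>
  obtain m where m: "2 * sig \<le> m" "b powr (real sig - real m) < 1 / 2" "2 * Ce' * Cp * b powr (0 - real m * \<kappa>) < 1 / 2"
    using eventually_happens'[OF sequentially_bot eventually_conj[OF eventually_ge_at_top[of "2 * sig"] eventually_conj[OF l1 l2]]] by blast
  obtain K0 where K0: "0 \<le> K0" "\<And>f \<delta> \<tau> H x k. Lloc q f \<Longrightarrow> good_cover \<delta> H \<Longrightarrow> 0 \<le> \<delta> \<Longrightarrow> 0 < (\<tau>::real) \<Longrightarrow>
    \<exists>G Q j w. G \<in> sets lebesgue \<and> G \<subseteq> Bl x k \<and>
      emeasure lebesgue (Bl x k - G) \<le> ennreal ((\<tau> + \<delta> * b powr (real sig - real m)) * b powr k) \<and>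
      finite Q \<and> disjoint_family_on (\<lambda>y. Bl y (j y)) Q \<and> (\<forall>y\<in>Q. Bl y (j y) \<subseteq> Bl x (k + int sig)) \<and>
      (\<Sum>y\<in>Q. b powr j y) \<le> b powr - real m * b powr k \<and>
      (\<forall>y. 0 \<le> w y) \<and> (\<Sum>y\<in>Q. w y powr (q / (q - 1))) \<le> 1 \<and>
      ennreal (b powr k) * osc_on q d f x k G \<le> ennreal K0 * (ennreal (b powr k) * osc d x (k + int sig) f) +
        2 * (\<Sum>y\<in>Q. ennreal ((b powr k / b powr j y) powr ((q - 1) / q) * w y * b powr (j y + int sig)) *
          osc_on q d f y (j y + int sig) (H y (j y + int sig)))"
    by (rule good_cover_step[OF q(1) m(1), of d]) (rule that)
  \<comment> \<open>The solution of K = K0 * Ce + K / 2, so that the same constant is recovered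
    after the step.\<close>
  define K where "K = 2 * (K0 * Ce)"
  have K: "0 \<le> K" using K0 Ce by (simp add: K_def)
  show ?thesis
  proof (rule that[OF K])
    show "0 \<le> b powr (real sig - real m)" "b powr (real sig - real m) \<le> 1 / 2" using m by auto
    fix f :: "real^'n \<Rightarrow> real" and \<delta> \<tau> H assume f: "Lloc q f" and H: "good_cover \<delta> H" and tH: "osc_tested q d f (ennreal K * camp_norm A D N 1 d \<theta> f) H"
      and \<delta>: "0 \<le> \<delta>" and \<tau>: "0 < (\<tau>::real)"
    have fl: "locint f" using Lloc_locint[OF f] q by simp
    let ?\<Phi> = "camp_norm A D N 1 d \<theta> f"
    let ?P = "\<lambda>x k G Q j w. G \<in> sets lebesgue \<and> G \<subseteq> Bl x k \<and>
      emeasure lebesgue (Bl x k - G) \<le> ennreal ((\<tau> + \<delta> * b powr (real sig - real m)) * b powr k) \<and>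
      finite Q \<and> disjoint_family_on (\<lambda>y. Bl y (j y)) Q \<and> (\<forall>y\<in>Q. Bl y (j y) \<subseteq> Bl x (k + int sig)) \<and>
      (\<Sum>y\<in>Q. b powr j y) \<le> b powr - real m * b powr k \<and>
      (\<forall>y. 0 \<le> w y) \<and> (\<Sum>y\<in>Q. w y powr (q / (q - 1))) \<le> 1 \<and>
      ennreal (b powr k) * osc_on q d f x k G \<le> ennreal K0 * (ennreal (b powr k) * osc d x (k + int sig) f) +
        2 * (\<Sum>y\<in>Q. ennreal ((b powr k / b powr j y) powr ((q - 1) / q) * w y * b powr (j y + int sig)) *
          osc_on q d f y (j y + int sig) (H y (j y + int sig)))"
    \<comment> \<open>The selection is made for all balls at once, because the new cover may not
      depend on the family on which it is tested.\<close>
    have "\<forall>x k. \<exists>G Q j w. ?P x k G Q j w" using K0(2)[OF f H \<delta> \<tau>] by blast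
    then obtain G Q j w where P: "\<forall>x k. ?P x k (G x k) (Q x k) (j x k) (w x k)"
      unfolding choice_iff by blast
    have "good_cover (\<tau> + \<delta> * b powr (real sig - real m)) G" unfolding good_cover_def using P by blast
    moreover have "osc_tested q d f (ennreal K * ?\<Phi>) G"
      unfolding osc_tested_def
    proof (intro allI impI)
      fix n :: nat and xs and ks :: "nat \<Rightarrow> int" and c :: "nat \<Rightarrow> real" assume c: "\<forall>i<n. 0 \<le> c i"
      define J where "J = {..<n}"
      define I where "I i = Q (xs i) (ks i)" for i
      define Qk where "Qk i = j (xs i) (ks i)" for i
      define W where "W i = w (xs i) (ks i)" for i
      \<comment> \<open>The coefficients of the family of all stopping balls, in the form of the
        packing estimate: the exponent 1 / t from the change of measure is (q - 1) / q, and the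
        weights are those of the l^q duality.\<close>
      define cc where "cc p = c (fst p) * (b powr ks (fst p) / b powr Qk (fst p) (snd p)) powr (1 / t) * W (fst p) (snd p)" for p
      define Os where "Os y k = osc_on q d f y k (H y k)" for y k
      let ?N = "N (fam J xs ks c)"
      have c0: "0 \<le> c i" if "i \<in> J" for i using c that by (simp add: J_def)
      have J: "finite J" by (simp add: J_def)
      have I: "finite (I i)" "disjoint_family_on (\<lambda>y. Bl y (Qk i y)) (I i)"
        "\<And>y. y \<in> I i \<Longrightarrow> Bl y (Qk i y) \<subseteq> Bl (xs i) (ks i + int sig)"
        "(\<Sum>y\<in>I i. b powr Qk i y) \<le> b powr - real m * b powr ks i"
        "\<And>y. 0 \<le> W i y" "(\<Sum>y\<in>I i. W i y powr t) \<le> 1"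
        "ennreal (b powr ks i) * osc_on q d f (xs i) (ks i) (G (xs i) (ks i)) \<le> ennreal K0 * (ennreal (b powr ks i) * osc d (xs i) (ks i + int sig) f) +
          2 * (\<Sum>y\<in>I i. ennreal ((b powr ks i / b powr Qk i y) powr (1 / t) * W i y * b powr (Qk i y + int sig)) * Os y (Qk i y + int sig))" for i
        using P[rule_format, of "xs i" "ks i"] unfolding I_def Qk_def W_def t_def[symmetric] t Os_def by simp_all
      have cc0: "0 \<le> cc p" if "p \<in> Sigma J I" for p
        using that c0 I(5) by (auto simp: cc_def)
      have PJ: "finite (Sigma J I)" using J I(1) by simp
      have first: "(\<Sum>i\<in>J. ennreal (c i) * (ennreal K0 * (ennreal (b powr ks i) * osc d (xs i) (ks i + int sig) f))) \<le> ennreal (K0 * Ce) * ?\<Phi> * ?N"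
      proof -
        have "(\<Sum>i\<in>J. ennreal (c i) * (ennreal K0 * (ennreal (b powr ks i) * osc d (xs i) (ks i + int sig) f)))
            = ennreal K0 * (\<Sum>i\<in>J. ennreal (c i * b powr ks i) * oscq 1 d (xs i) (ks i + int sig) f)"
          unfolding oscq_1[OF fl] sum_distrib_left using c0 by (intro sum.cong) (auto simp: ennreal_mult mult_ac)
        also have "\<dots> \<le> ennreal K0 * (\<Sum>i\<in>J. ennreal (c i * b powr (ks i + int sig)) * oscq 1 d (xs i) (ks i + int sig) f)"
          using c0 b_gt_1 by (intro mult_left_mono sum_mono mult_right_mono ennreal_leI powr_mono) auto
        also have "\<dots> \<le> ennreal K0 * (?\<Phi> * N (fam J xs (\<lambda>i. ks i + int sig) c))"
          by (intro mult_left_mono camp_norm_ge[OF J c0]) auto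
        also have "\<dots> \<le> ennreal K0 * (?\<Phi> * (ennreal Ce * ?N))"
          by (intro mult_left_mono Ce(2)[OF J c0]) auto
        finally show ?thesis using K0(1) Ce(1) by (simp add: ennreal_mult mult_ac)
      qed
      have second: "(\<Sum>i\<in>J. ennreal (c i) * (2 * (\<Sum>y\<in>I i. ennreal ((b powr ks i / b powr Qk i y) powr (1 / t) * W i y * b powr (Qk i y + int sig)) * Os y (Qk i y + int sig))))
          \<le> ennreal (K0 * Ce) * ?\<Phi> * ?N"
      proof -
        have "(\<Sum>i\<in>J. ennreal (c i) * (2 * (\<Sum>y\<in>I i. ennreal ((b powr ks i / b powr Qk i y) powr (1 / t) * W i y * b powr (Qk i y + int sig)) * Os y (Qk i y + int sig))))
            = 2 * (\<Sum>i\<in>J. \<Sum>y\<in>I i. ennreal (cc (i, y) * b powr (Qk i y + int sig)) * Os y (Qk i y + int sig))"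
          unfolding sum_distrib_left
        proof (intro sum.cong refl)
          fix i y assume i: "i \<in> J"
          have "ennreal (cc (i, y) * b powr (Qk i y + int sig)) = ennreal (c i) * ennreal ((b powr ks i / b powr Qk i y) powr (1 / t) * W i y * b powr (Qk i y + int sig))"
            unfolding cc_def fst_conv snd_conv mult.assoc by (rule ennreal_mult'[OF c0[OF i]])
          then show "ennreal (c i) * (2 * (ennreal ((b powr ks i / b powr Qk i y) powr (1 / t) * W i y * b powr (Qk i y + int sig)) * Os y (Qk i y + int sig)))
              = 2 * (ennreal (cc (i, y) * b powr (Qk i y + int sig)) * Os y (Qk i y + int sig))"
            by (simp only: mult_ac)
        qed
        also have "(\<Sum>i\<in>J. \<Sum>y\<in>I i. ennreal (cc (i, y) * b powr (Qk i y + int sig)) * Os y (Qk i y + int sig))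
            = (\<Sum>p\<in>Sigma J I. ennreal (cc p * b powr (Qk (fst p) (snd p) + int sig)) * Os (snd p) (Qk (fst p) (snd p) + int sig))"
          using J I(1) by (subst sum.Sigma) (auto simp: case_prod_unfold)
        also have "\<dots> \<le> ennreal K * ?\<Phi> * N (fam (Sigma J I) snd (\<lambda>p. Qk (fst p) (snd p) + int sig) cc)"
          unfolding Os_def by (rule osc_tested_sum[OF tH PJ cc0])
        also have "\<dots> \<le> ennreal K * ?\<Phi> * (ennreal Ce' * N (fam (Sigma J I) snd (\<lambda>p. Qk (fst p) (snd p)) cc))"
          by (intro mult_left_mono Ce'(2)[OF PJ cc0]) auto
        also have "\<dots> \<le> ennreal K * ?\<Phi> * (ennreal Ce' * (ennreal (Cp * (b powr - real m) powr \<kappa>) * ?N))"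
        proof (intro mult_left_mono)
          show "N (fam (Sigma J I) snd (\<lambda>p. Qk (fst p) (snd p)) cc) \<le> ennreal (Cp * (b powr - real m) powr \<kappa>) * ?N"
            using Cp(3)[of J I c "\<lambda>i y. y" Qk xs ks W "b powr - real m", OF J I(1) c0 I(3) I(5) I(2) I(4) I(6) b_powr_pos]
            unfolding cc_def[abs_def] by simp
        qed auto
        finally have "(\<Sum>i\<in>J. ennreal (c i) * (2 * (\<Sum>y\<in>I i. ennreal ((b powr ks i / b powr Qk i y) powr (1 / t) * W i y * b powr (Qk i y + int sig)) * Os y (Qk i y + int sig))))
            \<le> 2 * (ennreal K * ?\<Phi> * (ennreal Ce' * (ennreal (Cp * (b powr - real m) powr \<kappa>) * ?N)))" by (simp add: mult_left_mono)
        also have "\<dots> = ennreal (2 * Ce' * Cp * (b powr - real m) powr \<kappa> * K) * ?\<Phi> * ?N"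
          using K Ce'(1) Cp(1) by (simp add: ennreal_mult mult_ac)
        also have "\<dots> \<le> ennreal (K0 * Ce) * ?\<Phi> * ?N"
        proof (intro mult_right_mono ennreal_leI)
          have "2 * Ce' * Cp * (b powr - real m) powr \<kappa> \<le> 1 / 2" using m(3) by (simp add: powr_powr)
          then have "2 * Ce' * Cp * (b powr - real m) powr \<kappa> * K \<le> 1 / 2 * K" by (intro mult_right_mono K)
          then show "2 * Ce' * Cp * (b powr - real m) powr \<kappa> * K \<le> K0 * Ce" by (simp add: K_def)
        qed auto
        finally show ?thesis .
      qed
      have "(\<Sum>i\<in>J. ennreal (c i * b powr ks i) * osc_on q d f (xs i) (ks i) (G (xs i) (ks i)))
          = (\<Sum>i\<in>J. ennreal (c i) * (ennreal (b powr ks i) * osc_on q d f (xs i) (ks i) (G (xs i) (ks i))))"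
        using c0 by (intro sum.cong) (auto simp: ennreal_mult mult_ac)
      also have "\<dots> \<le> (\<Sum>i\<in>J. ennreal (c i) * (ennreal K0 * (ennreal (b powr ks i) * osc d (xs i) (ks i + int sig) f) +
          2 * (\<Sum>y\<in>I i. ennreal ((b powr ks i / b powr Qk i y) powr (1 / t) * W i y * b powr (Qk i y + int sig)) * Os y (Qk i y + int sig))))"
        by (intro sum_mono mult_left_mono I(7)) auto
      also have "\<dots> \<le> ennreal (K0 * Ce) * ?\<Phi> * ?N + ennreal (K0 * Ce) * ?\<Phi> * ?N"
        unfolding distrib_left sum.distrib by (intro add_mono first second)
      also have "\<dots> = ennreal K * ?\<Phi> * ?N"
        using K0(1) Ce(1) by (simp add: K_def ennreal_mult mult.assoc flip: mult_2)
      finally show "(\<Sum>i<n. ennreal (c i * b powr ks i) * osc_on q d f (xs i) (ks i) (G (xs i) (ks i))) \<le> ennreal K * ?\<Phi> * N (fam {..<n} xs ks c)"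
        by (simp add: J_def)
    qed
    ultimately show "\<exists>G. good_cover (\<tau> + \<delta> * b powr (real sig - real m)) G \<and> osc_tested q d f (ennreal K * ?\<Phi>) G" by blast
  qed
qed

text \<open>The tested inequality holds trivially for empty sets, is carried to covers of ever
  smaller defect with an unchanged constant, and passes to the full balls in the limit.\<close>

lemma camp_norm_q_le:
  fixes d :: nat
  assumes q: "1 < q" "p0 < q / (q - 1)"
  obtains C where "0 \<le> C" "\<And>f. Lloc q f \<Longrightarrow> camp_norm A D N q d \<theta> f \<le> ennreal C * camp_norm A D N 1 d \<theta> f"
proof -
  obtain K \<eta> where K: "0 \<le> K" and \<eta>: "0 \<le> \<eta>" "\<eta> \<le> 1 / 2"
    and step: "\<And>f \<delta> \<tau> H. Lloc q f \<Longrightarrow> good_cover \<delta> H \<Longrightarrow> osc_tested q d f (ennreal K * camp_norm A D N 1 d \<theta> f) H \<Longrightarrow>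
      0 \<le> \<delta> \<Longrightarrow> 0 < (\<tau>::real) \<Longrightarrow> \<exists>G. good_cover (\<tau> + \<delta> * \<eta>) G \<and> osc_tested q d f (ennreal K * camp_norm A D N 1 d \<theta> f) G"
    by (rule osc_tested_step[OF q, of d]) (rule that)
  obtain C where C: "0 \<le> C" "\<And>f M. Lloc q f \<Longrightarrow> osc_tested q d f M Bl \<Longrightarrow> camp_norm A D N q d \<theta> f \<le> ennreal C * M"
    by (rule camp_norm_le_tested[OF less_imp_le[OF q(1)], of d]) (rule that)
  show ?thesis
  proof (rule that[of "C * K"])
    show "0 \<le> C * K" using C K by simp
    fix f :: "real^'n \<Rightarrow> real" assume f: "Lloc q f"
    let ?M = "ennreal K * camp_norm A D N 1 d \<theta> f"
    have good_mono: "good_cover \<delta>' G" if "good_cover \<delta> G" "\<delta> \<le> \<delta>'" for \<delta> \<delta>' G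
      using that unfolding good_cover_def by (meson ennreal_leI mult_right_mono order_trans powr_ge_zero)
    \<comment> \<open>The slack \<epsilon> pays for the losses \<tau>: with \<tau> = \<epsilon> / 2
      and slack \<epsilon> / 2 before the step, the defect afterwards is at most 3 \<epsilon> / 4 +
      (1 / 2) ^ Suc n.\<close>
    have it: "\<exists>G. good_cover (\<epsilon> + (1 / 2) ^ n) G \<and> osc_tested q d f ?M G" if "0 < \<epsilon>" for \<epsilon> n
      using that
    proof (induction n arbitrary: \<epsilon>)
      case 0
      \<comment> \<open>A defect of at least 1 admits the empty set in every ball.\<close>
      have "good_cover (\<epsilon> + (1 / 2) ^ 0) (\<lambda>x k. {})"
        using 0 by (auto simp: good_cover_def emeasure_Bl distrib_right intro!: ennreal_leI)
      moreover have "osc_tested q d f ?M (\<lambda>x k. {})" by (simp add: osc_tested_def osc_on_def)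
      ultimately show ?case by blast
    next
      case (Suc n)
      obtain H where H: "good_cover (\<epsilon> / 2 + (1 / 2) ^ n) H" "osc_tested q d f ?M H"
        using Suc.IH[of "\<epsilon> / 2"] Suc.prems by auto
      have p: "0 \<le> \<epsilon> / 2 + (1 / 2) ^ n" using Suc.prems by (intro add_nonneg_nonneg) auto
      obtain G where G: "good_cover (\<epsilon> / 2 + (\<epsilon> / 2 + (1 / 2) ^ n) * \<eta>) G" "osc_tested q d f ?M G"
        using step[OF f H p, of "\<epsilon> / 2"] Suc.prems by auto
      have "(\<epsilon> / 2 + (1 / 2) ^ n) * \<eta> \<le> (\<epsilon> / 2 + (1 / 2) ^ n) * (1 / 2)" by (intro mult_left_mono \<eta> p)
      then have "\<epsilon> / 2 + (\<epsilon> / 2 + (1 / 2) ^ n) * \<eta> \<le> \<epsilon> + (1 / 2) ^ Suc n" using Suc.prems by simp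
      then show ?case using good_mono[OF G(1)] G(2) by blast
    qed
    \<comment> \<open>One more iteration, with slack (1 / 2) ^ Suc n, brings the two contributions
      together to exactly (1 / 2) ^ n.\<close>
    have "\<exists>G. good_cover ((1 / 2) ^ n) G \<and> osc_tested q d f ?M G" for n :: nat
      using it[of "(1 / 2) ^ Suc n" "Suc n"] by simp
    then obtain G where "\<And>n::nat. good_cover ((1 / 2) ^ n) (G n)" "\<And>n. osc_tested q d f ?M (G n)" by metis
    then have "osc_tested q d f ?M Bl" using q by (intro osc_tested_limit[OF f]) auto
    from C(2)[OF f this] show "camp_norm A D N q d \<theta> f \<le> ennreal (C * K) * camp_norm A D N 1 d \<theta> f"
      using C(1) K by (simp add: ennreal_mult mult.assoc)
  qed
qed

end

section \<open>The equivalence\<close>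

text \<open>A real kernel vector, read as a complex one, would make 0 an eigenvalue, and its modulus
  is not above 1.\<close>

lemma dilation_invertible:
  fixes A :: "real^'n^'n"
  assumes "dilation A"
  shows "invertible A"
proof (rule ccontr)
  assume "\<not> invertible A"
  then obtain v where v: "A *v v = 0" "v \<noteq> 0"
    by (auto simp: invertible_left_inverse matrix_left_invertible_ker)
  define w where "w = (\<chi> i. complex_of_real (v $ i))"
  have "cmat A *v w = (\<chi> i. complex_of_real ((A *v v) $ i))"
    by (simp add: vec_eq_iff cmat_def w_def matrix_vector_mult_def)
  also have "\<dots> = 0" unfolding v(1) by (simp add: vec_eq_iff)
  finally have "cmat A *v w - 0 *s w = 0" by simp
  moreover have "\<not> eigen A 0" using assms by (auto simp: dilation_def)
  ultimately have "w = 0" by (rule eigen_ker[rotated])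
  then show False using v(2) by (simp add: vec_eq_iff w_def)
qed

theorem theorem4p3:
  fixes A :: "real^'n^'n" and D :: "(real^'n) set" and N :: "(real^'n \<Rightarrow> real) \<Rightarrow> ennreal"
    and r lm lp pm \<theta>0 p0 q \<epsilon> s :: real and d :: nat
  assumes dil: "dilation A"
    and lm: "1 < lm" and eig: "\<forall>z. eigen A z \<longrightarrow> lm < cmod z \<and> cmod z < lp"
    and ell: "ellipsoid0 D" and vol: "emeasure lebesgue D = 1"
    and r: "1 < r" "D \<subseteq> (\<lambda>x. r *\<^sub>R x) ` D" "(\<lambda>x. r *\<^sub>R x) ` D \<subseteq> (\<lambda>x. A *v x) ` D"
    and X: "ball_qBfs A D N" and ac: "abs_cont_norm N"
    and FS: "0 < pm" "assumption_FS A D N pm"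
    and th: "0 < \<theta>0" "\<theta>0 < min pm 1"
    and AA: "\<theta>0 < p0" "assumption_A A D N \<theta>0 p0"
    and dd: "\<lfloor>(1 / \<theta>0 - 1) * ln (bdet A) / ln lm\<rfloor> \<le> int d"
    and qq: "1 \<le> q" "1 < p0 \<longrightarrow> q < conj_exp p0"
    and ss: "0 < s" "s < \<theta>0"
    and eps: "ln (bdet A) / ln lm * (2 / s + real d * ln lp / ln (bdet A)) < \<epsilon>"
  shows "\<exists>C1 C2::real. 0 < C1 \<and> 0 < C2 \<and>
    (\<forall>f. Lloc q f \<longrightarrow>
       (camp_norm A D N q d \<theta>0 f < top \<longleftrightarrow> star_norm A D N d \<theta>0 (\<epsilon> * ln lm / ln (bdet A)) f < top) \<and>
       camp_norm A D N q d \<theta>0 f \<le> ennreal C1 * star_norm A D N d \<theta>0 (\<epsilon> * ln lm / ln (bdet A)) f \<and>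
       star_norm A D N d \<theta>0 (\<epsilon> * ln lm / ln (bdet A)) f \<le> ennreal C2 * camp_norm A D N q d \<theta>0 f)"
proof -
  interpret dual_space A D r N \<theta>0 pm s p0
    using dilation_invertible[OF dil] ell vol r X ac FS th AA ss by unfold_locales auto
  define \<beta> where "\<beta> = \<epsilon> * ln lm / ln b"
  have R: "\<And>z. eigen A z \<Longrightarrow> cmod z < lp" using eig by blast
  have lp1: "1 < lp" by (rule eigen_bound_gt_1[OF R])
  have lnb: "0 < ln b" using b_gt_1 by simp
  have \<beta>: "2 / s + real d * ln lp / ln b < \<beta>"
    using eps lnb lm by (simp add: \<beta>_def field_simps)
  have s2: "0 < 1 / s" using ss by simp
  have two: "2 / s = 2 * (1 / s)" by simp
  have dl: "0 \<le> real d * ln lp / ln b" using lp1 lnb by simp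
  \<comment> \<open>The two summands of the lower bound serve two purposes: 2 / s gives the exponent
    for the dilated families, and d ln lp / ln b gives lp ^ d < b powr \<beta>.\<close>
  have \<beta>0: "0 < \<beta>" "1 / s < 1 + \<beta>" "real d * ln lp / ln b < \<beta>" using \<beta> s2 dl unfolding two by linarith+
  have "real d * ln lp < \<beta> * ln b" using \<beta>0(3) lnb by (simp add: field_simps)
  then have "exp (real d * ln lp) < exp (\<beta> * ln b)" by simp
  then have Rb: "lp ^ d < b powr \<beta>" using lp1 b_gt_1 by (simp add: powr_def exp_of_nat_mult)
  obtain Cs where Cs: "0 \<le> Cs" "\<And>f. locint f \<Longrightarrow> star_norm A D N d \<theta>0 \<beta> f \<le> ennreal Cs * camp_norm A D N 1 d \<theta>0 f"
    by (rule star_norm_le_camp_norm[OF R \<beta>0(2,1) Rb]) auto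
  obtain Cq where Cq: "0 \<le> Cq" "\<And>f. Lloc q f \<Longrightarrow> camp_norm A D N q d \<theta>0 f \<le> ennreal Cq * camp_norm A D N 1 d \<theta>0 f"
  proof (cases "q = 1")
    case True
    then show thesis by (intro that[of 1]) auto
  next
    case False
    then have q1: "1 < q" using qq by simp
    \<comment> \<open>For p0 > 1 this is q < p0' with the roles of the exponents exchanged; for p0
      \<le> 1 it holds because a conjugate exponent exceeds 1.\<close>
    have "p0 < q / (q - 1)"
    proof (cases "1 < p0")
      case True
      then have "q < p0 / (p0 - 1)" using qq by (simp add: conj_exp_def)
      then have "q * (p0 - 1) < p0" using True by (simp add: field_simps)
      then have "p0 * (q - 1) < q" by (simp add: algebra_simps)
      then show ?thesis using q1 by (simp add: field_simps)
    next
      case False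
      moreover have "1 < q / (q - 1)" using q1 by simp
      ultimately show ?thesis by linarith
    qed
    then show thesis by (rule camp_norm_q_le[OF q1, of d]) (rule that)
  qed
  define C1 where "C1 = max 1 (2 * Cq)"
  define C2 where "C2 = max 1 Cs"
  show ?thesis
    unfolding \<beta>_def[symmetric]
  proof (rule exI[of _ C1], rule exI[of _ C2], intro conjI allI impI)
    show "0 < C1" "0 < C2" by (auto simp: C1_def C2_def)
    fix f :: "real^'n \<Rightarrow> real" assume f: "Lloc q f"
    have fl: "locint f" by (rule Lloc_locint[OF f qq(1)])
    have "camp_norm A D N q d \<theta>0 f \<le> ennreal Cq * (2 * star_norm A D N d \<theta>0 \<beta> f)"
      by (intro order_trans[OF Cq(2)[OF f]] mult_left_mono camp_norm_le_star_norm[OF fl \<beta>0(1)]) auto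
    also have "\<dots> = ennreal (2 * Cq) * star_norm A D N d \<theta>0 \<beta> f" using Cq(1) by (simp add: ennreal_mult mult_ac)
    also have "\<dots> \<le> ennreal C1 * star_norm A D N d \<theta>0 \<beta> f" by (intro mult_right_mono ennreal_leI) (auto simp: C1_def)
    finally show le1: "camp_norm A D N q d \<theta>0 f \<le> ennreal C1 * star_norm A D N d \<theta>0 \<beta> f" .
    have "star_norm A D N d \<theta>0 \<beta> f \<le> ennreal Cs * camp_norm A D N q d \<theta>0 f"
      by (intro order_trans[OF Cs(2)[OF fl]] mult_left_mono camp_norm_1_le[OF fl qq(1)]) auto
    also have "\<dots> \<le> ennreal C2 * camp_norm A D N q d \<theta>0 f" by (intro mult_right_mono ennreal_leI) (auto simp: C2_def)
    finally show le2: "star_norm A D N d \<theta>0 \<beta> f \<le> ennreal C2 * camp_norm A D N q d \<theta>0 f" .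
    show "camp_norm A D N q d \<theta>0 f < top \<longleftrightarrow> star_norm A D N d \<theta>0 \<beta> f < top"
      using le1 le2 by (auto intro: le_less_trans simp: ennreal_mult_less_top)
  qed
qed

end
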